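(* Let $1 \le b \le B$ and let $\ell \ge 1$, and assume the internal memory size satisfies $M \ge \ell b$. There is an external-memory data structure that maintains a set of $\ell$ catenable priority queues with attrition (I/O-CPQAs) and supports each of the operations $\textsc{FindMin}$, $\textsc{DeleteMin}$, $\textsc{CatenateAndAttrite}$ and $\textsc{InsertAndAttrite}$ in $\mathcal{O}(1/b)$ amortized I/Os and $\mathcal{O}(1)$ worst case I/Os per operation. Its space usage is $\mathcal{O}(\frac{n-m}{b})$ disk blocks after $n$ calls in total to $\textsc{CatenateAndAttrite}$ and $\textsc{InsertAndAttrite}$ and $m$ calls to $\textsc{DeleteMin}$.
   Context: The computational model is the I/O model: data resides on a disk divided into blocks of $B$ consecutive words, computation takes place for free in an internal memory of $M$ words, and an I/O reads one block from disk into memory or writes one block to disk; time is measured as the number of I/Os and space as the number of disk blocks used. An I/O-CPQA stores a sequence of elements from a totally ordered set and supports: $\textsc{FindMin}(Q)$ returns the minimum element of $Q$; $\textsc{DeleteMin}(Q)$ removes the minimum element $e$ of $Q$ and returns $e$ and $Q\setminus\{e\}$; $\textsc{CatenateAndAttrite}(Q_1,Q_2)$ concatenates $Q_2$ to the end of $Q_1$ and removes ("attrites") every element of $Q_1$ larger than $\min(Q_2)$, returning $\{e \in Q_1 : e < \min(Q_2)\} \cup Q_2$; $\textsc{InsertAndAttrite}(Q,e)$ inserts $e$ at the end of $Q$ and removes all elements of $Q$ larger than $e$.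
   Formalization: The formal theorem additionally assumes M ≥ 2B, the customary assumption of the I/O model; with only M ≥ ℓb the claim fails, e.g. for B = M = b = ℓ = 1, where two elements can never be in memory together to be compared. *)

theory Defs
  imports Complex_Main
begin

text \<open>
  The I/O model. Elements of the ordered set are indivisible: a program can only move them between
  memory cells and compare them, which is why \<open>prog\<close> does not mention the element type. A program
  is a well-founded tree, so it always terminates; infinite branching on the number stored in a cell
  expresses that internal computation is free. Nothing but memory and disk survives from
  one operation to the next.
\<close>

datatype 'a word = Elem 'a | Num nat

datatype prog =
    Halt
  | Copy nat nat prog            \<comment> \<open>source cell, target cell\<close>
  | SetNum nat nat prog          \<comment> \<open>target cell, number\<close>
  | CaseNum nat "nat \<Rightarrow> prog"    \<comment> \<open>branch on the number in a cell\<close>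
  | IfLess nat nat prog prog     \<comment> \<open>compare the elements in two cells\<close>
  | GetArg nat prog              \<comment> \<open>copy the element passed to the operation into a cell\<close>
  | Output nat prog              \<comment> \<open>return the element in a cell\<close>
  | ReadBlock nat nat prog       \<comment> \<open>block address, first target cell\<close>
  | WriteBlock nat nat prog      \<comment> \<open>block address, first source cell\<close>
  | FreeBlock nat prog           \<comment> \<open>the block is no longer in use\<close>

record machine =
  mem_size :: nat
  block_size :: nat
  word_max :: nat   \<comment> \<open>largest number, and largest block address, that fits into a word\<close>

record 'a config =
  mem :: "nat \<Rightarrow> 'a word"
  disk :: "nat \<Rightarrow> 'a word list option"   \<comment> \<open>\<open>None\<close>: block not in use\<close>
  result :: "'a option"
  ios :: nat

text \<open>
  Execution yields \<open>None\<close> on a fault: a cell outside the memory, a number or address that does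
  not fit into a word, a word of the wrong kind, or reading a block that is not in use.
\<close>

primrec exec :: "machine \<Rightarrow> 'a::linorder option \<Rightarrow> prog \<Rightarrow> 'a config \<Rightarrow> 'a config option" where
  "exec mc arg Halt s = Some s"
| "exec mc arg (Copy i j p) s =
    (if i < mem_size mc \<and> j < mem_size mc
     then exec mc arg p (s\<lparr>mem := (mem s)(j := mem s i)\<rparr>) else None)"
| "exec mc arg (SetNum j k p) s =
    (if j < mem_size mc \<and> k \<le> word_max mc
     then exec mc arg p (s\<lparr>mem := (mem s)(j := Num k)\<rparr>) else None)"
| "exec mc arg (CaseNum i f) s =
    (if i < mem_size mc
     then (case mem s i of Num k \<Rightarrow> exec mc arg (f k) s | Elem _ \<Rightarrow> None) else None)"
| "exec mc arg (IfLess i j p q) s =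
    (if i < mem_size mc \<and> j < mem_size mc
     then (case (mem s i, mem s j) of
             (Elem x, Elem y) \<Rightarrow> if x < y then exec mc arg p s else exec mc arg q s
           | _ \<Rightarrow> None)
     else None)"
| "exec mc arg (GetArg j p) s =
    (if j < mem_size mc
     then (case arg of Some e \<Rightarrow> exec mc arg p (s\<lparr>mem := (mem s)(j := Elem e)\<rparr>) | None \<Rightarrow> None)
     else None)"
| "exec mc arg (Output i p) s =
    (if i < mem_size mc
     then (case mem s i of Elem e \<Rightarrow> exec mc arg p (s\<lparr>result := Some e\<rparr>) | Num _ \<Rightarrow> None)
     else None)"
| "exec mc arg (ReadBlock a j p) s =
    (if a \<le> word_max mc \<and> j + block_size mc \<le> mem_size mc
     then (case disk s a of
             Some blk \<Rightarrow> exec mc arg p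
               (s\<lparr>mem := (\<lambda>k. if j \<le> k \<and> k < j + block_size mc then blk ! (k - j) else mem s k),
                  ios := Suc (ios s)\<rparr>)
           | None \<Rightarrow> None)
     else None)"
| "exec mc arg (WriteBlock a i p) s =
    (if a \<le> word_max mc \<and> i + block_size mc \<le> mem_size mc
     then exec mc arg p
       (s\<lparr>disk := (disk s)(a := Some (map (mem s) [i..<i + block_size mc])),
          ios := Suc (ios s)\<rparr>)
     else None)"
| "exec mc arg (FreeBlock a p) s = exec mc arg p (s\<lparr>disk := (disk s)(a := None)\<rparr>)"

definition blank_config :: "'a config" where
  "blank_config = \<lparr>mem = (\<lambda>_. Num 0), disk = (\<lambda>_. None), result = None, ios = 0\<rparr>"

definition blocks_used :: "'a config \<Rightarrow> nat" where
  "blocks_used s = card {a. disk s a \<noteq> None}"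


text \<open>
  Catenable priority queues with attrition. Attrition keeps the stored sequence strictly increasing,
  so that it is determined by the set of its elements. A family of queues is indexed by
  \<open>{..<l}\<close>; the result of catenating queues \<open>i\<close> and \<open>j\<close> becomes queue \<open>i\<close>, and queue \<open>j\<close> is
  left empty. The minimum of an empty queue counts as infinite when catenating.
\<close>

datatype 'a cpqa_op =
    FindMin nat
  | DeleteMin nat
  | CatenateAndAttrite nat nat
  | InsertAndAttrite nat 'a

definition catenate_attrite :: "'a::linorder set \<Rightarrow> 'a set \<Rightarrow> 'a set" where
  "catenate_attrite Q1 Q2 = (if Q2 = {} then Q1 else {e \<in> Q1. e < Min Q2} \<union> Q2)"

definition insert_attrite :: "'a::linorder set \<Rightarrow> 'a \<Rightarrow> 'a set" where
  "insert_attrite Q e = {x \<in> Q. \<not> x > e} \<union> {e}"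

fun cpqa_step :: "'a::linorder cpqa_op \<Rightarrow> (nat \<Rightarrow> 'a set) \<Rightarrow> (nat \<Rightarrow> 'a set)" where
  "cpqa_step (FindMin i) Q = Q"
| "cpqa_step (DeleteMin i) Q = Q(i := Q i - {Min (Q i)})"
| "cpqa_step (CatenateAndAttrite i j) Q = Q(i := catenate_attrite (Q i) (Q j), j := {})"
| "cpqa_step (InsertAndAttrite i e) Q = Q(i := insert_attrite (Q i) e)"

fun cpqa_answer :: "'a::linorder cpqa_op \<Rightarrow> (nat \<Rightarrow> 'a set) \<Rightarrow> 'a option" where
  "cpqa_answer (FindMin i) Q = Some (Min (Q i))"
| "cpqa_answer (DeleteMin i) Q = Some (Min (Q i))"
| "cpqa_answer (CatenateAndAttrite i j) Q = None"
| "cpqa_answer (InsertAndAttrite i e) Q = None"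

fun cpqa_legal :: "nat \<Rightarrow> 'a::linorder cpqa_op \<Rightarrow> (nat \<Rightarrow> 'a set) \<Rightarrow> bool" where
  "cpqa_legal l (FindMin i) Q \<longleftrightarrow> i < l \<and> Q i \<noteq> {}"
| "cpqa_legal l (DeleteMin i) Q \<longleftrightarrow> i < l \<and> Q i \<noteq> {}"
| "cpqa_legal l (CatenateAndAttrite i j) Q \<longleftrightarrow> i < l \<and> j < l \<and> i \<noteq> j"
| "cpqa_legal l (InsertAndAttrite i e) Q \<longleftrightarrow> i < l"

fun all_legal :: "nat \<Rightarrow> 'a::linorder cpqa_op list \<Rightarrow> (nat \<Rightarrow> 'a set) \<Rightarrow> bool" where
  "all_legal l [] Q \<longleftrightarrow> True"
| "all_legal l (x # xs) Q \<longleftrightarrow> cpqa_legal l x Q \<and> all_legal l xs (cpqa_step x Q)"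

fun all_answers :: "'a::linorder cpqa_op list \<Rightarrow> (nat \<Rightarrow> 'a set) \<Rightarrow> 'a option list" where
  "all_answers [] Q = []"
| "all_answers (x # xs) Q = cpqa_answer x Q # all_answers xs (cpqa_step x Q)"

fun is_delete :: "'a cpqa_op \<Rightarrow> bool" where
  "is_delete (DeleteMin i) = True"
| "is_delete _ = False"

fun is_catenate_or_insert :: "'a cpqa_op \<Rightarrow> bool" where
  "is_catenate_or_insert (CatenateAndAttrite i j) = True"
| "is_catenate_or_insert (InsertAndAttrite i e) = True"
| "is_catenate_or_insert _ = False"



record cpqa_impl =
  find_min_prog :: "nat \<Rightarrow> prog"
  delete_min_prog :: "nat \<Rightarrow> prog"
  catenate_prog :: "nat \<Rightarrow> nat \<Rightarrow> prog"
  insert_prog :: "nat \<Rightarrow> prog"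

fun exec_op :: "machine \<Rightarrow> cpqa_impl \<Rightarrow> 'a::linorder cpqa_op \<Rightarrow> 'a config \<Rightarrow> 'a config option" where
  "exec_op mc D (FindMin i) s = exec mc None (find_min_prog D i) s"
| "exec_op mc D (DeleteMin i) s = exec mc None (delete_min_prog D i) s"
| "exec_op mc D (CatenateAndAttrite i j) s = exec mc None (catenate_prog D i j) s"
| "exec_op mc D (InsertAndAttrite i e) s = exec mc (Some e) (insert_prog D i) s"

text \<open>
  Runs a sequence of operations; besides the final configuration, returns for each operation its
  answer and the number of I/Os it performed.
\<close>

fun run_ops :: "machine \<Rightarrow> cpqa_impl \<Rightarrow> 'a::linorder cpqa_op list \<Rightarrow> 'a config
    \<Rightarrow> ('a config \<times> ('a option \<times> nat) list) option" where
  "run_ops mc D [] s = Some (s, [])"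
| "run_ops mc D (x # xs) s =
    (case exec_op mc D x (s\<lparr>result := None, ios := 0\<rparr>) of
       None \<Rightarrow> None
     | Some s' \<Rightarrow>
         (case run_ops mc D xs s' of
            None \<Rightarrow> None
          | Some (s'', tr) \<Rightarrow> Some (s'', (result s', ios s') # tr)))"

end

theory Submission
  imports Defs "HOL-Library.Nat_Bijection"
begin

text \<open>
  Attrition is lazy: a queue is represented by a sequence of elements whose strict suffix minima are
  the elements of the queue, so catenation only has to append sequences. The sequence is cut into
  records of \<open>\<Theta>(b)\<close> elements, and the records form a tree: the root comes first, and it carries a list
  \<open>C\<close> of records that are known to survive, a buffer \<open>B\<close>, and a stack \<open>D\<close> of segments of trees
  whose attrition has been postponed. The invariant that \<open>C\<close> is at least as long as the work
  \<open>D\<close> still requires is restored after every catenation and every removal of the root by a constant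
  number of steps, each of which extends \<open>C\<close>, or drops attrited records, or merges two segments.
  Hence these operations cost \<open>O(1)\<close> I/Os in the worst case.

  If \<open>b\<close> is bounded, this suffices. Otherwise each queue keeps its first and its last \<open>O(b)\<close> elements
  in memory, such that a record is created or consumed only once per \<open>\<Omega>(b)\<close> operations. The
  potential charges each buffered element \<open>O(1)\<close> and each record \<open>O(b)\<close>; the buffers pay for
  new records, and the records for their removal. Blocks of attrited records may stay allocated, but
  the elements stored are never more than the insertions minus the deletions.
\<close>

section \<open>Survivors of attrition\<close>

fun survivors :: "'a::linorder list \<Rightarrow> 'a set" where
  "survivors [] = {}"
| "survivors (x # xs) = (if \<forall>y\<in>set xs. x < y then insert x (survivors xs) else survivors xs)"

lemma survivors_subset: "survivors xs \<subseteq> set xs"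
  by (induction xs) auto

lemma finite_survivors [simp]: "finite (survivors xs)"
  by (rule finite_subset[OF survivors_subset]) simp

lemma survivor_below: "x \<in> set xs \<Longrightarrow> \<exists>y\<in>survivors xs. y \<le> x"
proof (induction xs arbitrary: x)
  case (Cons z xs)
  show ?case
  proof (cases "\<forall>y\<in>set xs. z < y")
    case True
    then show ?thesis using Cons.prems Cons.IH by (cases "x = z") auto
  next
    case False
    then obtain y where "y \<in> set xs" "y \<le> z" by (auto simp: not_less)
    moreover have "survivors (z # xs) = survivors xs" using False by auto
    ultimately show ?thesis using Cons.prems Cons.IH[of x] Cons.IH[of y] by (auto intro: order_trans)
  qed
qed simp

lemma survivors_eq_empty_iff [simp]: "survivors xs = {} \<longleftrightarrow> xs = []"
proof
  assume "survivors xs = {}"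
  then show "xs = []" using survivor_below[of "hd xs" xs] by (cases xs) auto
qed simp

lemma less_survivors_iff: "(\<forall>y\<in>survivors xs. x < y) \<longleftrightarrow> (\<forall>y\<in>set xs. x < y)"
  using survivor_below[of _ xs] survivors_subset[of xs] by (meson in_mono less_le_trans)

lemma survivors_append: "survivors (xs @ ys) = catenate_attrite (survivors xs) (survivors ys)"
proof (cases "ys = []")
  case False
  then have "survivors (xs @ ys) = {e \<in> survivors xs. \<forall>x\<in>set ys. e < x} \<union> survivors ys"
    by (induction xs) auto
  then show ?thesis using False less_survivors_iff[of ys] by (auto simp: catenate_attrite_def)
qed (simp add: catenate_attrite_def)

lemma survivors_append_cong:
  "survivors xs = survivors xs' \<Longrightarrow> survivors ys = survivors ys' \<Longrightarrow> survivors (xs @ ys) = survivors (xs' @ ys')"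
  by (simp add: survivors_append)

lemma survivors_append_attrited:
  assumes "z \<in> set zs" "\<And>y. y \<in> set ys \<Longrightarrow> z \<le> y"
  shows "survivors (ys @ zs) = survivors zs"
  using assms(2)
proof (induction ys)
  case (Cons y ys)
  then have "z \<le> y" by simp
  then have "\<not> (\<forall>x\<in>set (ys @ zs). y < x)" using assms(1) by (auto simp: not_less)
  then have "survivors ((y # ys) @ zs) = survivors (ys @ zs)" by auto
  then show ?case using Cons by simp
qed simp

lemma survivors_append_middle_attrited:
  assumes "z \<in> set zs" "\<And>y. y \<in> set ys \<Longrightarrow> z \<le> y"
  shows "survivors (xs @ ys @ zs) = survivors (xs @ zs)"
  by (rule survivors_append_cong[OF refl]) (rule survivors_append_attrited[OF assms])

lemma le_dropWhile_less:
  fixes xs :: "'a::linorder list"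
  assumes "sorted_wrt (<) xs" "y \<in> set (dropWhile (\<lambda>x. x < e) xs)"
  shows "e \<le> y"
  using assms by (induction xs) (auto split: if_splits intro: less_imp_le order_trans)

lemma survivors_takeWhile_append:
  assumes "sorted_wrt (<) xs" "e \<in> set zs"
  shows "survivors (takeWhile (\<lambda>x. x < e) xs @ zs) = survivors (xs @ zs)"
proof -
  have "survivors (takeWhile (\<lambda>x. x < e) xs @ dropWhile (\<lambda>x. x < e) xs @ zs)
      = survivors (takeWhile (\<lambda>x. x < e) xs @ zs)"
    by (rule survivors_append_middle_attrited[OF assms(2)]) (rule le_dropWhile_less[OF assms(1)])
  then show ?thesis by (metis append_assoc takeWhile_dropWhile_id)
qed

lemma insert_attrite_eq_catenate: "insert_attrite Q e = catenate_attrite Q (survivors [e])"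
  by (auto simp: insert_attrite_def catenate_attrite_def)

lemma Min_survivors_Cons: "\<forall>y\<in>set xs. x < y \<Longrightarrow> Min (survivors (x # xs)) = x"
  using survivors_subset[of xs] by (intro Min_eqI) (auto intro: less_imp_le)

lemma survivors_Cons_minus_Min:
  "\<forall>y\<in>set xs. x < y \<Longrightarrow> survivors (x # xs) - {Min (survivors (x # xs))} = survivors xs"
  using survivors_subset[of xs] by (subst Min_survivors_Cons) auto

lemma sorted_wrt_takeWhile: "sorted_wrt P xs \<Longrightarrow> sorted_wrt P (takeWhile p xs)"
  by (metis sorted_wrt_append takeWhile_dropWhile_id)

lemma sorted_wrt_hd_le: "sorted_wrt (<) (xs :: 'a::linorder list) \<Longrightarrow> x \<in> set xs \<Longrightarrow> hd xs \<le> x"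
  by (cases xs) (auto intro: less_imp_le)

section \<open>Records on disk\<close>

text \<open>
  Record \<open>a\<close> occupies the blocks \<open>16 a, \<dots>, 16 a + 11\<close>: its elements, and eleven blocks holding one
  number each. Fields 1 to 4 link the record into a list (successor, predecessor, last record of the
  segment, first record of the next lower segment; the latter two are meaningful for the first record
  of a segment only), fields 5 to 10 describe the lists below the record, and field 11 is the
  number of its elements.

  The cells \<open>0, \<dots>, B\<close> are scratch space: the numbers an operation works with are kept in the control
  state of the program.
\<close>

abbreviation (input) succ_field :: nat where "succ_field \<equiv> 1"
abbreviation (input) pred_field :: nat where "pred_field \<equiv> 2"
abbreviation (input) end_field :: nat where "end_field \<equiv> 3"
abbreviation (input) below_field :: nat where "below_field \<equiv> 4"
abbreviation (input) size_field :: nat where "size_field \<equiv> 11"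

definition get_field :: "nat \<Rightarrow> nat \<Rightarrow> (nat \<Rightarrow> prog) \<Rightarrow> prog" where
  "get_field a j k = ReadBlock (16 * a + j) 0 (CaseNum 0 k)"

definition set_field :: "nat \<Rightarrow> nat \<Rightarrow> nat \<Rightarrow> prog \<Rightarrow> prog" where
  "set_field a j v p = SetNum 0 v (WriteBlock (16 * a + j) 0 p)"

primrec free_blocks :: "nat \<Rightarrow> nat \<Rightarrow> prog \<Rightarrow> prog" where
  "free_blocks a 0 p = FreeBlock (16 * a) p"
| "free_blocks a (Suc n) p = FreeBlock (16 * a + Suc n) (free_blocks a n p)"

definition free_record :: "nat \<Rightarrow> prog \<Rightarrow> prog" where
  "free_record a p = free_blocks a 15 p"

primrec init_fields :: "nat \<Rightarrow> nat \<Rightarrow> nat \<Rightarrow> prog \<Rightarrow> prog" where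
  "init_fields a v 0 p = p"
| "init_fields a v (Suc n) p = set_field a (Suc n) v (init_fields a 0 n p)"

definition new_record :: "nat \<Rightarrow> nat \<Rightarrow> prog \<Rightarrow> prog" where
  "new_record a n p = WriteBlock (16 * a) 0 (init_fields a n size_field p)"

definition output_key :: "nat \<Rightarrow> prog \<Rightarrow> prog" where
  "output_key a p = ReadBlock (16 * a) 0 (Output 0 p)"

primrec copy_cells :: "nat \<Rightarrow> nat \<Rightarrow> nat \<Rightarrow> prog \<Rightarrow> prog" where
  "copy_cells c d 0 p = p"
| "copy_cells c d (Suc n) p = Copy c d (copy_cells (Suc c) (Suc d) n p)"

primrec count_less :: "nat \<Rightarrow> nat \<Rightarrow> nat \<Rightarrow> nat \<Rightarrow> (nat \<Rightarrow> prog) \<Rightarrow> prog" where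
  "count_less c d 0 i k = k i"
| "count_less c d (Suc n) i k = IfLess (c + i) d (count_less c d n (Suc i) k) (k i)"

definition store_record :: "nat \<Rightarrow> nat \<Rightarrow> nat \<Rightarrow> prog \<Rightarrow> prog" where
  "store_record c n a p = copy_cells c 0 n (new_record a n p)"

definition load_record :: "nat \<Rightarrow> nat \<Rightarrow> nat \<Rightarrow> prog \<Rightarrow> prog" where
  "load_record a c n p = ReadBlock (16 * a) 0 (copy_cells 0 c n p)"

locale io_programs =
  fixes B :: nat
begin

definition compare_keys :: "nat \<Rightarrow> nat \<Rightarrow> prog \<Rightarrow> prog \<Rightarrow> prog" where
  "compare_keys a a' p q = ReadBlock (16 * a) 0 (Copy 0 B (ReadBlock (16 * a') 0 (IfLess B 0 p q)))"

end

definition holds :: "(nat \<Rightarrow> 'a word) \<Rightarrow> nat \<Rightarrow> 'a list \<Rightarrow> bool" where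
  "holds m c xs \<longleftrightarrow> (\<forall>k<length xs. m (c + k) = Elem (xs ! k))"

definition put :: "(nat \<Rightarrow> 'a word) \<Rightarrow> nat \<Rightarrow> 'a list \<Rightarrow> nat \<Rightarrow> 'a word" where
  "put m c xs = (\<lambda>x. if c \<le> x \<and> x < c + length xs then Elem (xs ! (x - c)) else m x)"

lemma holds_Nil [simp]: "holds m c []"
  by (simp add: holds_def)

lemma holds_Cons: "holds m c (x # xs) \<longleftrightarrow> m c = Elem x \<and> holds m (Suc c) xs"
  by (simp add: holds_def All_less_Suc2)

lemma holds_append: "holds m c (xs @ ys) \<longleftrightarrow> holds m c xs \<and> holds m (c + length xs) ys"
  by (induction xs arbitrary: c) (auto simp: holds_Cons)

lemma holds_takeWhile: "holds m c xs \<Longrightarrow> holds m c (takeWhile P xs)"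
  using holds_append[of m c "takeWhile P xs" "dropWhile P xs"] by simp

lemma put_Nil [simp]: "put m c [] = m"
  by (auto simp: put_def fun_eq_iff)

lemma holds_put [simp]: "holds (put m c xs) c xs"
  by (simp add: holds_def put_def)

lemma holds_cong:
  "(\<And>x. c \<le> x \<Longrightarrow> x < c + length xs \<Longrightarrow> m' x = m x) \<Longrightarrow> holds m' c xs = holds m c xs"
  by (auto simp: holds_def)

lemma holds_put_other:
  "d + length ys \<le> c \<or> c + length xs \<le> d \<Longrightarrow> holds (put m c xs) d ys = holds m d ys"
  by (rule holds_cong) (auto simp: put_def)

lemma put_cong_above: "B < d \<Longrightarrow> \<forall>c>B. m c = m' c \<Longrightarrow> \<forall>c>B. put m d xs c = put m' d xs c" for B :: nat
  by (simp add: put_def)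

record 'a view =
  vmem :: "nat \<Rightarrow> 'a word"
  vresult :: "'a option"
  vaddrs :: "nat set"
  velems :: "nat \<Rightarrow> 'a list"
  vfields :: "nat \<Rightarrow> nat \<Rightarrow> nat"

abbreviation upd_field :: "(nat \<Rightarrow> nat \<Rightarrow> nat) \<Rightarrow> nat \<Rightarrow> nat \<Rightarrow> nat \<Rightarrow> nat \<Rightarrow> nat \<Rightarrow> nat" where
  "upd_field fd a j v \<equiv> fd(a := (fd a)(j := v))"

definition add_record :: "'a view \<Rightarrow> nat \<Rightarrow> 'a list \<Rightarrow> 'a view" where
  "add_record st a xs = st\<lparr>vaddrs := insert a (vaddrs st), velems := (velems st)(a := xs),
     vfields := (vfields st)(a := (\<lambda>j. if j = size_field then length xs else 0))\<rparr>"

lemma block_address_eq_iff: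
  "j < 16 \<Longrightarrow> j' < 16 \<Longrightarrow> 16 * a + j = 16 * a' + j' \<longleftrightarrow> a = a' \<and> j = j'" for a a' j j' :: nat
proof -
  assume "j < 16" "j' < 16"
  then have "(16 * a + j) div 16 = a" "(16 * a' + j') div 16 = a'" by simp_all
  then show ?thesis by fastforce
qed

locale io_machine = io_programs B
  for B :: nat +
  fixes M W :: nat and arg :: "'a::linorder option"
  assumes block_pos: "1 \<le> B" and two_blocks: "2 * B \<le> M" and word_pos: "1 \<le> W"
begin

abbreviation mc :: machine where
  "mc \<equiv> \<lparr>mem_size = M, block_size = B, word_max = W\<rparr>"

definition record_at :: "(nat \<Rightarrow> 'a word list option) \<Rightarrow> nat \<Rightarrow> 'a list \<Rightarrow> (nat \<Rightarrow> nat) \<Rightarrow> bool" where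
  "record_at d a xs f \<longleftrightarrow> xs \<noteq> [] \<and> length xs \<le> B \<and> 16 * a + 15 \<le> W \<and> f size_field = length xs
     \<and> (\<exists>blk. d (16 * a) = Some blk \<and> (\<forall>i<length xs. blk ! i = Elem (xs ! i)))
     \<and> (\<forall>j\<in>{1..11}. f j \<le> W \<and> (\<exists>blk. d (16 * a + j) = Some blk \<and> blk ! 0 = Num (f j)))"

definition implements :: "'a config \<Rightarrow> 'a view \<Rightarrow> bool" where
  "implements s st \<longleftrightarrow> (\<forall>c>B. mem s c = vmem st c) \<and> result s = vresult st \<and> finite (vaddrs st)
     \<and> (\<forall>a\<in>vaddrs st. record_at (disk s) a (velems st a) (vfields st a))
     \<and> (\<forall>x. disk s x \<noteq> None \<longrightarrow> x div 16 \<in> vaddrs st \<and> x mod 16 \<le> 11)"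

definition runs :: "prog \<Rightarrow> 'a view \<Rightarrow> nat \<Rightarrow> ('a config \<Rightarrow> bool) \<Rightarrow> bool" where
  "runs p st n Q \<longleftrightarrow> (\<forall>s. implements s st \<longrightarrow>
     (\<exists>s'. exec mc arg p s = Some s' \<and> ios s' \<le> ios s + n \<and> Q s'))"

lemma runs_mono: "runs p st n Q \<Longrightarrow> n \<le> m \<Longrightarrow> runs p st m Q"
  unfolding runs_def by (meson add_left_mono order_trans)

lemma runs_step:
  assumes "runs p st' n' Q"
    and "\<And>s. implements s st \<Longrightarrow>
      \<exists>s'. exec mc arg q s = exec mc arg p s' \<and> implements s' st' \<and> ios s' + n' \<le> ios s + n"
  shows "runs q st n Q"
  unfolding runs_def
proof (intro allI impI)
  fix s assume "implements s st"
  from assms(2)[OF this] obtain s' where s': "exec mc arg q s = exec mc arg p s'" "implements s' st'"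
    "ios s' + n' \<le> ios s + n" by blast
  from assms(1) s'(2) obtain s'' where "exec mc arg p s' = Some s''" "ios s'' \<le> ios s' + n'" "Q s''"
    unfolding runs_def by blast
  with s' show "\<exists>s'. exec mc arg q s = Some s' \<and> ios s' \<le> ios s + n \<and> Q s'" by auto
qed

lemma runs_step_to:
  assumes "runs p st' n' Q"
    and "\<And>s. implements s st \<Longrightarrow>
      exec mc arg q s = exec mc arg p (f s) \<and> implements (f s) st' \<and> ios (f s) + n' \<le> ios s + n"
  shows "runs q st n Q"
  using assms(1) by (rule runs_step) (use assms(2) in blast)

lemma runs_Halt: "(\<And>s. implements s st \<Longrightarrow> Q s) \<Longrightarrow> runs Halt st n Q"
  by (simp add: runs_def)

lemma runs_SetNum:
  assumes "B < j" "j < M" "v \<le> W" "runs p (st\<lparr>vmem := (vmem st)(j := Num v)\<rparr>) n Q"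
  shows "runs (SetNum j v p) st n Q"
  by (rule runs_step_to[OF assms(4), where f = "\<lambda>s. s\<lparr>mem := (mem s)(j := Num v)\<rparr>"])
    (use assms in \<open>auto simp: implements_def\<close>)

lemma runs_CaseNum:
  assumes "B < i" "i < M" "vmem st i = Num v" "runs (f v) st n Q"
  shows "runs (CaseNum i f) st n Q"
  by (rule runs_step_to[OF assms(4), where f = id]) (use assms in \<open>auto simp: implements_def\<close>)

lemma runs_Output:
  assumes "B < i" "i < M" "vmem st i = Elem x" "runs p (st\<lparr>vresult := Some x\<rparr>) n Q"
  shows "runs (Output i p) st n Q"
  by (rule runs_step_to[OF assms(4), where f = "\<lambda>s. s\<lparr>result := Some x\<rparr>"])
    (use assms in \<open>auto simp: implements_def\<close>)

lemma runs_GetArg: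
  assumes "B < j" "j < M" "arg = Some e" "runs p (st\<lparr>vmem := put (vmem st) j [e]\<rparr>) n Q"
  shows "runs (GetArg j p) st n Q"
  by (rule runs_step_to[OF assms(4), where f = "\<lambda>s. s\<lparr>mem := (mem s)(j := Elem e)\<rparr>"])
    (use assms in \<open>auto simp: implements_def put_def\<close>)

subsection \<open>Reading and writing the fields of a record\<close>

lemma implements_record_at:
  "implements s st \<Longrightarrow> a \<in> vaddrs st \<Longrightarrow> record_at (disk s) a (velems st a) (vfields st a)"
  by (simp add: implements_def)

lemma implements_mem:
  "implements s st \<Longrightarrow> (\<And>c. c > B \<Longrightarrow> m c = mem s c) \<Longrightarrow> implements (s\<lparr>mem := m, ios := n\<rparr>) st"
  by (simp add: implements_def)

lemma record_at_field:
  "record_at d a xs f \<Longrightarrow> 1 \<le> j \<Longrightarrow> j \<le> 11 \<Longrightarrow>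
    \<exists>blk. d (16 * a + j) = Some blk \<and> blk ! 0 = Num (f j) \<and> f j \<le> W \<and> 16 * a + j \<le> W"
  unfolding record_at_def by fastforce

lemma record_at_elems:
  "record_at d a xs f \<Longrightarrow> \<exists>blk. d (16 * a) = Some blk \<and> blk ! 0 = Elem (hd xs) \<and>
     (\<forall>i<length xs. blk ! i = Elem (xs ! i)) \<and> 16 * a \<le> W"
  unfolding record_at_def by (fastforce simp: hd_conv_nth)

lemma record_at_frame:
  assumes "record_at d a xs f" and same: "\<And>j. j < 16 \<Longrightarrow> d' (16 * a + j) = d (16 * a + j)"
  shows "record_at d' a xs f"
proof -
  have "d' (16 * a) = d (16 * a)" using same[of 0] by simp
  moreover have "j \<in> {1..11} \<Longrightarrow> d' (16 * a + j) = d (16 * a + j)" for j by (rule same) simp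
  ultimately show ?thesis using assms(1) unfolding record_at_def by simp
qed

lemma runs_get_field:
  assumes "a \<in> vaddrs st" "1 \<le> j" "j \<le> 11" "1 \<le> n"
    and cont: "vfields st a j \<le> W \<Longrightarrow> runs (k (vfields st a j)) st (n - 1) Q"
  shows "runs (get_field a j k) st n Q"
  unfolding runs_def
proof (intro allI impI)
  fix s assume s: "implements s st"
  obtain blk where blk: "disk s (16 * a + j) = Some blk" "blk ! 0 = Num (vfields st a j)"
      "vfields st a j \<le> W" "16 * a + j \<le> W"
    using record_at_field[OF implements_record_at[OF s assms(1)] assms(2,3)] by blast
  let ?s = "s\<lparr>mem := (\<lambda>c. if 0 \<le> c \<and> c < 0 + B then blk ! (c - 0) else mem s c), ios := Suc (ios s)\<rparr>"
  have exec: "exec mc arg (get_field a j k) s = exec mc arg (k (vfields st a j)) ?s"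
    using blk block_pos two_blocks by (simp add: get_field_def)
  have "implements ?s st" by (rule implements_mem[OF s]) simp
  from cont[OF blk(3), unfolded runs_def, rule_format, OF this] assms(4)
  show "\<exists>s'. exec mc arg (get_field a j k) s = Some s' \<and> ios s' \<le> ios s + n \<and> Q s'"
    unfolding exec by auto
qed

lemma runs_get_size:
  assumes a: "a \<in> vaddrs st" and n: "1 \<le> n" and cont: "runs (k (length (velems st a))) st (n - 1) Q"
  shows "runs (get_field a size_field k) st n Q"
proof (cases "\<exists>s. implements s st")
  case True
  then obtain s where "implements s st" by blast
  from implements_record_at[OF this a] have "vfields st a size_field = length (velems st a)"
    by (simp add: record_at_def)
  then show ?thesis using assms by (intro runs_get_field) auto
next
  case False
  then show ?thesis by (simp add: runs_def)
qed

lemma runs_set_field: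
  assumes a: "a \<in> vaddrs st" and j: "1 \<le> j" "j \<le> 10" and v: "v \<le> W" and n: "1 \<le> n"
    and cont: "runs p (st\<lparr>vfields := upd_field (vfields st) a j v\<rparr>) (n - 1) Q"
  shows "runs (set_field a j v p) st n Q"
proof (rule runs_step[OF cont])
  fix s assume s: "implements s st"
  note rec = implements_record_at[OF s a]
  let ?fd = "upd_field (vfields st) a j v"
  let ?m = "(mem s)(0 := Num v)"
  let ?d = "(disk s)(16 * a + j \<mapsto> map ?m [0..<0 + B])"
  let ?s = "s\<lparr>mem := ?m, disk := ?d, ios := Suc (ios s)\<rparr>"
  have "16 * a + j \<le> W" using rec j by (auto simp: record_at_def)
  then have exec: "exec mc arg (set_field a j v p) s = exec mc arg p ?s"
    using v block_pos two_blocks by (simp add: set_field_def)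
  have recs: "record_at ?d a' (velems st a') (?fd a')" if "a' \<in> vaddrs st" for a'
  proof (cases "a' = a")
    case True
    have "16 * a + j \<noteq> 16 * a" using j by simp
    then show ?thesis using rec j v block_pos True unfolding record_at_def by (auto simp: nth_append)
  next
    case False
    have "record_at ?d a' (velems st a') (vfields st a')"
      by (rule record_at_frame[OF implements_record_at[OF s that]])
        (use False j in \<open>auto simp: block_address_eq_iff\<close>)
    then show ?thesis using False by simp
  qed
  have "(16 * a + j) div 16 = a" "(16 * a + j) mod 16 = j" using j by auto
  then have "implements ?s (st\<lparr>vfields := ?fd\<rparr>)"
    using s recs a j block_pos unfolding implements_def by auto
  then show "\<exists>s'. exec mc arg (set_field a j v p) s = exec mc arg p s' \<and>
      implements s' (st\<lparr>vfields := ?fd\<rparr>) \<and> ios s' + (n - 1) \<le> ios s + n"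
    using exec n by (intro exI[of _ ?s]) auto
qed

lemma runs_compare_keys:
  assumes a: "a \<in> vaddrs st" and a': "a' \<in> vaddrs st" and n: "2 \<le> n"
    and less: "hd (velems st a) < hd (velems st a') \<Longrightarrow> runs p st (n - 2) Q"
    and not_less: "\<not> hd (velems st a) < hd (velems st a') \<Longrightarrow> runs q st (n - 2) Q"
  shows "runs (compare_keys a a' p q) st n Q"
proof -
  let ?p = "if hd (velems st a) < hd (velems st a') then p else q"
  have "runs ?p st (n - 2) Q" using less not_less by auto
  then show ?thesis
  proof (rule runs_step)
    fix s assume s: "implements s st"
    obtain blk where blk: "disk s (16 * a) = Some blk" "blk ! 0 = Elem (hd (velems st a))" "16 * a \<le> W"
      using record_at_elems[OF implements_record_at[OF s a]] by blast
    obtain blk' where blk': "disk s (16 * a') = Some blk'" "blk' ! 0 = Elem (hd (velems st a'))" "16 * a' \<le> W"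
      using record_at_elems[OF implements_record_at[OF s a']] by blast
    let ?s = "s\<lparr>mem := (\<lambda>c. if c < B then blk' ! c else if c = B then blk ! 0 else mem s c),
      ios := Suc (Suc (ios s))\<rparr>"
    have "exec mc arg (compare_keys a a' p q) s = exec mc arg ?p ?s"
      using blk blk' block_pos two_blocks
      by (simp add: compare_keys_def) (auto intro!: arg_cong[of _ _ "exec mc arg _"] simp: fun_eq_iff)
    moreover have "implements ?s st" by (rule implements_mem[OF s]) simp
    ultimately show "\<exists>s'. exec mc arg (compare_keys a a' p q) s = exec mc arg ?p s' \<and>
        implements s' st \<and> ios s' + (n - 2) \<le> ios s + n"
      using n by (intro exI[of _ ?s]) auto
  qed
qed

lemma runs_output_key:
  assumes a: "a \<in> vaddrs st" and n: "1 \<le> n"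
    and cont: "runs p (st\<lparr>vresult := Some (hd (velems st a))\<rparr>) (n - 1) Q"
  shows "runs (output_key a p) st n Q"
proof (rule runs_step[OF cont])
  fix s assume s: "implements s st"
  obtain blk where blk: "disk s (16 * a) = Some blk" "blk ! 0 = Elem (hd (velems st a))" "16 * a \<le> W"
    using record_at_elems[OF implements_record_at[OF s a]] by blast
  let ?s = "s\<lparr>mem := (\<lambda>c. if 0 \<le> c \<and> c < 0 + B then blk ! (c - 0) else mem s c), ios := Suc (ios s),
    result := Some (hd (velems st a))\<rparr>"
  have "exec mc arg (output_key a p) s = exec mc arg p ?s"
    using blk block_pos two_blocks by (simp add: output_key_def)
  moreover have "implements ?s (st\<lparr>vresult := Some (hd (velems st a))\<rparr>)" using s by (simp add: implements_def)
  ultimately show "\<exists>s'. exec mc arg (output_key a p) s = exec mc arg p s' \<and>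
      implements s' (st\<lparr>vresult := Some (hd (velems st a))\<rparr>) \<and> ios s' + (n - 1) \<le> ios s + n"
    using n by (intro exI[of _ ?s]) simp
qed

subsection \<open>Allocating and freeing records\<close>

lemma exec_free_blocks:
  "exec mc arg (free_blocks a n p) s =
    exec mc arg p (s\<lparr>disk := (\<lambda>x. if 16 * a \<le> x \<and> x \<le> 16 * a + n then None else disk s x)\<rparr>)"
proof (induction n arbitrary: s)
  case 0
  have "(disk s)(16 * a := None) = (\<lambda>x. if 16 * a \<le> x \<and> x \<le> 16 * a + 0 then None else disk s x)"
    by auto
  then show ?case by simp
next
  case (Suc n)
  have "(\<lambda>x. if 16 * a \<le> x \<and> x \<le> 16 * a + n then None else ((disk s)(16 * a + Suc n := None)) x)
      = (\<lambda>x. if 16 * a \<le> x \<and> x \<le> 16 * a + Suc n then None else disk s x)"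
    by (rule ext) auto
  then show ?case by (simp add: Suc.IH cong: if_cong)
qed

lemma runs_free_record:
  assumes "runs p (st\<lparr>vaddrs := vaddrs st - {a}\<rparr>) n Q"
  shows "runs (free_record a p) st n Q"
proof (rule runs_step[OF assms])
  fix s assume s: "implements s st"
  let ?d = "\<lambda>x. if 16 * a \<le> x \<and> x \<le> 16 * a + 15 then None else disk s x"
  let ?s = "s\<lparr>disk := ?d\<rparr>"
  have "record_at ?d a' (velems st a') (vfields st a')" if "a' \<in> vaddrs st - {a}" for a'
  proof (rule record_at_frame[OF implements_record_at[OF s]])
    fix j :: nat assume "j < 16"
    moreover have "a' \<noteq> a" using that by simp
    ultimately have "\<not> (16 * a \<le> 16 * a' + j \<and> 16 * a' + j \<le> 16 * a + 15)" by auto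
    then show "?d (16 * a' + j) = disk s (16 * a' + j)" by (simp only: if_False)
  qed (use that in simp)
  moreover have "x div 16 \<in> vaddrs st - {a} \<and> x mod 16 \<le> 11" if "?d x \<noteq> None" for x
  proof -
    have "disk s x \<noteq> None" "\<not> (16 * a \<le> x \<and> x \<le> 16 * a + 15)" using that by (auto split: if_splits)
    then show ?thesis using s by (auto simp: implements_def)
  qed
  ultimately have "implements ?s (st\<lparr>vaddrs := vaddrs st - {a}\<rparr>)" using s by (simp add: implements_def)
  then show "\<exists>s'. exec mc arg (free_record a p) s = exec mc arg p s' \<and>
      implements s' (st\<lparr>vaddrs := vaddrs st - {a}\<rparr>) \<and> ios s' + n \<le> ios s + n"
    by (intro exI[of _ ?s]) (simp add: free_record_def exec_free_blocks)
qed

lemma exec_init_fields: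
  assumes "16 * a + n \<le> W" "v \<le> W"
  shows "\<exists>s'. exec mc arg (init_fields a v n p) s = exec mc arg p s' \<and>
     (\<forall>c>0. mem s' c = mem s c) \<and> result s' = result s \<and> ios s' = ios s + n \<and>
     (\<forall>j\<in>{1..n}. \<exists>blk. disk s' (16 * a + j) = Some blk \<and> blk ! 0 = Num (if j = n then v else 0)) \<and>
     (\<forall>x. x \<notin> {16 * a + 1..16 * a + n} \<longrightarrow> disk s' x = disk s x)"
  using assms
proof (induction n arbitrary: v s)
  case (Suc n)
  let ?m = "(mem s)(0 := Num v)"
  let ?s = "s\<lparr>mem := ?m, disk := (disk s)(16 * a + Suc n \<mapsto> map ?m [0..<0 + B]), ios := Suc (ios s)\<rparr>"
  have exec: "exec mc arg (init_fields a v (Suc n) p) s = exec mc arg (init_fields a 0 n p) ?s"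
    using Suc.prems block_pos two_blocks by (simp add: set_field_def)
  obtain s' where s': "exec mc arg (init_fields a 0 n p) ?s = exec mc arg p s'"
     "\<forall>c>0. mem s' c = mem ?s c" "result s' = result ?s" "ios s' = ios ?s + n"
     "\<forall>j\<in>{1..n}. \<exists>blk. disk s' (16 * a + j) = Some blk \<and> blk ! 0 = Num (if j = n then 0 else 0)"
     "\<forall>x. x \<notin> {16 * a + 1..16 * a + n} \<longrightarrow> disk s' x = disk ?s x"
    using Suc.IH[of 0 ?s] Suc.prems(1) by auto
  have "disk s' (16 * a + Suc n) = Some (map ?m [0..<0 + B])" using s'(6) by simp
  then have "\<exists>blk. disk s' (16 * a + j) = Some blk \<and> blk ! 0 = Num (if j = Suc n then v else 0)"
    if "j \<in> {1..Suc n}" for j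
    using s'(5) that block_pos by (cases "j = Suc n") (auto simp: le_Suc_eq)
  then show ?case
    unfolding exec s'(1) using s'(2-4,6) by (intro exI[of _ s']) auto
qed auto

lemma implements_add_record:
  assumes s: "implements s st" and new: "a \<notin> vaddrs st"
    and rec: "record_at (disk s') a xs (\<lambda>j. if j = size_field then length xs else 0)"
    and frame: "\<forall>x. x \<notin> {16 * a..16 * a + 11} \<longrightarrow> disk s' x = disk s x"
    and mem: "\<forall>c>B. mem s' c = mem s c" and result: "result s' = result s"
  shows "implements s' (add_record st a xs)"
proof -
  have "record_at (disk s') a' (velems st a') (vfields st a')" if "a' \<in> vaddrs st" for a'
  proof (rule record_at_frame[OF implements_record_at[OF s that]])
    fix j :: nat assume "j < 16"
    moreover have "a' \<noteq> a" using that new by auto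
    ultimately have "16 * a' + j \<notin> {16 * a..16 * a + 11}" by auto
    then show "disk s' (16 * a' + j) = disk s (16 * a' + j)" using frame by blast
  qed
  moreover have "x div 16 \<in> insert a (vaddrs st) \<and> x mod 16 \<le> 11" if "disk s' x \<noteq> None" for x
  proof (cases "x \<in> {16 * a..16 * a + 11}")
    case True
    then obtain i where "x = 16 * a + i" "i \<le> 11"
      by (metis add_le_cancel_left atLeastAtMost_iff le_iff_add)
    then show ?thesis by simp
  next
    case False
    then have "disk s x \<noteq> None" using frame that by metis
    then show ?thesis using s by (simp add: implements_def)
  qed
  ultimately show ?thesis using assms unfolding implements_def add_record_def by auto
qed

lemma exec_new_record:
  assumes s: "implements s st" and new: "a \<notin> vaddrs st" "16 * a + 15 \<le> W"
    and xs: "xs \<noteq> []" "length xs \<le> B" "length xs \<le> W" "\<And>i. i < length xs \<Longrightarrow> mem s i = Elem (xs ! i)"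
  shows "\<exists>s'. exec mc arg (new_record a (length xs) p) s = exec mc arg p s' \<and>
     implements s' (add_record st a xs) \<and> ios s' = ios s + 12"
proof -
  let ?blk = "map (mem s) [0..<0 + B]"
  let ?s = "s\<lparr>disk := (disk s)(16 * a \<mapsto> ?blk), ios := Suc (ios s)\<rparr>"
  have exec: "exec mc arg (new_record a (length xs) p) s = exec mc arg (init_fields a (length xs) 11 p) ?s"
    using new two_blocks by (simp add: new_record_def del: init_fields.simps)
  obtain s' where s': "exec mc arg (init_fields a (length xs) 11 p) ?s = exec mc arg p s'"
     "\<forall>c>0. mem s' c = mem ?s c" "result s' = result ?s" "ios s' = ios ?s + 11"
     "\<forall>j\<in>{1..11}. \<exists>blk. disk s' (16 * a + j) = Some blk \<and> blk ! 0 = Num (if j = 11 then length xs else 0)"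
     "\<forall>x. x \<notin> {16 * a + 1..16 * a + 11} \<longrightarrow> disk s' x = disk ?s x"
    using exec_init_fields[of a 11 "length xs" p ?s] new xs by auto
  have "disk s' (16 * a) = Some ?blk" using s'(6) by simp
  then have "record_at (disk s') a xs (\<lambda>j. if j = 11 then length xs else 0)"
    using s'(5) new xs word_pos unfolding record_at_def by auto
  moreover have "\<forall>x. x \<notin> {16 * a..16 * a + 11} \<longrightarrow> disk s' x = disk s x" using s'(6) by auto
  ultimately have "implements s' (add_record st a xs)"
    using s'(2,3) by (intro implements_add_record[OF s new(1)]) auto
  then show ?thesis unfolding exec s'(1) using s'(4) by (intro exI[of _ s']) auto
qed

lemma implements_blocks_used:
  assumes s: "implements s st"
  shows "blocks_used s \<le> 12 * card (vaddrs st)"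
proof -
  have "{a. disk s a \<noteq> None} \<subseteq> (\<lambda>(a, j). 16 * a + j) ` (vaddrs st \<times> {..11})"
  proof
    fix x assume "x \<in> {a. disk s a \<noteq> None}"
    then have "x div 16 \<in> vaddrs st" "x mod 16 \<le> 11" using s by (auto simp: implements_def)
    moreover have "x = 16 * (x div 16) + x mod 16" by simp
    ultimately show "x \<in> (\<lambda>(a, j). 16 * a + j) ` (vaddrs st \<times> {..11})"
      by (intro image_eqI[of _ _ "(x div 16, x mod 16)"]) auto
  qed
  moreover have "finite (vaddrs st \<times> {..11::nat})" using s by (simp add: implements_def)
  ultimately have "blocks_used s \<le> card (vaddrs st \<times> {..11::nat})"
    unfolding blocks_used_def by (meson card_image_le card_mono finite_imageI le_trans)
  then show ?thesis by (simp add: card_cartesian_product)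
qed

subsection \<open>Moving elements\<close>

lemma exec_copy_cells:
  assumes "holds (mem s) c xs" "d \<le> c \<or> c + length xs \<le> d" "c + length xs \<le> M" "d + length xs \<le> M"
  shows "exec mc arg (copy_cells c d (length xs) p) s = exec mc arg p (s\<lparr>mem := put (mem s) d xs\<rparr>)"
  using assms
proof (induction xs arbitrary: c d s)
  case (Cons x xs)
  let ?s = "s\<lparr>mem := (mem s)(d := mem s c)\<rparr>"
  have x: "mem s c = Elem x" "holds (mem s) (Suc c) xs" using Cons.prems(1) by (auto simp: holds_Cons)
  have "holds (mem ?s) (Suc c) xs = holds (mem s) (Suc c) xs"
    by (rule holds_cong) (use Cons.prems(2) in auto)
  then have "holds (mem ?s) (Suc c) xs" using x by blast
  then have "exec mc arg (copy_cells (Suc c) (Suc d) (length xs) p) ?s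
      = exec mc arg p (?s\<lparr>mem := put (mem ?s) (Suc d) xs\<rparr>)"
    by (rule Cons.IH) (use Cons.prems in auto)
  moreover have "put ((mem s)(d := Elem x)) (Suc d) xs = put (mem s) d (x # xs)"
    by (auto simp: put_def fun_eq_iff nth_Cons' Suc_diff_Suc)
  ultimately show ?case using Cons.prems x by simp
qed simp

lemma runs_copy_cells:
  assumes "holds (vmem st) c xs" "length xs = k" "d \<le> c \<or> c + k \<le> d" "c + k \<le> M" "d + k \<le> M" "B < c" "B < d"
    and cont: "runs p (st\<lparr>vmem := put (vmem st) d xs\<rparr>) n Q"
  shows "runs (copy_cells c d k p) st n Q"
proof (rule runs_step_to[OF cont, where f = "\<lambda>s. s\<lparr>mem := put (mem s) d xs\<rparr>"])
  fix s assume s: "implements s st"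
  then have mem: "\<forall>c>B. mem s c = vmem st c" by (simp add: implements_def)
  have "holds (mem s) c xs = holds (vmem st) c xs" by (rule holds_cong) (use mem assms(6) in auto)
  then show "exec mc arg (copy_cells c d k p) s = exec mc arg p (s\<lparr>mem := put (mem s) d xs\<rparr>) \<and>
      implements (s\<lparr>mem := put (mem s) d xs\<rparr>) (st\<lparr>vmem := put (vmem st) d xs\<rparr>) \<and>
      ios (s\<lparr>mem := put (mem s) d xs\<rparr>) + n \<le> ios s + n"
    using assms exec_copy_cells[of s c xs d p] put_cong_above[OF assms(7) mem] s by (simp add: implements_def)
qed

lemma exec_count_less:
  assumes "holds (mem s) (c + i) xs" "mem s d = Elem y" "c + i + length xs \<le> M" "d < M"
  shows "exec mc arg (count_less c d (length xs) i k) s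
    = exec mc arg (k (i + length (takeWhile (\<lambda>x. x < y) xs))) s"
  using assms
proof (induction xs arbitrary: i)
  case (Cons x xs)
  have "mem s (c + i) = Elem x" "holds (mem s) (c + Suc i) xs" using Cons.prems(1) by (auto simp: holds_Cons)
  then show ?case using Cons by simp
qed simp

lemma runs_count_less:
  assumes "holds (vmem st) c xs" "length xs = m" "vmem st d = Elem y" "c + m \<le> M" "d < M" "B < c" "B < d"
    and cont: "runs (k (length (takeWhile (\<lambda>x. x < y) xs))) st n Q"
  shows "runs (count_less c d m 0 k) st n Q"
proof (rule runs_step_to[OF cont, where f = id])
  fix s assume s: "implements s st"
  then have mem: "\<forall>c>B. mem s c = vmem st c" by (simp add: implements_def)
  have "holds (mem s) c xs = holds (vmem st) c xs" by (rule holds_cong) (use mem assms(6) in auto)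
  then show "exec mc arg (count_less c d m 0 k) s = exec mc arg (k (length (takeWhile (\<lambda>x. x < y) xs))) (id s) \<and>
      implements (id s) st \<and> ios (id s) + n \<le> ios s + n"
    using assms mem s exec_count_less[of s c 0 xs d y k] by simp
qed

lemma runs_store_record:
  assumes "holds (vmem st) c xs" "length xs = k" "xs \<noteq> []" "k \<le> B" "c + k \<le> M" "B < c"
    and new: "a \<notin> vaddrs st" "16 * a + 15 \<le> W" and "k \<le> W" and cont: "runs p (add_record st a xs) n Q"
  shows "runs (store_record c k a p) st (n + 12) Q"
proof (rule runs_step[OF cont])
  fix s assume s: "implements s st"
  then have mem: "\<forall>c>B. mem s c = vmem st c" by (simp add: implements_def)
  let ?s = "s\<lparr>mem := put (mem s) 0 xs\<rparr>"
  have "holds (mem s) c xs = holds (vmem st) c xs" by (rule holds_cong) (use mem assms(6) in auto)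
  then have exec: "exec mc arg (store_record c k a p) s = exec mc arg (new_record a k p) ?s"
    unfolding store_record_def using assms exec_copy_cells[of s c xs 0 "new_record a k p"] by simp
  have "implements ?s st" using s assms(2,4) by (simp add: implements_def put_def)
  from exec_new_record[OF this new assms(3), of p] obtain s' where
    "exec mc arg (new_record a k p) ?s = exec mc arg p s'" "implements s' (add_record st a xs)"
    "ios s' = ios ?s + 12"
    using assms(2,4,9) by (auto simp: put_def)
  then show "\<exists>s'. exec mc arg (store_record c k a p) s = exec mc arg p s' \<and>
      implements s' (add_record st a xs) \<and> ios s' + n \<le> ios s + (n + 12)"
    unfolding exec by (intro exI[of _ s']) simp
qed

lemma runs_load_record:
  assumes a: "a \<in> vaddrs st" and k: "k \<le> length (velems st a)" and c: "c + k \<le> M" "B < c" and n: "1 \<le> n"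
    and cont: "runs p (st\<lparr>vmem := put (vmem st) c (take k (velems st a))\<rparr>) (n - 1) Q"
  shows "runs (load_record a c k p) st n Q"
proof (rule runs_step[OF cont])
  fix s assume s: "implements s st"
  note rec = implements_record_at[OF s a]
  obtain blk where blk: "disk s (16 * a) = Some blk"
      "\<forall>i<length (velems st a). blk ! i = Elem (velems st a ! i)" "16 * a \<le> W"
    using record_at_elems[OF rec] by blast
  have kB: "k \<le> B" using rec k by (simp add: record_at_def)
  let ?s = "s\<lparr>mem := (\<lambda>x. if 0 \<le> x \<and> x < 0 + B then blk ! (x - 0) else mem s x), ios := Suc (ios s)\<rparr>"
  let ?xs = "take k (velems st a)"
  let ?s' = "?s\<lparr>mem := put (mem ?s) c ?xs\<rparr>"
  have "holds (mem ?s) 0 ?xs" using blk(2) k kB by (simp add: holds_def)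
  then have "exec mc arg (copy_cells 0 c k p) ?s = exec mc arg p ?s'"
    using exec_copy_cells[of ?s 0 ?xs c p] c k kB two_blocks by simp
  then have "exec mc arg (load_record a c k p) s = exec mc arg p ?s'"
    unfolding load_record_def using blk two_blocks by simp
  moreover have "implements ?s' (st\<lparr>vmem := put (vmem st) c ?xs\<rparr>)"
    using s c(2) put_cong_above[OF c(2), of "mem ?s" "vmem st" ?xs] by (simp add: implements_def)
  ultimately show "\<exists>s'. exec mc arg (load_record a c k p) s = exec mc arg p s' \<and>
      implements s' (st\<lparr>vmem := put (vmem st) c ?xs\<rparr>) \<and> ios s' + (n - 1) \<le> ios s + n"
    using n by (intro exI[of _ ?s']) simp
qed

end

section \<open>Trees of records\<close>

text \<open>
  A record carries a sorted list of elements and three lists of records that follow it: the clean list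
  \<open>C\<close>, whose keys are known to survive, the buffer \<open>B\<close>, a sorted list that may still be attrited by \<open>D\<close>,
  and the stack \<open>D\<close> of sorted segments (uppermost, that is last, segment first). The records of \<open>C\<close>
  and \<open>B\<close> have no lists below them, hence they are mere pairs of an address and a list of elements.
\<close>

type_synonym 'a entry = "nat \<times> 'a list"

datatype 'a rtree = Node (addr: nat) (elts: "'a list") (clean: "'a entry list")
  (buffer: "'a entry list") (stack: "'a rtree list list")

type_synonym 'a lists = "'a entry list \<times> 'a entry list \<times> 'a rtree list list"

abbreviation key :: "'a rtree \<Rightarrow> 'a" where "key r \<equiv> hd (elts r)"
abbreviation rkey :: "'a entry \<Rightarrow> 'a" where "rkey c \<equiv> hd (snd c)"
abbreviation root :: "'a rtree \<Rightarrow> 'a entry" where "root r \<equiv> (addr r, elts r)"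

primrec records :: "'a rtree \<Rightarrow> 'a entry list" where
  "records (Node a e C B D) = (a, e) # C @ B @ concat (map concat (rev (map (map records) D)))"

definition stack_records :: "'a rtree list list \<Rightarrow> 'a entry list" where
  "stack_records D = concat (map records (concat (rev D)))"

lemma records_eq: "records r = root r # clean r @ buffer r @ stack_records (stack r)"
proof -
  have "concat (map concat (rev (map (map records) D))) = stack_records D" for D :: "'a rtree list list"
    by (induction D) (auto simp: stack_records_def)
  then show ?thesis by (cases r) simp
qed

declare records.simps [simp del]

lemma stack_records_simps [simp]:
  "stack_records [] = []" "stack_records (g # D) = stack_records D @ concat (map records g)"
  by (simp_all add: stack_records_def)

lemma root_in_records: "root r \<in> set (records r)"
  by (simp add: records_eq)

lemma root_in_stack_records: "r \<in> set (concat D) \<Longrightarrow> root r \<in> set (stack_records D)"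
  by (auto simp: stack_records_def intro!: bexI[of _ r] root_in_records)

lemma records_subset_stack_records: "r \<in> set (concat D) \<Longrightarrow> set (records r) \<subseteq> set (stack_records D)"
  by (auto simp: stack_records_def)

definition contents :: "'a entry list \<Rightarrow> 'a list" where
  "contents P = concat (map snd P)"

lemma contents_simps [simp]:
  "contents [] = []" "contents (p # P) = snd p @ contents P" "contents (P @ P') = contents P @ contents P'"
  by (simp_all add: contents_def)

definition debt :: "'a rtree list list \<Rightarrow> nat" where
  "debt D = (if D = [] then 0 else length (concat D) + length D - 1)"

lemma debt_pos: "\<forall>g\<in>set D. g \<noteq> [] \<Longrightarrow> D \<noteq> [] \<Longrightarrow> 1 \<le> debt D"
  by (cases D) (auto simp: debt_def neq_Nil_conv)

subsection \<open>The order of the records\<close>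

definition min_first :: "'a::linorder entry \<Rightarrow> bool" where
  "min_first c \<longleftrightarrow> snd c \<noteq> [] \<and> (\<forall>x\<in>set (snd c). rkey c \<le> x)"

abbreviation rkey_sorted :: "'a::linorder entry list \<Rightarrow> bool" where
  "rkey_sorted \<equiv> sorted_wrt (\<lambda>c d. rkey c < rkey d)"

abbreviation key_sorted :: "'a::linorder rtree list \<Rightarrow> bool" where
  "key_sorted \<equiv> sorted_wrt (\<lambda>r r'. key r < key r')"

definition lists_ordered :: "'a::linorder entry list \<Rightarrow> 'a entry list \<Rightarrow> 'a rtree list list \<Rightarrow> bool" where
  "lists_ordered C B D \<longleftrightarrow> (\<forall>c\<in>set C \<union> set B. min_first c)
     \<and> rkey_sorted (C @ B)
     \<and> (\<forall>c\<in>set C. \<forall>r\<in>set (concat D). rkey c < key r)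
     \<and> (B \<noteq> [] \<longrightarrow> D \<noteq> [])
     \<and> (\<forall>g\<in>set D. g \<noteq> [] \<and> key_sorted g)
     \<and> (\<forall>r\<in>set (concat (butlast D)). key (hd (last D)) < key r)"

primrec rtree_ok :: "'a::linorder rtree \<Rightarrow> bool" where
  "rtree_ok (Node a e C B D) \<longleftrightarrow> min_first (a, e) \<and> lists_ordered C B D \<and> debt D \<le> length C
     \<and> (\<forall>c\<in>set C \<union> set B. hd e < rkey c) \<and> (\<forall>r\<in>set (concat D). hd e < key r)
     \<and> (\<forall>bs\<in>set (map (map rtree_ok) D). \<forall>b\<in>set bs. b)"

declare rtree_ok.simps [simp del]

definition lists_ok :: "'a::linorder entry list \<Rightarrow> 'a entry list \<Rightarrow> 'a rtree list list \<Rightarrow> bool" where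
  "lists_ok C B D \<longleftrightarrow> lists_ordered C B D \<and> (\<forall>r\<in>set (concat D). rtree_ok r)"

lemma rtree_ok_iff: "rtree_ok r \<longleftrightarrow> min_first (root r) \<and> lists_ok (clean r) (buffer r) (stack r)
     \<and> debt (stack r) \<le> length (clean r)
     \<and> (\<forall>c\<in>set (clean r) \<union> set (buffer r). key r < rkey c) \<and> (\<forall>r'\<in>set (concat (stack r)). key r < key r')"
  unfolding lists_ok_def by (cases r) (auto simp: rtree_ok.simps)

lemma lists_ordered_min_first: "lists_ordered C B D \<Longrightarrow> c \<in> set C \<union> set B \<Longrightarrow> min_first c"
  by (simp add: lists_ordered_def)

lemma lists_ordered_clean_less: "lists_ordered C B D \<Longrightarrow> c \<in> set C \<Longrightarrow> r \<in> set (concat D) \<Longrightarrow> rkey c < key r"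
  unfolding lists_ordered_def by blast

lemma lists_ordered_segment: "lists_ordered C B D \<Longrightarrow> g \<in> set D \<Longrightarrow> g \<noteq> [] \<and> key_sorted g"
  by (simp add: lists_ordered_def)

lemma lists_ok_empty: "lists_ok [] B D \<Longrightarrow> debt D = 0 \<Longrightarrow> B = [] \<and> D = []"
  using debt_pos[of D] by (auto simp: lists_ok_def lists_ordered_def)

lemma sorted_wrt_less_le_last:
  fixes f :: "'b \<Rightarrow> 'a::linorder"
  shows "sorted_wrt (\<lambda>x y. f x < f y) xs \<Longrightarrow> x \<in> set xs \<Longrightarrow> f x \<le> f (last xs)"
  by (induction xs) (auto intro: less_imp_le)

lemma sorted_wrt_less_hd_le:
  fixes f :: "'b \<Rightarrow> 'a::linorder"
  shows "sorted_wrt (\<lambda>x y. f x < f y) xs \<Longrightarrow> x \<in> set xs \<Longrightarrow> f (hd xs) \<le> f x"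
  by (cases xs) (auto intro: less_imp_le)

lemma lists_ordered_last_clean_le:
  assumes "lists_ordered C B D" "C \<noteq> []"
  shows "c \<in> set C \<Longrightarrow> rkey c \<le> rkey (last C)" "c \<in> set B \<Longrightarrow> rkey (last C) \<le> rkey c"
    "r \<in> set (concat D) \<Longrightarrow> rkey (last C) < key r"
proof -
  have sorted: "rkey_sorted (C @ B)" using assms(1) by (simp add: lists_ordered_def)
  show "c \<in> set C \<Longrightarrow> rkey c \<le> rkey (last C)"
    by (rule sorted_wrt_less_le_last[of rkey]) (use sorted in \<open>simp_all add: sorted_wrt_append\<close>)
  show "c \<in> set B \<Longrightarrow> rkey (last C) \<le> rkey c"
    using sorted assms(2) by (auto simp: sorted_wrt_append intro: less_imp_le)
  show "r \<in> set (concat D) \<Longrightarrow> rkey (last C) < key r"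
    using lists_ordered_clean_less[OF assms(1)] assms(2) by simp
qed

lemma hd_last_in_concat:
  assumes "lists_ordered C B D" "D \<noteq> []"
  shows "hd (last D) \<in> set (concat D)"
  using lists_ordered_segment[OF assms(1)] assms(2) by (auto intro!: bexI[of _ "last D"])

lemma lists_ordered_hd_last_le:
  assumes "lists_ordered C B D" "r \<in> set (concat D)"
  shows "key (hd (last D)) \<le> key r"
proof -
  have "D \<noteq> []" using assms(2) by auto
  then have "set (concat D) = set (concat (butlast D)) \<union> set (last D)"
    by (metis append_butlast_last_id concat_append concat.simps append_Nil2 set_append)
  with assms(2) consider "r \<in> set (concat (butlast D))" | "r \<in> set (last D)" by auto
  then show ?thesis
  proof cases
    case 1
    then show ?thesis using assms(1) by (auto simp: lists_ordered_def intro: less_imp_le)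
  next
    case 2
    have "key_sorted (last D)" using lists_ordered_segment[OF assms(1)] \<open>D \<noteq> []\<close> by auto
    then show ?thesis using 2 by (rule sorted_wrt_less_hd_le[of key])
  qed
qed

subsection \<open>Keys bound the contents from below\<close>

lemma contents_key_le:
  "x \<in> set (contents P) \<Longrightarrow> \<forall>c\<in>set P. min_first c \<Longrightarrow> \<exists>c\<in>set P. rkey c \<le> x"
  by (induction P) (auto simp: min_first_def)

lemma rtree_ok_key_le: "rtree_ok r \<Longrightarrow> x \<in> set (contents (records r)) \<Longrightarrow> key r \<le> x"
proof (induction r arbitrary: x)
  case (Node a e C B D)
  let ?r = "Node a e C B D"
  have ok: "rtree_ok ?r" by fact
  have root: "min_first (a, e)" and lists: "\<forall>c\<in>set (C @ B). min_first c \<and> hd e < rkey c"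
    and stack: "\<forall>r\<in>set (concat D). hd e < key r \<and> rtree_ok r"
    using rtree_ok_iff[THEN iffD1, OF ok] by (auto simp: lists_ok_def lists_ordered_def)
  from Node.prems(2) consider "x \<in> set e" | "x \<in> set (contents (C @ B))" | "x \<in> set (contents (stack_records D))"
    by (auto simp: records_eq[of ?r])
  then show ?case
  proof cases
    case 1
    then show ?thesis using root by (auto simp: min_first_def)
  next
    case 2
    from contents_key_le[OF this] lists show ?thesis by (auto intro: order_trans less_imp_le)
  next
    case 3
    then obtain g r where r: "g \<in> set D" "r \<in> set g" "x \<in> set (contents (records r))"
      by (auto simp: stack_records_def contents_def)
    then have "rtree_ok r" "hd e < key r" using stack by auto
    moreover from this r have "key r \<le> x" using Node.IH by blast
    ultimately show ?thesis by auto
  qed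
qed

lemma stack_contents_key_le:
  assumes "x \<in> set (contents (stack_records D))" and ok: "\<forall>r\<in>set (concat D). rtree_ok r"
  shows "\<exists>r\<in>set (concat D). key r \<le> x"
proof -
  from assms(1) obtain r where "r \<in> set (concat D)" "x \<in> set (contents (records r))"
    by (auto simp: stack_records_def contents_def)
  then show ?thesis using ok rtree_ok_key_le by blast
qed

lemma rkey_in_contents: "min_first c \<Longrightarrow> c \<in> set P \<Longrightarrow> rkey c \<in> set (contents P)"
  by (auto simp: contents_def min_first_def intro!: bexI[of _ c])

lemma key_in_stack_contents:
  assumes "r \<in> set (concat D)" "rtree_ok r"
  shows "key r \<in> set (contents (stack_records D))"
  using rkey_in_contents[of "root r"] root_in_stack_records[OF assms(1)] rtree_ok_iff[THEN iffD1, OF assms(2)]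
  by simp

lemma lists_ok_contents_less:
  assumes ok: "lists_ok C B D" and less: "\<forall>c\<in>set C \<union> set B. k < rkey c" "\<forall>r\<in>set (concat D). k < key r"
    and x: "x \<in> set (contents (C @ B @ stack_records D))"
  shows "k < x"
proof -
  from x consider "x \<in> set (contents (C @ B))" | "x \<in> set (contents (stack_records D))" by auto
  then show ?thesis
  proof cases
    case 1
    from contents_key_le[OF this] ok less(1) show ?thesis
      by (auto simp: lists_ok_def lists_ordered_def intro: less_le_trans)
  next
    case 2
    from stack_contents_key_le[OF this] ok less(2) show ?thesis
      by (auto simp: lists_ok_def intro: less_le_trans)
  qed
qed

lemma rtree_ok_key_less:
  assumes "rtree_ok r" "x \<in> set (contents (clean r @ buffer r @ stack_records (stack r)))"
  shows "key r < x"
  using lists_ok_contents_less[OF _ _ _ assms(2)] rtree_ok_iff[THEN iffD1, OF assms(1)] by blast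

lemma lists_ok_last_clean_le:
  assumes ok: "lists_ok C B D" and C: "C \<noteq> []" and x: "x \<in> set (contents (B @ stack_records D))"
  shows "rkey (last C) \<le> x"
proof -
  have ordered: "lists_ordered C B D" using ok by (simp add: lists_ok_def)
  note last_le = lists_ordered_last_clean_le[OF ordered C]
  from x consider "x \<in> set (contents B)" | "x \<in> set (contents (stack_records D))" by auto
  then show ?thesis
  proof cases
    case 1
    with ordered obtain c where "c \<in> set B" "rkey c \<le> x"
      using contents_key_le[of x B] by (auto simp: lists_ordered_def)
    then show ?thesis using last_le(2) by (meson order_trans)
  next
    case 2
    then obtain r where "r \<in> set (concat D)" "key r \<le> x"
      using stack_contents_key_le[of x D] ok by (auto simp: lists_ok_def)
    then show ?thesis using last_le(3) by (meson less_imp_le order_trans)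
  qed
qed

lemma lists_ok_stack_contents_ge:
  assumes ok: "lists_ok C B D" and x: "x \<in> set (contents (stack_records D))"
  shows "key (hd (last D)) \<le> x"
proof -
  obtain r where "r \<in> set (concat D)" "key r \<le> x"
    using stack_contents_key_le[OF x] ok by (auto simp: lists_ok_def)
  then show ?thesis using lists_ordered_hd_last_le[of C B D r] ok by (auto simp: lists_ok_def)
qed

subsection \<open>Dropping attrited records\<close>

definition attrites :: "'a::linorder entry list \<Rightarrow> 'a entry list \<Rightarrow> bool" where
  "attrites P P' \<longleftrightarrow> set P' \<subseteq> set P \<and> (distinct (map fst P) \<longrightarrow> distinct (map fst P')) \<and>
     survivors (contents P') = survivors (contents P)"

lemma attrites_refl [simp]: "attrites P P"
  by (simp add: attrites_def)

lemma attrites_trans: "attrites P P' \<Longrightarrow> attrites P' P'' \<Longrightarrow> attrites P P''"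
  by (auto simp: attrites_def)

lemma attrites_context: "attrites P P' \<Longrightarrow> attrites (X @ P) (X @ P')"
  by (auto simp: attrites_def survivors_append)

lemma attrites_drop:
  assumes "z \<in> set (contents Z)" "\<And>y. y \<in> set (contents Y) \<Longrightarrow> z \<le> y"
  shows "attrites (X @ Y @ Z) (X @ Z)"
  using survivors_append_middle_attrited[OF assms] by (auto simp: attrites_def)

lemma attrites_contents: "attrites P P' \<Longrightarrow> set (contents P') \<subseteq> set (contents P)"
  unfolding attrites_def contents_def by auto

lemma attrites_drop_before_tree:
  assumes "r \<in> set (concat D)" "rtree_ok r" "\<And>y. y \<in> set (contents Y) \<Longrightarrow> key r \<le> y"
  shows "attrites (X @ Y @ stack_records D) (X @ stack_records D)"
  by (rule attrites_drop[OF key_in_stack_contents[OF assms(1,2)] assms(3)])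

definition reduces_to :: "'a::linorder entry list \<Rightarrow> nat \<Rightarrow> 'a lists \<Rightarrow> bool" where
  "reduces_to P n = (\<lambda>(C, B, D). lists_ok C B D \<and> attrites P (C @ B @ stack_records D) \<and> debt D \<le> length C + n)"

subsection \<open>Unfolding the first tree of a segment\<close>

fun bias_segment :: "'a::linorder entry list \<Rightarrow> 'a rtree \<Rightarrow> 'a rtree list \<Rightarrow> 'a lists" where
  "bias_segment C r g =
    (if clean r = [] then (C, [], if g = [] then [] else [g])
     else if g = [] then (C @ clean r, buffer r, stack r)
     else if \<not> rkey (last (clean r)) < key (hd g) then (C, clean r, [g])
     else if stack r = [] \<or> \<not> key (hd (last (stack r))) < key (hd g) then (C @ clean r, buffer r, [g])
     else (C @ clean r, buffer r, g # stack r))"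

context
  fixes C :: "'a::linorder entry list" and r :: "'a rtree" and g :: "'a rtree list"
  assumes lists_ok: "lists_ok C [] [r # g]"
begin

lemma segment_ordered: "lists_ordered C [] [r # g]" and root_ok: "rtree_ok r"
  and siblings_ok: "\<forall>r'\<in>set g. rtree_ok r'"
  using lists_ok by (auto simp: lists_ok_def)

lemma children_ok: "lists_ok (clean r) (buffer r) (stack r)"
  and children_ordered: "lists_ordered (clean r) (buffer r) (stack r)"
  and children_debt: "debt (stack r) \<le> length (clean r)"
  using rtree_ok_iff[THEN iffD1, OF root_ok] by (auto simp: lists_ok_def)

lemma records_unfold:
  "C @ stack_records [r # g] = (C @ [root r]) @ clean r @ buffer r @ stack_records (stack r) @ stack_records [g]"
  by (simp add: records_eq[of r])

lemma clean_less_root: "c \<in> set C \<Longrightarrow> rkey c < key r"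
  using lists_ordered_clean_less[OF segment_ordered] by simp

lemma root_less_children:
  "c \<in> set (clean r) \<union> set (buffer r) \<Longrightarrow> key r < rkey c" "r' \<in> set (concat (stack r)) \<Longrightarrow> key r < key r'"
  using rtree_ok_iff[THEN iffD1, OF root_ok] by blast+

lemma unfolded_min_first: "\<forall>c\<in>set ((C @ [root r]) @ clean r) \<union> set (buffer r). min_first c"
  using segment_ordered children_ordered rtree_ok_iff[THEN iffD1, OF root_ok] by (auto simp: lists_ordered_def)

lemma unfolded_sorted: "rkey_sorted (((C @ [root r]) @ clean r) @ buffer r)"
proof -
  have "\<forall>c\<in>set C. \<forall>d\<in>set (clean r) \<union> set (buffer r). rkey c < rkey d"
    using clean_less_root root_less_children(1) by (meson less_trans)
  then show ?thesis
    using segment_ordered children_ordered clean_less_root root_less_children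
    unfolding lists_ordered_def sorted_wrt_append by (simp add: ball_Un)
qed

lemma unfolded_less_stack: "c \<in> set ((C @ [root r]) @ clean r) \<Longrightarrow> d \<in> set (concat (stack r)) \<Longrightarrow> rkey c < key d"
proof -
  assume c: "c \<in> set ((C @ [root r]) @ clean r)" and d: "d \<in> set (concat (stack r))"
  from c consider "c \<in> set C" | "c = root r" | "c \<in> set (clean r)" by auto
  then show ?thesis
  proof cases
    case 1
    then show ?thesis using clean_less_root root_less_children(2)[OF d] by (blast intro: less_trans)
  next
    case 2
    then show ?thesis using root_less_children(2)[OF d] by simp
  next
    case 3
    then show ?thesis using lists_ordered_clean_less[OF children_ordered] d by blast
  qed
qed

lemma siblings_lists_ok: "g \<noteq> [] \<Longrightarrow> lists_ok (C @ [root r]) [] [g]"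
  using segment_ordered unfolded_min_first siblings_ok
  by (auto simp: lists_ok_def lists_ordered_def sorted_wrt_append)

lemma unfold_no_siblings: "lists_ok ((C @ [root r]) @ clean r) (buffer r) (stack r)"
proof -
  have "\<forall>c\<in>set ((C @ [root r]) @ clean r). \<forall>d\<in>set (concat (stack r)). rkey c < key d"
    using unfolded_less_stack by blast
  then have "lists_ordered ((C @ [root r]) @ clean r) (buffer r) (stack r)"
    using children_ordered unfolded_min_first unfolded_sorted unfolding lists_ordered_def by blast
  then show ?thesis using children_ok unfolding lists_ok_def by blast
qed

context
  assumes siblings: "g \<noteq> []"
begin

lemma next_sibling: "hd g \<in> set (concat [g])" "rtree_ok (hd g)"
  using siblings siblings_ok by auto

lemma unfold_buffer:
  assumes "clean r \<noteq> []" "\<not> rkey (last (clean r)) < key (hd g)"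
  shows "lists_ok (C @ [root r]) (clean r) [g]"
    "attrites (C @ stack_records [r # g]) ((C @ [root r]) @ clean r @ stack_records [g])"
proof -
  show "lists_ok (C @ [root r]) (clean r) [g]"
    using siblings_lists_ok[OF siblings] unfolded_min_first unfolded_sorted children_ordered
    unfolding lists_ok_def lists_ordered_def by (auto simp: sorted_wrt_append)
  have "attrites (((C @ [root r]) @ clean r) @ (buffer r @ stack_records (stack r)) @ stack_records [g])
      (((C @ [root r]) @ clean r) @ stack_records [g])"
  proof (rule attrites_drop_before_tree[OF next_sibling])
    fix y assume "y \<in> set (contents (buffer r @ stack_records (stack r)))"
    then have "rkey (last (clean r)) \<le> y" by (rule lists_ok_last_clean_le[OF children_ok assms(1)])
    then show "key (hd g) \<le> y" using assms(2) by auto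
  qed
  then show "attrites (C @ stack_records [r # g]) ((C @ [root r]) @ clean r @ stack_records [g])"
    unfolding records_unfold by simp
qed

lemma unfolded_less_siblings:
  assumes "rkey (last (clean r)) < key (hd g)" "c \<in> set ((C @ [root r]) @ clean r)" "r' \<in> set g"
  shows "rkey c < key r'"
proof (cases "c \<in> set (clean r)")
  case True
  then have "rkey c \<le> rkey (last (clean r))"
    using lists_ordered_last_clean_le(1)[OF children_ordered] by fastforce
  also note assms(1)
  also have "key (hd g) \<le> key r'"
    by (rule sorted_wrt_less_hd_le[of key]) (use segment_ordered assms(3) in \<open>auto simp: lists_ordered_def\<close>)
  finally show ?thesis .
next
  case False
  then show ?thesis
    using lists_ordered_clean_less[of "C @ [root r]" "[]" "[g]"] siblings_lists_ok[OF siblings] assms(2,3)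
    by (auto simp: lists_ok_def)
qed

lemma unfold_dropping_stack:
  assumes "rkey (last (clean r)) < key (hd g)" "stack r = [] \<or> \<not> key (hd (last (stack r))) < key (hd g)"
  shows "lists_ok ((C @ [root r]) @ clean r) (buffer r) [g]"
    "attrites (C @ stack_records [r # g]) (((C @ [root r]) @ clean r) @ buffer r @ stack_records [g])"
proof -
  have "\<forall>c\<in>set ((C @ [root r]) @ clean r). \<forall>d\<in>set (concat [g]). rkey c < key d"
    using unfolded_less_siblings[OF assms(1)] by simp
  then show "lists_ok ((C @ [root r]) @ clean r) (buffer r) [g]"
    using siblings_lists_ok[OF siblings] unfolded_min_first unfolded_sorted
    unfolding lists_ok_def lists_ordered_def by auto
  have "attrites (((C @ [root r]) @ clean r @ buffer r) @ stack_records (stack r) @ stack_records [g])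
      (((C @ [root r]) @ clean r @ buffer r) @ stack_records [g])"
  proof (rule attrites_drop_before_tree[OF next_sibling])
    fix y assume y: "y \<in> set (contents (stack_records (stack r)))"
    then have "stack r \<noteq> []" by auto
    then show "key (hd g) \<le> y" using lists_ok_stack_contents_ge[OF children_ok y] assms(2) by auto
  qed
  then show "attrites (C @ stack_records [r # g]) (((C @ [root r]) @ clean r) @ buffer r @ stack_records [g])"
    unfolding records_unfold by simp
qed

lemma unfold_pushing_siblings:
  assumes "rkey (last (clean r)) < key (hd g)" "stack r \<noteq> []" "key (hd (last (stack r))) < key (hd g)"
  shows "lists_ok ((C @ [root r]) @ clean r) (buffer r) (g # stack r)"
proof -
  have "\<forall>c\<in>set ((C @ [root r]) @ clean r). \<forall>d\<in>set (concat (g # stack r)). rkey c < key d"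
    using unfolded_less_siblings[OF assms(1)] unfolded_less_stack by (simp add: ball_Un del: set_concat)
  moreover have "\<forall>r'\<in>set g. key (hd (last (stack r))) < key r'"
    using assms(3) segment_ordered by (cases g) (auto simp: lists_ordered_def intro: less_trans)
  then have "\<forall>d\<in>set (concat (butlast (g # stack r))). key (hd (last (g # stack r))) < key d"
    using children_ordered assms(2) by (simp add: lists_ordered_def ball_Un)
  ultimately show ?thesis
    using siblings_lists_ok[OF siblings] unfolded_min_first unfolded_sorted children_ok assms(2)
    unfolding lists_ok_def lists_ordered_def by auto
qed

end

lemma bias_segment_reduces_to:
  assumes debt: "debt [r # g] \<le> length C + n"
  shows "reduces_to (C @ stack_records [r # g]) (n - 1) (bias_segment (C @ [root r]) r g)"
proof -
  have debt': "length g + 1 \<le> length C + n" using debt by (simp add: debt_def)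
  consider "clean r = []" | "clean r \<noteq> []" "g = []"
    | "clean r \<noteq> []" "g \<noteq> []" "\<not> rkey (last (clean r)) < key (hd g)"
    | "clean r \<noteq> []" "g \<noteq> []" "rkey (last (clean r)) < key (hd g)"
      "stack r = [] \<or> \<not> key (hd (last (stack r))) < key (hd g)"
    | "clean r \<noteq> []" "g \<noteq> []" "rkey (last (clean r)) < key (hd g)" "stack r \<noteq> []"
      "key (hd (last (stack r))) < key (hd g)"
    by blast
  then show ?thesis
  proof cases
    case 1
    then have "buffer r = []" "stack r = []" using lists_ok_empty children_ok children_debt by auto
    moreover have "lists_ok (C @ [root r]) [] []"
      using unfolded_min_first unfolded_sorted 1
      by (auto simp: lists_ok_def lists_ordered_def sorted_wrt_append)
    ultimately show ?thesis using 1 siblings_lists_ok debt' records_unfold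
      by (auto simp: reduces_to_def debt_def)
  next
    case 2
    then show ?thesis using unfold_no_siblings records_unfold children_debt by (simp add: reduces_to_def)
  next
    case 3
    then show ?thesis using unfold_buffer debt' by (simp add: reduces_to_def debt_def)
  next
    case 4
    then show ?thesis using unfold_dropping_stack debt' by (simp add: reduces_to_def debt_def)
  next
    case 5
    moreover have "debt (g # stack r) \<le> length ((C @ [root r]) @ clean r) + (n - 1)"
      using children_debt debt' 5 by (simp add: debt_def)
    ultimately show ?thesis using unfold_pushing_siblings records_unfold by (simp add: reduces_to_def)
  qed
qed

end

subsection \<open>Merging the two uppermost segments\<close>

definition drop_last_tree :: "'a rtree list \<Rightarrow> 'a rtree list list \<Rightarrow> 'a rtree list list" where
  "drop_last_tree u D = (if butlast u = [] then D else butlast u # D)"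

fun bias_stack :: "'a::linorder entry list \<Rightarrow> 'a rtree list list \<Rightarrow> 'a lists" where
  "bias_stack C [] = (C, [], [])"
| "bias_stack C [g] = bias_segment (C @ [root (hd g)]) (hd g) (tl g)"
| "bias_stack C (t # u # D) =
    (if key (last u) < key (hd t) then (C, [], (u @ t) # D) else (C, [], t # drop_last_tree u D))"

lemma lists_ok_merge_segments:
  assumes ok: "lists_ok C [] (t # u # D)" and less: "key (last u) < key (hd t)"
  shows "lists_ok C [] ((u @ t) # D)"
proof -
  have ordered: "lists_ordered C [] (t # u # D)" using ok by (simp add: lists_ok_def)
  have sorted: "t \<noteq> []" "u \<noteq> []" "key_sorted t" "key_sorted u"
    using ordered by (auto simp: lists_ordered_def)
  have "key r < key r'" if "r \<in> set u" "r' \<in> set t" for r r'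
  proof -
    have "key r \<le> key (last u)" by (rule sorted_wrt_less_le_last[of key, OF sorted(4) that(1)])
    also note less
    also have "key (hd t) \<le> key r'" by (rule sorted_wrt_less_hd_le[of key, OF sorted(3) that(2)])
    finally show ?thesis .
  qed
  moreover have "set (concat ((u @ t) # D)) = set (concat (t # u # D))" by auto
  moreover have "\<forall>r\<in>set (concat (butlast ((u @ t) # D))). key (hd (last ((u @ t) # D))) < key r"
    using ordered sorted by (cases "D = []") (auto simp: lists_ordered_def)
  ultimately show ?thesis using ok sorted unfolding lists_ok_def lists_ordered_def
    by (simp add: sorted_wrt_append)
qed

lemma lists_ok_drop_last_tree:
  assumes ok: "lists_ok C [] (t # u # D)" and not_less: "\<not> key (last u) < key (hd t)"
  shows "lists_ok C [] (t # drop_last_tree u D)" "D = [] \<Longrightarrow> butlast u \<noteq> []"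
proof -
  have ordered: "lists_ordered C [] (t # u # D)" using ok by (simp add: lists_ok_def)
  have sorted: "t \<noteq> []" "u \<noteq> []" "key_sorted u" using ordered by (auto simp: lists_ordered_def)
  then have u: "u = butlast u @ [last u]" by simp
  let ?D = "t # drop_last_tree u D"
  show D: "butlast u \<noteq> []" if "D = []"
  proof
    assume "butlast u = []"
    then have "hd u = last u" using u by (metis append_Nil list.sel(1))
    then show False using ordered that not_less sorted by (auto simp: lists_ordered_def)
  qed
  have sub: "set (concat ?D) \<subseteq> set (concat (t # u # D))"
    using in_set_butlastD[of _ u] by (auto simp: drop_last_tree_def)
  have "hd (butlast u) = hd u" if "butlast u \<noteq> []" using that u by (metis hd_append2)
  then have "\<forall>r\<in>set (concat (butlast ?D)). key (hd (last ?D)) < key r"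
    using ordered sorted D in_set_butlastD[of _ u]
    by (cases "D = []") (auto simp: lists_ordered_def drop_last_tree_def)
  moreover have "key_sorted (butlast u)" using sorted(3) u by (metis sorted_wrt_append)
  then have "\<forall>g\<in>set ?D. g \<noteq> [] \<and> key_sorted g" using ordered
    by (auto simp: lists_ordered_def drop_last_tree_def)
  moreover have "\<forall>c\<in>set C. \<forall>r\<in>set (concat ?D). rkey c < key r"
    using lists_ordered_clean_less[OF ordered] sub by blast
  moreover have "(\<forall>c\<in>set C \<union> set []. min_first c) \<and> rkey_sorted (C @ [])"
    using ordered by (simp add: lists_ordered_def)
  moreover have "\<forall>r\<in>set (concat ?D). rtree_ok r" using ok sub unfolding lists_ok_def by blast
  ultimately show "lists_ok C [] ?D" unfolding lists_ok_def lists_ordered_def by blast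
qed

lemma attrites_drop_last_tree:
  assumes ok: "lists_ok C [] (t # u # D)" and not_less: "\<not> key (last u) < key (hd t)"
  shows "attrites (C @ stack_records (t # u # D)) (C @ stack_records (t # drop_last_tree u D))"
proof -
  have ne: "t \<noteq> []" "u \<noteq> []" and oks: "rtree_ok (hd t)" "rtree_ok (last u)"
    using ok by (auto simp: lists_ok_def lists_ordered_def)
  let ?X = "C @ stack_records D @ concat (map records (butlast u))"
  have "attrites (?X @ records (last u) @ stack_records [t]) (?X @ stack_records [t])"
  proof (rule attrites_drop_before_tree[OF _ oks(1)])
    show "hd t \<in> set (concat [t])" using ne by simp
    fix y assume "y \<in> set (contents (records (last u)))"
    then have "key (last u) \<le> y" by (rule rtree_ok_key_le[OF oks(2)])
    then show "key (hd t) \<le> y" using not_less by auto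
  qed
  moreover have "concat (map records u) = concat (map records (butlast u)) @ records (last u)"
    by (subst append_butlast_last_id[OF ne(2), symmetric]) (simp del: append_butlast_last_id)
  ultimately show ?thesis by (auto simp: drop_last_tree_def)
qed

lemma bias_stack_reduces_to:
  assumes ok: "lists_ok C [] D" and D: "D \<noteq> []" and debt: "debt D \<le> length C + n"
  shows "reduces_to (C @ stack_records D) (n - 1) (bias_stack C D)"
proof (cases "(C, D)" rule: bias_stack.cases)
  case (2 C' g)
  then obtain r g' where "g = r # g'" using ok by (cases g) (auto simp: lists_ok_def lists_ordered_def)
  then show ?thesis using bias_segment_reduces_to[of C r g' n] ok debt 2 by (simp del: bias_segment.simps)
next
  case (3 C' t u D')
  then have ok': "lists_ok C [] (t # u # D')" using ok by simp
  then have "t \<noteq> []" "u \<noteq> []" by (auto simp: lists_ok_def lists_ordered_def)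
  then have "length u = Suc (length (butlast u))" by (simp add: Suc_leI)
  moreover have "length (concat D') + length u + length t + length D' + 1 \<le> length C + n"
    using debt 3 by (simp add: debt_def)
  ultimately show ?thesis
    using 3 lists_ok_merge_segments[OF ok'] lists_ok_drop_last_tree[OF ok'] attrites_drop_last_tree[OF ok']
    by (auto simp: reduces_to_def debt_def drop_last_tree_def)
qed (use D in auto)

subsection \<open>The bias operation\<close>

definition bias :: "'a::linorder entry list \<Rightarrow> 'a entry list \<Rightarrow> 'a rtree list list \<Rightarrow> 'a lists" where
  "bias C B D =
    (if D = [] then (C, B, D)
     else if B \<noteq> [] \<and> rkey (hd B) < key (hd (last D)) then (C @ [hd B], tl B, D)
     else bias_stack C D)"

lemma drop_buffer:
  assumes ok: "lists_ok C B D" and D: "D \<noteq> []" and attrited: "B = [] \<or> \<not> rkey (hd B) < key (hd (last D))"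
  shows "lists_ok C [] D" "attrites (C @ B @ stack_records D) (C @ stack_records D)"
proof -
  have ordered: "lists_ordered C B D" using ok by (simp add: lists_ok_def)
  then show "lists_ok C [] D" using ok by (auto simp: lists_ok_def lists_ordered_def sorted_wrt_append)
  have first: "hd (last D) \<in> set (concat D)" by (rule hd_last_in_concat[OF ordered D])
  show "attrites (C @ B @ stack_records D) (C @ stack_records D)"
  proof (rule attrites_drop_before_tree[OF first])
    show "rtree_ok (hd (last D))" using ok first unfolding lists_ok_def by blast
    fix y assume y: "y \<in> set (contents B)"
    then have B: "B \<noteq> []" by auto
    obtain c where c: "c \<in> set B" "rkey c \<le> y"
      using contents_key_le[OF y] ordered by (auto simp: lists_ordered_def)
    have "rkey (hd B) \<le> rkey c"
      by (rule sorted_wrt_less_hd_le[of rkey])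
        (use ordered c(1) in \<open>auto simp: lists_ordered_def sorted_wrt_append\<close>)
    then show "key (hd (last D)) \<le> y" using attrited B c(2) by auto
  qed
qed

lemma bias_reduces_to:
  assumes ok: "lists_ok C B D" and debt: "debt D \<le> length C + n"
  shows "reduces_to (C @ B @ stack_records D) (n - 1) (bias C B D)"
proof -
  consider "D = []" | "D \<noteq> []" "B \<noteq> []" "rkey (hd B) < key (hd (last D))"
    | "D \<noteq> []" "B = [] \<or> \<not> rkey (hd B) < key (hd (last D))" by blast
  then show ?thesis
  proof cases
    case 1
    then show ?thesis using assms by (auto simp: bias_def reduces_to_def debt_def)
  next
    case 2
    then obtain c B' where B: "B = c # B'" by (cases B) auto
    have ordered: "lists_ordered C B D" using ok by (simp add: lists_ok_def)
    have "rkey c < key r" if "r \<in> set (concat D)" for r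
      using lists_ordered_hd_last_le[OF ordered that] 2 B by auto
    then have "lists_ok (C @ [c]) B' D" using ok B ordered by (auto simp: lists_ok_def lists_ordered_def)
    then show ?thesis using 2 B debt by (simp add: bias_def reduces_to_def)
  next
    case 3
    have "reduces_to (C @ stack_records D) (n - 1) (bias_stack C D)"
      by (rule bias_stack_reduces_to[OF drop_buffer(1)[OF ok 3] 3(1) debt])
    then have "reduces_to (C @ B @ stack_records D) (n - 1) (bias_stack C D)"
      using drop_buffer(2)[OF ok 3] by (auto simp: reduces_to_def intro: attrites_trans)
    then show ?thesis using 3 by (auto simp: bias_def)
  qed
qed

lemma bias_trees:
  assumes bias: "bias C B D = (C', B', D')" and r': "r' \<in> set (concat D')" and ne: "\<forall>g\<in>set D. g \<noteq> []"
  shows "r' \<in> set (concat D) \<or> (\<exists>r\<in>set (concat D). r' \<in> set (concat (stack r)))"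
proof (cases "D = [] \<or> (B \<noteq> [] \<and> rkey (hd B) < key (hd (last D)))")
  case True
  then show ?thesis using bias r' by (auto simp: bias_def split: if_splits)
next
  case False
  then have eq: "bias_stack C D = (C', B', D')" using bias by (auto simp: bias_def)
  show ?thesis
  proof (cases "(C, D)" rule: bias_stack.cases)
    case (2 C0 g)
    then obtain r g' where "g = r # g'" using ne by (cases g) auto
    then show ?thesis using eq r' 2 by (auto split: if_splits)
  next
    case (3 C0 t u D0)
    then show ?thesis using eq r' by (auto simp: drop_last_tree_def split: if_splits dest: in_set_butlastD)
  qed (use False in auto)
qed

subsection \<open>Attaching a tree\<close>

definition attach :: "'a::linorder entry list \<Rightarrow> 'a entry list \<Rightarrow> 'a rtree list list \<Rightarrow> 'a rtree \<Rightarrow> 'a lists" where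
  "attach C B D r =
    (if C \<noteq> [] \<and> \<not> rkey (last C) < key r then ([], C, [[r]])
     else if D = [] \<or> \<not> key (hd (last D)) < key r then (C, B, [[r]])
     else (C, B, [r] # D))"

lemma attach_reduces_to:
  assumes ok: "lists_ok C B D" and debt: "debt D \<le> length C" and r: "rtree_ok r"
  shows "reduces_to (C @ B @ stack_records D @ records r) 2 (attach C B D r)"
proof -
  have ordered: "lists_ordered C B D" using ok by (simp add: lists_ok_def)
  have r_in: "r \<in> set (concat [[r]])" by simp
  have clean_less: "rkey c < key r" if "rkey (last C) < key r" "c \<in> set C" for c
    using lists_ordered_last_clean_le(1)[OF ordered _ that(2)] that by fastforce
  consider "C \<noteq> []" "\<not> rkey (last C) < key r"
    | "C = [] \<or> rkey (last C) < key r" "D = [] \<or> \<not> key (hd (last D)) < key r"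
    | "C = [] \<or> rkey (last C) < key r" "D \<noteq> []" "key (hd (last D)) < key r" by blast
  then show ?thesis
  proof cases
    case 1
    have "attrites (C @ (B @ stack_records D) @ stack_records [[r]]) (C @ stack_records [[r]])"
      by (rule attrites_drop_before_tree[OF r_in r])
        (use lists_ok_last_clean_le[OF ok 1(1)] 1(2) in \<open>force simp: not_less intro: order_trans\<close>)
    moreover have "lists_ok [] C [[r]]" using ordered r
      by (auto simp: lists_ok_def lists_ordered_def sorted_wrt_append)
    ultimately show ?thesis using 1 by (simp add: reduces_to_def attach_def debt_def)
  next
    case 2
    have "attrites ((C @ B) @ stack_records D @ stack_records [[r]]) ((C @ B) @ stack_records [[r]])"
    proof (rule attrites_drop_before_tree[OF r_in r])
      fix y assume y: "y \<in> set (contents (stack_records D))"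
      then have "D \<noteq> []" by auto
      then show "key r \<le> y" using lists_ok_stack_contents_ge[OF ok y] 2(2) by auto
    qed
    moreover have "lists_ok C B [[r]]" using ordered r clean_less 2(1)
      by (auto simp: lists_ok_def lists_ordered_def)
    ultimately show ?thesis using 2 by (auto simp: reduces_to_def attach_def debt_def)
  next
    case 3
    then have "lists_ok C B ([r] # D)"
      using ok ordered r clean_less by (auto simp: lists_ok_def lists_ordered_def)
    then show ?thesis using 3 debt by (auto simp: reduces_to_def attach_def debt_def)
  qed
qed

section \<open>Linked lists of records\<close>

type_synonym header = "nat \<times> nat \<times> nat \<times> nat \<times> nat \<times> nat"

definition header_of :: "(nat \<Rightarrow> nat) \<Rightarrow> header" where
  "header_of f = (f 5, f 6, f 7, f 8, f 9, f 10)"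

definition read_header :: "nat \<Rightarrow> (header \<Rightarrow> prog) \<Rightarrow> prog" where
  "read_header a k = get_field a 5 (\<lambda>cf. get_field a 6 (\<lambda>cl. get_field a 7 (\<lambda>bf. get_field a 8 (\<lambda>bl.
     get_field a 9 (\<lambda>df. get_field a 10 (\<lambda>dt. k (cf, cl, bf, bl, df, dt)))))))"

fun write_header :: "nat \<Rightarrow> header \<Rightarrow> prog \<Rightarrow> prog" where
  "write_header a (cf, cl, bf, bl, df, dt) p = set_field a 5 cf (set_field a 6 cl (set_field a 7 bf
     (set_field a 8 bl (set_field a 9 df (set_field a 10 dt p)))))"

definition append_prog :: "nat \<Rightarrow> nat \<Rightarrow> nat \<Rightarrow> prog \<Rightarrow> prog" where
  "append_prog cf cl x p = (if cf = 0 then p else set_field cl succ_field x p)"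

definition first_or :: "nat \<Rightarrow> nat \<Rightarrow> nat" where
  "first_or cf x = (if cf = 0 then x else cf)"

context io_programs
begin

definition merge_prog :: "nat \<Rightarrow> nat \<Rightarrow> nat \<Rightarrow> nat \<Rightarrow> (header \<Rightarrow> prog) \<Rightarrow> prog" where
  "merge_prog cf cl df t k =
    get_field t below_field (\<lambda>u. get_field u end_field (\<lambda>z. compare_keys z t
      (get_field t end_field (\<lambda>e. set_field z succ_field t (set_field t pred_field z
        (set_field u end_field e (k (cf, cl, 0, 0, df, u))))))
      (if z = u then get_field u below_field (\<lambda>v. set_field t below_field v (k (cf, cl, 0, 0, df, t)))
       else get_field z pred_field (\<lambda>w. set_field u end_field w (k (cf, cl, 0, 0, df, t))))))"

fun unfold_children_prog :: "nat \<Rightarrow> nat \<Rightarrow> nat \<Rightarrow> header \<Rightarrow> (header \<Rightarrow> prog) \<Rightarrow> prog" where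
  "unfold_children_prog f a n (c, c', b, b', d, d') k =
    compare_keys c' n
      (set_field a succ_field c
        (if d = 0 then k (f, c', b, b', n, n)
         else compare_keys d n (set_field n below_field d' (k (f, c', b, b', d, n))) (k (f, c', b, b', n, n))))
      (k (f, a, c, c', n, n))"

definition unfold_prog :: "nat \<Rightarrow> nat \<Rightarrow> nat \<Rightarrow> (header \<Rightarrow> prog) \<Rightarrow> prog" where
  "unfold_prog cf cl a k =
    get_field a end_field (\<lambda>e. read_header a (\<lambda>(c, c', b, b', d, d'). append_prog cf cl a
      (if e = a then
         (if c = 0 then k (first_or cf a, a, 0, 0, 0, 0)
          else set_field a succ_field c (k (first_or cf a, c', b, b', d, d')))
       else
         get_field a succ_field (\<lambda>n. set_field n end_field e
           (if c = 0 then k (first_or cf a, a, 0, 0, n, n)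
            else unfold_children_prog (first_or cf a) a n (c, c', b, b', d, d') k)))))"

definition bias_stack_prog :: "nat \<Rightarrow> nat \<Rightarrow> nat \<Rightarrow> nat \<Rightarrow> (header \<Rightarrow> prog) \<Rightarrow> prog" where
  "bias_stack_prog cf cl df dt k = (if df \<noteq> dt then merge_prog cf cl df dt k else unfold_prog cf cl df k)"

end

subsection \<open>Lists and stacks\<close>

definition list_ends :: "nat list \<Rightarrow> nat \<Rightarrow> nat \<Rightarrow> bool" where
  "list_ends xs f l \<longleftrightarrow> (if xs = [] then f = 0 else f = hd xs \<and> l = last xs)"

definition linked :: "(nat \<Rightarrow> nat \<Rightarrow> nat) \<Rightarrow> nat list \<Rightarrow> bool" where
  "linked fd xs \<longleftrightarrow> successively (\<lambda>x y. fd x succ_field = y) xs"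

definition doubly_linked :: "(nat \<Rightarrow> nat \<Rightarrow> nat) \<Rightarrow> nat list \<Rightarrow> bool" where
  "doubly_linked fd xs \<longleftrightarrow> successively (\<lambda>x y. fd x succ_field = y \<and> fd y pred_field = x) xs"

fun linked_stack :: "(nat \<Rightarrow> nat \<Rightarrow> nat) \<Rightarrow> nat list list \<Rightarrow> bool" where
  "linked_stack fd [] \<longleftrightarrow> True"
| "linked_stack fd (g # ds) \<longleftrightarrow> g \<noteq> [] \<and> doubly_linked fd g \<and> fd (hd g) end_field = last g \<and>
     (ds \<noteq> [] \<longrightarrow> fd (hd g) below_field = hd (hd ds)) \<and> linked_stack fd ds"

fun linked_lists :: "(nat \<Rightarrow> nat \<Rightarrow> nat) \<Rightarrow> header \<Rightarrow> nat list \<Rightarrow> nat list \<Rightarrow> nat list list \<Rightarrow> bool" where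
  "linked_lists fd (cf, cl, bf, bl, df, dt) cs bs ds \<longleftrightarrow>
     list_ends cs cf cl \<and> list_ends bs bf bl \<and> linked fd cs \<and> linked fd bs \<and> linked_stack fd ds \<and>
     (if ds = [] then df = 0 else df = hd (last ds) \<and> dt = hd (hd ds))"

definition lists_at :: "(nat \<Rightarrow> nat \<Rightarrow> nat) \<Rightarrow> header \<Rightarrow> 'a lists \<Rightarrow> bool" where
  "lists_at fd h = (\<lambda>(C, B, D). linked_lists fd h (map fst C) (map fst B) (map (map addr) D))"

primrec rtree_at :: "(nat \<Rightarrow> nat \<Rightarrow> nat) \<Rightarrow> 'a rtree \<Rightarrow> bool" where
  "rtree_at fd (Node a e C B D) \<longleftrightarrow> linked_lists fd (header_of (fd a)) (map fst C) (map fst B) (map (map addr) D)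
     \<and> (\<forall>bs\<in>set (map (map (rtree_at fd)) D). \<forall>b\<in>set bs. b)"

lemma rtree_at_iff: "rtree_at fd r \<longleftrightarrow>
    lists_at fd (header_of (fd (addr r))) (clean r, buffer r, stack r) \<and> (\<forall>r'\<in>set (concat (stack r)). rtree_at fd r')"
  by (cases r) (auto simp: lists_at_def)

declare rtree_at.simps [simp del]

lemma linked_simps [simp]: "linked fd []" "linked fd [x]"
  by (simp_all add: linked_def)

lemma doubly_linked_simps [simp]: "doubly_linked fd []" "doubly_linked fd [x]"
  by (simp_all add: doubly_linked_def)

lemma linked_append:
  "linked fd (xs @ ys) \<longleftrightarrow> linked fd xs \<and> linked fd ys \<and>
    (xs \<noteq> [] \<longrightarrow> ys \<noteq> [] \<longrightarrow> fd (last xs) succ_field = hd ys)"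
  unfolding linked_def by (auto simp: successively_append_iff)

lemma doubly_linked_append:
  "doubly_linked fd (xs @ ys) \<longleftrightarrow> doubly_linked fd xs \<and> doubly_linked fd ys \<and>
    (xs \<noteq> [] \<longrightarrow> ys \<noteq> [] \<longrightarrow> fd (last xs) succ_field = hd ys \<and> fd (hd ys) pred_field = last xs)"
  unfolding doubly_linked_def by (auto simp: successively_append_iff)

lemma successively_cong_nth:
  assumes "\<And>i. Suc i < length xs \<Longrightarrow> P (xs ! i) (xs ! Suc i) = P' (xs ! i) (xs ! Suc i)"
  shows "successively P xs = successively P' xs"
  using assms by (auto simp: successively_conv_nth)

lemma nth_in_set_butlast: "Suc i < length xs \<Longrightarrow> xs ! i \<in> set (butlast xs)"
  by (metis Suc_lessE diff_Suc_1 length_butlast less_Suc_eq nth_butlast nth_mem)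

lemma linked_cong:
  assumes "\<forall>x\<in>set (butlast xs). fd' x succ_field = fd x succ_field"
  shows "linked fd' xs = linked fd xs"
  unfolding linked_def by (rule successively_cong_nth) (use assms nth_in_set_butlast in fastforce)

lemma linked_frame: "(\<And>x. x \<in> set xs \<Longrightarrow> fd' x = fd x) \<Longrightarrow> linked fd' xs = linked fd xs"
  by (rule linked_cong) (auto dest: in_set_butlastD)

lemma doubly_linked_cong:
  assumes "\<forall>x\<in>set (butlast xs). fd' x succ_field = fd x succ_field"
    "\<forall>x\<in>set (tl xs). fd' x pred_field = fd x pred_field"
  shows "doubly_linked fd' xs = doubly_linked fd xs"
  unfolding doubly_linked_def
proof (rule successively_cong_nth)
  fix i assume i: "Suc i < length xs"
  then have "xs ! Suc i \<in> set (tl xs)" by (cases xs) auto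
  with nth_in_set_butlast[OF i] assms
  show "(fd' (xs ! i) succ_field = xs ! Suc i \<and> fd' (xs ! Suc i) pred_field = xs ! i) =
    (fd (xs ! i) succ_field = xs ! Suc i \<and> fd (xs ! Suc i) pred_field = xs ! i)" by auto
qed

lemma in_set_tlD: "x \<in> set (tl xs) \<Longrightarrow> x \<in> set xs"
  by (cases xs) auto

lemma hd_notin_tl: "distinct xs \<Longrightarrow> xs \<noteq> [] \<Longrightarrow> hd xs \<notin> set (tl xs)"
  by (cases xs) auto

lemma eq_last_iff_Nil: "distinct (x # xs) \<Longrightarrow> x = last (x # xs) \<longleftrightarrow> xs = []"
  by (cases xs rule: rev_cases) auto

lemma last_notin_butlast: "distinct xs \<Longrightarrow> xs \<noteq> [] \<Longrightarrow> last xs \<notin> set (butlast xs)"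
  by (cases xs rule: rev_cases) auto

lemma linked_stack_cong:
  assumes "\<forall>x\<in>set (concat ds). \<forall>j<5. fd' x j = fd x j"
  shows "linked_stack fd' ds = linked_stack fd ds"
  using assms
proof (induction ds)
  case (Cons g ds)
  have "doubly_linked fd' g = doubly_linked fd g"
    by (rule doubly_linked_cong) (use Cons.prems in \<open>auto dest: in_set_butlastD in_set_tlD\<close>)
  moreover have "hd g \<in> set (concat (g # ds))" if "g \<noteq> []" using that by simp
  ultimately show ?case using Cons by auto
qed simp

lemma linked_stack_frame:
  "(\<And>x. x \<in> set (concat ds) \<Longrightarrow> fd' x = fd x) \<Longrightarrow> linked_stack fd' ds = linked_stack fd ds"
  by (rule linked_stack_cong) simp

lemma linked_stack_nonempty: "linked_stack fd ds \<Longrightarrow> g \<in> set ds \<Longrightarrow> g \<noteq> []"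
  by (induction ds) auto

subsection \<open>Relinking\<close>

definition relinks :: "nat set \<Rightarrow> (nat \<Rightarrow> nat \<Rightarrow> nat) \<Rightarrow> (nat \<Rightarrow> nat \<Rightarrow> nat) \<Rightarrow> bool" where
  "relinks X fd fd' \<longleftrightarrow> (\<forall>x. x \<notin> X \<longrightarrow> fd' x = fd x) \<and> (\<forall>x j. 5 \<le> j \<longrightarrow> fd' x j = fd x j)"

lemma relinks_refl [simp]: "relinks X fd fd"
  by (simp add: relinks_def)

lemma relinks_upd_field: "relinks X fd fd' \<Longrightarrow> x \<in> X \<Longrightarrow> j < 5 \<Longrightarrow> relinks X fd (upd_field fd' x j v)"
  by (auto simp: relinks_def)

lemma relinks_mono: "relinks X fd fd' \<Longrightarrow> X \<subseteq> Y \<Longrightarrow> relinks Y fd fd'"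
  by (auto simp: relinks_def)

definition append_link :: "(nat \<Rightarrow> nat \<Rightarrow> nat) \<Rightarrow> nat list \<Rightarrow> nat \<Rightarrow> nat \<Rightarrow> nat \<Rightarrow> nat" where
  "append_link fd cs x = (if cs = [] then fd else upd_field fd (last cs) succ_field x)"

lemma append_link_other: "x \<notin> set cs \<Longrightarrow> append_link fd cs y x = fd x"
  by (auto simp: append_link_def)

lemma linked_append_link:
  assumes "linked fd cs" "distinct cs"
  shows "linked (append_link fd cs x) (cs @ [x])"
proof (cases "cs = []")
  case False
  then have "last cs \<notin> set (butlast cs)" using assms(2) by (intro last_notin_butlast)
  then have "linked (append_link fd cs x) cs = linked fd cs"
    by (intro linked_cong) (auto simp: append_link_def)
  then show ?thesis using assms False by (simp add: linked_append append_link_def)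
qed simp

lemma relinks_append_link: "set cs \<subseteq> X \<Longrightarrow> relinks X fd (append_link fd cs x)"
  using last_in_set[of cs] by (auto simp: append_link_def relinks_def simp del: last_in_set)

lemma list_ends_snoc: "0 \<notin> set cs \<Longrightarrow> list_ends cs cf cl \<Longrightarrow> list_ends (cs @ [x]) (first_or cf x) x"
  by (cases cs) (auto simp: list_ends_def first_or_def)

lemma list_ends_append_Cons:
  "0 \<notin> set cs \<Longrightarrow> list_ends cs cf cl \<Longrightarrow> list_ends ds c c' \<Longrightarrow> ds \<noteq> [] \<Longrightarrow>
    list_ends (cs @ x # ds) (first_or cf x) c'"
  by (cases cs) (auto simp: list_ends_def first_or_def)

lemma linked_stack_merge:
  assumes stack: "linked_stack fd (T # U # S)" and dist: "distinct (concat (T # U # S))"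
  defines "fd1 \<equiv> upd_field fd (last U) succ_field (hd T)"
  defines "fd2 \<equiv> upd_field fd1 (hd T) pred_field (last U)"
  shows "linked_stack (upd_field fd2 (hd U) end_field (last T)) ((U @ T) # S)"
    (is "linked_stack ?fd _")
proof -
  have ne: "T \<noteq> []" "U \<noteq> []" using stack by auto
  have out: "hd T \<notin> set U" "hd T \<notin> set (concat S)" "last U \<notin> set T" "last U \<notin> set (concat S)"
    "hd U \<notin> set T" "hd U \<notin> set (concat S)"
    using dist hd_in_set[OF ne(1)] hd_in_set[OF ne(2)] last_in_set[OF ne(2)]
    by (auto simp del: hd_in_set last_in_set set_concat)
  have ends: "hd T \<notin> set (tl T)" "last U \<notin> set (butlast U)" "hd U \<notin> set (tl U)"
    using dist ne by (simp_all add: hd_notin_tl last_notin_butlast)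
  have hd_last: "hd T \<noteq> last U" "hd T \<noteq> hd U" using out(1) ne by auto
  have "doubly_linked ?fd U = doubly_linked fd U" "doubly_linked ?fd T = doubly_linked fd T"
    by (rule doubly_linked_cong; use out ends in \<open>auto simp: fd1_def fd2_def dest: in_set_butlastD in_set_tlD\<close>)+
  moreover have "linked_stack ?fd S = linked_stack fd S"
    by (rule linked_stack_cong) (use out in \<open>auto simp: fd1_def fd2_def\<close>)
  ultimately show ?thesis
    using stack ne hd_last by (auto simp: fd1_def fd2_def doubly_linked_append)
qed

lemma linked_stack_drop_segment:
  assumes stack: "linked_stack fd (T # [x] # S)" and S: "S \<noteq> []" and dist: "distinct (concat (T # [x] # S))"
  shows "linked_stack (upd_field fd (hd T) below_field (fd x below_field)) (T # S)" (is "linked_stack ?fd _")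
proof -
  have "hd T \<in> set T" using stack by simp
  then have out: "hd T \<notin> set (concat S)" using dist by (auto simp del: set_concat)
  have "doubly_linked ?fd T = doubly_linked fd T" by (rule doubly_linked_cong) auto
  moreover have "linked_stack ?fd S = linked_stack fd S" by (rule linked_stack_cong) (use out in auto)
  ultimately show ?thesis using stack S by auto
qed

lemma linked_stack_drop_last:
  assumes stack: "linked_stack fd (T # (V @ [x]) # S)" and V: "V \<noteq> []"
    and dist: "distinct (concat (T # (V @ [x]) # S))"
  shows "linked_stack (upd_field fd (hd V) end_field (fd x pred_field)) (T # V # S)" (is ?stack)
    and "fd x pred_field = last V"
proof -
  let ?fd = "upd_field fd (hd V) end_field (fd x pred_field)"
  have "hd V \<in> set V" using V by simp
  then have out: "hd V \<notin> set T" "hd V \<notin> set (concat S)" using dist by (auto simp del: set_concat)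
  have "doubly_linked fd (V @ [x])" using stack by simp
  then have links: "doubly_linked fd V" "fd x pred_field = last V" using V
    by (simp_all add: doubly_linked_append)
  then show "fd x pred_field = last V" by simp
  have "doubly_linked ?fd T = doubly_linked fd T" "doubly_linked ?fd V = doubly_linked fd V"
    by (rule doubly_linked_cong; auto)+
  moreover have "linked_stack ?fd S = linked_stack fd S" by (rule linked_stack_cong) (use out in auto)
  moreover have "hd T \<noteq> hd V" using out(1) stack by (metis hd_in_set linked_stack.simps(2))
  ultimately show ?stack using stack V links by auto
qed

subsection \<open>Addresses\<close>

lemma addr_in_records: "r \<in> set g \<Longrightarrow> addr r \<in> fst ` set (concat (map records g))"
  using root_in_records[of r] by force

lemma addrs_subset_stack_records: "set (concat (map (map addr) D)) \<subseteq> fst ` set (stack_records D)"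
  using root_in_stack_records by force

lemma lists_at_frame:
  assumes "\<And>x. x \<in> fst ` set (C @ B @ stack_records D) \<Longrightarrow> fd' x = fd x"
  shows "lists_at fd' h (C, B, D) = lists_at fd h (C, B, D)"
proof -
  have "linked fd' (map fst C) = linked fd (map fst C)" "linked fd' (map fst B) = linked fd (map fst B)"
    by (rule linked_frame; use assms in auto)+
  moreover have "linked_stack fd' (map (map addr) D) = linked_stack fd (map (map addr) D)"
  proof (rule linked_stack_frame)
    fix x assume "x \<in> set (concat (map (map addr) D))"
    then have "x \<in> fst ` set (stack_records D)" using addrs_subset_stack_records by blast
    then show "fd' x = fd x" by (intro assms) auto
  qed
  ultimately show ?thesis by (cases h) (simp add: lists_at_def)
qed

lemma distinct_addr: "distinct (map fst (concat (map records g))) \<Longrightarrow> distinct (map addr g)"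
proof (induction g)
  case (Cons r g)
  have "addr r \<in> fst ` set (records r)" by (simp add: records_eq[of r])
  then have "addr r \<notin> fst ` set (concat (map records g))" using Cons.prems by auto
  then have "addr r \<notin> addr ` set g" using addr_in_records by (metis imageE)
  then show ?case using Cons by auto
qed simp

lemma distinct_stack_addrs:
  assumes "distinct (map fst (stack_records D))"
  shows "distinct (concat (map (map addr) D))"
proof -
  have "distinct (map addr (concat (rev D)))" using assms unfolding stack_records_def by (rule distinct_addr)
  then show ?thesis by (simp add: map_concat rev_map[symmetric])
qed

context io_machine
begin

definition stored :: "'a view \<Rightarrow> 'a entry list \<Rightarrow> bool" where
  "stored st P \<longleftrightarrow> distinct (map fst P) \<and>
     (\<forall>p\<in>set P. fst p \<in> vaddrs st \<and> 0 < fst p \<and> fst p \<le> W \<and> velems st (fst p) = snd p)"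

lemma storedD:
  assumes "stored st P" "p \<in> set P"
  shows "fst p \<in> vaddrs st" "0 < fst p" "fst p \<le> W" "velems st (fst p) = snd p"
  using assms by (auto simp: stored_def)

lemma stored_addr: "stored st P \<Longrightarrow> x \<in> fst ` set P \<Longrightarrow> x \<in> vaddrs st \<and> 0 < x \<and> x \<le> W"
  by (auto simp: stored_def)

lemma stored_Cons: "stored st ((a, e) # P) \<longleftrightarrow>
    a \<notin> fst ` set P \<and> a \<in> vaddrs st \<and> 0 < a \<and> a \<le> W \<and> velems st a = e \<and> stored st P"
  by (auto simp: stored_def simp del: split_paired_All)

lemma stored_append: "stored st (P @ P') \<longleftrightarrow> stored st P \<and> stored st P' \<and> fst ` set P \<inter> fst ` set P' = {}"
  by (auto simp: stored_def simp del: split_paired_All)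

lemma stored_attrites: "stored st P \<Longrightarrow> attrites P P' \<Longrightarrow> stored st P'"
  by (auto simp: stored_def attrites_def)

lemma stored_vfields [simp]: "stored (st\<lparr>vfields := fd\<rparr>) P = stored st P"
  by (simp add: stored_def)

lemma stored_free_record:
  assumes "stored st P" "a \<notin> fst ` set P"
  shows "stored (st\<lparr>vaddrs := vaddrs st - {a}\<rparr>) P"
proof -
  have "fst p \<noteq> a" if "p \<in> set P" for p using assms(2) that by blast
  then show ?thesis using assms(1) by (simp add: stored_def)
qed

lemma stored_stack:
  assumes stored: "stored st (stack_records D)" and r: "r \<in> set (concat D)"
  shows "addr r \<in> vaddrs st" "0 < addr r" "addr r \<le> W" "velems st (addr r) = elts r"
  using storedD[OF stored root_in_stack_records[OF r]] by simp_all

fun header_fits :: "header \<Rightarrow> bool" where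
  "header_fits (cf, cl, bf, bl, df, dt) \<longleftrightarrow> cf \<le> W \<and> cl \<le> W \<and> bf \<le> W \<and> bl \<le> W \<and> df \<le> W \<and> dt \<le> W"

lemma runs_read_header:
  assumes "a \<in> vaddrs st" "6 \<le> n"
    and "header_fits (header_of (vfields st a)) \<Longrightarrow> runs (k (header_of (vfields st a))) st (n - 6) Q"
  shows "runs (read_header a k) st n Q"
  unfolding read_header_def using assms
  by (intro runs_get_field) (auto simp: header_of_def numeral_eq_Suc)

lemma runs_write_header:
  assumes "a \<in> vaddrs st" "6 \<le> n" "header_fits h"
    and cont: "\<And>fd'. header_of (fd' a) = h \<Longrightarrow> (\<forall>x. x \<noteq> a \<longrightarrow> fd' x = vfields st x) \<Longrightarrow>
      runs p (st\<lparr>vfields := fd'\<rparr>) (n - 6) Q"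
  shows "runs (write_header a h p) st n Q"
proof (cases h)
  case (fields cf cl bf bl df dt)
  let ?fd = "(vfields st)(a := (vfields st a)(5 := cf, 6 := cl, 7 := bf, 8 := bl, 9 := df, 10 := dt))"
  have "runs p (st\<lparr>vfields := ?fd\<rparr>) (n - 6) Q"
    by (rule cont) (auto simp: header_of_def fields)
  then show ?thesis using assms(1-3)
    unfolding fields write_header.simps by (intro runs_set_field) (auto simp: numeral_eq_Suc)
qed

lemma runs_append_prog:
  assumes ends: "list_ends cs cf cl" and cs: "0 \<notin> set cs" "set cs \<subseteq> vaddrs st" and "x \<le> W" "1 \<le> n"
    and cont: "runs p (st\<lparr>vfields := append_link (vfields st) cs x\<rparr>) (n - 1) Q"
  shows "runs (append_prog cf cl x p) st n Q"
proof (cases "cs = []")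
  case True
  then have "runs p st (n - 1) Q" using cont by (simp add: append_link_def)
  then show ?thesis using True ends by (auto simp: append_prog_def list_ends_def intro: runs_mono)
next
  case False
  then have "cl = last cs" "cf \<noteq> 0" "last cs \<in> set cs" using ends cs(1) by (cases cs; auto simp: list_ends_def)+
  then show ?thesis using assms False unfolding append_prog_def append_link_def
    by (auto intro!: runs_set_field)
qed

subsection \<open>Headers of stored lists\<close>

context
  fixes st :: "'a view" and fd :: "nat \<Rightarrow> nat \<Rightarrow> nat" and cf cl bf bl df dt :: nat
    and C B' :: "'a entry list" and D :: "'a rtree list list"
  assumes at: "lists_at fd (cf, cl, bf, bl, df, dt) (C, B', D)"
    and stored: "stored st (C @ B' @ stack_records D)"
    and ordered: "lists_ordered C B' D"
begin

lemma clean_first_eq_0_iff: "cf = 0 \<longleftrightarrow> C = []"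
  using at storedD(2)[OF stored, of "hd C"] by (cases C) (auto simp: lists_at_def list_ends_def)

lemma clean_last_stored:
  assumes "C \<noteq> []"
  shows "cl \<in> vaddrs st" "velems st cl = snd (last C)"
  using at assms storedD[OF stored, of "last C"] by (auto simp: lists_at_def list_ends_def last_map)

lemma buffer_first_stored:
  assumes "B' \<noteq> []"
  shows "bf = fst (hd B')" "bf \<in> vaddrs st" "bf \<noteq> 0" "bf \<le> W" "velems st bf = snd (hd B')"
  using at assms storedD[OF stored, of "hd B'"] by (auto simp: lists_at_def list_ends_def hd_map)

lemma stack_first_stored:
  assumes "D \<noteq> []"
  shows "df = addr (hd (last D))" "df \<in> vaddrs st" "df \<noteq> 0" "velems st df = elts (hd (last D))"
proof -
  have first: "hd (last D) \<in> set (concat D)" by (rule hd_last_in_concat[OF ordered assms])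
  have "last D \<noteq> []" using lists_ordered_segment[OF ordered] assms by auto
  then show df: "df = addr (hd (last D))" using at assms by (simp add: lists_at_def last_map hd_map)
  show "df \<in> vaddrs st" "df \<noteq> 0" "velems st df = elts (hd (last D))"
    using stored_stack[of st D "hd (last D)", OF _ first] stored unfolding df by (simp_all add: stored_append)
qed

lemma stack_first_eq_0_iff: "df = 0 \<longleftrightarrow> D = []"
  using stack_first_stored(3) at by (cases "D = []") (auto simp: lists_at_def)

end

subsection \<open>Merging segments on disk\<close>

context
  fixes st :: "'a view" and C B' :: "'a entry list" and t u :: "'a rtree list" and D :: "'a rtree list list"
    and cf cl bf bl df dt :: nat
  assumes at: "lists_at (vfields st) (cf, cl, bf, bl, df, dt) (C, B', t # u # D)"
    and ok: "lists_ok C [] (t # u # D)"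
    and stored: "stored st (C @ stack_records (t # u # D))"
    and fits: "header_fits (cf, cl, bf, bl, df, dt)"
begin

abbreviation (input) "top_addrs \<equiv> map addr t"
abbreviation (input) "second_addrs \<equiv> map addr u"
abbreviation (input) "lower_addrs \<equiv> map (map addr) D"
abbreviation (input) "segment_addrs \<equiv> addr ` set (concat (t # u # D))"

lemma segments_ordered: "lists_ordered C [] (t # u # D)" "t \<noteq> []" "u \<noteq> []"
  using ok by (auto simp: lists_ok_def lists_ordered_def)

lemma segments_linked:
  "list_ends (map fst C) cf cl" "linked (vfields st) (map fst C)"
  "linked_stack (vfields st) (top_addrs # second_addrs # lower_addrs)"
  "df = hd (last (second_addrs # lower_addrs))" "dt = hd top_addrs"
  using at by (auto simp: lists_at_def)

lemma segments_distinct: "distinct (concat (top_addrs # second_addrs # lower_addrs))"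
  using distinct_stack_addrs[of "t # u # D"] stored by (simp add: stored_append stored_def)

lemma segments_stored: "r \<in> set (concat (t # u # D)) \<Longrightarrow>
    addr r \<in> vaddrs st \<and> addr r \<le> W \<and> velems st (addr r) = elts r"
  using stored_stack[of st "t # u # D" r] stored unfolding stored_append by blast

lemma segment_addr_stored: "x \<in> segment_addrs \<Longrightarrow> x \<in> vaddrs st \<and> x \<le> W"
  using segments_stored by auto

lemma segment_ends:
  "hd top_addrs \<in> segment_addrs" "last top_addrs \<in> segment_addrs" "hd second_addrs \<in> segment_addrs"
  "last second_addrs \<in> segment_addrs"
  using segments_ordered(2,3) by (auto simp: hd_map last_map)

lemma segment_ends_stored:
  "hd top_addrs \<in> vaddrs st" "hd second_addrs \<in> vaddrs st" "last second_addrs \<in> vaddrs st" "hd top_addrs \<le> W"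
  "last top_addrs \<le> W" "hd second_addrs \<le> W" "last second_addrs \<le> W"
  using segment_addr_stored segment_ends by blast+

lemma clean_still_linked:
  assumes "relinks segment_addrs (vfields st) fd'"
  shows "linked fd' (map fst C)"
proof -
  have "fst ` set C \<inter> fst ` set (stack_records (t # u # D)) = {}" using stored by (simp only: stored_append)
  moreover have "segment_addrs \<subseteq> fst ` set (stack_records (t # u # D))"
    using addrs_subset_stack_records[of "t # u # D"] by (simp add: image_Un image_UN)
  ultimately have "fst ` set C \<inter> segment_addrs = {}" by blast
  then have "linked fd' (map fst C) = linked (vfields st) (map fst C)"
    by (intro linked_frame) (use assms in \<open>auto simp: relinks_def disjoint_iff simp del: set_concat\<close>)
  then show ?thesis using segments_linked(2) by simp
qed

lemma bottom_neq_top: "df \<noteq> dt"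
proof -
  have "last (second_addrs # lower_addrs) \<in> set (second_addrs # lower_addrs)" by (rule last_in_set) simp
  moreover from this have "last (second_addrs # lower_addrs) \<noteq> []"
    using linked_stack_nonempty[of "vfields st" "second_addrs # lower_addrs"] segments_linked(3) by simp
  ultimately have "df \<in> set (concat (second_addrs # lower_addrs))" unfolding segments_linked(4)
    by (metis UN_iff hd_in_set set_concat)
  moreover have "hd top_addrs \<in> set top_addrs" using segments_ordered(2) by (intro hd_in_set) simp
  ultimately show ?thesis using segments_distinct segments_linked(5) by (auto simp del: set_concat)
qed

lemma top_keys: "hd (velems st (last second_addrs)) = key (last u)" "hd (velems st (hd top_addrs)) = key (hd t)"
  using segments_stored[of "last u"] segments_stored[of "hd t"] segments_ordered(2,3)
  by (auto simp: last_map hd_map)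

lemma runs_merge_segments:
  assumes less: "key (last u) < key (hd t)"
    and cont: "\<And>fd' h. relinks segment_addrs (vfields st) fd' \<Longrightarrow> header_fits h \<Longrightarrow>
        lists_at fd' h (bias_stack C (t # u # D)) \<Longrightarrow> runs (k h) (st\<lparr>vfields := fd'\<rparr>) n Q"
  shows "runs (merge_prog cf cl df dt k) st (n + 18) Q"
proof -
  let ?fd1 = "upd_field (vfields st) (last second_addrs) succ_field (hd top_addrs)"
  let ?fd2 = "upd_field ?fd1 (hd top_addrs) pred_field (last second_addrs)"
  let ?fd = "upd_field ?fd2 (hd second_addrs) end_field (last top_addrs)"
  have relinks: "relinks segment_addrs (vfields st) ?fd"
    by (intro relinks_upd_field relinks_refl) (use segment_ends in auto)
  have "lists_at ?fd (cf, cl, 0, 0, df, hd second_addrs) (bias_stack C (t # u # D))"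
    using linked_stack_merge[OF segments_linked(3) segments_distinct] clean_still_linked[OF relinks]
      segments_linked less segments_ordered(3)
    by (auto simp: lists_at_def list_ends_def hd_append simp del: fun_upd_apply)
  then have "runs (k (cf, cl, 0, 0, df, hd second_addrs)) (st\<lparr>vfields := ?fd\<rparr>) n Q"
    by (intro cont relinks) (use fits segment_ends_stored in auto)
  then have "\<forall>m\<ge>n. runs (k (cf, cl, 0, 0, df, hd second_addrs)) (st\<lparr>vfields := ?fd\<rparr>) m Q"
    by (auto intro: runs_mono)
  then show ?thesis unfolding merge_prog_def
    using segment_ends_stored top_keys less segments_linked(3,5)
    by (auto intro!: runs_get_field runs_set_field runs_compare_keys)
qed

lemma runs_drop_segment:
  assumes not_less: "\<not> key (last u) < key (hd t)" and single: "last second_addrs = hd second_addrs"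
    and cont: "\<And>fd' h. relinks segment_addrs (vfields st) fd' \<Longrightarrow> header_fits h \<Longrightarrow>
        lists_at fd' h (bias_stack C (t # u # D)) \<Longrightarrow> runs (k h) (st\<lparr>vfields := fd'\<rparr>) n Q"
  shows "runs (merge_prog cf cl df dt k) st (n + 18) Q"
proof -
  have "distinct second_addrs" using segments_distinct by simp
  then have u: "butlast u = []"
    using single last_notin_butlast[of second_addrs] segments_ordered(3) by (cases u) (auto split: if_splits)
  then have D: "D \<noteq> []" using lists_ok_drop_last_tree(2)[OF ok not_less] by blast
  have second: "second_addrs = [hd second_addrs]" using u segments_ordered(3)
    by (cases u) (auto split: if_splits)
  let ?fd = "upd_field (vfields st) (hd top_addrs) below_field (vfields st (hd second_addrs) below_field)"
  have relinks: "relinks segment_addrs (vfields st) ?fd"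
    by (intro relinks_upd_field relinks_refl) (use segment_ends in auto)
  have "linked_stack ?fd (top_addrs # lower_addrs)"
    using linked_stack_drop_segment[of "vfields st" top_addrs "hd second_addrs" lower_addrs] segments_linked(3)
      segments_distinct second D
    by (simp del: fun_upd_apply linked_stack.simps)
  then have "lists_at ?fd (cf, cl, 0, 0, df, dt) (bias_stack C (t # u # D))"
    using clean_still_linked[OF relinks] segments_linked not_less u D
    by (auto simp: lists_at_def list_ends_def drop_last_tree_def simp del: fun_upd_apply)
  then have "runs (k (cf, cl, 0, 0, df, dt)) (st\<lparr>vfields := ?fd\<rparr>) n Q"
    by (intro cont relinks) (use fits in auto)
  then have "\<forall>m\<ge>n. runs (k (cf, cl, 0, 0, df, dt)) (st\<lparr>vfields := ?fd\<rparr>) m Q" by (auto intro: runs_mono)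
  moreover have "vfields st (hd second_addrs) below_field \<in> segment_addrs"
  proof -
    have "hd D \<noteq> []" "hd D \<in> set D" using lists_ordered_segment[OF segments_ordered(1)] D by auto
    moreover from this have "vfields st (hd second_addrs) below_field = addr (hd (hd D))"
      using segments_linked(3) segments_ordered(2,3) D by (simp add: hd_map)
    moreover from calculation have "hd (hd D) \<in> set (concat (t # u # D))" by (auto intro!: bexI[of _ "hd D"])
    ultimately show ?thesis by blast
  qed
  then have "vfields st (hd second_addrs) below_field \<le> W" using segment_addr_stored by blast
  ultimately show ?thesis unfolding merge_prog_def
    using segment_ends_stored top_keys not_less single segments_linked(3,5)
    by (auto intro!: runs_get_field runs_set_field runs_compare_keys)
qed

lemma runs_drop_last_tree:
  assumes not_less: "\<not> key (last u) < key (hd t)" and several: "last second_addrs \<noteq> hd second_addrs"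
    and cont: "\<And>fd' h. relinks segment_addrs (vfields st) fd' \<Longrightarrow> header_fits h \<Longrightarrow>
        lists_at fd' h (bias_stack C (t # u # D)) \<Longrightarrow> runs (k h) (st\<lparr>vfields := fd'\<rparr>) n Q"
  shows "runs (merge_prog cf cl df dt k) st (n + 18) Q"
proof -
  let ?V = "map addr (butlast u)"
  have ne: "butlast u \<noteq> []" using several segments_ordered(3) by (cases u rule: rev_cases) auto
  have second: "second_addrs = ?V @ [last second_addrs]" using segments_ordered(3)
    by (metis append_butlast_last_id map_butlast map_is_Nil_conv)
  then have V: "hd ?V = hd second_addrs" "last ?V \<in> set second_addrs" using ne
    by (metis hd_append2 map_is_Nil_conv, metis Un_iff last_in_set map_is_Nil_conv set_append)
  let ?fd = "upd_field (vfields st) (hd ?V) end_field (vfields st (last second_addrs) pred_field)"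
  note dropped = linked_stack_drop_last[of "vfields st" top_addrs ?V "last second_addrs" lower_addrs]
  have stack: "linked_stack ?fd (top_addrs # ?V # lower_addrs)"
    and pred: "vfields st (last second_addrs) pred_field = last ?V"
    using dropped segments_linked(3) segments_distinct ne unfolding second[symmetric] by auto
  have relinks: "relinks segment_addrs (vfields st) ?fd"
    by (intro relinks_upd_field relinks_refl) (use segment_ends V in auto)
  have "lists_at ?fd (cf, cl, 0, 0, df, dt) (bias_stack C (t # u # D))"
    using stack clean_still_linked[OF relinks] segments_linked not_less ne V
    by (auto simp: lists_at_def list_ends_def drop_last_tree_def simp del: fun_upd_apply)
  then have "runs (k (cf, cl, 0, 0, df, dt)) (st\<lparr>vfields := ?fd\<rparr>) n Q"
    by (intro cont relinks) (use fits in auto)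
  then have "\<forall>m\<ge>n. runs (k (cf, cl, 0, 0, df, dt)) (st\<lparr>vfields := ?fd\<rparr>) m Q" by (auto intro: runs_mono)
  moreover have "last ?V \<in> segment_addrs" using V(2) by auto
  then have "last ?V \<le> W" using segment_addr_stored by blast
  ultimately show ?thesis unfolding merge_prog_def
    using segment_ends_stored top_keys not_less several pred V segments_linked(3,5)
    by (auto intro!: runs_get_field runs_set_field runs_compare_keys)
qed

lemma runs_merge_prog:
  assumes "\<And>fd' h. relinks segment_addrs (vfields st) fd' \<Longrightarrow> header_fits h \<Longrightarrow>
      lists_at fd' h (bias_stack C (t # u # D)) \<Longrightarrow> runs (k h) (st\<lparr>vfields := fd'\<rparr>) n Q"
  shows "runs (merge_prog cf cl df dt k) st (n + 18) Q"
  using runs_merge_segments runs_drop_segment runs_drop_last_tree assms by blast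

end

end

subsection \<open>Unfolding the first tree of a segment on disk\<close>

context io_machine
begin

context
  fixes st :: "'a view" and C B' :: "'a entry list" and r :: "'a rtree" and g :: "'a rtree list"
    and cf cl bf bl df dt :: nat and a f :: nat and cs gs kcs kbs :: "nat list" and kds :: "nat list list"
    and X :: "nat set"
  assumes at: "lists_at (vfields st) (cf, cl, bf, bl, df, dt) (C, B', [r # g])"
    and tree_at: "rtree_at (vfields st) r" and tree_ok: "rtree_ok r"
    and stored: "stored st (C @ stack_records [r # g])"
    and fits: "header_fits (cf, cl, bf, bl, df, dt)"
    and a_eq: "a = addr r" and f_eq: "f = first_or cf a"
    and cs_eq: "cs = map fst C" and gs_eq: "gs = map addr g"
    and kcs_eq: "kcs = map fst (clean r)" and kbs_eq: "kbs = map fst (buffer r)"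
    and kds_eq: "kds = map (map addr) (stack r)"
    and X_eq: "X = insert a (set cs \<union> set gs)"
begin

abbreviation (input) "fd_app \<equiv> append_link (vfields st) cs a"
abbreviation (input) "fd_seg \<equiv> upd_field fd_app (hd gs) end_field (last gs)"

lemmas addr_eqs =
  a_eq[symmetric] cs_eq[symmetric] gs_eq[symmetric] kcs_eq[symmetric] kbs_eq[symmetric] kds_eq[symmetric]

lemma addrs_eq_Nil_iff: "gs = [] \<longleftrightarrow> g = []" "kcs = [] \<longleftrightarrow> clean r = []" "kds = [] \<longleftrightarrow> stack r = []"
  by (simp_all add: gs_eq kcs_eq kds_eq)

lemma segment_linked:
  "list_ends cs cf cl" "linked (vfields st) cs" "doubly_linked (vfields st) (a # gs)"
  "vfields st a end_field = last (a # gs)" "df = a" "dt = a"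
  using at by (auto simp: lists_at_def a_eq cs_eq gs_eq)

lemma records_split: "C @ stack_records [r # g] =
    C @ root r # clean r @ buffer r @ stack_records (stack r) @ concat (map records g)"
  by (simp add: records_eq[of r])

lemma children_stored: "stored st (clean r @ buffer r @ stack_records (stack r))"
  using stored unfolding records_split by (auto simp: stored_append stored_Cons)

lemma children_lists_ordered: "lists_ordered (clean r) (buffer r) (stack r)"
  using rtree_ok_iff[THEN iffD1, OF tree_ok] by (simp add: lists_ok_def)

lemma addrs_disjoint:
  "a \<notin> set cs" "a \<notin> set kcs" "a \<notin> set kbs" "a \<notin> set (concat kds)" "a \<notin> set gs"
  "set cs \<inter> set kcs = {}" "set cs \<inter> set kbs = {}" "set cs \<inter> set (concat kds) = {}" "set cs \<inter> set gs = {}"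
  "set kcs \<inter> set gs = {}" "set kbs \<inter> set gs = {}" "set (concat kds) \<inter> set gs = {}" "distinct cs"
proof -
  have "distinct (cs @ a # kcs @ kbs @ map fst (stack_records (stack r)) @ map fst (concat (map records g)))"
    using stored unfolding records_split stored_def by (simp add: a_eq cs_eq kcs_eq kbs_eq)
  moreover have "set gs \<subseteq> set (map fst (concat (map records g)))" using addr_in_records[of _ g]
    by (auto simp: gs_eq)
  moreover have "set (concat kds) \<subseteq> set (map fst (stack_records (stack r)))"
    using addrs_subset_stack_records[of "stack r"] by (simp add: kds_eq)
  ultimately show "a \<notin> set cs" "a \<notin> set kcs" "a \<notin> set kbs" "a \<notin> set (concat kds)" "a \<notin> set gs"
    "set cs \<inter> set kcs = {}" "set cs \<inter> set kbs = {}" "set cs \<inter> set (concat kds) = {}" "set cs \<inter> set gs = {}"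
    "set kcs \<inter> set gs = {}" "set kbs \<inter> set gs = {}" "set (concat kds) \<inter> set gs = {}" "distinct cs"
    by (auto simp del: set_concat)
qed

lemma clean_addrs_stored: "0 \<notin> set cs" "set cs \<subseteq> vaddrs st"
  using stored_addr[of st C] stored by (auto simp: stored_append cs_eq)

lemma tree_stored: "r' \<in> set (r # g) \<Longrightarrow>
    addr r' \<in> vaddrs st \<and> 0 < addr r' \<and> addr r' \<le> W \<and> velems st (addr r') = elts r'"
  using stored_stack[of st "[r # g]" r'] stored by (simp add: stored_append)

lemma root_stored: "a \<in> vaddrs st" "a \<noteq> 0" "a \<le> W" "a \<in> X"
  using tree_stored[of r] by (auto simp: a_eq X_eq)

lemma first_or_fits: "f \<le> W"
  using root_stored fits by (simp add: f_eq first_or_def)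

lemma relinks_app: "relinks X (vfields st) fd_app"
  by (intro relinks_append_link) (auto simp: X_eq)

lemma clean_linked: "(\<And>x. x \<in> set cs \<Longrightarrow> fd' x = fd_app x) \<Longrightarrow> linked fd' (cs @ [a])"
proof -
  assume "\<And>x. x \<in> set cs \<Longrightarrow> fd' x = fd_app x"
  then have "linked fd' (cs @ [a]) = linked fd_app (cs @ [a])" by (intro linked_cong) auto
  then show ?thesis using linked_append_link[OF segment_linked(2)] addrs_disjoint(13) by simp
qed

lemma clean_ends: "list_ends (cs @ [a]) f a"
  unfolding f_eq by (rule list_ends_snoc[OF clean_addrs_stored(1) segment_linked(1)])

lemma children_still_linked:
  assumes "relinks X (vfields st) fd'"
  shows "linked fd' kcs = linked (vfields st) kcs" "linked fd' kbs = linked (vfields st) kbs"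
    "linked_stack fd' kds = linked_stack (vfields st) kds"
proof -
  have same: "fd' x = vfields st x" if "x \<in> set kcs \<union> set kbs \<union> set (concat kds)" for x
    using that assms addrs_disjoint unfolding X_eq relinks_def by (auto simp del: set_concat simp: disjoint_iff)
  show "linked fd' kcs = linked (vfields st) kcs" "linked fd' kbs = linked (vfields st) kbs"
    by (rule linked_frame; use same in auto)+
  show "linked_stack fd' kds = linked_stack (vfields st) kds" by (rule linked_stack_frame) (use same in auto)
qed

context
  fixes c c' b b' d d' :: nat
  assumes header: "header_of (vfields st a) = (c, c', b, b', d, d')"
begin

lemma children_at: "lists_at (vfields st) (c, c', b, b', d, d') (clean r, buffer r, stack r)"
  using tree_at header by (simp add: rtree_at_iff[of _ r] a_eq)

lemma children_linked:
  "list_ends kcs c c'" "list_ends kbs b b'" "linked (vfields st) kcs" "linked (vfields st) kbs"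
  "linked_stack (vfields st) kds" "if kds = [] then d = 0 else d = hd (last kds) \<and> d' = hd (hd kds)"
  using children_at by (auto simp: lists_at_def kcs_eq kbs_eq kds_eq)

lemma child_first_eq_0_iff: "c = 0 \<longleftrightarrow> kcs = []"
  using clean_first_eq_0_iff[OF children_at children_stored children_lists_ordered] addrs_eq_Nil_iff by simp

lemmas child_last_stored = clean_last_stored[OF children_at children_stored children_lists_ordered]
lemmas child_stack_stored = stack_first_stored[OF children_at children_stored children_lists_ordered]
lemmas child_stack_eq_0_iff = stack_first_eq_0_iff[OF children_at children_stored children_lists_ordered]

lemma clean_ends_children: "kcs \<noteq> [] \<Longrightarrow> list_ends (cs @ a # kcs) f c'"
  unfolding f_eq by (rule list_ends_append_Cons[OF clean_addrs_stored(1) segment_linked(1) children_linked(1)])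

lemma clean_linked_children:
  assumes "relinks X (vfields st) fd'" "\<And>x. x \<in> set cs \<Longrightarrow> fd' x = fd_app x" "fd' a succ_field = c"
    and "kcs \<noteq> []"
  shows "linked fd' (cs @ a # kcs)"
proof -
  have "linked fd' ((cs @ [a]) @ kcs)"
    unfolding linked_append[of fd' "cs @ [a]"]
    using clean_linked[OF assms(2)] children_still_linked(1)[OF assms(1)]
      children_linked(1,3) assms(3,4) by (auto simp: list_ends_def)
  then show ?thesis by simp
qed

lemma runs_unfold_last_tree:
  assumes g: "gs = []"
    and cont: "\<And>fd' h. relinks X (vfields st) fd' \<Longrightarrow> header_fits h \<Longrightarrow>
        lists_at fd' h (bias_segment (C @ [root r]) r g) \<Longrightarrow> runs (k h) (st\<lparr>vfields := fd'\<rparr>) m Q"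
  shows "runs (unfold_prog cf cl a k) st (m + 18) Q"
proof (cases "kcs = []")
  case True
  have "lists_at fd_app (f, a, 0, 0, 0, 0) (bias_segment (C @ [root r]) r g)"
    using g True clean_linked[of fd_app] clean_ends
    by (simp add: lists_at_def list_ends_def addr_eqs addrs_eq_Nil_iff)
  then have "runs (k (f, a, 0, 0, 0, 0)) (st\<lparr>vfields := fd_app\<rparr>) m Q"
    by (intro cont relinks_app) (use first_or_fits root_stored in auto)
  then have "\<forall>j\<ge>m. runs (k (f, a, 0, 0, 0, 0)) (st\<lparr>vfields := fd_app\<rparr>) j Q" by (auto intro: runs_mono)
  then show ?thesis unfolding unfold_prog_def f_eq[symmetric]
    using clean_addrs_stored root_stored segment_linked(4) g True child_first_eq_0_iff header
    by (auto intro!: runs_get_field runs_read_header runs_append_prog[OF segment_linked(1)])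
next
  case False
  let ?fd = "upd_field fd_app a succ_field c"
  have relinks: "relinks X (vfields st) ?fd" by (intro relinks_upd_field relinks_app root_stored) simp
  have "linked ?fd (cs @ a # kcs)"
    by (rule clean_linked_children[OF relinks]) (use addrs_disjoint(1) False in auto)
  then have "lists_at ?fd (f, c', b, b', d, d') (bias_segment (C @ [root r]) r g)"
    using g False clean_ends_children children_linked children_still_linked[OF relinks]
    by (simp add: lists_at_def addr_eqs addrs_eq_Nil_iff del: fun_upd_apply)
  then have "header_fits (c, c', b, b', d, d') \<Longrightarrow> runs (k (f, c', b, b', d, d')) (st\<lparr>vfields := ?fd\<rparr>) m Q"
    by (intro cont relinks) (use first_or_fits in simp_all)
  then have "\<forall>j\<ge>m. header_fits (c, c', b, b', d, d') \<longrightarrow> runs (k (f, c', b, b', d, d')) (st\<lparr>vfields := ?fd\<rparr>) j Q"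
    by (auto intro: runs_mono)
  then show ?thesis unfolding unfold_prog_def f_eq[symmetric]
    using clean_addrs_stored root_stored segment_linked(4) g False child_first_eq_0_iff header
      append_link_other[OF addrs_disjoint(1)]
    by (auto intro!: runs_get_field runs_set_field runs_read_header runs_append_prog[OF segment_linked(1)])
qed

context
  assumes siblings: "gs \<noteq> []"
begin

lemma sibling_first:
  "hd gs \<in> set gs" "hd gs \<in> vaddrs st" "hd gs \<le> W" "hd gs \<in> X" "hd gs \<noteq> a" "hd gs \<notin> set cs" "hd gs \<noteq> 0"
  "velems st (hd gs) = elts (hd g)"
proof -
  have "hd gs = addr (hd g)" "hd g \<in> set g" "hd gs \<in> set gs" using siblings by (auto simp: gs_eq hd_map)
  then show "hd gs \<in> set gs" "hd gs \<in> vaddrs st" "hd gs \<le> W" "hd gs \<noteq> 0" "hd gs \<in> X"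
      "velems st (hd gs) = elts (hd g)"
    using tree_stored[of "hd g"] by (auto simp: X_eq)
  then show "hd gs \<noteq> a" "hd gs \<notin> set cs" using addrs_disjoint(5,9) by auto
qed

lemma sibling_last: "last gs \<le> W" "last gs \<noteq> a"
proof -
  have "last gs \<in> set gs" "last gs = addr (last g)" "last g \<in> set g" using siblings
    by (auto simp: gs_eq last_map)
  then show "last gs \<le> W" "last gs \<noteq> a" using tree_stored[of "last g"] addrs_disjoint(5) by auto
qed

lemma root_fields:
  "vfields st a succ_field = hd gs" "vfields st a end_field = last gs" "fd_app a succ_field = hd gs"
  using segment_linked(3,4) siblings append_link_other[OF addrs_disjoint(1), of "vfields st" a]
  by (cases gs; auto simp: doubly_linked_def)+

lemma relinks_seg: "relinks X (vfields st) fd_seg"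
  by (intro relinks_upd_field relinks_app sibling_first) simp

lemma fd_seg_clean: "x \<in> set cs \<Longrightarrow> fd_seg x = fd_app x"
  using sibling_first(6) by auto

lemma siblings_linked:
  assumes "\<And>x j. x \<in> set gs \<Longrightarrow> j < 4 \<Longrightarrow> fd' x j = fd_seg x j"
  shows "linked_stack fd' [gs]"
proof -
  have same: "fd_seg x j = vfields st x j" if "x \<in> set gs" "j \<noteq> end_field" for x j
  proof -
    have "x \<notin> set cs" using that(1) addrs_disjoint(9) by auto
    then show ?thesis using that(2) sibling_first(6) by (auto simp: append_link_other)
  qed
  have "doubly_linked fd' gs = doubly_linked (vfields st) gs"
    by (rule doubly_linked_cong; use assms same
      in \<open>auto dest!: in_set_butlastD in_set_tlD simp del: fun_upd_apply\<close>)
  moreover have "doubly_linked (vfields st) gs"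
    using segment_linked(3) doubly_linked_append[of "vfields st" "[a]" gs] by simp
  ultimately show ?thesis using assms[of "hd gs" end_field] sibling_first(1) siblings by simp
qed

lemma runs_unfold_leaf:
  assumes leaf: "kcs = []"
    and cont: "\<And>fd' h. relinks X (vfields st) fd' \<Longrightarrow> header_fits h \<Longrightarrow>
        lists_at fd' h (bias_segment (C @ [root r]) r g) \<Longrightarrow> runs (k h) (st\<lparr>vfields := fd'\<rparr>) m Q"
  shows "runs (unfold_prog cf cl a k) st (m + 18) Q"
proof -
  have "lists_at fd_seg (f, a, 0, 0, hd gs, hd gs) (bias_segment (C @ [root r]) r g)"
    using siblings leaf clean_linked[OF fd_seg_clean] siblings_linked[of fd_seg] clean_ends
    by (simp add: lists_at_def list_ends_def addr_eqs addrs_eq_Nil_iff del: fun_upd_apply)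
  then have "runs (k (f, a, 0, 0, hd gs, hd gs)) (st\<lparr>vfields := fd_seg\<rparr>) m Q"
    by (intro cont relinks_seg) (use first_or_fits root_stored sibling_first in auto)
  then have "\<forall>j\<ge>m. runs (k (f, a, 0, 0, hd gs, hd gs)) (st\<lparr>vfields := fd_seg\<rparr>) j Q" by (auto intro: runs_mono)
  then show ?thesis unfolding unfold_prog_def f_eq[symmetric]
    using clean_addrs_stored root_stored root_fields sibling_first sibling_last leaf child_first_eq_0_iff header
    by (auto intro!: runs_get_field runs_set_field runs_read_header runs_append_prog[OF segment_linked(1)])
qed

context
  assumes children: "kcs \<noteq> []"
begin

lemma last_child_key: "hd (velems st c') = rkey (last (clean r))" "c' \<in> vaddrs st" "c \<noteq> 0"
  using child_last_stored child_first_eq_0_iff children addrs_eq_Nil_iff by simp_all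

lemma runs_unfold_siblings:
  assumes cont: "header_fits (c, c', b, b', d, d') \<Longrightarrow>
      runs (unfold_children_prog f a (hd gs) (c, c', b, b', d, d') k) (st\<lparr>vfields := fd_seg\<rparr>) (m + 8) Q"
  shows "runs (unfold_prog cf cl a k) st (m + 18) Q"
proof -
  have "header_fits (c, c', b, b', d, d') \<Longrightarrow>
      runs (unfold_children_prog f a (hd gs) (c, c', b, b', d, d') k) (st\<lparr>vfields := fd_seg\<rparr>) (8 + m) Q"
    using cont by (simp only: add.commute)
  then show ?thesis unfolding unfold_prog_def f_eq[symmetric]
    using clean_addrs_stored root_stored root_fields sibling_first sibling_last last_child_key(3) header
    by (auto intro!: runs_get_field runs_set_field runs_read_header runs_append_prog[OF segment_linked(1)]
      simp del: unfold_children_prog.simps)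
qed

abbreviation (input) "fd_children \<equiv> upd_field fd_seg a succ_field c"
abbreviation (input) "fd_push \<equiv> upd_field fd_children (hd gs) below_field d'"

lemma relinks_children: "relinks X (vfields st) fd_children" "relinks X (vfields st) fd_push"
  by (intro relinks_upd_field relinks_seg root_stored sibling_first; simp)+

lemma lists_at_unfold_buffer:
  assumes "\<not> rkey (last (clean r)) < key (hd g)"
  shows "lists_at fd_seg (f, a, c, c', hd gs, hd gs) (bias_segment (C @ [root r]) r g)"
  using siblings children assms clean_linked[OF fd_seg_clean] siblings_linked[of fd_seg] clean_ends
    children_linked children_still_linked[OF relinks_seg]
  by (simp add: lists_at_def addr_eqs addrs_eq_Nil_iff del: fun_upd_apply)

lemma lists_at_unfold_dropping_stack:
  assumes "rkey (last (clean r)) < key (hd g)" "kds = [] \<or> \<not> key (hd (last (stack r))) < key (hd g)"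
  shows "lists_at fd_children (f, c', b, b', hd gs, hd gs) (bias_segment (C @ [root r]) r g)"
proof -
  have "linked fd_children (cs @ a # kcs)"
    by (rule clean_linked_children[OF relinks_children(1) _ _ children])
      (use fd_seg_clean addrs_disjoint(1) in auto)
  moreover have "linked_stack fd_children [gs]" by (rule siblings_linked) (use addrs_disjoint(5) in auto)
  ultimately show ?thesis
    using siblings children assms clean_ends_children children_linked children_still_linked[OF relinks_children(1)]
    by (simp add: lists_at_def addr_eqs addrs_eq_Nil_iff del: fun_upd_apply linked_stack.simps)
qed

lemma lists_at_unfold_pushing_siblings:
  assumes "rkey (last (clean r)) < key (hd g)" "kds \<noteq> []" "key (hd (last (stack r))) < key (hd g)"
  shows "lists_at fd_push (f, c', b, b', d, hd gs) (bias_segment (C @ [root r]) r g)"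
proof -
  have "linked fd_push (cs @ a # kcs)"
    by (rule clean_linked_children[OF relinks_children(2) _ _ children])
      (use fd_seg_clean addrs_disjoint(1) sibling_first(5,6) in auto)
  moreover have "linked_stack fd_push [gs]"
    by (rule siblings_linked) (use addrs_disjoint(5) sibling_first(5) in auto)
  then have "linked_stack fd_push (gs # kds)"
    using children_still_linked[OF relinks_children(2)] children_linked(5,6) assms(2) by simp
  ultimately show ?thesis
    using siblings children assms clean_ends_children children_linked children_still_linked[OF relinks_children(2)]
    by (simp add: lists_at_def addr_eqs addrs_eq_Nil_iff del: fun_upd_apply linked_stack.simps)
qed

lemma child_keys:
  "hd (velems (st\<lparr>vfields := fd'\<rparr>) c') = rkey (last (clean r))" "c' \<in> vaddrs (st\<lparr>vfields := fd'\<rparr>)"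
  "hd (velems (st\<lparr>vfields := fd'\<rparr>) (hd gs)) = key (hd g)" "hd gs \<in> vaddrs (st\<lparr>vfields := fd'\<rparr>)"
  "a \<in> vaddrs (st\<lparr>vfields := fd'\<rparr>)"
  using last_child_key sibling_first root_stored by simp_all

lemma runs_unfold_children:
  assumes cont: "\<And>fd' h. relinks X (vfields st) fd' \<Longrightarrow> header_fits h \<Longrightarrow>
        lists_at fd' h (bias_segment (C @ [root r]) r g) \<Longrightarrow> runs (k h) (st\<lparr>vfields := fd'\<rparr>) m Q"
  shows "runs (unfold_prog cf cl a k) st (m + 18) Q"
proof (rule runs_unfold_siblings)
  assume child_fits: "header_fits (c, c', b, b', d, d')"
  have cont': "runs (k h) (st\<lparr>vfields := fd'\<rparr>) j Q"
    if "lists_at fd' h (bias_segment (C @ [root r]) r g)" "relinks X (vfields st) fd'" "header_fits h" "m \<le> j"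
    for fd' h j
    using cont[OF that(2,3,1)] that(4) by (rule runs_mono)
  note fits' = child_fits first_or_fits root_stored(3) sibling_first(3)
  consider "\<not> rkey (last (clean r)) < key (hd g)"
    | "rkey (last (clean r)) < key (hd g)" "kds = [] \<or> \<not> key (hd (last (stack r))) < key (hd g)"
    | "rkey (last (clean r)) < key (hd g)" "kds \<noteq> []" "key (hd (last (stack r))) < key (hd g)" by blast
  then show "runs (unfold_children_prog f a (hd gs) (c, c', b, b', d, d') k) (st\<lparr>vfields := fd_seg\<rparr>) (m + 8) Q"
  proof cases
    case 1
    have "runs (k (f, a, c, c', hd gs, hd gs)) (st\<lparr>vfields := fd_seg\<rparr>) (m + 8 - 2) Q"
      by (rule cont'[OF lists_at_unfold_buffer[OF 1] relinks_seg]) (use fits' in simp_all)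
    then show ?thesis unfolding unfold_children_prog.simps
      by (intro runs_compare_keys) (use 1 child_keys in simp_all)
  next
    case 2
    have "runs (k (f, c', b, b', hd gs, hd gs)) (st\<lparr>vfields := fd_children\<rparr>) j Q" if "m \<le> j" for j
      by (rule cont'[OF lists_at_unfold_dropping_stack[OF 2] relinks_children(1)]) (use fits' that in simp_all)
    then have "runs (if d = 0 then k (f, c', b, b', hd gs, hd gs) else compare_keys d (hd gs)
        (set_field (hd gs) below_field d' (k (f, c', b, b', d, hd gs))) (k (f, c', b, b', hd gs, hd gs)))
        (st\<lparr>vfields := fd_children\<rparr>) (5 + m) Q"
      using 2(2) child_stack_stored child_stack_eq_0_iff child_keys addrs_eq_Nil_iff
      by (cases "kds = []") (auto intro!: runs_compare_keys)
    then show ?thesis unfolding unfold_children_prog.simps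
      by (intro runs_compare_keys runs_set_field)
        (use 2(1) child_keys fits' in \<open>simp_all del: fun_upd_apply split del: if_split\<close>)
  next
    case 3
    have "runs (k (f, c', b, b', d, hd gs)) (st\<lparr>vfields := fd_push\<rparr>) (m + 2) Q"
      by (rule cont'[OF lists_at_unfold_pushing_siblings[OF 3] relinks_children(2)]) (use fits' in simp_all)
    then have "runs (compare_keys d (hd gs) (set_field (hd gs) below_field d' (k (f, c', b, b', d, hd gs)))
        (k (f, c', b, b', hd gs, hd gs))) (st\<lparr>vfields := fd_children\<rparr>) (5 + m) Q"
      using 3 child_stack_stored child_keys addrs_eq_Nil_iff fits'
      by (intro runs_compare_keys runs_set_field) simp_all
    then show ?thesis unfolding unfold_children_prog.simps using 3(2) child_stack_eq_0_iff addrs_eq_Nil_iff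
      by (intro runs_compare_keys runs_set_field) (use 3(1) child_keys fits' in \<open>simp_all del: fun_upd_apply\<close>)
  qed
qed

end

end

end

lemma runs_unfold_prog:
  assumes "\<And>fd' h. relinks X (vfields st) fd' \<Longrightarrow> header_fits h \<Longrightarrow>
      lists_at fd' h (bias_segment (C @ [root r]) r g) \<Longrightarrow> runs (k h) (st\<lparr>vfields := fd'\<rparr>) m Q"
  shows "runs (unfold_prog cf cl df k) st (m + 18) Q"
proof -
  obtain c c' b b' d d' where header: "header_of (vfields st a) = (c, c', b, b', d, d')" by (metis prod_cases6)
  show ?thesis unfolding segment_linked(5)
    using runs_unfold_last_tree[OF header] runs_unfold_leaf[OF header] runs_unfold_children[OF header] assms
    by blast
qed

end

lemma runs_bias_stack_prog:
  assumes at: "lists_at (vfields st) (cf, cl, bf, bl, df, dt) (C, B', D)"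
    and trees_at: "\<forall>r\<in>set (concat D). rtree_at (vfields st) r"
    and ok: "lists_ok C [] D" and D: "D \<noteq> []" and stored: "stored st (C @ stack_records D)"
    and fits: "header_fits (cf, cl, bf, bl, df, dt)"
    and cont: "\<And>fd' h. relinks (fst ` set C \<union> addr ` set (concat D)) (vfields st) fd' \<Longrightarrow> header_fits h \<Longrightarrow>
        lists_at fd' h (bias_stack C D) \<Longrightarrow> runs (k h) (st\<lparr>vfields := fd'\<rparr>) n Q"
  shows "runs (bias_stack_prog cf cl df dt k) st (n + 18) Q"
proof (cases "(C, D)" rule: bias_stack.cases)
  case (2 C' g)
  then obtain r g' where D: "D = [r # g']" using ok by (cases g) (auto simp: lists_ok_def lists_ordered_def)
  have "df = dt" using at D by (simp add: lists_at_def)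
  moreover have "runs (unfold_prog cf cl df k) st (n + 18) Q"
    by (rule runs_unfold_prog[where C = C and r = r and g = g', OF _ _ _ _ _ refl refl refl refl refl refl refl refl])
      (use at trees_at ok stored fits cont D in \<open>auto simp: lists_ok_def simp del: bias_segment.simps\<close>)
  ultimately show ?thesis by (simp add: bias_stack_prog_def)
next
  case (3 C' t u D')
  then have D: "D = t # u # D'" by simp
  have "df \<noteq> dt" by (rule bottom_neq_top) (use at ok stored fits D in auto)
  moreover have "runs (merge_prog cf cl df dt k) st (n + 18) Q"
  proof (rule runs_merge_prog)
    fix fd' h assume "relinks (addr ` set (concat (t # u # D'))) (vfields st) fd'" "header_fits h"
      "lists_at fd' h (bias_stack C (t # u # D'))"
    then show "runs (k h) (st\<lparr>vfields := fd'\<rparr>) n Q" unfolding D[symmetric]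
      by (intro cont) (auto simp: relinks_def)
  qed (use at ok stored fits D in auto)
  ultimately show ?thesis by (simp add: bias_stack_prog_def)
qed (use D in auto)

end

section \<open>Catenation and removal of the first record\<close>

context io_programs
begin

definition advance_prog :: "header \<Rightarrow> (header \<Rightarrow> prog) \<Rightarrow> prog" where
  "advance_prog = (\<lambda>(cf, cl, bf, bl, df, dt) k. append_prog cf cl bf
    (if bf = bl then k (first_or cf bf, bf, 0, bl, df, dt)
     else get_field bf succ_field (\<lambda>n. k (first_or cf bf, bf, n, bl, df, dt))))"

fun bias_prog :: "header \<Rightarrow> (header \<Rightarrow> prog) \<Rightarrow> prog" where
  "bias_prog (cf, cl, bf, bl, df, dt) k =
    (if df = 0 then k (cf, cl, bf, bl, df, dt)
     else if bf = 0 then bias_stack_prog cf cl df dt k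
     else compare_keys bf df (advance_prog (cf, cl, bf, bl, df, dt) k) (bias_stack_prog cf cl df dt k))"

primrec settle_prog :: "nat \<Rightarrow> nat \<Rightarrow> header \<Rightarrow> prog \<Rightarrow> prog" where
  "settle_prog 0 a h p = write_header a h p"
| "settle_prog (Suc n) a h p = bias_prog h (\<lambda>h. settle_prog n a h p)"

fun attach_stack_prog :: "header \<Rightarrow> nat \<Rightarrow> (header \<Rightarrow> prog) \<Rightarrow> prog" where
  "attach_stack_prog (cf, cl, bf, bl, df, dt) a k =
    (if df = 0 then k (cf, cl, bf, bl, a, a)
     else compare_keys df a (set_field a below_field dt (k (cf, cl, bf, bl, df, a))) (k (cf, cl, bf, bl, a, a)))"

fun attach_prog :: "header \<Rightarrow> nat \<Rightarrow> (header \<Rightarrow> prog) \<Rightarrow> prog" where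
  "attach_prog (cf, cl, bf, bl, df, dt) a k = set_field a end_field a
    (if cf = 0 then attach_stack_prog (cf, cl, bf, bl, df, dt) a k
     else compare_keys cl a (attach_stack_prog (cf, cl, bf, bl, df, dt) a k) (k (0, 0, cf, cl, a, a)))"

definition link_prog :: "nat \<Rightarrow> nat \<Rightarrow> prog \<Rightarrow> prog" where
  "link_prog a a' p = read_header a (\<lambda>h. attach_prog h a' (\<lambda>h. settle_prog 2 a h p))"

text \<open>Address \<open>0\<close> stands for the empty tree.\<close>

definition join_prog :: "nat \<Rightarrow> nat \<Rightarrow> (nat \<Rightarrow> prog) \<Rightarrow> prog" where
  "join_prog a a' k =
    (if a = 0 then k a' else if a' = 0 then k a else compare_keys a a' (link_prog a a' (k a)) (k a'))"

definition pop_prog :: "nat \<Rightarrow> (nat \<Rightarrow> prog) \<Rightarrow> prog" where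
  "pop_prog a k = read_header a (\<lambda>(cf, cl, bf, bl, df, dt). free_record a
    (if cf = 0 then k 0
     else if cf = cl then settle_prog 1 cf (0, 0, bf, bl, df, dt) (k cf)
     else get_field cf succ_field (\<lambda>n. settle_prog 1 cf (n, cl, bf, bl, df, dt) (k cf))))"

end

subsection \<open>Frame properties of trees\<close>

lemma rtree_at_frame:
  assumes "rtree_at fd r" "\<forall>x\<in>fst ` set (clean r @ buffer r @ stack_records (stack r)). fd' x = fd x"
    "\<forall>j\<ge>5. fd' (addr r) j = fd (addr r) j"
  shows "rtree_at fd' r"
  using assms
proof (induction r)
  case (Node a e C B D)
  let ?r = "Node a e C B D"
  have same: "fd' x = fd x" if "x \<in> fst ` set (C @ B @ stack_records D)" for x
    using Node.prems(2) that unfolding rtree.sel by blast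
  have "lists_at fd' h (C, B, D) = lists_at fd h (C, B, D)" for h by (rule lists_at_frame[OF same])
  moreover have "header_of (fd' a) = header_of (fd a)" using Node.prems(3) by (simp add: header_of_def)
  moreover have "rtree_at fd' r" if r: "r \<in> set (concat D)" for r
  proof -
    from r obtain g where g: "g \<in> set D" "r \<in> set g" by auto
    have inside: "fst ` set (records r) \<subseteq> fst ` set (C @ B @ stack_records D)"
      using records_subset_stack_records[OF r] by auto
    then have "fd' x = fd x" if "x \<in> fst ` set (records r)" for x using same that by blast
    then have "fd' (addr r) = fd (addr r)"
      "\<forall>x\<in>fst ` set (clean r @ buffer r @ stack_records (stack r)). fd' x = fd x"
      by (simp_all add: records_eq[of r])
    moreover have "\<forall>r'\<in>set (concat D). rtree_at fd r'"
      using rtree_at_iff[THEN iffD1, OF Node.prems(1)] by simp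
    then have "rtree_at fd r" using r by blast
    ultimately show ?thesis using Node.IH[OF g] by auto
  qed
  ultimately show ?case
    using Node.prems(1) unfolding rtree_at_iff[of _ ?r] by simp
qed

lemma rtree_at_cong:
  "rtree_at fd r \<Longrightarrow> (\<And>x. x \<in> fst ` set (records r) \<Longrightarrow> fd' x = fd x) \<Longrightarrow> rtree_at fd' r"
  by (rule rtree_at_frame[of fd]) (auto simp: records_eq[of r])

lemma descendants_disjoint:
  assumes dist: "distinct (map fst (C @ B @ stack_records D))" and r: "r \<in> set (concat D)"
  shows "fst ` set (clean r @ buffer r @ stack_records (stack r)) \<inter>
    (fst ` set C \<union> fst ` set B \<union> addr ` set (concat D)) = {}"
proof -
  define K where "K = map fst (clean r @ buffer r @ stack_records (stack r))"
  have "r \<in> set (concat (rev D))" using r by auto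
  then obtain xs ys where split: "concat (rev D) = xs @ r # ys" by (metis split_list)
  define X where "X = map fst (concat (map records xs))"
  define Y where "Y = map fst (concat (map records ys))"
  have "map fst (stack_records D) = X @ addr r # K @ Y"
    by (simp add: stack_records_def split records_eq[of r] X_def Y_def K_def)
  then have "distinct (map fst C @ map fst B @ X @ addr r # K @ Y)" using dist by simp
  then have disjoint: "set K \<inter> (set (map fst C) \<union> set (map fst B) \<union> (set X \<union> {addr r} \<union> set Y)) = {}" by auto
  have "set (concat D) = set xs \<union> {r} \<union> set ys"
    by (metis split set_append list.simps(15) set_rev rev_concat set_concat insert_is_Un sup_assoc)
  moreover have "addr ` set xs \<subseteq> set X" "addr ` set ys \<subseteq> set Y"
    using addr_in_records unfolding X_def Y_def set_map by blast+
  ultimately have "addr ` set (concat D) \<subseteq> set X \<union> {addr r} \<union> set Y" unfolding image_Un by blast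
  then show ?thesis using disjoint unfolding K_def set_map by blast
qed

context io_machine
begin

definition lists_valid :: "'a view \<Rightarrow> header \<Rightarrow> 'a entry list \<Rightarrow> 'a entry list \<Rightarrow> 'a rtree list list \<Rightarrow> bool" where
  "lists_valid st h C B' D \<longleftrightarrow> lists_ok C B' D \<and> lists_at (vfields st) h (C, B', D) \<and>
     (\<forall>r\<in>set (concat D). rtree_at (vfields st) r) \<and> stored st (C @ B' @ stack_records D) \<and> header_fits h"

definition tree_valid :: "'a view \<Rightarrow> 'a rtree \<Rightarrow> bool" where
  "tree_valid st r \<longleftrightarrow> rtree_ok r \<and> rtree_at (vfields st) r \<and> stored st (records r)"

lemma lists_validD:
  assumes "lists_valid st h C B' D"
  shows "lists_ok C B' D" "lists_ordered C B' D" "lists_at (vfields st) h (C, B', D)"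
    "\<forall>r\<in>set (concat D). rtree_at (vfields st) r" "stored st (C @ B' @ stack_records D)" "header_fits h"
  using assms by (simp_all add: lists_valid_def lists_ok_def)

lemma lists_valid_distinct: "lists_valid st h C B' D \<Longrightarrow> distinct (map fst (C @ B' @ stack_records D))"
  by (simp add: lists_valid_def stored_def)

lemma tree_valid_lists_valid:
  "tree_valid st r \<Longrightarrow> header_fits (header_of (vfields st (addr r))) \<Longrightarrow>
    lists_valid st (header_of (vfields st (addr r))) (clean r) (buffer r) (stack r)"
  by (auto simp: tree_valid_def lists_valid_def rtree_ok_iff[of r] rtree_at_iff[of _ r] records_eq[of r] stored_Cons)

lemma tree_valid_root:
  assumes "tree_valid st r"
  shows "addr r \<in> vaddrs st" "0 < addr r" "addr r \<le> W" "velems st (addr r) = elts r" "elts r \<noteq> []"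
  using storedD[of st "records r" "root r"] root_in_records[of r] assms
  by (auto simp: tree_valid_def rtree_ok_iff min_first_def)

lemma tree_valid_Node:
  assumes valid: "lists_valid st h C B' D" and debt: "debt D \<le> length C" and root: "min_first (a, e)"
    and stored: "stored st ((a, e) # C @ B' @ stack_records D)"
    and less: "\<forall>x\<in>set (contents (C @ B' @ stack_records D)). hd e < x"
    and fd': "header_of (fd' a) = h" "\<forall>x. x \<noteq> a \<longrightarrow> fd' x = vfields st x"
  shows "tree_valid (st\<lparr>vfields := fd'\<rparr>) (Node a e C B' D)"
proof -
  have a: "a \<notin> fst ` set (C @ B' @ stack_records D)" using stored by (simp add: stored_Cons)
  have same: "fd' x = vfields st x" if "x \<in> fst ` set (C @ B' @ stack_records D)" for x
    using a that fd'(2) by metis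
  have "hd e < rkey c" if "c \<in> set C \<union> set B'" for c
    using less rkey_in_contents[of c "C @ B' @ stack_records D"]
      lists_ordered_min_first[OF lists_validD(2)[OF valid] that] that by auto
  moreover have "hd e < key r" if "r \<in> set (concat D)" for r
  proof -
    have "rtree_ok r" using lists_validD(1)[OF valid] that by (auto simp: lists_ok_def)
    then have "key r \<in> set (contents (stack_records D))" using key_in_stack_contents[OF that] by blast
    then show ?thesis using less by simp
  qed
  ultimately have "rtree_ok (Node a e C B' D)"
    using lists_validD(1)[OF valid] debt root by (subst rtree_ok_iff) auto
  moreover have "rtree_at fd' r" if "r \<in> set (concat D)" for r
  proof (rule rtree_at_cong[of "vfields st"])
    show "rtree_at (vfields st) r" using lists_validD(4)[OF valid] that by blast
    fix x assume "x \<in> fst ` set (records r)"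
    then show "fd' x = vfields st x" using records_subset_stack_records[OF that] by (intro same) auto
  qed
  moreover have "lists_at fd' h (C, B', D) = lists_at (vfields st) h (C, B', D)"
    by (rule lists_at_frame) (rule same)
  then have "lists_at fd' h (C, B', D)" using lists_validD(3)[OF valid] by simp
  ultimately show ?thesis
    using stored fd'(1) unfolding tree_valid_def
    by (simp add: rtree_at_iff[of _ "Node a e C B' D"] records_eq[of "Node a e C B' D"])
qed

subsection \<open>The bias operation on disk\<close>

lemma lists_at_advance:
  assumes valid: "lists_valid st (cf, cl, bf, bl, df, dt) C (c # B') D" and D: "D \<noteq> []"
  defines "fd' \<equiv> append_link (vfields st) (map fst C) bf"
  shows "lists_at fd' (first_or cf bf, bf, if B' = [] then 0 else hd (map fst B'), bl, df, dt) (C @ [c], B', D)"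
    "bf = bl \<longleftrightarrow> B' = []" "B' \<noteq> [] \<Longrightarrow> fd' bf succ_field = hd (map fst B')"
proof -
  note valid' = lists_validD[OF valid]
  define cs where "cs = map fst C"
  have ends: "list_ends cs cf cl" "bf = fst c" "bl = last (map fst (c # B'))"
    and links: "linked (vfields st) cs" "linked (vfields st) (fst c # map fst B')"
      "linked_stack (vfields st) (map (map addr) D)" "df = hd (last (map (map addr) D))"
      "dt = hd (hd (map (map addr) D))"
    using valid'(3) D by (auto simp: lists_at_def list_ends_def cs_def)
  have dist: "distinct (cs @ fst c # map fst B' @ map fst (stack_records D))"
    using lists_valid_distinct[OF valid] by (simp add: cs_def)
  have same: "fd' x = vfields st x" if "x \<notin> set cs" for x
    using that unfolding fd'_def cs_def by (rule append_link_other)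
  have "linked fd' (cs @ [bf])"
    unfolding fd'_def cs_def[symmetric] using links(1) dist by (intro linked_append_link) auto
  moreover have "linked fd' (map fst B') = linked (vfields st) (map fst B')"
    by (rule linked_frame[OF same]) (use dist in auto)
  moreover have "linked_stack fd' (map (map addr) D) = linked_stack (vfields st) (map (map addr) D)"
  proof (rule linked_stack_frame[OF same])
    fix x assume "x \<in> set (concat (map (map addr) D))"
    then have "x \<in> set (map fst (stack_records D))" using addrs_subset_stack_records[of D] by auto
    then show "x \<notin> set cs" using dist by auto
  qed
  moreover have successor: "linked (vfields st) (map fst B')"
      "B' \<noteq> [] \<Longrightarrow> vfields st bf succ_field = hd (map fst B')"
    using links(2) ends(2) linked_append[of "vfields st" "[fst c]" "map fst B'"] by auto
  moreover have "0 \<notin> set cs" using stored_addr[OF valid'(5)] by (auto simp: cs_def)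
  ultimately show "lists_at fd' (first_or cf bf, bf, if B' = [] then 0 else hd (map fst B'), bl, df, dt) (C @ [c], B', D)"
    using list_ends_snoc[OF _ ends(1), of bf] ends(2,3) links(3-5) D
    by (simp add: lists_at_def list_ends_def cs_def)
  show "bf = bl \<longleftrightarrow> B' = []" using eq_last_iff_Nil[of "fst c" "map fst B'"] ends(2,3) dist by simp
  show "B' \<noteq> [] \<Longrightarrow> fd' bf succ_field = hd (map fst B')" using successor(2) same[of bf] dist ends(2) by simp
qed

lemma runs_advance_prog:
  assumes valid: "lists_valid st (cf, cl, bf, bl, df, dt) C (c # B') D" and D: "D \<noteq> []"
    and cont: "\<And>h. header_fits h \<Longrightarrow> lists_at (append_link (vfields st) (map fst C) bf) h (C @ [c], B', D) \<Longrightarrow>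
        runs (k h) (st\<lparr>vfields := append_link (vfields st) (map fst C) bf\<rparr>) n Q"
  shows "runs (advance_prog (cf, cl, bf, bl, df, dt) k) st (n + 2) Q"
proof -
  note valid' = lists_validD[OF valid] and advanced = lists_at_advance[OF valid D]
  have ends: "list_ends (map fst C) cf cl" "bf = fst c" using valid'(3)
    by (auto simp: lists_at_def list_ends_def)
  have clean: "0 \<notin> set (map fst C)" "set (map fst C) \<subseteq> vaddrs st" using stored_addr[OF valid'(5)] by auto
  have bf: "bf \<in> vaddrs st" "bf \<le> W" using storedD[OF valid'(5), of c] ends(2) by auto
  let ?next = "if B' = [] then 0 else hd (map fst B')"
  let ?st = "st\<lparr>vfields := append_link (vfields st) (map fst C) bf\<rparr>"
  have "?next \<le> W" using storedD(3)[OF valid'(5), of "hd B'"] by (simp add: hd_map)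
  then have "runs (k (first_or cf bf, bf, ?next, bl, df, dt)) ?st n Q"
    by (intro cont advanced(1)) (use bf valid'(6) in \<open>auto simp: first_or_def\<close>)
  then have "\<forall>m\<ge>n. runs (k (first_or cf bf, bf, ?next, bl, df, dt)) ?st m Q" by (auto intro: runs_mono)
  then have "runs (if bf = bl then k (first_or cf bf, bf, 0, bl, df, dt)
      else get_field bf succ_field (\<lambda>n. k (first_or cf bf, bf, n, bl, df, dt))) ?st (n + 2 - 1) Q"
    using advanced(2,3) bf by (auto intro!: runs_get_field)
  then show ?thesis unfolding advance_prog_def prod.case
    by (intro runs_append_prog[OF ends(1) clean bf(2)]) simp_all
qed

lemma runs_bias_stack_dropping_buffer:
  assumes valid: "lists_valid st (cf, cl, bf, bl, df, dt) C B' D"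
    and D: "D \<noteq> []" and buffer: "B' = [] \<or> \<not> rkey (hd B') < key (hd (last D))"
    and cont: "\<And>fd' h'. relinks (fst ` set C \<union> fst ` set B' \<union> addr ` set (concat D)) (vfields st) fd' \<Longrightarrow>
        header_fits h' \<Longrightarrow> lists_at fd' h' (bias C B' D) \<Longrightarrow> runs (k h') (st\<lparr>vfields := fd'\<rparr>) n Q"
  shows "runs (bias_stack_prog cf cl df dt k) st (n + 18) Q"
proof -
  note valid' = lists_validD[OF valid] and dropped = drop_buffer[OF lists_validD(1)[OF valid] D buffer]
  show ?thesis
  proof (rule runs_bias_stack_prog[OF valid'(3,4) dropped(1) D stored_attrites[OF valid'(5) dropped(2)] valid'(6)])
    fix fd' h' assume "relinks (fst ` set C \<union> addr ` set (concat D)) (vfields st) fd'" "header_fits h'"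
      "lists_at fd' h' (bias_stack C D)"
    moreover have "bias C B' D = bias_stack C D" using D buffer by (auto simp: bias_def)
    ultimately show "runs (k h') (st\<lparr>vfields := fd'\<rparr>) n Q" by (intro cont) (auto elim!: relinks_mono)
  qed
qed

lemma runs_bias_prog_relinks:
  assumes valid: "lists_valid st h C B' D"
    and cont: "\<And>fd' h'. relinks (fst ` set C \<union> fst ` set B' \<union> addr ` set (concat D)) (vfields st) fd' \<Longrightarrow>
        header_fits h' \<Longrightarrow> lists_at fd' h' (bias C B' D) \<Longrightarrow> runs (k h') (st\<lparr>vfields := fd'\<rparr>) n Q"
  shows "runs (bias_prog h k) st (n + 20) Q"
proof -
  obtain cf cl bf bl df dt where h: "h = (cf, cl, bf, bl, df, dt)" by (metis prod_cases6)
  note valid' = lists_validD[OF valid[unfolded h]]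
  note buffer = buffer_first_stored[OF valid'(3,5,2)]
    and stack = stack_first_stored[OF valid'(3,5,2)] stack_first_eq_0_iff[OF valid'(3,5,2)]
  let ?X = "fst ` set C \<union> fst ` set B' \<union> addr ` set (concat D)"
  consider "D = []" | "D \<noteq> []" "B' \<noteq> []" "rkey (hd B') < key (hd (last D))"
    | "D \<noteq> []" "B' = [] \<or> \<not> rkey (hd B') < key (hd (last D))" by blast
  then show ?thesis
  proof cases
    case 1
    then have "lists_at (vfields st) h (bias C B' D)" using valid'(3) h by (simp add: bias_def)
    then have "runs (k h) st n Q" using cont[of "vfields st" h] valid'(6) h by simp
    then have "runs (k h) st (n + 20) Q" by (rule runs_mono) simp
    then show ?thesis using stack(5) 1 by (simp add: h)
  next
    case 2
    then obtain c B'' where B': "B' = c # B''" by (cases B') auto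
    have "runs (advance_prog (cf, cl, bf, bl, df, dt) k) st (n + 2) Q"
    proof (rule runs_advance_prog)
      show "lists_valid st (cf, cl, bf, bl, df, dt) C (c # B'') D" using valid h B' by simp
      let ?fd = "append_link (vfields st) (map fst C) bf"
      fix h' assume "header_fits h'" "lists_at ?fd h' (C @ [c], B'', D)"
      then show "runs (k h') (st\<lparr>vfields := ?fd\<rparr>) n Q"
        using 2 B' by (intro cont relinks_append_link) (auto simp: bias_def)
    qed (use 2 in simp)
    then have "\<forall>m\<ge>n + 2. runs (advance_prog (cf, cl, bf, bl, df, dt) k) st m Q" by (auto intro: runs_mono)
    then show ?thesis using 2 buffer stack by (auto simp: h intro!: runs_compare_keys)
  next
    case 3
    have "runs (bias_stack_prog cf cl df dt k) st (n + 18) Q"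
      by (rule runs_bias_stack_dropping_buffer[OF valid[unfolded h] 3 cont])
    then have "\<forall>m\<ge>n + 18. runs (bias_stack_prog cf cl df dt k) st m Q" by (auto intro: runs_mono)
    moreover have "bf = 0 \<longleftrightarrow> B' = []"
      using buffer(3) valid'(3) by (cases "B' = []") (auto simp: lists_at_def list_ends_def)
    ultimately show ?thesis using 3 buffer stack
      by (cases "B' = []") (auto simp: h intro!: runs_compare_keys)
  qed
qed

lemma lists_valid_bias:
  assumes valid: "lists_valid st h C B' D" and bias: "bias C B' D = (C', B'', D')"
    and relinks: "relinks (fst ` set C \<union> fst ` set B' \<union> addr ` set (concat D)) (vfields st) fd'"
    and at: "header_fits h'" "lists_at fd' h' (C', B'', D')"
    and ok: "lists_ok C' B'' D'"
    and attrites: "attrites (C @ B' @ stack_records D) (C' @ B'' @ stack_records D')"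
  shows "lists_valid (st\<lparr>vfields := fd'\<rparr>) h' C' B'' D'"
proof -
  note valid' = lists_validD[OF valid]
  note disjoint = descendants_disjoint[OF lists_valid_distinct[OF valid]]
  have "rtree_at fd' r'" if r': "r' \<in> set (concat D')" for r'
  proof -
    have "\<forall>g\<in>set D. g \<noteq> []" using valid'(2) by (simp add: lists_ordered_def)
    from bias_trees[OF bias r' this] show ?thesis
    proof
      assume r': "r' \<in> set (concat D)"
      show ?thesis
        by (rule rtree_at_frame[of "vfields st"])
          (use valid'(4) r' disjoint[OF r'] relinks
            in \<open>auto simp: relinks_def disjoint_iff simp del: set_concat\<close>)
    next
      assume "\<exists>r\<in>set (concat D). r' \<in> set (concat (stack r))"
      then obtain r where r: "r \<in> set (concat D)" "r' \<in> set (concat (stack r))" by blast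
      show ?thesis
      proof (rule rtree_at_cong)
        show "rtree_at (vfields st) r'" using valid'(4) r rtree_at_iff[of "vfields st" r] by blast
        have "fst ` set (records r') \<subseteq> fst ` set (clean r @ buffer r @ stack_records (stack r))"
          using records_subset_stack_records[OF r(2)] by auto
        then show "fd' x = vfields st x" if "x \<in> fst ` set (records r')" for x
          using that disjoint[OF r(1)] relinks unfolding relinks_def by blast
      qed
    qed
  qed
  then show ?thesis using at ok stored_attrites[OF valid'(5) attrites] by (simp add: lists_valid_def)
qed

lemma runs_bias_prog:
  assumes valid: "lists_valid st h C B' D" and debt: "debt D \<le> length C + m"
    and cont: "\<And>fd' h' C' B'' D'. (\<forall>x. x \<notin> fst ` set (C @ B' @ stack_records D) \<longrightarrow> fd' x = vfields st x) \<Longrightarrow>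
        lists_valid (st\<lparr>vfields := fd'\<rparr>) h' C' B'' D' \<Longrightarrow>
        attrites (C @ B' @ stack_records D) (C' @ B'' @ stack_records D') \<Longrightarrow>
        debt D' \<le> length C' + (m - 1) \<Longrightarrow> runs (k h') (st\<lparr>vfields := fd'\<rparr>) n Q"
  shows "runs (bias_prog h k) st (n + 20) Q"
proof (rule runs_bias_prog_relinks[OF valid])
  fix fd' h'
  let ?X = "fst ` set C \<union> fst ` set B' \<union> addr ` set (concat D)"
  assume relinks: "relinks ?X (vfields st) fd'" and at: "header_fits h'" "lists_at fd' h' (bias C B' D)"
  obtain C' B'' D' where bias: "bias C B' D = (C', B'', D')" by (metis prod_cases3)
  have reduced: "lists_ok C' B'' D'" "attrites (C @ B' @ stack_records D) (C' @ B'' @ stack_records D')"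
    "debt D' \<le> length C' + (m - 1)"
    using bias_reduces_to[OF lists_validD(1)[OF valid] debt] bias by (auto simp: reduces_to_def)
  have "addr ` set (concat D) \<subseteq> fst ` set (stack_records D)" using root_in_stack_records by force
  then have "\<forall>x. x \<notin> fst ` set (C @ B' @ stack_records D) \<longrightarrow> fd' x = vfields st x"
    using relinks unfolding relinks_def set_append image_Un by blast
  with reduced show "runs (k h') (st\<lparr>vfields := fd'\<rparr>) n Q"
    using lists_valid_bias[OF valid bias relinks at(1) at(2)[unfolded bias]] cont by blast
qed

lemma attrites_frame_trans:
  assumes "attrites P P'" "\<forall>x. x \<notin> fst ` set P \<longrightarrow> fd' x = fd x" "\<forall>x. x \<notin> fst ` set P' \<longrightarrow> fd'' x = fd' x"
  shows "\<forall>x. x \<notin> fst ` set P \<longrightarrow> fd'' x = fd x"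
proof -
  have "fst ` set P' \<subseteq> fst ` set P" using assms(1) unfolding attrites_def by blast
  then show ?thesis using assms(2,3) by (metis subsetD)
qed

lemma runs_settle_prog:
  assumes root: "min_first (a, e)" and stored: "stored st P"
    and cont: "\<And>fd' r. tree_valid (st\<lparr>vfields := fd'\<rparr>) r \<Longrightarrow> addr r = a \<Longrightarrow> attrites P (records r) \<Longrightarrow>
        (\<forall>x. x \<notin> fst ` set P \<longrightarrow> fd' x = vfields st x) \<Longrightarrow> runs p (st\<lparr>vfields := fd'\<rparr>) m Q"
    and "lists_valid (st\<lparr>vfields := fd\<rparr>) h C B' D" "debt D \<le> length C + n"
    and "attrites P ((a, e) # C @ B' @ stack_records D)" "\<forall>x. x \<notin> fst ` set P \<longrightarrow> fd x = vfields st x"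
    and "\<forall>x\<in>set (contents (C @ B' @ stack_records D)). hd e < x"
  shows "runs (settle_prog n a h p) (st\<lparr>vfields := fd\<rparr>) (m + 6 + 20 * n) Q"
  using assms(4-)
proof (induction n arbitrary: fd h C B' D)
  case 0
  let ?r = "Node a e C B' D" and ?st = "st\<lparr>vfields := fd\<rparr>"
  have stored': "stored ?st ((a, e) # C @ B' @ stack_records D)" using stored_attrites[OF stored 0(3)] by simp
  have "runs (write_header a h p) ?st (m + 6) Q"
  proof (rule runs_write_header)
    fix fd' assume fd': "header_of (fd' a) = h" "\<forall>x. x \<noteq> a \<longrightarrow> fd' x = vfields ?st x"
    have valid: "tree_valid (?st\<lparr>vfields := fd'\<rparr>) ?r"
      by (rule tree_valid_Node[OF 0(1) _ root stored' 0(5) fd']) (use 0(2) in simp)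
    have attrites: "attrites P (records ?r)" using 0(3) by (simp add: records_eq[of ?r])
    have "\<forall>x. x \<notin> fst ` set P \<longrightarrow> fd' x = vfields st x"
      by (rule attrites_frame_trans[OF 0(3,4)]) (use fd'(2) in simp)
    then have "runs p (st\<lparr>vfields := fd'\<rparr>) m Q"
      using valid by (intro cont[OF _ _ attrites]) simp_all
    then show "runs p (?st\<lparr>vfields := fd'\<rparr>) (m + 6 - 6) Q" by simp
  qed (use 0(1) stored' lists_validD(6) in \<open>auto simp: stored_Cons\<close>)
  then show ?case by simp
next
  case (Suc n)
  let ?st = "st\<lparr>vfields := fd\<rparr>"
  have "runs (bias_prog h (\<lambda>h. settle_prog n a h p)) ?st ((m + 6 + 20 * n) + 20) Q"
  proof (rule runs_bias_prog[OF Suc.prems(1,2)])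
    fix fd1 h1 C1 B1 D1
    assume frame: "\<forall>x. x \<notin> fst ` set (C @ B' @ stack_records D) \<longrightarrow> fd1 x = vfields ?st x"
      and valid: "lists_valid (?st\<lparr>vfields := fd1\<rparr>) h1 C1 B1 D1"
      and attrites: "attrites (C @ B' @ stack_records D) (C1 @ B1 @ stack_records D1)"
      and debt: "debt D1 \<le> length C1 + (Suc n - 1)"
    have "attrites P ((a, e) # C1 @ B1 @ stack_records D1)"
      using attrites_trans[OF Suc.prems(3)] attrites_context[OF attrites, of "[(a, e)]"] by simp
    moreover have "\<forall>x. x \<notin> fst ` set P \<longrightarrow> fd1 x = vfields st x"
      by (rule attrites_frame_trans[OF Suc.prems(3,4)]) (use frame in simp)
    moreover have "\<forall>x\<in>set (contents (C1 @ B1 @ stack_records D1)). hd e < x"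
      using Suc.prems(5) attrites_contents[OF attrites] by blast
    ultimately have "runs (settle_prog n a h1 p) (st\<lparr>vfields := fd1\<rparr>) (m + 6 + 20 * n) Q"
      using valid debt by (intro Suc.IH) simp_all
    then show "runs (settle_prog n a h1 p) (?st\<lparr>vfields := fd1\<rparr>) (m + 6 + 20 * n) Q" by simp
  qed
  then show ?case by (simp add: algebra_simps)
qed

subsection \<open>Joining two trees\<close>

context
  fixes st :: "'a view" and cf cl bf bl df dt :: nat and C B' :: "'a entry list" and D :: "'a rtree list list"
    and r :: "'a rtree"
  assumes valid: "lists_valid st (cf, cl, bf, bl, df, dt) C B' D" and debt: "debt D \<le> length C"
    and tree: "tree_valid st r"
    and disjoint: "fst ` set (C @ B' @ stack_records D) \<inter> fst ` set (records r) = {}"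
begin

lemma attached_tree_ok: "rtree_ok r" "rtree_at (vfields st) r"
  using tree by (auto simp: tree_valid_def)

lemma lists_still_at:
  assumes "relinks {addr r} (vfields st) fd'"
  shows "lists_at fd' (cf, cl, bf, bl, df, dt) (C, B', D)"
proof -
  have "addr r \<in> fst ` set (records r)" using root_in_records[of r] by force
  then have "addr r \<notin> fst ` set (C @ B' @ stack_records D)" using disjoint by blast
  then have "fd' x = vfields st x" if "x \<in> fst ` set (C @ B' @ stack_records D)" for x
    using that assms unfolding relinks_def by (metis singletonD)
  then have "lists_at fd' (cf, cl, bf, bl, df, dt) (C, B', D) =
      lists_at (vfields st) (cf, cl, bf, bl, df, dt) (C, B', D)" by (rule lists_at_frame)
  then show ?thesis using lists_validD(3)[OF valid] by simp
qed

lemma lists_valid_attach: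
  assumes att: "attach C B' D r = (C', B'', D')" and relinks: "relinks {addr r} (vfields st) fd'"
    and at: "header_fits h'" "lists_at fd' h' (C', B'', D')"
  shows "lists_valid (st\<lparr>vfields := fd'\<rparr>) h' C' B'' D'"
    "attrites (C @ B' @ stack_records D @ records r) (C' @ B'' @ stack_records D')" "debt D' \<le> length C' + 2"
proof -
  show attrites: "attrites (C @ B' @ stack_records D @ records r) (C' @ B'' @ stack_records D')"
    and "debt D' \<le> length C' + 2"
    using attach_reduces_to[OF lists_validD(1)[OF valid] debt attached_tree_ok(1)] att
    by (auto simp: reduces_to_def)
  have "rtree_at fd' r'" if "r' \<in> set (concat D')" for r'
  proof (cases "r' = r")
    case True
    have "addr r \<notin> fst ` set (clean r @ buffer r @ stack_records (stack r))"
      using tree unfolding tree_valid_def records_eq[of r] stored_Cons by blast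
    then have "\<forall>x\<in>fst ` set (clean r @ buffer r @ stack_records (stack r)). fd' x = vfields st x"
      using relinks unfolding relinks_def by (metis singletonD)
    then show ?thesis unfolding True
      by (rule rtree_at_frame[OF attached_tree_ok(2)]) (use relinks in \<open>simp add: relinks_def\<close>)
  next
    case False
    then have r': "r' \<in> set (concat D)" using that att by (auto simp: attach_def split: if_splits)
    show ?thesis
    proof (rule rtree_at_cong)
      show "rtree_at (vfields st) r'" using lists_validD(4)[OF valid] r' by blast
      fix x assume "x \<in> fst ` set (records r')"
      then have "x \<in> fst ` set (C @ B' @ stack_records D)" using records_subset_stack_records[OF r'] by auto
      moreover have "addr r \<in> fst ` set (records r)" using root_in_records[of r] by force
      ultimately have "x \<noteq> addr r" using disjoint by blast
      then show "fd' x = vfields st x" using relinks by (simp add: relinks_def)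
    qed
  qed
  moreover have "stored st (C @ B' @ stack_records D @ records r)"
    using lists_validD(5)[OF valid] tree disjoint stored_append[of st "C @ B' @ stack_records D" "records r"]
    by (simp add: tree_valid_def)
  from stored_attrites[OF this attrites] have "stored st (C' @ B'' @ stack_records D')" .
  moreover have "lists_ok C' B'' D'"
    using attach_reduces_to[OF lists_validD(1)[OF valid] debt attached_tree_ok(1)] att
    by (auto simp: reduces_to_def)
  ultimately show "lists_valid (st\<lparr>vfields := fd'\<rparr>) h' C' B'' D'" using at by (simp add: lists_valid_def)
qed

lemma runs_attach_prog:
  assumes cont: "\<And>fd' h' C' B'' D'. lists_valid (st\<lparr>vfields := fd'\<rparr>) h' C' B'' D' \<Longrightarrow>
      attrites (C @ B' @ stack_records D @ records r) (C' @ B'' @ stack_records D') \<Longrightarrow>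
      debt D' \<le> length C' + 2 \<Longrightarrow> (\<forall>x. x \<noteq> addr r \<longrightarrow> fd' x = vfields st x) \<Longrightarrow>
      runs (k h') (st\<lparr>vfields := fd'\<rparr>) n Q"
  shows "runs (attach_prog (cf, cl, bf, bl, df, dt) (addr r) k) st (n + 6) Q"
proof -
  note valid' = lists_validD[OF valid] and root = tree_valid_root[OF tree]
  note clean = clean_first_eq_0_iff[OF valid'(3,5,2)] clean_last_stored[OF valid'(3,5,2)]
    and stack = stack_first_eq_0_iff[OF valid'(3,5,2)] stack_first_stored[OF valid'(3,5,2)]
  let ?fd1 = "upd_field (vfields st) (addr r) end_field (addr r)"
  let ?fd2 = "upd_field ?fd1 (addr r) below_field dt"
  have cont': "\<forall>m\<ge>n. runs (k h') (st\<lparr>vfields := fd'\<rparr>) m Q"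
    if "attach C B' D r = (C', B'', D')" "relinks {addr r} (vfields st) fd'" "header_fits h'"
      "lists_at fd' h' (C', B'', D')" for C' B'' D' fd' h'
    using cont[OF lists_valid_attach[OF that]] that(2) by (auto simp: relinks_def intro: runs_mono)
  have relinks: "relinks {addr r} (vfields st) ?fd1" "relinks {addr r} (vfields st) ?fd2"
    by (auto simp: relinks_def)
  have at: "lists_at ?fd1 (cf, cl, bf, bl, df, dt) (C, B', D)"
      "lists_at ?fd2 (cf, cl, bf, bl, df, dt) (C, B', D)"
    using lists_still_at relinks by blast+
  consider "C \<noteq> []" "\<not> rkey (last C) < key r"
    | "C = [] \<or> rkey (last C) < key r" "D = [] \<or> \<not> key (hd (last D)) < key r"
    | "C = [] \<or> rkey (last C) < key r" "D \<noteq> []" "key (hd (last D)) < key r" by blast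
  then show ?thesis
  proof cases
    case 1
    then have "attach C B' D r = ([], C, [[r]])" by (simp add: attach_def)
    then have "\<forall>m\<ge>n. runs (k (0, 0, cf, cl, addr r, addr r)) (st\<lparr>vfields := ?fd1\<rparr>) m Q"
      by (rule cont'[OF _ relinks(1)]) (use at(1) valid'(6) root(3) in \<open>auto simp: lists_at_def list_ends_def\<close>)
    then show ?thesis using 1 clean root by (auto intro!: runs_set_field runs_compare_keys)
  next
    case 2
    then have "attach C B' D r = (C, B', [[r]])" by (auto simp: attach_def)
    then have "\<forall>m\<ge>n. runs (k (cf, cl, bf, bl, addr r, addr r)) (st\<lparr>vfields := ?fd1\<rparr>) m Q"
      by (rule cont'[OF _ relinks(1)]) (use at(1) valid'(6) root(3) in \<open>auto simp: lists_at_def\<close>)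
    then show ?thesis using 2 clean stack root
      by (cases "C = []"; cases "D = []") (auto intro!: runs_set_field runs_compare_keys)
  next
    case 3
    then have "attach C B' D r = (C, B', [r] # D)" by (auto simp: attach_def)
    then have "\<forall>m\<ge>n. runs (k (cf, cl, bf, bl, df, addr r)) (st\<lparr>vfields := ?fd2\<rparr>) m Q"
      by (rule cont'[OF _ relinks(2)]) (use at(2) 3(2) valid'(6) root(3) in \<open>auto simp: lists_at_def\<close>)
    then show ?thesis using 3 clean stack root valid'(6)
      by (cases "C = []") (auto intro!: runs_set_field runs_compare_keys)
  qed
qed

end

lemma runs_link_prog:
  assumes tree: "tree_valid st r" "tree_valid st r'"
    and disjoint: "fst ` set (records r) \<inter> fst ` set (records r') = {}" and less: "key r < key r'"
    and cont: "\<And>fd' r''. tree_valid (st\<lparr>vfields := fd'\<rparr>) r'' \<Longrightarrow> addr r'' = addr r \<Longrightarrow>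
        attrites (records r @ records r') (records r'') \<Longrightarrow>
        (\<forall>x. x \<notin> fst ` set (records r @ records r') \<longrightarrow> fd' x = vfields st x) \<Longrightarrow>
        runs p (st\<lparr>vfields := fd'\<rparr>) n Q"
  shows "runs (link_prog (addr r) (addr r') p) st (n + 58) Q"
  unfolding link_prog_def
proof (rule runs_read_header[OF tree_valid_root(1)[OF tree(1)]])
  let ?h = "header_of (vfields st (addr r))"
  let ?P = "clean r @ buffer r @ stack_records (stack r)"
  obtain cf cl bf bl df dt where h: "?h = (cf, cl, bf, bl, df, dt)" by (metis prod_cases6)
  have ok: "rtree_ok r" "rtree_ok r'" and stored: "stored st (records r @ records r')"
    using tree disjoint by (auto simp: tree_valid_def stored_append)
  note ok_iff = rtree_ok_iff[THEN iffD1, OF ok(1)]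
  have a': "addr r' \<in> fst ` set (records r')" using root_in_records[of r'] by force
  have less_contents: "key r < x" if "x \<in> set (contents (?P @ records r'))" for x
    using that rtree_ok_key_less[OF ok(1), of x] rtree_ok_key_le[OF ok(2), of x] less by auto
  assume "header_fits ?h"
  from tree_valid_lists_valid[OF tree(1) this] h
  have valid: "lists_valid st (cf, cl, bf, bl, df, dt) (clean r) (buffer r) (stack r)" by simp
  have "runs (attach_prog (cf, cl, bf, bl, df, dt) (addr r') (\<lambda>h. settle_prog 2 (addr r) h p)) st (n + 46 + 6) Q"
  proof (rule runs_attach_prog[OF valid _ tree(2)])
    show "debt (stack r) \<le> length (clean r)" using ok_iff by blast
    show "fst ` set ?P \<inter> fst ` set (records r') = {}" using disjoint by (auto simp: records_eq[of r])
    fix fd1 h1 C1 B1 D1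
    assume valid: "lists_valid (st\<lparr>vfields := fd1\<rparr>) h1 C1 B1 D1"
      and attrites: "attrites (clean r @ buffer r @ stack_records (stack r) @ records r') (C1 @ B1 @ stack_records D1)"
      and debt: "debt D1 \<le> length C1 + 2" and frame: "\<forall>x. x \<noteq> addr r' \<longrightarrow> fd1 x = vfields st x"
    have "attrites (records r @ records r') (root r # C1 @ B1 @ stack_records D1)"
      using attrites_context[OF attrites, of "[root r]"] by (simp add: records_eq[of r])
    moreover have "\<forall>x. x \<notin> fst ` set (records r @ records r') \<longrightarrow> fd1 x = vfields st x"
    proof (intro allI impI)
      fix x assume "x \<notin> fst ` set (records r @ records r')"
      then have "x \<noteq> addr r'" using a' by auto
      then show "fd1 x = vfields st x" using frame by simp
    qed
    moreover have "\<forall>x\<in>set (contents (C1 @ B1 @ stack_records D1)). key r < x"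
      using attrites_contents[OF attrites] less_contents by auto
    moreover have "min_first (root r)" using ok_iff by blast
    ultimately have "runs (settle_prog 2 (addr r) h1 p) (st\<lparr>vfields := fd1\<rparr>) (n + 6 + 20 * 2) Q"
      by (intro runs_settle_prog[OF _ stored cont valid debt])
    then show "runs (settle_prog 2 (addr r) h1 p) (st\<lparr>vfields := fd1\<rparr>) (n + 46) Q" by (rule runs_mono) simp
  qed
  then show "runs (attach_prog ?h (addr r') (\<lambda>h. settle_prog 2 (addr r) h p)) st (n + 58 - 6) Q"
    unfolding h by (rule runs_mono) simp
qed simp

lemma runs_join_trees:
  assumes tree: "tree_valid st r" "tree_valid st r'"
    and disjoint: "fst ` set (records r) \<inter> fst ` set (records r') = {}"
    and cont: "\<And>fd' r''. tree_valid (st\<lparr>vfields := fd'\<rparr>) r'' \<Longrightarrow> attrites (records r @ records r') (records r'') \<Longrightarrow>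
        (\<forall>x. x \<notin> fst ` set (records r @ records r') \<longrightarrow> fd' x = vfields st x) \<Longrightarrow>
        runs (k (addr r'')) (st\<lparr>vfields := fd'\<rparr>) n Q"
  shows "runs (join_prog (addr r) (addr r') k) st (n + 60) Q"
proof -
  note root = tree_valid_root[OF tree(1)] and root' = tree_valid_root[OF tree(2)]
  have ok: "rtree_ok r" "rtree_ok r'" using tree by (auto simp: tree_valid_def)
  have "runs (compare_keys (addr r) (addr r') (link_prog (addr r) (addr r') (k (addr r))) (k (addr r'))) st (n + 60) Q"
  proof (rule runs_compare_keys[OF root(1) root'(1)])
    assume "hd (velems st (addr r)) < hd (velems st (addr r'))"
    then have "key r < key r'" using root root' by simp
    from runs_link_prog[OF tree disjoint this] cont
    have "runs (link_prog (addr r) (addr r') (k (addr r))) st (n + 58) Q" by metis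
    then show "runs (link_prog (addr r) (addr r') (k (addr r))) st (n + 60 - 2) Q" by (rule runs_mono) simp
  next
    assume not_less: "\<not> hd (velems st (addr r)) < hd (velems st (addr r'))"
    have "attrites ([] @ records r @ records r') ([] @ records r')"
    proof (rule attrites_drop)
      show "key r' \<in> set (contents (records r'))"
        using rkey_in_contents[OF _ root_in_records[of r']] rtree_ok_iff[THEN iffD1, OF ok(2)] by simp
      show "key r' \<le> y" if "y \<in> set (contents (records r))" for y
        using rtree_ok_key_le[OF ok(1) that] not_less root root' by simp
    qed
    then have "runs (k (addr r')) (st\<lparr>vfields := vfields st\<rparr>) n Q" using cont[of "vfields st" r'] tree(2)
      by simp
    then show "runs (k (addr r')) st (n + 60 - 2) Q" by (auto intro: runs_mono)
  qed simp
  then show ?thesis using root(2) root'(2) by (simp add: join_prog_def)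
qed

subsection \<open>Removing the root of a tree\<close>

lemma runs_pop_clean:
  assumes tree: "tree_valid st r" and clean: "clean r = c # C"
    and at: "lists_at (vfields st) h (C, buffer r, stack r)" and fits: "header_fits h"
    and cont: "\<And>fd' r'. tree_valid (st\<lparr>vaddrs := vaddrs st - {addr r}, vfields := fd'\<rparr>) r' \<Longrightarrow> addr r' = fst c \<Longrightarrow>
        attrites (tl (records r)) (records r') \<Longrightarrow> (\<forall>x. x \<notin> fst ` set (records r) \<longrightarrow> fd' x = vfields st x) \<Longrightarrow>
        runs p (st\<lparr>vaddrs := vaddrs st - {addr r}, vfields := fd'\<rparr>) n Q"
  shows "runs (settle_prog 1 (fst c) h p) (st\<lparr>vaddrs := vaddrs st - {addr r}\<rparr>) (n + 26) Q"
proof -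
  let ?st = "st\<lparr>vaddrs := vaddrs st - {addr r}\<rparr>"
  let ?P = "C @ buffer r @ stack_records (stack r)"
  have records: "records r = root r # c # ?P" by (simp add: records_eq[of r] clean)
  have ok: "lists_ok (c # C) (buffer r) (stack r)" "debt (stack r) \<le> length (c # C)"
    using tree clean rtree_ok_iff[of r] by (auto simp: tree_valid_def)
  then have ordered: "lists_ordered (c # C) (buffer r) (stack r)" and okC: "lists_ok C (buffer r) (stack r)"
    by (auto simp: lists_ok_def lists_ordered_def)
  have stored: "stored ?st (c # ?P)"
    using tree unfolding tree_valid_def records stored_Cons by (intro stored_free_record) auto
  have valid: "lists_valid ?st h C (buffer r) (stack r)"
    using okC at fits stored tree
    by (cases c) (auto simp: lists_valid_def tree_valid_def rtree_at_iff[of _ r] stored_Cons)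
  have "runs (settle_prog 1 (fst c) h p) (?st\<lparr>vfields := vfields ?st\<rparr>) (n + 6 + 20 * 1) Q"
  proof (rule runs_settle_prog[OF _ stored])
    show "lists_valid (?st\<lparr>vfields := vfields ?st\<rparr>) h C (buffer r) (stack r)" using valid by simp
    show "min_first (fst c, snd c)" using ordered by (simp add: lists_ordered_def)
    show "\<forall>x\<in>set (contents ?P). rkey c < x"
    proof
      fix x assume x: "x \<in> set (contents ?P)"
      show "rkey c < x"
        by (rule lists_ok_contents_less[OF okC _ _ x]) (use ordered in \<open>auto simp: lists_ordered_def\<close>)
    qed
    fix fd' r'
    assume "tree_valid (?st\<lparr>vfields := fd'\<rparr>) r'" "addr r' = fst c" "attrites (c # ?P) (records r')"
      "\<forall>x. x \<notin> fst ` set (c # ?P) \<longrightarrow> fd' x = vfields ?st x"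
    then show "runs p (?st\<lparr>vfields := fd'\<rparr>) n Q" by (intro cont) (auto simp: records)
  qed (use ok(2) in auto)
  then have "runs (settle_prog 1 (fst c) h p) ?st (n + 6 + 20 * 1) Q" by simp
  then show ?thesis by (rule runs_mono) simp
qed

lemma runs_pop_nonempty:
  assumes tree: "tree_valid st r" and header: "header_of (vfields st (addr r)) = (cf, cl, bf, bl, df, dt)"
    and fits: "header_fits (cf, cl, bf, bl, df, dt)" and clean: "clean r = c # C"
    and cont: "\<And>fd' r'. tree_valid (st\<lparr>vaddrs := vaddrs st - {addr r}, vfields := fd'\<rparr>) r' \<Longrightarrow> addr r' = cf \<Longrightarrow>
        attrites (tl (records r)) (records r') \<Longrightarrow> (\<forall>x. x \<notin> fst ` set (records r) \<longrightarrow> fd' x = vfields st x) \<Longrightarrow>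
        runs p (st\<lparr>vaddrs := vaddrs st - {addr r}, vfields := fd'\<rparr>) n Q"
  shows "runs (if cf = cl then settle_prog 1 cf (0, 0, bf, bl, df, dt) p
      else get_field cf succ_field (\<lambda>n. settle_prog 1 cf (n, cl, bf, bl, df, dt) p))
    (st\<lparr>vaddrs := vaddrs st - {addr r}\<rparr>) (27 + n) Q"
proof -
  let ?st = "st\<lparr>vaddrs := vaddrs st - {addr r}\<rparr>"
  note valid = tree_valid_lists_valid[OF tree, unfolded header, OF fits]
  note at = lists_validD(3)[OF valid]
  have c: "cf = fst c" "cl = last (map fst (clean r))" "linked (vfields st) (fst c # map fst C)"
    using at clean by (auto simp: lists_at_def list_ends_def)
  then have linked: "linked (vfields st) (map fst C)" "C \<noteq> [] \<Longrightarrow> vfields st cf succ_field = hd (map fst C)"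
    using linked_append[of "vfields st" "[fst c]" "map fst C"] by auto
  have dist: "distinct (map fst (c # C))" and c_stored: "cf \<in> vaddrs ?st"
    using tree c(1) unfolding tree_valid_def records_eq[of r] clean by (auto simp: stored_def)
  have single: "cf = cl \<longleftrightarrow> C = []"
    using eq_last_iff_Nil[of "fst c" "map fst C"] c(1,2) clean dist by simp
  have settle: "runs (settle_prog 1 cf h' p) ?st (26 + n) Q"
    if "lists_at (vfields st) h' (C, buffer r, stack r)" "header_fits h'" for h'
    using runs_pop_clean[OF tree clean that] cont unfolding c(1)
    by (simp add: add.commute del: settle_prog.simps)
  show ?thesis
  proof (cases "C = []")
    case True
    then have "runs (settle_prog 1 cf (0, 0, bf, bl, df, dt) p) ?st (26 + n) Q"
      using at fits by (intro settle) (auto simp: lists_at_def list_ends_def)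
    then have "runs (settle_prog 1 cf (0, 0, bf, bl, df, dt) p) ?st (27 + n) Q" by (rule runs_mono) simp
    then show ?thesis using single True by (simp del: settle_prog.simps)
  next
    case False
    then have "runs (settle_prog 1 cf (hd (map fst C), cl, bf, bl, df, dt) p) ?st (26 + n) Q"
      using at fits linked clean c(2) storedD(3)[OF lists_validD(5)[OF valid], of "hd C"]
      by (intro settle) (auto simp: lists_at_def list_ends_def hd_map)
    then have "runs (get_field cf succ_field (\<lambda>n. settle_prog 1 cf (n, cl, bf, bl, df, dt) p)) ?st (27 + n) Q"
      using c_stored linked(2)[OF False] by (intro runs_get_field) (simp_all del: settle_prog.simps)
    then show ?thesis using single False by (simp del: settle_prog.simps)
  qed
qed

lemma runs_pop_tree:
  assumes tree: "tree_valid st r"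
    and cont_empty: "tl (records r) = [] \<Longrightarrow> runs (k 0) (st\<lparr>vaddrs := vaddrs st - {addr r}\<rparr>) n Q"
    and cont: "\<And>fd' r'. tree_valid (st\<lparr>vaddrs := vaddrs st - {addr r}, vfields := fd'\<rparr>) r' \<Longrightarrow>
        attrites (tl (records r)) (records r') \<Longrightarrow> (\<forall>x. x \<notin> fst ` set (records r) \<longrightarrow> fd' x = vfields st x) \<Longrightarrow>
        runs (k (addr r')) (st\<lparr>vaddrs := vaddrs st - {addr r}, vfields := fd'\<rparr>) n Q"
  shows "runs (pop_prog (addr r) k) st (n + 40) Q"
  unfolding pop_prog_def
proof (rule runs_read_header[OF tree_valid_root(1)[OF tree]])
  let ?h = "header_of (vfields st (addr r))"
  let ?st = "st\<lparr>vaddrs := vaddrs st - {addr r}\<rparr>"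
  obtain cf cl bf bl df dt where h: "?h = (cf, cl, bf, bl, df, dt)" by (metis prod_cases6)
  let ?p = "if cf = cl then settle_prog 1 cf (0, 0, bf, bl, df, dt) (k cf)
     else get_field cf succ_field (\<lambda>n. settle_prog 1 cf (n, cl, bf, bl, df, dt) (k cf))"
  assume fits: "header_fits ?h"
  note valid = tree_valid_lists_valid[OF tree this, unfolded h]
  note empty = clean_first_eq_0_iff[OF lists_validD(3,5,2)[OF valid]]
  have "runs (if cf = 0 then k 0 else ?p) ?st (n + 34) Q"
  proof (cases "clean r")
    case Nil
    then have "buffer r = []" "stack r = []"
      using lists_ok_empty[of "buffer r" "stack r"] rtree_ok_iff[of r] tree by (auto simp: tree_valid_def)
    then have "runs (k 0) ?st n Q" using cont_empty Nil by (simp add: records_eq[of r])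
    then show ?thesis using empty Nil by (auto intro: runs_mono)
  next
    case (Cons c C)
    have "runs ?p ?st (27 + n) Q"
      by (rule runs_pop_nonempty[OF tree h fits[unfolded h] Cons]) (use cont in metis)
    then have "runs ?p ?st (n + 34) Q" by (rule runs_mono) simp
    then show ?thesis using empty Cons by simp
  qed
  then have "runs (free_record (addr r) (if cf = 0 then k 0 else ?p)) st (n + 34) Q" by (rule runs_free_record)
  then show "runs (case ?h of (cf, cl, bf, bl, df, dt) \<Rightarrow> free_record (addr r)
      (if cf = 0 then k 0 else if cf = cl then settle_prog 1 cf (0, 0, bf, bl, df, dt) (k cf)
       else get_field cf succ_field (\<lambda>n. settle_prog 1 cf (n, cl, bf, bl, df, dt) (k cf)))) st (n + 40 - 6) Q"
    unfolding h prod.case by (rule runs_mono) simp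
qed simp

end

section \<open>Forests\<close>

definition root_of :: "'a rtree option \<Rightarrow> nat" where
  "root_of t = (case t of None \<Rightarrow> 0 | Some r \<Rightarrow> addr r)"

definition elems_of :: "'a rtree option \<Rightarrow> 'a list" where
  "elems_of t = (case t of None \<Rightarrow> [] | Some r \<Rightarrow> contents (records r))"

definition addrs_of :: "'a rtree option \<Rightarrow> nat set" where
  "addrs_of t = (case t of None \<Rightarrow> {} | Some r \<Rightarrow> fst ` set (records r))"

lemma root_of_simps [simp]: "root_of None = 0" "root_of (Some r) = addr r"
  by (simp_all add: root_of_def)

lemma elems_of_simps [simp]: "elems_of None = []" "elems_of (Some r) = contents (records r)"
  by (simp_all add: elems_of_def)

lemma addrs_of_simps [simp]: "addrs_of None = {}" "addrs_of (Some r) = fst ` set (records r)"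
  by (simp_all add: addrs_of_def)

abbreviation leaf :: "nat \<Rightarrow> 'a list \<Rightarrow> 'a rtree" where
  "leaf a xs \<equiv> Node a xs [] [] []"

lemma records_leaf [simp]: "records (leaf a xs) = [(a, xs)]"
  by (simp add: records_eq[of "leaf a xs"])

context io_machine
begin

definition forest :: "'a view \<Rightarrow> (nat \<Rightarrow> 'a rtree option) \<Rightarrow> bool" where
  "forest st tr \<longleftrightarrow> (\<forall>i r. tr i = Some r \<longrightarrow> tree_valid st r) \<and>
     (\<forall>i j. i \<noteq> j \<longrightarrow> addrs_of (tr i) \<inter> addrs_of (tr j) = {})"

lemma forest_tree_valid: "forest st tr \<Longrightarrow> tr i = Some r \<Longrightarrow> tree_valid st r"
  by (simp add: forest_def)

lemma tree_valid_frame: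
  assumes "tree_valid st r"
    and same: "\<And>x. x \<in> fst ` set (records r) \<Longrightarrow>
      vfields st' x = vfields st x \<and> velems st' x = velems st x \<and> (x \<in> vaddrs st \<longrightarrow> x \<in> vaddrs st')"
  shows "tree_valid st' r"
proof -
  have "rtree_at (vfields st') r"
    by (rule rtree_at_cong[of "vfields st"]) (use assms(1) same in \<open>auto simp: tree_valid_def\<close>)
  then show ?thesis using assms by (simp add: tree_valid_def stored_def)
qed

lemma forest_view [simp]:
  "forest (st\<lparr>vmem := m\<rparr>) tr = forest st tr" "forest (st\<lparr>vresult := x\<rparr>) tr = forest st tr"
  by (simp_all add: forest_def tree_valid_def stored_def)

lemma forest_fun_upd:
  assumes forest: "forest st tr" and t: "\<And>r. t = Some r \<Longrightarrow> tree_valid st' r"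
    and frame: "\<And>m x. m \<noteq> i \<Longrightarrow> x \<in> addrs_of (tr m) \<Longrightarrow> x \<notin> addrs_of t \<and> vfields st' x = vfields st x \<and>
      velems st' x = velems st x \<and> (x \<in> vaddrs st \<longrightarrow> x \<in> vaddrs st')"
  shows "forest st' (tr(i := t))"
  unfolding forest_def
proof (intro conjI allI impI)
  fix m r assume r: "(tr(i := t)) m = Some r"
  show "tree_valid st' r"
  proof (cases "m = i")
    case False
    then have "tree_valid st r" "addrs_of (tr m) = fst ` set (records r)" using forest r
      by (auto simp: forest_def)
    then show ?thesis using tree_valid_frame frame[OF False] by metis
  qed (use r t in simp)
next
  fix m m' :: nat assume "m \<noteq> m'"
  then show "addrs_of ((tr(i := t)) m) \<inter> addrs_of ((tr(i := t)) m') = {}"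
    using forest frame[of m] frame[of m'] by (auto simp: forest_def)
qed

lemma forest_remove: "forest st tr \<Longrightarrow> forest st (tr(i := None))"
  by (rule forest_fun_upd[of st]) auto

lemma forest_move:
  assumes "forest st tr" "i \<noteq> j"
  shows "forest st (tr(i := tr j, j := None))"
proof -
  have disjoint: "m \<noteq> m' \<Longrightarrow> addrs_of (tr m) \<inter> addrs_of (tr m') = {}" for m m'
    using assms(1) by (simp add: forest_def)
  have "forest st ((tr(j := None))(i := tr j))"
  proof (rule forest_fun_upd[OF forest_remove[OF assms(1)]])
    fix m x assume "m \<noteq> i" "x \<in> addrs_of ((tr(j := None)) m)"
    then have "m \<noteq> j" "x \<in> addrs_of (tr m)" by (auto split: if_splits)
    then show "x \<notin> addrs_of (tr j) \<and> vfields st x = vfields st x \<and> velems st x = velems st x \<and>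
        (x \<in> vaddrs st \<longrightarrow> x \<in> vaddrs st)" using disjoint[of m j] by blast
  qed (rule forest_tree_valid[OF assms(1)])
  then show ?thesis using assms(2) by (simp add: fun_upd_twist)
qed

lemma forest_add_record:
  assumes forest: "forest st tr" and a: "a \<notin> vaddrs st" "0 < a" "a \<le> W" and xs: "min_first (a, xs)"
  shows "forest (add_record st a xs) (tr(i := Some (leaf a xs)))"
proof (rule forest_fun_upd[OF forest])
  let ?st = "add_record st a xs"
  have "rtree_ok (leaf a xs)"
    using xs by (subst rtree_ok_iff) (simp add: lists_ok_def lists_ordered_def debt_def)
  moreover have "rtree_at (vfields ?st) (leaf a xs)"
    by (subst rtree_at_iff) (simp add: lists_at_def header_of_def list_ends_def add_record_def)
  moreover have "stored ?st (records (leaf a xs))" using a by (simp add: stored_def add_record_def)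
  ultimately show "tree_valid ?st r" if "Some (leaf a xs) = Some r" for r using that
    by (auto simp: tree_valid_def)
  fix m x assume "x \<in> addrs_of (tr m)"
  then obtain r where "tr m = Some r" "x \<in> fst ` set (records r)" by (cases "tr m") auto
  then have "x \<in> vaddrs st" using forest by (auto simp: forest_def tree_valid_def stored_def)
  then have "x \<noteq> a" using a by auto
  then show "x \<notin> addrs_of (Some (leaf a xs)) \<and> vfields ?st x = vfields st x \<and> velems ?st x = velems st x \<and>
      (x \<in> vaddrs st \<longrightarrow> x \<in> vaddrs ?st)" by (simp add: add_record_def)
qed

lemma root_of_eq_0_iff: "forest st tr \<Longrightarrow> root_of (tr i) = 0 \<longleftrightarrow> tr i = None"
  by (cases "tr i") (auto dest: tree_valid_root(2)[OF forest_tree_valid])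

lemma root_of_le: "forest st tr \<Longrightarrow> root_of (tr i) \<le> W"
  by (cases "tr i") (auto dest: tree_valid_root(3)[OF forest_tree_valid])

lemma contents_records: "contents (records r) = elts r @ contents (tl (records r))"
  by (simp add: records_eq[of r])

lemma forest_root_less:
  "forest st tr \<Longrightarrow> tr i = Some r \<Longrightarrow> x \<in> set (contents (tl (records r))) \<Longrightarrow> key r < x"
  using rtree_ok_key_less[of r] by (auto simp: forest_def tree_valid_def records_eq[of r])

lemma runs_join_prog:
  assumes forest: "forest st tr" and ij: "i \<noteq> j"
    and cont: "\<And>fd' t. forest (st\<lparr>vfields := fd'\<rparr>) (tr(i := t, j := None)) \<Longrightarrow>
      survivors (elems_of t) = survivors (elems_of (tr i) @ elems_of (tr j)) \<Longrightarrow>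
      runs (k (root_of t)) (st\<lparr>vfields := fd'\<rparr>) n Q"
  shows "runs (join_prog (root_of (tr i)) (root_of (tr j)) k) st (n + 60) Q"
proof (cases "tr i = None \<or> tr j = None")
  case True
  define t where "t = (if tr i = None then tr j else tr i)"
  have "forest st (tr(i := t, j := None))"
    using forest_move[OF forest ij] forest_remove[OF forest, of j] True by (auto simp: t_def fun_upd_idem)
  then have "runs (k (root_of t)) (st\<lparr>vfields := vfields st\<rparr>) n Q"
    by (intro cont) (use True in \<open>auto simp: t_def\<close>)
  then have "runs (k (root_of t)) st (n + 60) Q" by (auto intro: runs_mono)
  then show ?thesis using True root_of_eq_0_iff[OF forest] by (auto simp: join_prog_def t_def)
next
  case False
  then obtain r r' where r: "tr i = Some r" "tr j = Some r'" by auto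
  have disjoint: "addrs_of (tr m) \<inter> addrs_of (tr m') = {}" if "m \<noteq> m'" for m m'
    using forest that by (simp add: forest_def)
  have "runs (join_prog (addr r) (addr r') k) st (n + 60) Q"
  proof (rule runs_join_trees[OF forest_tree_valid[OF forest r(1)] forest_tree_valid[OF forest r(2)]])
    show "fst ` set (records r) \<inter> fst ` set (records r') = {}" using disjoint[OF ij] r by simp
    fix fd' r''
    assume joined: "tree_valid (st\<lparr>vfields := fd'\<rparr>) r''" "attrites (records r @ records r') (records r'')"
      and frame: "\<forall>x. x \<notin> fst ` set (records r @ records r') \<longrightarrow> fd' x = vfields st x"
    have "forest (st\<lparr>vfields := fd'\<rparr>) ((tr(j := None))(i := Some r''))"
    proof (rule forest_fun_upd[OF forest_remove[OF forest]])
      fix m x assume m: "m \<noteq> i" "x \<in> addrs_of ((tr(j := None)) m)"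
      then have "m \<noteq> j" "x \<in> addrs_of (tr m)" by (auto split: if_splits)
      then have "x \<notin> fst ` set (records r @ records r')" using disjoint[OF m(1)] disjoint[of m j] r by auto
      moreover have "fst ` set (records r'') \<subseteq> fst ` set (records r @ records r')"
        using joined(2) unfolding attrites_def by blast
      ultimately show "x \<notin> addrs_of (Some r'') \<and> vfields (st\<lparr>vfields := fd'\<rparr>) x = vfields st x \<and>
          velems (st\<lparr>vfields := fd'\<rparr>) x = velems st x \<and> (x \<in> vaddrs st \<longrightarrow> x \<in> vaddrs (st\<lparr>vfields := fd'\<rparr>))"
        using frame by auto
    qed (use joined(1) in simp)
    then have "runs (k (root_of (Some r''))) (st\<lparr>vfields := fd'\<rparr>) n Q"
      using joined(2) r ij by (intro cont) (simp_all add: fun_upd_twist attrites_def)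
    then show "runs (k (addr r'')) (st\<lparr>vfields := fd'\<rparr>) n Q" by simp
  qed
  then show ?thesis using r by simp
qed

lemma runs_pop_prog:
  assumes forest: "forest st tr" and r: "tr i = Some r"
    and cont: "\<And>fd' t. forest (st\<lparr>vaddrs := vaddrs st - {addr r}, vfields := fd'\<rparr>) (tr(i := t)) \<Longrightarrow>
      survivors (elems_of t) = survivors (contents (tl (records r))) \<Longrightarrow>
      runs (k (root_of t)) (st\<lparr>vaddrs := vaddrs st - {addr r}, vfields := fd'\<rparr>) n Q"
  shows "runs (pop_prog (addr r) k) st (n + 40) Q"
proof -
  have root: "addr r \<in> fst ` set (records r)" using root_in_records[of r] by force
  have popped: "forest (st\<lparr>vaddrs := vaddrs st - {addr r}, vfields := fd'\<rparr>) (tr(i := t))"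
    if "\<And>r'. t = Some r' \<Longrightarrow> tree_valid (st\<lparr>vaddrs := vaddrs st - {addr r}, vfields := fd'\<rparr>) r'"
      and sub: "addrs_of t \<subseteq> fst ` set (records r)"
      and frame: "\<forall>x. x \<notin> fst ` set (records r) \<longrightarrow> fd' x = vfields st x" for fd' t
  proof (rule forest_fun_upd[OF forest that(1)])
    fix m x assume m: "m \<noteq> i" "x \<in> addrs_of (tr m)"
    then have "addrs_of (tr m) \<inter> addrs_of (tr i) = {}" using forest by (simp add: forest_def)
    then have "x \<notin> fst ` set (records r)" using m(2) r by auto
    moreover from this have "x \<noteq> addr r" using root by blast
    ultimately show "x \<notin> addrs_of t \<and> vfields (st\<lparr>vaddrs := vaddrs st - {addr r}, vfields := fd'\<rparr>) x = vfields st x \<and>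
        velems (st\<lparr>vaddrs := vaddrs st - {addr r}, vfields := fd'\<rparr>) x = velems st x \<and>
        (x \<in> vaddrs st \<longrightarrow> x \<in> vaddrs (st\<lparr>vaddrs := vaddrs st - {addr r}, vfields := fd'\<rparr>))"
      using sub frame by auto
  qed
  show ?thesis
  proof (rule runs_pop_tree[OF forest_tree_valid[OF forest r]])
    assume "tl (records r) = []"
    then have "runs (k (root_of (None :: 'a rtree option)))
        (st\<lparr>vaddrs := vaddrs st - {addr r}, vfields := vfields st\<rparr>) n Q"
      by (intro cont popped) simp_all
    then show "runs (k 0) (st\<lparr>vaddrs := vaddrs st - {addr r}\<rparr>) n Q" by simp
  next
    fix fd' r'
    assume popped': "tree_valid (st\<lparr>vaddrs := vaddrs st - {addr r}, vfields := fd'\<rparr>) r'"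
      "attrites (tl (records r)) (records r')" "\<forall>x. x \<notin> fst ` set (records r) \<longrightarrow> fd' x = vfields st x"
    have "set (tl (records r)) \<subseteq> set (records r)" by (auto dest: in_set_tlD)
    then have "fst ` set (records r') \<subseteq> fst ` set (records r)" using popped'(2) unfolding attrites_def by blast
    then have "runs (k (root_of (Some r'))) (st\<lparr>vaddrs := vaddrs st - {addr r}, vfields := fd'\<rparr>) n Q"
      using popped' by (intro cont popped) (simp_all add: attrites_def)
    then show "runs (k (addr r')) (st\<lparr>vaddrs := vaddrs st - {addr r}, vfields := fd'\<rparr>) n Q" by simp
  qed
qed

lemma implements_start: "implements s st \<Longrightarrow> implements (s\<lparr>result := None, ios := 0\<rparr>) (st\<lparr>vresult := None\<rparr>)"
  by (simp add: implements_def)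

definition blank_view :: "'a view" where
  "blank_view = \<lparr>vmem = (\<lambda>_. Num 0), vresult = None, vaddrs = {}, velems = (\<lambda>_. []), vfields = (\<lambda>_ _. 0)\<rparr>"

lemma implements_blank: "implements blank_config blank_view"
  by (simp add: implements_def blank_config_def blank_view_def)

end

section \<open>Sequences of operations\<close>

fun op_arg :: "'a cpqa_op \<Rightarrow> 'a option" where
  "op_arg (InsertAndAttrite i e) = Some e"
| "op_arg _ = None"

fun op_prog :: "cpqa_impl \<Rightarrow> 'a cpqa_op \<Rightarrow> prog" where
  "op_prog D (FindMin i) = find_min_prog D i"
| "op_prog D (DeleteMin i) = delete_min_prog D i"
| "op_prog D (CatenateAndAttrite i j) = catenate_prog D i j"
| "op_prog D (InsertAndAttrite i e) = insert_prog D i"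

lemma exec_op_eq: "exec_op mc D x s = exec mc (op_arg x) (op_prog D x) s"
  by (cases x) simp_all

definition size_change :: "'a cpqa_op \<Rightarrow> int" where
  "size_change x = of_bool (is_catenate_or_insert x) - of_bool (is_delete x)"

lemma sum_size_change:
  "(\<Sum>x\<leftarrow>ops. size_change x) =
    int (length (filter is_catenate_or_insert ops)) - int (length (filter is_delete ops))"
  by (induction ops) (auto simp: size_change_def)

definition meets_bounds :: "nat \<Rightarrow> nat \<Rightarrow> machine \<Rightarrow> cpqa_impl \<Rightarrow> 'a::linorder cpqa_op list \<Rightarrow> bool" where
  "meets_bounds C b mc D ops \<longleftrightarrow> (\<exists>s tr. run_ops mc D ops blank_config = Some (s, tr) \<and>
     map fst tr = all_answers ops (\<lambda>_. {}) \<and> (\<forall>t \<in> set (map snd tr). t \<le> C) \<and>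
     real (sum_list (map snd tr)) \<le> real C * (real (length ops) / real b) \<and>
     real (blocks_used s) \<le> real C * ((real (length (filter is_catenate_or_insert ops))
       - real (length (filter is_delete ops))) / real b))"

text \<open>
  In the invariant \<open>Inv s Q t e \<phi>\<close>, \<open>t\<close> counts the operations performed, \<open>e\<close> bounds the number of
  elements stored, and \<open>\<phi>\<close> bounds the potential, of which \<open>\<beta>\<close> units pay for one I/O.
\<close>

locale amortized_impl =
  fixes mc :: machine and D :: cpqa_impl and l N \<kappa> \<beta> c :: nat
    and Inv :: "'a::linorder config \<Rightarrow> (nat \<Rightarrow> 'a set) \<Rightarrow> nat \<Rightarrow> int \<Rightarrow> int \<Rightarrow> bool"
  assumes step: "\<And>s Q t x (e::int) (\<phi>::int). Inv s Q t e \<phi> \<Longrightarrow> cpqa_legal l x Q \<Longrightarrow> t < N \<Longrightarrow>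
      \<exists>s'. exec mc (op_arg x) (op_prog D x) (s\<lparr>result := None, ios := 0\<rparr>) = Some s' \<and>
        ios s' \<le> \<kappa> \<and> result s' = cpqa_answer x Q \<and>
        Inv s' (cpqa_step x Q) (Suc t) (e + size_change x) (\<phi> + c - \<beta> * ios s')"
    and blank: "Inv blank_config (\<lambda>_. {}) 0 0 0"
    and blocks: "\<And>s Q t (e::int) (\<phi>::int). Inv s Q t e \<phi> \<Longrightarrow> \<beta> * blocks_used s \<le> 12 * e"
    and potential: "\<And>s Q t (e::int) (\<phi>::int). Inv s Q t e \<phi> \<Longrightarrow> 0 \<le> \<phi>"
begin

lemma run_ops_invariant:
  fixes e \<phi> :: int
  assumes "Inv s Q t e \<phi>" "all_legal l ops Q" "t + length ops \<le> N"
  shows "\<exists>s' tr Q'. run_ops mc D ops s = Some (s', tr) \<and> map fst tr = all_answers ops Q \<and>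
    (\<forall>n\<in>set (map snd tr). n \<le> \<kappa>) \<and> Inv s' Q' (t + length ops) (e + (\<Sum>x\<leftarrow>ops. size_change x))
      (\<phi> + c * length ops - \<beta> * sum_list (map snd tr))"
  using assms
proof (induction ops arbitrary: s Q t e \<phi>)
  case Nil
  then show ?case by auto
next
  case (Cons x ops)
  obtain s1 where s1: "exec mc (op_arg x) (op_prog D x) (s\<lparr>result := None, ios := 0\<rparr>) = Some s1" "ios s1 \<le> \<kappa>"
      "result s1 = cpqa_answer x Q" "Inv s1 (cpqa_step x Q) (Suc t) (e + size_change x) (\<phi> + c - \<beta> * ios s1)"
    using step[OF Cons.prems(1), of x] Cons.prems(2,3) by auto
  obtain s2 tr Q' where s2: "run_ops mc D ops s1 = Some (s2, tr)" "map fst tr = all_answers ops (cpqa_step x Q)"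
      "\<forall>n\<in>set (map snd tr). n \<le> \<kappa>" "Inv s2 Q' (Suc t + length ops) (e + size_change x + (\<Sum>x\<leftarrow>ops. size_change x))
        (\<phi> + c - \<beta> * ios s1 + c * length ops - \<beta> * sum_list (map snd tr))"
    using Cons.IH[OF s1(4)] Cons.prems(2,3) by auto
  have "run_ops mc D (x # ops) s = Some (s2, (result s1, ios s1) # tr)"
    using s1(1) s2(1) by (simp add: exec_op_eq)
  moreover have "Inv s2 Q' (t + length (x # ops)) (e + (\<Sum>x\<leftarrow>x # ops. size_change x))
      (\<phi> + c * length (x # ops) - \<beta> * sum_list (map snd ((result s1, ios s1) # tr)))"
    using s2(4) by (simp add: algebra_simps)
  ultimately show ?case using s1(2,3) s2(2,3)
    by (intro exI[of _ s2] exI[of _ "(result s1, ios s1) # tr"] exI) auto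
qed

lemma scaled_bound:
  fixes C b \<gamma> k S :: nat and m :: int
  assumes bound: "\<beta> * S \<le> k * m" and C: "\<gamma> * k \<le> C" and b: "1 \<le> b" "b \<le> \<gamma> * \<beta>" and m: "0 \<le> m"
  shows "real S \<le> real C * (real_of_int m / real b)"
proof -
  have "int b * int S \<le> int (\<gamma> * \<beta>) * int S" using b(2) by (intro mult_right_mono) (simp_all flip: of_nat_mult)
  also have "\<dots> = int \<gamma> * (int \<beta> * int S)" by simp
  also have "\<dots> \<le> int \<gamma> * (int k * m)" using bound by (intro mult_left_mono) auto
  also have "\<dots> = int (\<gamma> * k) * m" by simp
  also have "\<dots> \<le> int C * m" using C m by (intro mult_right_mono) (simp_all flip: of_nat_mult)
  finally have "real_of_int (int b * int S) \<le> real_of_int (int C * m)" by (simp only: of_int_le_iff)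
  then show ?thesis using b(1) by (simp add: field_simps)
qed

lemma meets_bounds:
  fixes ops :: "'a cpqa_op list"
  assumes legal: "all_legal l ops (\<lambda>_. {})" "length ops \<le> N"
    and b: "1 \<le> b" "b \<le> \<gamma> * \<beta>" and C: "\<kappa> \<le> C" "\<gamma> * c \<le> C" "\<gamma> * 12 \<le> C"
  shows "meets_bounds C b mc D ops"
proof -
  define e where "e = (\<Sum>x\<leftarrow>ops. size_change x)"
  obtain s tr Q where run: "run_ops mc D ops blank_config = Some (s, tr)"
      "map fst tr = all_answers ops (\<lambda>_. {})"
      "\<forall>n\<in>set (map snd tr). n \<le> \<kappa>" "Inv s Q (length ops) e (int c * length ops - int \<beta> * sum_list (map snd tr))"
    using run_ops_invariant[OF blank legal(1)] legal(2) by (auto simp: e_def)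
  have "real (sum_list (map snd tr)) \<le> real C * (real_of_int (length ops) / real b)"
    by (rule scaled_bound[OF _ C(2) b]) (use potential[OF run(4)] in auto)
  moreover have "real (blocks_used s) \<le> real C * (real_of_int e / real b)"
  proof (rule scaled_bound[OF _ C(3) b])
    show bound: "int (\<beta> * blocks_used s) \<le> int 12 * e" using blocks[OF run(4)] by simp
    have "0 \<le> int (\<beta> * blocks_used s)" by simp
    with bound show "0 \<le> e" by linarith
  qed
  moreover have "real_of_int e =
      real (length (filter is_catenate_or_insert ops)) - real (length (filter is_delete ops))"
    unfolding e_def sum_size_change by simp
  moreover have "\<forall>n\<in>set (map snd tr). n \<le> C" using run(3) C(1) by fastforce
  ultimately show ?thesis unfolding meets_bounds_def using run(1,2) by auto
qed

end

section \<open>Small blocks\<close>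

text \<open>
  If \<open>b\<close> is bounded, every operation may perform a constant number of I/Os, and a queue is a tree of
  one-element records. Between two operations cell \<open>i\<close> holds the address of the root of queue \<open>i\<close>,
  paired with the number of records allocated so far; during an operation the control state keeps
  these numbers, because the memory may have no cells to spare.
\<close>

primrec load_numbers :: "nat \<Rightarrow> ((nat \<Rightarrow> nat) \<Rightarrow> prog) \<Rightarrow> prog" where
  "load_numbers 0 k = k (\<lambda>_. 0)"
| "load_numbers (Suc n) k = CaseNum n (\<lambda>v. load_numbers n (\<lambda>f. k (f(n := v))))"

primrec store_numbers :: "nat \<Rightarrow> (nat \<Rightarrow> nat) \<Rightarrow> prog" where
  "store_numbers 0 f = Halt"
| "store_numbers (Suc n) f = SetNum n (f n) (store_numbers n f)"

definition store_state :: "nat \<Rightarrow> (nat \<Rightarrow> nat) \<Rightarrow> nat \<Rightarrow> prog" where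
  "store_state l g c = store_numbers l (\<lambda>i. prod_encode (g i, c))"

definition load_state :: "nat \<Rightarrow> ((nat \<Rightarrow> nat) \<Rightarrow> nat \<Rightarrow> prog) \<Rightarrow> prog" where
  "load_state l k = load_numbers l (\<lambda>f. k (\<lambda>i. fst (prod_decode (f i))) (snd (prod_decode (f 0))))"

definition (in io_programs) small_impl :: "nat \<Rightarrow> cpqa_impl" where
  "small_impl l = \<lparr>
     find_min_prog = (\<lambda>i. load_state l (\<lambda>g c. output_key (g i) (store_state l g c))),
     delete_min_prog = (\<lambda>i. load_state l (\<lambda>g c.
       output_key (g i) (pop_prog (g i) (\<lambda>a. store_state l (g(i := a)) c)))),
     catenate_prog = (\<lambda>i j. load_state l (\<lambda>g c.
       join_prog (g i) (g j) (\<lambda>a. store_state l (g(i := a, j := 0)) c))),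
     insert_prog = (\<lambda>i. load_state l (\<lambda>g c. GetArg 0 (new_record (Suc c) 1
       (join_prog (g i) (Suc c) (\<lambda>a. store_state l (g(i := a)) (Suc c))))))\<rparr>"

context io_machine
begin

lemma exec_load_numbers:
  assumes "n \<le> M" "\<forall>i<n. mem s i = Num (f i)"
  shows "exec mc arg (load_numbers n k) s = exec mc arg (k (\<lambda>i. if i < n then f i else 0)) s"
  using assms
proof (induction n arbitrary: k)
  case (Suc n)
  have "(\<lambda>i. if i < n then f i else 0)(n := f n) = (\<lambda>i. if i < Suc n then f i else 0)"
    by (auto simp: fun_eq_iff less_Suc_eq)
  then show ?case using Suc by simp
qed simp

lemma exec_store_numbers:
  assumes "n \<le> M" "\<forall>i<n. f i \<le> W"
  shows "exec mc arg (store_numbers n f) s =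
    Some (s\<lparr>mem := (\<lambda>i. if i < n then Num (f i) else mem s i)\<rparr>)"
  using assms
proof (induction n arbitrary: s)
  case (Suc n)
  have "(\<lambda>i. if i < n then Num (f i) else ((mem s)(n := Num (f n))) i) =
      (\<lambda>i. if i < Suc n then Num (f i) else mem s i)"
    by (auto simp: fun_eq_iff less_Suc_eq)
  then show ?case using Suc by (simp cong: if_cong)
qed simp

lemma runs_insert_record:
  assumes "arg = Some e" "a \<notin> vaddrs st" "16 * a + 15 \<le> W" "runs p (add_record st a [e]) n Q"
  shows "runs (GetArg 0 (new_record a 1 p)) st (n + 12) Q"
proof (rule runs_step[OF assms(4)])
  fix s assume "implements s st"
  then have "implements (s\<lparr>mem := (mem s)(0 := Elem e)\<rparr>) st" using block_pos by (simp add: implements_def)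
  from exec_new_record[OF this assms(2,3), of "[e]" p] obtain s' where
    "exec mc arg (new_record a 1 p) (s\<lparr>mem := (mem s)(0 := Elem e)\<rparr>) = exec mc arg p s'"
    "implements s' (add_record st a [e])" "ios s' = ios s + 12"
    using block_pos word_pos by auto
  then show "\<exists>s'. exec mc arg (GetArg 0 (new_record a 1 p)) s = exec mc arg p s' \<and>
      implements s' (add_record st a [e]) \<and> ios s' + n \<le> ios s + (n + 12)"
    using assms(1) block_pos two_blocks by (intro exI[of _ s']) simp
qed

end

locale small_blocks = io_machine +
  fixes l N :: nat
  assumes queues: "1 \<le> l" "l \<le> M" and word_ge: "16 * N + 31 \<le> W"
    and word_pair: "\<And>a c. a \<le> N \<Longrightarrow> c \<le> N \<Longrightarrow> prod_encode (a, c) \<le> W"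
begin

definition small_state :: "'a view \<Rightarrow> (nat \<Rightarrow> 'a rtree option) \<Rightarrow> nat \<Rightarrow> (nat \<Rightarrow> 'a set) \<Rightarrow> nat \<Rightarrow> int \<Rightarrow> bool" where
  "small_state st tr c Q t e \<longleftrightarrow> forest st tr \<and> (\<forall>i\<ge>l. tr i = None) \<and> (\<forall>i<l. Q i = survivors (elems_of (tr i))) \<and>
     (\<forall>a\<in>vaddrs st. a \<le> c \<and> length (velems st a) = 1) \<and> finite (vaddrs st) \<and> c \<le> t \<and> int (card (vaddrs st)) \<le> e"

definition small_inv :: "'a config \<Rightarrow> (nat \<Rightarrow> 'a set) \<Rightarrow> nat \<Rightarrow> int \<Rightarrow> bool" where
  "small_inv s Q t e \<longleftrightarrow> (\<exists>st tr c. implements s st \<and> small_state st tr c Q t e \<and>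
     (\<forall>i<l. mem s i = Num (prod_encode (root_of (tr i), c))))"

lemma small_stateD:
  assumes "small_state st tr c Q t e"
  shows "forest st tr" "tr l = None" "i < l \<Longrightarrow> Q i = survivors (elems_of (tr i))"
  using assms by (simp_all add: small_state_def)

lemma small_state_view [simp]: "small_state (st\<lparr>vmem := m\<rparr>) tr c Q t e = small_state st tr c Q t e"
  "small_state (st\<lparr>vresult := x\<rparr>) tr c Q t e = small_state st tr c Q t e"
  by (simp_all add: small_state_def)

lemma root_of_le_count: "small_state st tr c Q t e \<Longrightarrow> root_of (tr i) \<le> c"
  using tree_valid_root(1)[OF forest_tree_valid, of st tr i] by (cases "tr i") (auto simp: small_state_def)

lemma runs_store_state:
  assumes state: "small_state st tr c Q t e" and t: "t \<le> N" and g: "\<forall>i<l. g i = root_of (tr i)"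
    and result: "vresult st = x"
  shows "runs (store_state l g c) st n (\<lambda>s'. result s' = x \<and> small_inv s' Q t e)"
  unfolding runs_def
proof (intro allI impI)
  fix s assume s: "implements s st"
  have "c \<le> N" using state t by (simp add: small_state_def)
  then have "prod_encode (g i, c) \<le> W" if "i < l" for i
    using root_of_le_count[OF state, of i] that g by (intro word_pair) auto
  then have "exec mc arg (store_state l g c) s =
      Some (s\<lparr>mem := (\<lambda>i. if i < l then Num (prod_encode (g i, c)) else mem s i)\<rparr>)" (is "_ = Some ?s")
    unfolding store_state_def using exec_store_numbers[of l "\<lambda>i. prod_encode (g i, c)" s] queues by simp
  moreover have "implements ?s (st\<lparr>vmem := mem ?s\<rparr>)" using s by (simp add: implements_def)
  then have "small_inv ?s Q t e" unfolding small_inv_def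
    by (intro exI[of _ "st\<lparr>vmem := mem ?s\<rparr>"] exI[of _ tr] exI[of _ c]) (use state g in simp)
  moreover have "result ?s = x" using s result by (simp add: implements_def)
  ultimately show "\<exists>s'. exec mc arg (store_state l g c) s = Some s' \<and> ios s' \<le> ios s + n \<and>
      result s' = x \<and> small_inv s' Q t e"
    by simp
qed

lemma exec_load_state:
  assumes inv: "small_inv s Q t e"
    and cont: "\<And>st tr c g. small_state st tr c Q t e \<Longrightarrow> \<forall>i<l. g i = root_of (tr i) \<Longrightarrow> vresult st = None \<Longrightarrow>
      runs (k g c) st n P"
  shows "\<exists>s'. exec mc arg (load_state l k) (s\<lparr>result := None, ios := 0\<rparr>) = Some s' \<and> ios s' \<le> n \<and> P s'"
proof -
  obtain st tr c where s: "implements s st" "small_state st tr c Q t e"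
    "\<forall>i<l. mem s i = Num (prod_encode (root_of (tr i), c))"
    using inv by (auto simp: small_inv_def)
  let ?s = "s\<lparr>result := None, ios := 0\<rparr>"
  let ?f = "\<lambda>i. if i < l then prod_encode (root_of (tr i), c) else 0"
  let ?g = "\<lambda>i. fst (prod_decode (?f i))"
  have "exec mc arg (load_state l k) ?s = exec mc arg (k ?g (snd (prod_decode (?f 0)))) ?s"
    unfolding load_state_def using exec_load_numbers[of l ?s "\<lambda>i. prod_encode (root_of (tr i), c)"] s(3) queues
    by simp
  also have "snd (prod_decode (?f 0)) = c" using queues by simp
  finally have exec: "exec mc arg (load_state l k) ?s = exec mc arg (k ?g c) ?s" .
  have "runs (k ?g c) (st\<lparr>vresult := None\<rparr>) n P" by (rule cont[of _ tr]) (use s(2) in auto)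
  then show ?thesis using implements_start[OF s(1)] unfolding exec runs_def by fastforce
qed

lemma nonempty_queue:
  assumes state: "small_state st tr c Q t e" and i: "i < l" "Q i \<noteq> {}"
  obtains r where "tr i = Some r" "addr r \<in> vaddrs st" "velems st (addr r) = elts r" "Min (Q i) = key r"
    "Q i - {Min (Q i)} = survivors (contents (tl (records r)))"
proof -
  obtain r where r: "tr i = Some r" using small_stateD(3)[OF state i(1)] i(2) by (cases "tr i") auto
  note root = tree_valid_root[OF forest_tree_valid[OF small_stateD(1)[OF state] r]]
  have "length (elts r) = 1" using state root(1,4) by (auto simp: small_state_def)
  then obtain x where "elts r = [x]" by (cases "elts r") auto
  then have Q: "Q i = survivors (key r # contents (tl (records r)))"
    using small_stateD(3)[OF state i(1)] r contents_records[of r] by simp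
  have less: "\<forall>y\<in>set (contents (tl (records r))). key r < y"
    using forest_root_less[OF small_stateD(1)[OF state] r] by blast
  show ?thesis
    by (rule that[OF r root(1,4)])
      (use Min_survivors_Cons[OF less] survivors_Cons_minus_Min[OF less] in \<open>simp_all only: Q\<close>)
qed

lemma find_min_step:
  assumes inv: "small_inv s Q t e" and legal: "cpqa_legal l (FindMin i) Q" and t: "t < N"
  shows "\<exists>s'. exec mc arg (find_min_prog (small_impl l) i) (s\<lparr>result := None, ios := 0\<rparr>) = Some s' \<and> ios s' \<le> 80 \<and>
    result s' = Some (Min (Q i)) \<and> small_inv s' Q (Suc t) e"
  unfolding small_impl_def cpqa_impl.simps
proof (rule exec_load_state[OF inv])
  fix st tr c g
  assume state: "small_state st tr c Q t e" and g: "\<forall>i<l. g i = root_of (tr i)" and "vresult st = None"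
  have i: "i < l" "Q i \<noteq> {}" using legal by auto
  then obtain r where r: "tr i = Some r" "addr r \<in> vaddrs st" "velems st (addr r) = elts r" "Min (Q i) = key r"
    using nonempty_queue[OF state] by metis
  have "small_state (st\<lparr>vresult := Some (key r)\<rparr>) tr c Q (Suc t) e" using state by (simp add: small_state_def)
  then have "runs (store_state l g c) (st\<lparr>vresult := Some (key r)\<rparr>) 79
      (\<lambda>s'. result s' = Some (Min (Q i)) \<and> small_inv s' Q (Suc t) e)"
    by (rule runs_store_state) (use t g r in auto)
  then show "runs (output_key (g i) (store_state l g c)) st 80
      (\<lambda>s'. result s' = Some (Min (Q i)) \<and> small_inv s' Q (Suc t) e)"
    using g i r by (intro runs_output_key) auto
qed

lemma delete_min_step:
  assumes inv: "small_inv s Q t e" and legal: "cpqa_legal l (DeleteMin i) Q" and t: "t < N"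
  shows "\<exists>s'. exec mc arg (delete_min_prog (small_impl l) i) (s\<lparr>result := None, ios := 0\<rparr>) = Some s' \<and> ios s' \<le> 80 \<and>
    result s' = Some (Min (Q i)) \<and> small_inv s' (cpqa_step (DeleteMin i) Q) (Suc t) (e - 1)"
  unfolding small_impl_def cpqa_impl.simps
proof (rule exec_load_state[OF inv])
  fix st tr c g
  assume state: "small_state st tr c Q t e" and g: "\<forall>i<l. g i = root_of (tr i)" and "vresult st = None"
  have i: "i < l" "Q i \<noteq> {}" using legal by auto
  then obtain r where r: "tr i = Some r" "addr r \<in> vaddrs st" "velems st (addr r) = elts r" "Min (Q i) = key r"
      "Q i - {Min (Q i)} = survivors (contents (tl (records r)))"
    using nonempty_queue[OF state] by metis
  let ?post = "\<lambda>s'. result s' = Some (Min (Q i)) \<and> small_inv s' (cpqa_step (DeleteMin i) Q) (Suc t) (e - 1)"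
  let ?st = "st\<lparr>vresult := Some (key r)\<rparr>"
  have "runs (pop_prog (addr r) (\<lambda>a. store_state l (g(i := a)) c)) ?st (39 + 40) ?post"
  proof (rule runs_pop_prog[where tr = tr and i = i])
    show "forest ?st tr" "tr i = Some r" using small_stateD(1)[OF state] r(1) by simp_all
    fix fd' t'
    let ?st' = "?st\<lparr>vaddrs := vaddrs ?st - {addr r}, vfields := fd'\<rparr>"
    assume "forest ?st' (tr(i := t'))" "survivors (elems_of t') = survivors (contents (tl (records r)))"
    moreover have "card (vaddrs st) = Suc (card (vaddrs st - {addr r}))"
      by (rule card.remove) (use state r(2) in \<open>simp_all add: small_state_def\<close>)
    ultimately have "small_state ?st' (tr(i := t')) c (cpqa_step (DeleteMin i) Q) (Suc t) (e - 1)"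
      using state i r by (auto simp: small_state_def)
    then show "runs (store_state l (g(i := root_of t')) c) ?st' 39 ?post"
      by (rule runs_store_state) (use t g r in auto)
  qed
  then show "runs (output_key (g i) (pop_prog (g i) (\<lambda>a. store_state l (g(i := a)) c))) st 80 ?post"
    using g i r by (intro runs_output_key) auto
qed

lemma catenate_step:
  assumes inv: "small_inv s Q t e" and legal: "cpqa_legal l (CatenateAndAttrite i j) Q" and t: "t < N"
  shows "\<exists>s'. exec mc arg (catenate_prog (small_impl l) i j) (s\<lparr>result := None, ios := 0\<rparr>) = Some s' \<and> ios s' \<le> 80 \<and>
    result s' = None \<and> small_inv s' (cpqa_step (CatenateAndAttrite i j) Q) (Suc t) (e + 1)"
  unfolding small_impl_def cpqa_impl.simps
proof (rule exec_load_state[OF inv])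
  fix st tr c g
  assume state: "small_state st tr c Q t e" and g: "\<forall>i<l. g i = root_of (tr i)" and result: "vresult st = None"
  have ij: "i < l" "j < l" "i \<noteq> j" using legal by auto
  let ?Q = "cpqa_step (CatenateAndAttrite i j) Q"
  have "runs (join_prog (root_of (tr i)) (root_of (tr j)) (\<lambda>a. store_state l (g(i := a, j := 0)) c)) st (20 + 60)
      (\<lambda>s'. result s' = None \<and> small_inv s' ?Q (Suc t) (e + 1))"
  proof (rule runs_join_prog[OF small_stateD(1)[OF state] ij(3)])
    fix fd' t'
    assume "forest (st\<lparr>vfields := fd'\<rparr>) (tr(i := t', j := None))"
      "survivors (elems_of t') = survivors (elems_of (tr i) @ elems_of (tr j))"
    then have "small_state (st\<lparr>vfields := fd'\<rparr>) (tr(i := t', j := None)) c ?Q (Suc t) (e + 1)"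
      using state ij by (auto simp: small_state_def survivors_append)
    then show "runs (store_state l (g(i := root_of t', j := 0)) c) (st\<lparr>vfields := fd'\<rparr>) 20
        (\<lambda>s'. result s' = None \<and> small_inv s' ?Q (Suc t) (e + 1))"
      by (rule runs_store_state) (use t g result in auto)
  qed
  then show "runs (join_prog (g i) (g j) (\<lambda>a. store_state l (g(i := a, j := 0)) c)) st 80
      (\<lambda>s'. result s' = None \<and> small_inv s' ?Q (Suc t) (e + 1))"
    using g ij by simp
qed

lemma insert_step:
  assumes inv: "small_inv s Q t e" and legal: "cpqa_legal l (InsertAndAttrite i x) Q" and t: "t < N"
    and arg: "arg = Some x"
  shows "\<exists>s'. exec mc arg (insert_prog (small_impl l) i) (s\<lparr>result := None, ios := 0\<rparr>) = Some s' \<and> ios s' \<le> 80 \<and>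
    result s' = None \<and> small_inv s' (cpqa_step (InsertAndAttrite i x) Q) (Suc t) (e + 1)"
  unfolding small_impl_def cpqa_impl.simps
proof (rule exec_load_state[OF inv])
  fix st tr c g
  assume state: "small_state st tr c Q t e" and g: "\<forall>i<l. g i = root_of (tr i)" and result: "vresult st = None"
  have i: "i < l" "i \<noteq> l" using legal by auto
  have c: "Suc c \<notin> vaddrs st" "16 * Suc c + 15 \<le> W" "Suc c \<le> W"
    using state t word_ge by (auto simp: small_state_def)
  let ?Q = "cpqa_step (InsertAndAttrite i x) Q"
  let ?post = "\<lambda>s'. result s' = None \<and> small_inv s' ?Q (Suc t) (e + 1)"
  let ?st = "add_record st (Suc c) [x]"
  let ?tr = "tr(l := Some (leaf (Suc c) [x]))"
  have "runs (join_prog (root_of (?tr i)) (root_of (?tr l)) (\<lambda>a. store_state l (g(i := a)) (Suc c))) ?st (8 + 60) ?post"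
  proof (rule runs_join_prog[OF _ i(2)])
    show "forest ?st ?tr"
      by (rule forest_add_record[OF small_stateD(1)[OF state]]) (use c in \<open>auto simp: min_first_def\<close>)
    fix fd' t'
    assume forest: "forest (?st\<lparr>vfields := fd'\<rparr>) (?tr(i := t', l := None))"
      and t': "survivors (elems_of t') = survivors (elems_of (?tr i) @ elems_of (?tr l))"
    have "?tr(i := t', l := None) = tr(i := t')" using i small_stateD(2)[OF state] by (auto simp: fun_eq_iff)
    then have "small_state (?st\<lparr>vfields := fd'\<rparr>) (tr(i := t')) (Suc c) ?Q (Suc t) (e + 1)"
      using forest t' state i c(1)
      by (auto simp: small_state_def add_record_def survivors_append insert_attrite_eq_catenate le_SucI)
    then show "runs (store_state l (g(i := root_of t')) (Suc c)) (?st\<lparr>vfields := fd'\<rparr>) 8 ?post"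
      by (rule runs_store_state) (use t g result in \<open>auto simp: add_record_def\<close>)
  qed
  then have "runs (join_prog (g i) (Suc c) (\<lambda>a. store_state l (g(i := a)) (Suc c))) ?st 68 ?post" using g i
    by simp
  then have "runs (GetArg 0 (new_record (Suc c) 1 (join_prog (g i) (Suc c) (\<lambda>a. store_state l (g(i := a)) (Suc c)))))
      st (68 + 12) ?post"
    by (intro runs_insert_record[OF arg c(1,2)])
  then show "runs (GetArg 0 (new_record (Suc c) 1 (join_prog (g i) (Suc c) (\<lambda>a. store_state l (g(i := a)) (Suc c)))))
      st 80 ?post" by simp
qed

lemma small_step:
  assumes "small_inv s Q t e" "cpqa_legal l x Q" "t < N" "op_arg x = arg"
  shows "\<exists>s'. exec mc (op_arg x) (op_prog (small_impl l) x) (s\<lparr>result := None, ios := 0\<rparr>) = Some s' \<and> ios s' \<le> 80 \<and>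
    result s' = cpqa_answer x Q \<and> small_inv s' (cpqa_step x Q) (Suc t) (e + size_change x)"
  using assms find_min_step delete_min_step catenate_step insert_step
  by (cases x) (auto simp: size_change_def simp del: cpqa_legal.simps)

lemma small_inv_blank: "small_inv blank_config (\<lambda>_. {}) 0 0"
  unfolding small_inv_def
proof (intro exI conjI)
  show "small_state blank_view (\<lambda>_. None) 0 (\<lambda>_. {}) 0 0"
    by (simp add: small_state_def forest_def blank_view_def)
qed (rule implements_blank, simp add: blank_config_def prod_encode_def)

lemma small_inv_blocks_used: "small_inv s Q t e \<Longrightarrow> int (blocks_used s) \<le> 12 * e"
  using implements_blocks_used by (fastforce simp: small_inv_def small_state_def)

end

section \<open>Large blocks\<close>

locale large_programs = io_programs B for B :: nat +
  fixes bt :: nat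
begin

text \<open>
  Cell \<open>B + 1\<close> counts the records allocated so far, and queue \<open>i\<close> owns \<open>16 bt\<close> cells: its first elements
  are kept from \<open>front_cell i\<close> on, its last ones from \<open>rear_cell i\<close> on, and the three cells from
  \<open>info_cell i\<close> on hold the root of the tree of the remaining elements (\<open>0\<close> if there are none) and the
  lengths of the two buffers. Queue \<open>l\<close> is scratch space that turns an insertion into a catenation.
\<close>

definition front_cell :: "nat \<Rightarrow> nat" where "front_cell i = B + 2 + 16 * bt * i"
definition rear_cell :: "nat \<Rightarrow> nat" where "rear_cell i = front_cell i + 6 * bt"
definition info_cell :: "nat \<Rightarrow> nat" where "info_cell i = front_cell i + 10 * bt"

definition set_queue :: "nat \<Rightarrow> nat \<Rightarrow> nat \<Rightarrow> nat \<Rightarrow> prog \<Rightarrow> prog" where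
  "set_queue i g h t p = SetNum (info_cell i) g (SetNum (info_cell i + 1) h (SetNum (info_cell i + 2) t p))"

definition get_queue :: "nat \<Rightarrow> (nat \<Rightarrow> nat \<Rightarrow> nat \<Rightarrow> prog) \<Rightarrow> prog" where
  "get_queue i k =
    CaseNum (info_cell i) (\<lambda>g. CaseNum (info_cell i + 1) (\<lambda>h. CaseNum (info_cell i + 2) (\<lambda>t. k g h t)))"

definition finish :: "nat \<Rightarrow> nat \<Rightarrow> nat \<Rightarrow> nat \<Rightarrow> nat \<Rightarrow> prog" where
  "finish i g h t a = set_queue i g h t (SetNum (B + 1) a Halt)"

definition flush :: "nat \<Rightarrow> nat \<Rightarrow> nat \<Rightarrow> (nat \<Rightarrow> nat \<Rightarrow> prog) \<Rightarrow> prog" where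
  "flush c n a k =
    (if n \<le> 2 * bt then store_record c n (Suc a) (k (Suc a) (Suc a))
     else store_record c (n div 2) (Suc a) (store_record (c + n div 2) (n - n div 2) (Suc (Suc a))
       (join_prog (Suc a) (Suc (Suc a)) (\<lambda>g. k g (Suc (Suc a))))))"

definition push :: "nat \<Rightarrow> nat \<Rightarrow> nat \<Rightarrow> nat \<Rightarrow> nat \<Rightarrow> (nat \<Rightarrow> nat \<Rightarrow> prog) \<Rightarrow> prog" where
  "push g c n g' a k = flush c n a (\<lambda>r a. join_prog g r (\<lambda>g. join_prog g g' (\<lambda>g. k g a)))"

definition replace_prog :: "nat \<Rightarrow> nat \<Rightarrow> nat \<Rightarrow> nat \<Rightarrow> nat \<Rightarrow> nat \<Rightarrow> prog" where
  "replace_prog i j g' h' t' a = copy_cells (front_cell j) (front_cell i) h'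
    (copy_cells (rear_cell j) (rear_cell i) t' (finish i g' h' t' a))"

definition extend_front_prog :: "nat \<Rightarrow> nat \<Rightarrow> nat \<Rightarrow> nat \<Rightarrow> nat \<Rightarrow> nat \<Rightarrow> nat \<Rightarrow> prog" where
  "extend_front_prog i j h g' h' t' a = copy_cells (front_cell j) (front_cell i + h) h'
    (copy_cells (rear_cell j) (rear_cell i) t'
      (if h + h' \<le> 3 * bt then finish i g' (h + h') t' a
       else push 0 (front_cell i + 2 * bt) (h + h' - 2 * bt) g' a (\<lambda>g a. finish i g (2 * bt) t' a)))"

definition extend_rear_prog :: "nat \<Rightarrow> nat \<Rightarrow> nat \<Rightarrow> nat \<Rightarrow> nat \<Rightarrow> nat \<Rightarrow> nat \<Rightarrow> nat \<Rightarrow> prog" where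
  "extend_rear_prog i j g h n g' t' a =
    (let k = (\<lambda>g a. copy_cells (rear_cell j) (rear_cell i) t' (finish i g h t' a))
     in if bt \<le> n then push g (rear_cell i) n g' a k
        else if g' = 0 then finish i g h n a
        else get_field g' size_field (\<lambda>s. load_record g' (rear_cell i + n) s
          (pop_prog g' (\<lambda>g'. push g (rear_cell i) (n + s) g' a k))))"

definition catenate_queues :: "nat \<Rightarrow> nat \<Rightarrow> nat \<Rightarrow> nat \<Rightarrow> nat \<Rightarrow> nat \<Rightarrow> nat \<Rightarrow> nat \<Rightarrow> nat \<Rightarrow> prog" where
  "catenate_queues i j g h t g' h' t' a =
    count_less (front_cell i) (front_cell j) h 0 (\<lambda>h.
      if h = 0 then replace_prog i j g' h' t' a
      else if g = 0 then extend_front_prog i j h g' h' t' a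
      else count_less (rear_cell i) (front_cell j) t 0 (\<lambda>t.
        copy_cells (front_cell j) (rear_cell i + t) h' (extend_rear_prog i j g h (t + h') g' t' a)))"

definition trim_prog :: "nat \<Rightarrow> nat \<Rightarrow> nat \<Rightarrow> nat \<Rightarrow> (nat \<Rightarrow> prog) \<Rightarrow> prog" where
  "trim_prog t c d n k = (if t = 0 then k n else count_less c d n 0 k)"

definition next_record_prog :: "nat \<Rightarrow> nat \<Rightarrow> nat \<Rightarrow> nat \<Rightarrow> nat \<Rightarrow> prog" where
  "next_record_prog i g m t a = pop_prog g (\<lambda>g.
    if g = 0 then copy_cells (rear_cell i) (front_cell i + m) t (finish i 0 (m + t) 0 a)
    else load_record g (rear_cell i + 2 * bt) 1
      (count_less (front_cell i) (rear_cell i + 2 * bt) m 0 (\<lambda>m. finish i g m t a)))"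

definition refill_prog :: "nat \<Rightarrow> nat \<Rightarrow> nat \<Rightarrow> nat \<Rightarrow> prog" where
  "refill_prog i g t a = get_field g size_field (\<lambda>n. load_record g (front_cell i) n
    (trim_prog t (front_cell i) (rear_cell i) n (\<lambda>m.
      if m = 0 then copy_cells (rear_cell i) (front_cell i) t (finish i 0 t 0 a)
      else next_record_prog i g m t a)))"

definition drop_first :: "nat \<Rightarrow> nat \<Rightarrow> nat \<Rightarrow> nat \<Rightarrow> nat \<Rightarrow> prog" where
  "drop_first i g h t a =
    (if 2 \<le> h then copy_cells (front_cell i + 1) (front_cell i) (h - 1) (finish i g (h - 1) t a)
     else if g = 0 then finish i 0 0 0 a
     else refill_prog i g t a)"

definition large_impl :: "nat \<Rightarrow> cpqa_impl" where
  "large_impl l = \<lparr>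
     find_min_prog = (\<lambda>i. Output (front_cell i) Halt),
     delete_min_prog = (\<lambda>i. Output (front_cell i)
       (get_queue i (\<lambda>g h t. CaseNum (B + 1) (\<lambda>a. drop_first i g h t a)))),
     catenate_prog = (\<lambda>i j. get_queue i (\<lambda>g h t. get_queue j (\<lambda>g' h' t'. CaseNum (B + 1) (\<lambda>a.
       if h' = 0 then Halt else set_queue j 0 0 0 (catenate_queues i j g h t g' h' t' a))))),
     insert_prog = (\<lambda>i. GetArg (front_cell l) (get_queue i (\<lambda>g h t. CaseNum (B + 1) (\<lambda>a.
       catenate_queues i l g h t 0 1 0 a))))\<rparr>"

definition in_zone :: "nat \<Rightarrow> nat \<Rightarrow> bool" where
  "in_zone i x \<longleftrightarrow> front_cell i \<le> x \<and> x < front_cell i + 16 * bt"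

lemma cell_eqs: "rear_cell i = front_cell i + 6 * bt" "info_cell i = front_cell i + 10 * bt"
  by (simp_all add: rear_cell_def info_cell_def)

lemma front_cell_gt: "B + 1 < front_cell i"
  by (simp add: front_cell_def)

lemma zones_ordered:
  assumes "i < k"
  shows "front_cell i + 16 * bt \<le> front_cell k"
proof -
  have "16 * bt * Suc i \<le> 16 * bt * k" using assms by (intro mult_le_mono2) simp
  then show ?thesis by (simp add: front_cell_def)
qed

lemma zones_disjoint: "i \<noteq> k \<Longrightarrow> in_zone i x \<Longrightarrow> \<not> in_zone k x"
  using zones_ordered[of i k] zones_ordered[of k i] by (cases "i < k") (auto simp: in_zone_def)

definition same_outside :: "nat \<Rightarrow> (nat \<Rightarrow> 'a word) \<Rightarrow> (nat \<Rightarrow> 'a word) \<Rightarrow> bool" where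
  "same_outside i m m' \<longleftrightarrow> (\<forall>x. \<not> in_zone i x \<longrightarrow> m' x = m x)"

lemma same_outside_refl [simp]: "same_outside i m m"
  by (simp add: same_outside_def)

lemma same_outside_put:
  "same_outside i m m' \<Longrightarrow> front_cell i \<le> c \<Longrightarrow> c + length xs \<le> front_cell i + 16 * bt \<Longrightarrow>
    same_outside i m (put m' c xs)"
  by (auto simp: same_outside_def in_zone_def put_def)

end

subsection \<open>Queues and their potential\<close>

datatype 'a queue = Queue (front: "'a list") (middle: "'a rtree option") (rear: "'a list")

abbreviation empty_queue :: "'a queue" where
  "empty_queue \<equiv> Queue [] None []"

definition queue_elems :: "'a queue \<Rightarrow> 'a list" where
  "queue_elems x = front x @ elems_of (middle x) @ rear x"

definition buffered :: "'a queue \<Rightarrow> nat" where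
  "buffered x = length (front x) + length (rear x)"

definition trees :: "(nat \<Rightarrow> 'a queue) \<Rightarrow> nat \<Rightarrow> 'a rtree option" where
  "trees q = middle \<circ> q"

lemma trees_simps [simp]: "trees q k = middle (q k)" "trees (q(i := x)) = (trees q)(i := middle x)"
  by (simp_all add: trees_def fun_eq_iff)

locale large_blocks = io_machine B M W arg + large_programs B bt
  for B M W bt :: nat and arg :: "'a::linorder option" +
  fixes l N :: nat
  assumes bt: "1 \<le> bt" "2 * bt \<le> B" and memory: "B + 2 + 16 * bt * (l + 1) \<le> M" and memory_word: "M \<le> W"
    and word_ge: "16 * (2 * N + 2) + 15 \<le> W"
begin

lemma front_cell_le: "i \<le> l \<Longrightarrow> front_cell i + 16 * bt \<le> M"
proof -
  assume "i \<le> l"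
  then have "16 * bt * Suc i \<le> 16 * bt * (l + 1)" by (intro mult_le_mono2) simp
  then have "16 * bt * i + 16 * bt \<le> 16 * bt * (l + 1)" by simp
  then show ?thesis using memory unfolding front_cell_def by linarith
qed

definition records_bounded :: "'a view \<Rightarrow> nat \<Rightarrow> bool" where
  "records_bounded st a \<longleftrightarrow> finite (vaddrs st) \<and> (\<forall>x\<in>vaddrs st. x \<le> a \<and> bt \<le> length (velems st x) \<and>
     length (velems st x) \<le> 2 * bt \<and> sorted_wrt (<) (velems st x))"

definition disk_size :: "'a view \<Rightarrow> nat" where
  "disk_size st = (\<Sum>x\<in>vaddrs st. length (velems st x))"

definition queue_ok :: "'a queue \<Rightarrow> bool" where
  "queue_ok x \<longleftrightarrow> sorted_wrt (<) (front x) \<and> sorted_wrt (<) (rear x) \<and>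
     (\<forall>y\<in>set (front x). \<forall>z\<in>set (elems_of (middle x)) \<union> set (rear x). y < z) \<and>
     length (front x) \<le> 3 * bt \<and> length (rear x) < bt \<and>
     (middle x = None \<longrightarrow> rear x = []) \<and> (front x = [] \<longrightarrow> middle x = None)"

definition queue_potential :: "'a queue \<Rightarrow> nat" where
  "queue_potential x =
    (if middle x = None then length (front x) else 2 * bt + length (rear x) + (length (front x) - 2 * bt))"

definition queue_mem :: "(nat \<Rightarrow> 'a word) \<Rightarrow> nat \<Rightarrow> 'a queue \<Rightarrow> bool" where
  "queue_mem m i x \<longleftrightarrow> holds m (front_cell i) (front x) \<and> holds m (rear_cell i) (rear x) \<and>
     m (info_cell i) = Num (root_of (middle x)) \<and> m (info_cell i + 1) = Num (length (front x)) \<and>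
     m (info_cell i + 2) = Num (length (rear x))"

definition large_state :: "'a view \<Rightarrow> (nat \<Rightarrow> 'a queue) \<Rightarrow> nat \<Rightarrow> bool" where
  "large_state st q a \<longleftrightarrow> forest st (trees q) \<and> (\<forall>k\<ge>l. q k = empty_queue) \<and> records_bounded st a \<and>
     vmem st (B + 1) = Num a \<and> (\<forall>k\<le>l. queue_mem (vmem st) k (q k) \<and> queue_ok (q k))"

text \<open>
  \<open>finished\<close> describes the final configuration of an operation that changes only queue \<open>i\<close>: \<open>S\<close> is the
  resulting queue, \<open>E\<close> and \<open>\<phi>\<close> bound the contributions of the disk and of queue \<open>i\<close> to the number of
  stored elements and to the potential.
\<close>

definition finished :: "nat \<Rightarrow> (nat \<Rightarrow> 'a queue) \<Rightarrow> 'a set \<Rightarrow> int \<Rightarrow> nat \<Rightarrow> 'a option \<Rightarrow> int \<Rightarrow> 'a config \<Rightarrow> bool" where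
  "finished i q S E A r \<phi> s \<longleftrightarrow> (\<exists>st x a. implements s st \<and> large_state st (q(i := x)) a \<and> a \<le> A \<and>
     survivors (queue_elems x) = S \<and> int (disk_size st + buffered x) \<le> E \<and>
     int (300 * bt * card (vaddrs st) + 900 * queue_potential x) \<le> \<phi> \<and> result s = r)"

definition paid :: "prog \<Rightarrow> 'a view \<Rightarrow> int \<Rightarrow> (int \<Rightarrow> 'a config \<Rightarrow> bool) \<Rightarrow> bool" where
  "paid p st \<phi> G \<longleftrightarrow> (\<exists>n\<le>300. runs p st n (G (\<phi> - int (n * bt))))"

lemma paid_free: "runs p st 0 (G \<phi>) \<Longrightarrow> paid p st \<phi> G"
  unfolding paid_def by (intro exI[of _ 0]) simp

lemma paid_full: "runs p st n (G (\<phi> - 300 * int bt)) \<Longrightarrow> n \<le> 300 \<Longrightarrow> paid p st \<phi> G"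
  unfolding paid_def by (intro exI[of _ 300]) (auto intro: runs_mono)

lemma paid_step:
  assumes "paid p st' \<phi> G"
    and "\<And>n. runs p st' n (G (\<phi> - int (n * bt))) \<Longrightarrow> runs p' st n (G (\<phi> - int (n * bt)))"
  shows "paid p' st \<phi> G"
  using assms unfolding paid_def by blast

lemma queue_mem_frame:
  assumes mem: "queue_mem m k x" and ok: "queue_ok x" and same: "\<And>c. in_zone k c \<Longrightarrow> m' c = m c"
  shows "queue_mem m' k x"
proof -
  have "length (front x) \<le> 3 * bt" "length (rear x) < bt" using ok by (auto simp: queue_ok_def)
  then have "holds m' (front_cell k) (front x) = holds m (front_cell k) (front x)"
    "holds m' (rear_cell k) (rear x) = holds m (rear_cell k) (rear x)"
    by (rule_tac[!] holds_cong, rule_tac[!] same) (simp_all add: in_zone_def cell_eqs)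
  moreover have "in_zone k (info_cell k)" "in_zone k (info_cell k + 1)" "in_zone k (info_cell k + 2)"
    using bt by (simp_all add: in_zone_def cell_eqs)
  ultimately show ?thesis using mem same by (simp add: queue_mem_def)
qed

lemma runs_set_queue:
  assumes "i \<le> l" "g \<le> W" "h \<le> W" "t \<le> W"
    and "runs p (st\<lparr>vmem := (vmem st)(info_cell i := Num g, info_cell i + 1 := Num h, info_cell i + 2 := Num t)\<rparr>) n Q"
  shows "runs (set_queue i g h t p) st n Q"
  unfolding set_queue_def using assms front_cell_le[OF assms(1)] front_cell_gt[of i] bt
  by (intro runs_SetNum) (simp_all add: cell_eqs)

lemma runs_get_queue:
  assumes "i \<le> l" "queue_mem (vmem st) i x"
    and "runs (k (root_of (middle x)) (length (front x)) (length (rear x))) st n Q"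
  shows "runs (get_queue i k) st n Q"
  unfolding get_queue_def using assms front_cell_le[OF assms(1)] front_cell_gt[of i] bt
  by (intro runs_CaseNum) (auto simp: cell_eqs queue_mem_def)

lemma records_bounded_view [simp]:
  "records_bounded (st\<lparr>vfields := fd\<rparr>) a = records_bounded st a" "disk_size (st\<lparr>vfields := fd\<rparr>) = disk_size st"
  "records_bounded (st\<lparr>vmem := m\<rparr>) a = records_bounded st a" "disk_size (st\<lparr>vmem := m\<rparr>) = disk_size st"
  "records_bounded (st\<lparr>vresult := x\<rparr>) a = records_bounded st a" "disk_size (st\<lparr>vresult := x\<rparr>) = disk_size st"
  by (simp_all add: records_bounded_def disk_size_def)

lemma large_state_vresult [simp]: "large_state (st\<lparr>vresult := x\<rparr>) q a = large_state st q a"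
  by (simp add: large_state_def)

lemma records_bounded_free:
  assumes bounded: "records_bounded st a" and x: "x \<in> vaddrs st"
  shows "records_bounded (st\<lparr>vaddrs := vaddrs st - {x}, vfields := fd\<rparr>) a"
    "disk_size (st\<lparr>vaddrs := vaddrs st - {x}, vfields := fd\<rparr>) + length (velems st x) = disk_size st"
    "Suc (card (vaddrs st - {x})) = card (vaddrs st)"
proof -
  have finite: "finite (vaddrs st)" using bounded by (simp add: records_bounded_def)
  show "records_bounded (st\<lparr>vaddrs := vaddrs st - {x}, vfields := fd\<rparr>) a"
    using bounded by (simp add: records_bounded_def)
  show "disk_size (st\<lparr>vaddrs := vaddrs st - {x}, vfields := fd\<rparr>) + length (velems st x) = disk_size st"
    using sum.remove[OF finite x, of "\<lambda>x. length (velems st x)"] by (simp add: disk_size_def)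
  show "Suc (card (vaddrs st - {x})) = card (vaddrs st)" by (rule card.remove[OF finite x, symmetric])
qed

lemma records_bounded_add:
  assumes bounded: "records_bounded st a" and xs: "bt \<le> length xs" "length xs \<le> 2 * bt" "sorted_wrt (<) xs"
  shows "Suc a \<notin> vaddrs st" "records_bounded (add_record st (Suc a) xs) (Suc a)"
    "disk_size (add_record st (Suc a) xs) = disk_size st + length xs"
    "card (vaddrs (add_record st (Suc a) xs)) = Suc (card (vaddrs st))"
proof -
  show new: "Suc a \<notin> vaddrs st" using bounded by (auto simp: records_bounded_def)
  show "records_bounded (add_record st (Suc a) xs) (Suc a)"
    using bounded xs by (auto simp: records_bounded_def add_record_def)
  have "(\<Sum>x\<in>vaddrs st. length (((velems st)(Suc a := xs)) x)) = disk_size st"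
    unfolding disk_size_def by (rule sum.cong) (use new in auto)
  moreover have "disk_size (add_record st (Suc a) xs) =
      (\<Sum>x\<in>insert (Suc a) (vaddrs st). length (((velems st)(Suc a := xs)) x))"
    by (simp add: disk_size_def add_record_def)
  ultimately show "disk_size (add_record st (Suc a) xs) = disk_size st + length xs"
    using bounded new by (simp add: records_bounded_def)
  show "card (vaddrs (add_record st (Suc a) xs)) = Suc (card (vaddrs st))"
    using bounded new by (simp add: add_record_def records_bounded_def)
qed

subsection \<open>Moving a buffer into a tree\<close>

definition grown :: "'a view \<Rightarrow> 'a view \<Rightarrow> nat \<Rightarrow> nat \<Rightarrow> nat \<Rightarrow> bool" where
  "grown st st' n a a' \<longleftrightarrow> vmem st' = vmem st \<and> vresult st' = vresult st \<and> records_bounded st' a' \<and> a' \<le> a + 2 \<and>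
     disk_size st' = disk_size st + n \<and> card (vaddrs st') \<le> card (vaddrs st) + 2"

lemma grown_vfields [simp]: "grown st (st'\<lparr>vfields := fd\<rparr>) n a a' = grown st st' n a a'"
  by (simp add: grown_def)

lemma forest_store_record:
  assumes forest: "forest st tr" and bounded: "records_bounded st a"
    and xs: "bt \<le> length xs" "length xs \<le> 2 * bt" "sorted_wrt (<) xs" and word: "16 * Suc a + 15 \<le> W"
  shows "forest (add_record st (Suc a) xs) (tr(i := Some (leaf (Suc a) xs)))"
proof (rule forest_add_record[OF forest records_bounded_add(1)[OF bounded xs]])
  have "xs \<noteq> []" using xs(1) bt(1) by auto
  then show "min_first (Suc a, xs)" using sorted_wrt_hd_le[OF xs(3)] by (simp add: min_first_def)
qed (use word in simp_all)

lemma runs_store_sorted: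
  assumes xs: "bt \<le> length xs" "length xs \<le> 2 * bt" "sorted_wrt (<) xs" and mem: "holds (vmem st) c xs"
    and c: "B < c" "c + length xs \<le> M" and bounded: "records_bounded st a" and word: "16 * Suc a + 15 \<le> W"
    and cont: "runs p (add_record st (Suc a) xs) n Q"
  shows "runs (store_record c (length xs) (Suc a) p) st (n + 12) Q"
proof (rule runs_store_record[OF mem refl])
  show "xs \<noteq> []" using xs(1) bt(1) by auto
  show "length xs \<le> B" "length xs \<le> W" using xs(2) bt two_blocks memory_word by linarith+
qed (use c word cont records_bounded_add(1)[OF bounded xs] in auto)

lemma runs_flush_two_records:
  assumes forest: "forest st tr" and temp: "tr (l + 3) = None" and mem: "holds (vmem st) c (xs @ ys)"
    and xs: "bt \<le> length xs" "length xs \<le> 2 * bt" "sorted_wrt (<) xs"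
    and ys: "bt \<le> length ys" "length ys \<le> 2 * bt" "sorted_wrt (<) ys"
    and c: "B < c" "c + length xs + length ys \<le> M"
    and bounded: "records_bounded st a" and word: "16 * (a + 2) + 15 \<le> W"
    and cont: "\<And>st' t a'. forest st' (tr(l + 2 := t)) \<Longrightarrow> survivors (elems_of t) = survivors (xs @ ys) \<Longrightarrow>
      grown st st' (length xs + length ys) a a' \<Longrightarrow> runs (k (root_of t) a') st' m Q"
  shows "runs (store_record c (length xs) (Suc a) (store_record (c + length xs) (length ys) (Suc (Suc a))
    (join_prog (Suc a) (Suc (Suc a)) (\<lambda>g. k g (Suc (Suc a)))))) st (m + 84) Q"
proof -
  let ?st1 = "add_record st (Suc a) xs"
  let ?st2 = "add_record ?st1 (Suc (Suc a)) ys"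
  let ?tr1 = "tr(l + 2 := Some (leaf (Suc a) xs))"
  let ?tr2 = "?tr1(l + 3 := Some (leaf (Suc (Suc a)) ys))"
  note added1 = records_bounded_add[OF bounded xs]
  note added2 = records_bounded_add[OF added1(2) ys]
  have "forest ?st1 ?tr1" by (rule forest_store_record[OF forest bounded xs]) (use word in simp)
  then have forest2: "forest ?st2 ?tr2" by (rule forest_store_record[OF _ added1(2) ys]) (use word in simp)
  have "runs (join_prog (root_of (?tr2 (l + 2))) (root_of (?tr2 (l + 3))) (\<lambda>g. k g (Suc (Suc a)))) ?st2 (m + 60) Q"
  proof (rule runs_join_prog[OF forest2])
    fix fd' t
    assume joined: "forest (?st2\<lparr>vfields := fd'\<rparr>) (?tr2(l + 2 := t, l + 3 := None))"
      "survivors (elems_of t) = survivors (elems_of (?tr2 (l + 2)) @ elems_of (?tr2 (l + 3)))"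
    show "runs (k (root_of t) (Suc (Suc a))) (?st2\<lparr>vfields := fd'\<rparr>) m Q"
    proof (rule cont)
      have "?tr2(l + 2 := t, l + 3 := None) = tr(l + 2 := t)" using temp by (auto simp: fun_eq_iff)
      with joined(1) show "forest (?st2\<lparr>vfields := fd'\<rparr>) (tr(l + 2 := t))" by simp
      show "survivors (elems_of t) = survivors (xs @ ys)" using joined(2) by simp
      show "grown st (?st2\<lparr>vfields := fd'\<rparr>) (length xs + length ys) a (Suc (Suc a))"
        using added1(3,4) added2(2-4) by (simp add: grown_def) (simp add: add_record_def)
    qed
  qed simp
  then have "runs (join_prog (Suc a) (Suc (Suc a)) (\<lambda>g. k g (Suc (Suc a)))) ?st2 (m + 60) Q" by simp
  then have "runs (store_record (c + length xs) (length ys) (Suc (Suc a))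
      (join_prog (Suc a) (Suc (Suc a)) (\<lambda>g. k g (Suc (Suc a))))) ?st1 (m + 60 + 12) Q"
    by (rule runs_store_sorted[rotated -1, OF _ ys])
      (use mem c word added1(2) in \<open>simp_all add: holds_append add_record_def\<close>)
  then have "runs (store_record c (length xs) (Suc a) (store_record (c + length xs) (length ys) (Suc (Suc a))
      (join_prog (Suc a) (Suc (Suc a)) (\<lambda>g. k g (Suc (Suc a)))))) st (m + 60 + 12 + 12) Q"
    by (rule runs_store_sorted[rotated -1, OF _ xs]) (use mem c word bounded in \<open>simp_all add: holds_append\<close>)
  then show ?thesis by (rule runs_mono) simp
qed

lemma runs_flush:
  assumes forest: "forest st tr" and temp: "tr (l + 3) = None" and mem: "holds (vmem st) c xs"
    and xs: "sorted_wrt (<) xs" "length xs = n" "bt \<le> n" "n \<le> 4 * bt" and c: "B < c" "c + n \<le> M"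
    and bounded: "records_bounded st a" and word: "16 * (a + 2) + 15 \<le> W"
    and cont: "\<And>st' t a'. forest st' (tr(l + 2 := t)) \<Longrightarrow> survivors (elems_of t) = survivors xs \<Longrightarrow>
      grown st st' n a a' \<Longrightarrow> runs (k (root_of t) a') st' m Q"
  shows "runs (flush c n a k) st (m + 84) Q"
proof (cases "n \<le> 2 * bt")
  case True
  note xs' = xs(3)[folded xs(2)] True[folded xs(2)] xs(1)
  let ?st = "add_record st (Suc a) xs"
  have "runs (k (root_of (Some (leaf (Suc a) xs))) (Suc a)) ?st m Q"
  proof (rule cont)
    show "forest ?st (tr(l + 2 := Some (leaf (Suc a) xs)))"
      by (rule forest_store_record[OF forest bounded xs']) (use word in simp)
    show "grown st ?st n a (Suc a)"
      using records_bounded_add(2-4)[OF bounded xs'] xs(2) by (simp add: grown_def) (simp add: add_record_def)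
  qed simp
  then have "runs (store_record c n (Suc a) (k (Suc a) (Suc a))) st (m + 12) Q"
    unfolding xs(2)[symmetric] by (intro runs_store_sorted[OF xs' mem]) (use c word bounded xs(2) in simp_all)
  then have "runs (store_record c n (Suc a) (k (Suc a) (Suc a))) st (m + 84) Q" by (rule runs_mono) simp
  then show ?thesis using True by (simp add: flush_def)
next
  case False
  define ys zs where "ys = take (n div 2) xs" and "zs = drop (n div 2) xs"
  have split: "ys @ zs = xs" "length ys = n div 2" "length zs = n - n div 2"
    using xs(2) by (auto simp: ys_def zs_def)
  have sorted: "sorted_wrt (<) ys" "sorted_wrt (<) zs" using xs(1)
    unfolding split(1)[symmetric] sorted_wrt_append by auto
  have "runs (store_record c (length ys) (Suc a) (store_record (c + length ys) (length zs) (Suc (Suc a))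
      (join_prog (Suc a) (Suc (Suc a)) (\<lambda>g. k g (Suc (Suc a)))))) st (m + 84) Q"
  proof (rule runs_flush_two_records[OF forest temp])
    show "holds (vmem st) c (ys @ zs)" using mem split(1) by simp
    fix st' t a'
    assume "forest st' (tr(l + 2 := t))" "survivors (elems_of t) = survivors (ys @ zs)"
      "grown st st' (length ys + length zs) a a'"
    then show "runs (k (root_of t) a') st' m Q" using split by (intro cont) auto
  qed (use False xs(4) c bounded word sorted split(2,3) in auto)
  then show ?thesis unfolding split(2,3) flush_def using False by simp
qed

lemma runs_push:
  assumes forest: "forest st tr" and i: "i \<le> l" and temp: "tr (l + 2) = None" "tr (l + 3) = None"
    and mem: "holds (vmem st) c xs" and xs: "sorted_wrt (<) xs" "length xs = n" "bt \<le> n" "n \<le> 4 * bt"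
    and c: "B < c" "c + n \<le> M" and bounded: "records_bounded st a" and word: "16 * (a + 2) + 15 \<le> W"
    and cont: "\<And>st' t a'. forest st' (tr(i := t, l + 1 := None)) \<Longrightarrow>
      survivors (elems_of t) = survivors (elems_of (tr i) @ xs @ elems_of (tr (l + 1))) \<Longrightarrow>
      grown st st' n a a' \<Longrightarrow> runs (k (root_of t) a') st' m Q"
  shows "runs (push (root_of (tr i)) c n (root_of (tr (l + 1))) a k) st (m + 204) Q"
proof -
  have "runs (push (root_of (tr i)) c n (root_of (tr (l + 1))) a k) st (m + 60 + 60 + 84) Q"
    unfolding push_def
  proof (rule runs_flush[OF forest temp(2) mem xs c bounded word])
    fix st' t a'
    let ?tr = "tr(l + 2 := t)"
    assume flushed: "forest st' ?tr" "survivors (elems_of t) = survivors xs" "grown st st' n a a'"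
    have "runs (join_prog (root_of (?tr i)) (root_of (?tr (l + 2))) (\<lambda>g. join_prog g (root_of (tr (l + 1))) (\<lambda>g. k g a')))
        st' (m + 60 + 60) Q"
    proof (rule runs_join_prog[OF flushed(1)])
      fix fd1 t1
      let ?tr1 = "?tr(i := t1, l + 2 := None)"
      assume joined1: "forest (st'\<lparr>vfields := fd1\<rparr>) ?tr1"
        "survivors (elems_of t1) = survivors (elems_of (?tr i) @ elems_of (?tr (l + 2)))"
      have tr1: "?tr1 = tr(i := t1)" using temp(1) i by (auto simp: fun_eq_iff)
      have "runs (join_prog (root_of (?tr1 i)) (root_of (?tr1 (l + 1))) (\<lambda>g. k g a')) (st'\<lparr>vfields := fd1\<rparr>) (m + 60) Q"
      proof (rule runs_join_prog[OF joined1(1)])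
        fix fd2 t2
        assume joined2: "forest (st'\<lparr>vfields := fd1, vfields := fd2\<rparr>) (?tr1(i := t2, l + 1 := None))"
          "survivors (elems_of t2) = survivors (elems_of (?tr1 i) @ elems_of (?tr1 (l + 1)))"
        have "survivors (elems_of t1) = survivors (elems_of (tr i) @ xs)"
          using joined1(2) flushed(2) i by (simp add: survivors_append)
        from survivors_append_cong[OF this refl]
        have "survivors (elems_of t2) = survivors ((elems_of (tr i) @ xs) @ elems_of (tr (l + 1)))"
          using joined2(2) i by simp
        then show "runs (k (root_of t2) a') (st'\<lparr>vfields := fd1, vfields := fd2\<rparr>) m Q"
          using joined2(1) flushed(3) unfolding tr1 by (intro cont) simp_all
      qed (use i in simp)
      then show "runs (join_prog (root_of t1) (root_of (tr (l + 1))) (\<lambda>g. k g a')) (st'\<lparr>vfields := fd1\<rparr>) (m + 60) Q"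
        using i by simp
    qed (use i in simp)
    then show "runs (join_prog (root_of (tr i)) (root_of t) (\<lambda>g. join_prog g (root_of (tr (l + 1))) (\<lambda>g. k g a')))
        st' (m + 60 + 60) Q"
      using i by simp
  qed
  then show ?thesis by (rule runs_mono) simp
qed

end

subsection \<open>Changing one queue\<close>

lemma survivors_eq_less_iff:
  "survivors xs = survivors ys \<Longrightarrow> (\<forall>y\<in>set xs. x < y) \<longleftrightarrow> (\<forall>y\<in>set ys. x < y)"
  using less_survivors_iff[of xs x] less_survivors_iff[of ys x] by simp

locale queue_update = large_blocks B M W bt arg l N
  for B M W bt :: nat and arg :: "'a::linorder option" and l N :: nat +
  fixes i :: nat and q :: "nat \<Rightarrow> 'a queue" and st :: "'a view"
  assumes i: "i < l" and unused: "\<forall>k\<ge>l. q k = empty_queue"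
    and others: "\<And>k. k \<le> l \<Longrightarrow> k \<noteq> i \<Longrightarrow> queue_mem (vmem st) k (q k) \<and> queue_ok (q k)"
begin

lemma zone_i: "B + 1 < front_cell i" "front_cell i + 16 * bt \<le> M"
  using front_cell_gt front_cell_le[of i] i by auto

lemma large_state_finish:
  assumes forest: "forest st' ((trees q)(i := t))" and same: "same_outside i (vmem st) (vmem st')"
    and mem: "holds (vmem st') (front_cell i) H" "holds (vmem st') (rear_cell i) T"
    and ok: "queue_ok (Queue H t T)" and bounded: "records_bounded st' a"
  shows "large_state (st'\<lparr>vmem := (vmem st')(info_cell i := Num (root_of t), info_cell i + 1 := Num (length H),
      info_cell i + 2 := Num (length T), B + 1 := Num a)\<rparr>) (q(i := Queue H t T)) a"
proof -
  let ?m = "(vmem st')(info_cell i := Num (root_of t), info_cell i + 1 := Num (length H),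
      info_cell i + 2 := Num (length T), B + 1 := Num a)"
  have len: "length H \<le> 3 * bt" "length T < bt" using ok by (auto simp: queue_ok_def)
  have info: "in_zone i (info_cell i)" "in_zone i (info_cell i + 1)" "in_zone i (info_cell i + 2)"
    using bt by (simp_all add: in_zone_def cell_eqs)
  have "holds ?m (front_cell i) H = holds (vmem st') (front_cell i) H"
    "holds ?m (rear_cell i) T = holds (vmem st') (rear_cell i) T"
    by (rule holds_cong; use len zone_i in \<open>simp add: cell_eqs\<close>)+
  moreover have "B + 1 < info_cell i" using zone_i by (simp add: cell_eqs)
  ultimately have mem_i: "queue_mem ?m i (Queue H t T)" using mem by (simp add: queue_mem_def)
  have mem_k: "queue_mem ?m k (q k)" if k: "k \<le> l" "k \<noteq> i" for k
  proof (rule queue_mem_frame[of "vmem st"])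
    fix x assume x: "in_zone k x"
    then have "\<not> in_zone i x" using zones_disjoint[of k i] k by simp
    moreover from this have "x \<noteq> info_cell i" "x \<noteq> info_cell i + 1" "x \<noteq> info_cell i + 2" using info by auto
    moreover have "x \<noteq> B + 1" using x front_cell_gt[of k] by (auto simp: in_zone_def)
    ultimately show "?m x = vmem st x" using same by (simp add: same_outside_def)
  qed (use others[OF k] in auto)
  show ?thesis unfolding large_state_def
  proof (intro conjI allI impI)
    fix k assume "k \<le> l"
    then show "queue_mem (vmem (st'\<lparr>vmem := ?m\<rparr>)) k ((q(i := Queue H t T)) k)"
        "queue_ok ((q(i := Queue H t T)) k)"
      using mem_i mem_k[of k] ok others[of k] by (cases "k = i"; simp)+
  qed (use forest bounded unused i in auto)
qed

lemma runs_finish: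
  assumes forest: "forest st' ((trees q)(i := t))" and same: "same_outside i (vmem st) (vmem st')"
    and mem: "holds (vmem st') (front_cell i) H" "holds (vmem st') (rear_cell i) T"
    and ok: "queue_ok (Queue H t T)" and bounded: "records_bounded st' a" and a: "a \<le> A" "A \<le> W"
    and S: "survivors (H @ elems_of t @ T) = S" and E: "int (disk_size st' + length H + length T) \<le> E"
    and \<phi>: "int (300 * bt * card (vaddrs st') + 900 * queue_potential (Queue H t T)) \<le> \<phi>"
    and result: "vresult st' = r"
  shows "runs (finish i (root_of t) (length H) (length T) a) st' n (finished i q S E A r \<phi>)"
proof -
  let ?st = "st'\<lparr>vmem := (vmem st')(info_cell i := Num (root_of t), info_cell i + 1 := Num (length H),
      info_cell i + 2 := Num (length T), B + 1 := Num a)\<rparr>"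
  have "finished i q S E A r \<phi> s'" if "implements s' ?st" for s'
    unfolding finished_def
  proof (intro exI conjI)
    show "implements s' ?st" by fact
    show "large_state ?st (q(i := Queue H t T)) a" by (rule large_state_finish[OF forest same mem ok bounded])
    show "result s' = r" using that result by (simp add: implements_def)
  qed (use a S E \<phi> in \<open>simp_all add: queue_elems_def buffered_def add.assoc\<close>)
  then have halt: "runs Halt ?st n (finished i q S E A r \<phi>)" by (rule runs_Halt)
  have "length H \<le> 3 * bt" "length T < bt" using ok by (auto simp: queue_ok_def)
  moreover have "root_of t \<le> W" using root_of_le[OF forest, of i] by simp
  ultimately show ?thesis unfolding finish_def
    using i a zone_i memory_word bt two_blocks block_pos halt
    by (intro runs_set_queue runs_SetNum) simp_all
qed

subsection \<open>Catenation\<close>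

context
  fixes j a :: nat and t1 t2 :: "'a rtree option" and H1 T1 H2 T2 H1' T1' :: "'a list" and e :: 'a
    and S :: "'a set" and E \<phi> :: int
  assumes j: "j \<le> l" "i \<noteq> j" and queue_i: "q i = Queue H1 t1 T1"
    and forest: "forest st ((trees q)(l + 1 := t2))"
    and mem_i: "holds (vmem st) (front_cell i) H1" "holds (vmem st) (rear_cell i) T1"
    and mem_j: "holds (vmem st) (front_cell j) H2" "holds (vmem st) (rear_cell j) T2"
    and ok: "queue_ok (Queue H1 t1 T1)" "queue_ok (Queue H2 t2 T2)" and H2: "H2 \<noteq> []"
    and bounded: "records_bounded st a" and word: "16 * (a + 2) + 15 \<le> W"
    and e_eq: "e = hd H2"
    and trimmed_eq: "H1' = takeWhile (\<lambda>x. x < e) H1" "T1' = takeWhile (\<lambda>x. x < e) T1"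
    and S_eq: "S = survivors (H1 @ elems_of t1 @ T1 @ H2 @ elems_of t2 @ T2)"
    and E_eq: "E = int (disk_size st + length H1 + length T1 + length H2 + length T2)"
    and \<phi>_eq: "\<phi> = int (300 * bt * card (vaddrs st) +
      900 * (queue_potential (Queue H1 t1 T1) + queue_potential (Queue H2 t2 T2)))"
begin

abbreviation (input) "catenation_finished \<equiv> finished i q S E (a + 2) (vresult st)"

lemma zones_ij: "B + 1 < front_cell j" "front_cell j + 16 * bt \<le> M"
  "front_cell i + 16 * bt \<le> front_cell j \<or> front_cell j + 16 * bt \<le> front_cell i"
  using front_cell_gt front_cell_le[OF j(1)] zones_ordered[of i j] zones_ordered[of j i] j(2)
  by (auto simp: nat_neq_iff)

lemma catenation_lengths: "length H1 \<le> 3 * bt" "length T1 < bt" "length H2 \<le> 3 * bt" "length T2 < bt"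
  "length H1' \<le> length H1" "length T1' \<le> length T1"
  using ok by (auto simp: queue_ok_def trimmed_eq length_takeWhile_le)

lemma no_tree: "t1 = None \<Longrightarrow> T1 = []" "t2 = None \<Longrightarrow> T2 = []"
  using ok by (simp_all add: queue_ok_def)

lemma catenation_sorted: "sorted_wrt (<) H1" "sorted_wrt (<) T1" "sorted_wrt (<) H2" "sorted_wrt (<) T2"
    "sorted_wrt (<) H1'" "sorted_wrt (<) T1'"
  using ok sorted_wrt_takeWhile by (auto simp: queue_ok_def trimmed_eq)

lemma e_le: "y \<in> set H2 \<union> set (elems_of t2) \<union> set T2 \<Longrightarrow> e \<le> y"
  using ok(2) H2 sorted_wrt_hd_le[OF catenation_sorted(3)] by (auto simp: queue_ok_def e_eq intro: less_imp_le)

lemma catenation_trimmed_less: "x \<in> set H1' \<union> set T1' \<Longrightarrow> y \<in> set H2 \<union> set (elems_of t2) \<union> set T2 \<Longrightarrow> x < y"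
  using e_le[of y] by (auto simp: trimmed_eq dest!: set_takeWhileD)

lemma front_less: "x \<in> set H1' \<Longrightarrow> y \<in> set (elems_of t1 @ T1' @ H2 @ elems_of t2) \<union> set T2 \<Longrightarrow> x < y"
  using ok(1) catenation_trimmed_less[of x y] by (auto simp: queue_ok_def trimmed_eq dest!: set_takeWhileD)

lemma e_in: "e \<in> set H2"
  using H2 by (simp add: e_eq)

lemma catenation_survivors_trimmed: "S = survivors (H1' @ elems_of t1 @ T1' @ H2 @ elems_of t2 @ T2)"
proof -
  have "S = survivors (H1' @ elems_of t1 @ T1 @ H2 @ elems_of t2 @ T2)"
    unfolding S_eq trimmed_eq
    by (rule survivors_takeWhile_append[OF catenation_sorted(1), symmetric]) (simp add: e_in)
  moreover have "survivors (T1' @ H2 @ elems_of t2 @ T2) = survivors (T1 @ H2 @ elems_of t2 @ T2)"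
    unfolding trimmed_eq by (rule survivors_takeWhile_append[OF catenation_sorted(2)]) (simp add: e_in)
  ultimately show ?thesis by (simp add: survivors_append)
qed

lemma survivors_replaced:
  assumes "H1' = []"
  shows "S = survivors (H2 @ elems_of t2 @ T2)"
proof -
  have "e \<le> y" if "y \<in> set (H1 @ elems_of t1 @ T1)" for y
  proof (cases H1)
    case Nil
    then show ?thesis using that ok(1) by (auto simp: queue_ok_def)
  next
    case (Cons z zs)
    then have "e \<le> z" using assms by (auto simp: trimmed_eq split: if_splits)
    moreover have "z \<le> y" using that ok(1) Cons by (auto simp: queue_ok_def intro: less_imp_le)
    ultimately show ?thesis by simp
  qed
  then have "survivors ((H1 @ elems_of t1 @ T1) @ H2 @ elems_of t2 @ T2) = survivors (H2 @ elems_of t2 @ T2)"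
    by (intro survivors_append_attrited[of e]) (use e_in in auto)
  then show ?thesis by (simp add: S_eq)
qed

lemma forest_t2: "forest st ((trees q)(i := t2))"
proof -
  have "((trees q)(l + 1 := t2))(i := t2, l + 1 := None) = (trees q)(i := t2)"
    using unused i by (auto simp: fun_eq_iff)
  then show ?thesis using forest_move[OF forest, of i "l + 1"] i by simp
qed

lemma runs_replace_prog:
  assumes "H1' = []"
  shows "runs (replace_prog i j (root_of t2) (length H2) (length T2) a) st n (catenation_finished \<phi>)"
proof -
  let ?m1 = "put (vmem st) (front_cell i) H2"
  let ?m2 = "put ?m1 (rear_cell i) T2"
  have rear: "holds ?m1 (rear_cell j) T2"
    using mem_j(2) zones_ij catenation_lengths by (subst holds_put_other) (auto simp: cell_eqs)
  have front: "holds ?m2 (front_cell i) H2" using catenation_lengths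
    by (subst holds_put_other) (auto simp: cell_eqs)
  have "runs (finish i (root_of t2) (length H2) (length T2) a) (st\<lparr>vmem := ?m2\<rparr>) n (catenation_finished \<phi>)"
  proof (rule runs_finish)
    show "forest (st\<lparr>vmem := ?m2\<rparr>) ((trees q)(i := t2))" using forest_t2 by simp
    show "same_outside i (vmem st) (vmem (st\<lparr>vmem := ?m2\<rparr>))"
      using catenation_lengths by (simp, intro same_outside_put) (simp_all add: cell_eqs)
    show "survivors (H2 @ elems_of t2 @ T2) = S" using survivors_replaced[OF assms] by simp
  qed (use ok front bounded word E_eq \<phi>_eq in auto)
  then have "runs (copy_cells (rear_cell j) (rear_cell i) (length T2)
      (finish i (root_of t2) (length H2) (length T2) a)) (st\<lparr>vmem := ?m1\<rparr>) n (catenation_finished \<phi>)"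
    by (intro runs_copy_cells) (use rear zones_ij zone_i catenation_lengths in \<open>auto simp: cell_eqs\<close>)
  then show ?thesis unfolding replace_prog_def
    by (intro runs_copy_cells[OF mem_j(1)]) (use zones_ij zone_i catenation_lengths in auto)
qed

lemma runs_finish_pushed:
  assumes forest': "forest st' ((trees q)(i := t))" and t: "survivors (elems_of t) = survivors zs" "zs \<noteq> []"
    and same: "same_outside i (vmem st) (vmem st')" and result: "vresult st' = vresult st"
    and mem: "holds (vmem st') (front_cell i) F" "holds (vmem st') (rear_cell i) T2"
    and F: "sorted_wrt (<) F" "F \<noteq> []" "length F \<le> 3 * bt" "\<forall>x\<in>set F. \<forall>y\<in>set zs \<union> set T2. x < y"
    and S: "S = survivors (F @ zs @ T2)" and bounded': "records_bounded st' a'" "a' \<le> a + 2"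
    and size: "int (disk_size st' + length F + length T2) \<le> E"
    and card: "card (vaddrs st') \<le> card (vaddrs st) + 2"
    and pot: "2 * bt + length T2 + (length F - 2 * bt) + bt \<le>
      queue_potential (Queue H1 t1 T1) + queue_potential (Queue H2 t2 T2)"
  shows "runs (finish i (root_of t) (length F) (length T2) a') st' n (catenation_finished (\<phi> - 300 * int bt))"
proof (rule runs_finish[OF forest' same mem])
  have "elems_of t \<noteq> []" using t survivors_eq_empty_iff[of "elems_of t"] by auto
  then have t_some: "t \<noteq> None" by (metis elems_of_simps(1))
  have "\<forall>x\<in>set F. \<forall>y\<in>set (elems_of t) \<union> set T2. x < y" using F(4) survivors_eq_less_iff[OF t(1)]
    unfolding ball_Un by blast
  then show "queue_ok (Queue F t T2)" using F(1-3) ok(2) t_some by (auto simp: queue_ok_def)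
  show "survivors (F @ elems_of t @ T2) = S" unfolding S survivors_append t(1) ..
  have "300 * bt * card (vaddrs st') \<le> 300 * bt * (card (vaddrs st) + 2)" using card by (rule mult_le_mono2)
  also have "\<dots> = 300 * bt * card (vaddrs st) + 600 * bt" by (simp add: algebra_simps)
  finally have "300 * bt * card (vaddrs st') \<le> 300 * bt * card (vaddrs st) + 600 * bt" .
  moreover have "queue_potential (Queue F t T2) = 2 * bt + length T2 + (length F - 2 * bt)"
    using t_some by (auto simp: queue_potential_def)
  then have "queue_potential (Queue F t T2) + bt \<le>
      queue_potential (Queue H1 t1 T1) + queue_potential (Queue H2 t2 T2)" using pot by simp
  from mult_le_mono2[OF this, of 900] have "900 * queue_potential (Queue F t T2) + 900 * bt \<le>
      900 * (queue_potential (Queue H1 t1 T1) + queue_potential (Queue H2 t2 T2))" by (simp only: distrib_left)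
  ultimately have "300 * bt * card (vaddrs st') + 900 * queue_potential (Queue F t T2) + 300 * bt \<le>
      300 * bt * card (vaddrs st) + 900 * (queue_potential (Queue H1 t1 T1) + queue_potential (Queue H2 t2 T2))"
    by linarith
  then have "int (300 * bt * card (vaddrs st') + 900 * queue_potential (Queue F t T2) + 300 * bt) \<le> \<phi>"
    unfolding \<phi>_eq by (simp only: of_nat_le_iff)
  then show "int (300 * bt * card (vaddrs st') + 900 * queue_potential (Queue F t T2)) \<le> \<phi> - 300 * int bt"
    by simp
qed (use bounded' size result word in auto)

lemma runs_push_between:
  assumes forest': "forest st' ((trees q)(l + 1 := t))" and mem: "holds (vmem st') c xs"
    and xs: "sorted_wrt (<) xs" "length xs = n" "bt \<le> n" "n \<le> 4 * bt" and c: "B < c" "c + n \<le> M"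
    and bounded': "records_bounded st' a"
    and cont: "\<And>st'' t' a'. forest st'' ((trees q)(i := t')) \<Longrightarrow>
      survivors (elems_of t') = survivors (elems_of t1 @ xs @ elems_of t) \<Longrightarrow> grown st' st'' n a a' \<Longrightarrow>
      runs (k (root_of t') a') st'' m Q"
  shows "runs (push (root_of t1) c n (root_of t) a k) st' (m + 204) Q"
proof -
  let ?tr = "(trees q)(l + 1 := t)"
  have tr: "?tr i = t1" "?tr (l + 1) = t" using queue_i i by simp_all
  have "runs (push (root_of (?tr i)) c n (root_of (?tr (l + 1))) a k) st' (m + 204) Q"
  proof (rule runs_push[OF forest' _ _ _ mem xs c bounded' word])
    fix st'' t' a'
    assume pushed: "forest st'' (?tr(i := t', l + 1 := None))"
      "survivors (elems_of t') = survivors (elems_of (?tr i) @ xs @ elems_of (?tr (l + 1)))"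
      "grown st' st'' n a a'"
    have "?tr(i := t', l + 1 := None) = (trees q)(i := t')" using unused i by (auto simp: fun_eq_iff)
    then show "runs (k (root_of t') a') st'' m Q" using pushed tr by (intro cont) simp_all
  qed (use i unused in auto)
  then show ?thesis unfolding tr .
qed

lemma runs_finish_overflow:
  assumes t1: "t1 = None" and split: "F @ ys = H1' @ H2" "length F = 2 * bt" "ys \<noteq> []"
    and overflow: "3 * bt \<le> length F + length ys"
    and same: "same_outside i (vmem st) (vmem st1)" and result: "vresult st1 = vresult st"
    and mem: "holds (vmem st1) (front_cell i) F" "holds (vmem st1) (rear_cell i) T2"
    and grown: "grown st1 st' (length ys) a a'" and st1: "disk_size st1 = disk_size st" "vaddrs st1 = vaddrs st"
    and forest': "forest st' ((trees q)(i := t))" and t: "survivors (elems_of t) = survivors (ys @ elems_of t2)"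
  shows "runs (finish i (root_of t) (length F) (length T2) a') st' n (catenation_finished (\<phi> - 300 * int bt))"
proof (rule runs_finish_pushed[OF forest' t])
  have sorted': "sorted_wrt (<) (F @ ys)"
    unfolding split(1) sorted_wrt_append using catenation_sorted catenation_trimmed_less by auto
  then show "sorted_wrt (<) F" by (simp add: sorted_wrt_append)
  have "\<forall>x\<in>set F. \<forall>y\<in>set (elems_of t2) \<union> set T2. x < y"
  proof
    fix x assume "x \<in> set F"
    then have "x \<in> set H1' \<union> set H2" using split(1) by (metis UnCI set_append)
    then show "\<forall>y\<in>set (elems_of t2) \<union> set T2. x < y" using catenation_trimmed_less[of x] ok(2)
      by (auto simp: queue_ok_def)
  qed
  then show "\<forall>x\<in>set F. \<forall>y\<in>set (ys @ elems_of t2) \<union> set T2. x < y" using sorted'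
    by (auto simp: sorted_wrt_append)
  have "S = survivors ((H1' @ H2) @ elems_of t2 @ T2)" using catenation_survivors_trimmed t1 no_tree(1)
    by (simp add: trimmed_eq)
  then show "S = survivors (F @ (ys @ elems_of t2) @ T2)" unfolding split(1)[symmetric] by simp
  have len: "length F + length ys = length H1' + length H2" using arg_cong[OF split(1), of length] by simp
  then show "int (disk_size st' + length F + length T2) \<le> E"
    using grown st1(1) catenation_lengths(5) by (simp add: grown_def E_eq)
  show "2 * bt + length T2 + (length F - 2 * bt) + bt \<le>
      queue_potential (Queue H1 t1 T1) + queue_potential (Queue H2 t2 T2)"
    using len overflow catenation_lengths(5) split(2) t1 no_tree(2)
    by (cases t2) (auto simp: queue_potential_def)
qed (use same result mem grown st1 split bt in \<open>auto simp: grown_def\<close>)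

context
  fixes xs :: "'a list" and m1 :: "nat \<Rightarrow> 'a word" and st2 :: "'a view"
  assumes H1': "H1' \<noteq> []" and t1: "t1 = None" and xs_eq: "xs = H1' @ H2"
    and m1_eq: "m1 = put (vmem st) (front_cell i + length H1') H2"
    and st2_eq: "st2 = st\<lparr>vmem := put m1 (rear_cell i) T2\<rparr>"
begin

lemma extended_front:
  "holds m1 (rear_cell j) T2" "holds (vmem st2) (front_cell i) xs" "holds (vmem st2) (rear_cell i) T2"
  "same_outside i (vmem st) (vmem st2)" "sorted_wrt (<) xs"
  "\<forall>x\<in>set xs. \<forall>y\<in>set (elems_of t2) \<union> set T2. x < y"
proof -
  show "holds m1 (rear_cell j) T2"
    using mem_j(2) zones_ij catenation_lengths unfolding m1_eq by (subst holds_put_other) (auto simp: cell_eqs)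
  have "holds (vmem st) (front_cell i) H1'" unfolding trimmed_eq by (rule holds_takeWhile[OF mem_i(1)])
  then have "holds m1 (front_cell i) xs"
    unfolding m1_eq xs_eq holds_append by (subst holds_put_other) auto
  then show "holds (vmem st2) (front_cell i) xs"
    using catenation_lengths unfolding st2_eq by (simp, subst holds_put_other) (auto simp: xs_eq cell_eqs)
  show "holds (vmem st2) (rear_cell i) T2" by (simp add: st2_eq)
  show "same_outside i (vmem st) (vmem st2)"
    using catenation_lengths unfolding st2_eq m1_eq by (simp, intro same_outside_put) (simp_all add: cell_eqs)
  show "sorted_wrt (<) xs"
    unfolding xs_eq sorted_wrt_append using catenation_sorted catenation_trimmed_less by auto
  show "\<forall>x\<in>set xs. \<forall>y\<in>set (elems_of t2) \<union> set T2. x < y"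
    using catenation_trimmed_less ok(2) by (auto simp: xs_eq queue_ok_def)
qed

lemma extended_front_view: "vresult st2 = vresult st" "vaddrs st2 = vaddrs st" "disk_size st2 = disk_size st"
  "forest st2 tr = forest st tr" "records_bounded st2 c = records_bounded st c"
  by (simp_all add: st2_eq)

lemma survivors_extended_front: "S = survivors (xs @ elems_of t2 @ T2)"
  using catenation_survivors_trimmed t1 no_tree(1) by (simp add: xs_eq trimmed_eq)

lemma runs_finish_extended_front:
  assumes "length xs \<le> 3 * bt"
  shows "runs (finish i (root_of t2) (length xs) (length T2) a) st2 0 (catenation_finished \<phi>)"
proof (rule runs_finish)
  show "forest st2 ((trees q)(i := t2))" using forest_t2 by (simp add: extended_front_view)
  show "queue_ok (Queue xs t2 T2)" using extended_front(5,6) ok(2) H2 assms by (simp add: queue_ok_def xs_eq)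
  show "int (300 * bt * card (vaddrs st2) + 900 * queue_potential (Queue xs t2 T2)) \<le> \<phi>"
    using t1 catenation_lengths(5) by (auto simp: \<phi>_eq queue_potential_def xs_eq extended_front_view)
qed (use extended_front extended_front_view bounded word survivors_extended_front catenation_lengths(5) in
  \<open>auto simp: E_eq xs_eq\<close>)

lemma runs_push_overflow:
  assumes overflow: "3 * bt < length xs"
  shows "runs (push 0 (front_cell i + 2 * bt) (length xs - 2 * bt) (root_of t2) a
    (\<lambda>g a. finish i g (2 * bt) (length T2) a)) st2 (96 + 204) (catenation_finished (\<phi> - 300 * int bt))"
proof -
  define F ys where "F = take (2 * bt) xs" and "ys = drop (2 * bt) xs"
  have split: "F @ ys = xs" unfolding F_def ys_def by (rule append_take_drop_id)
  have len: "length F = 2 * bt" "length ys = length xs - 2 * bt" using overflow by (simp_all add: F_def ys_def)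
  then have ys: "ys \<noteq> []" using overflow bt by auto
  have held: "holds (vmem st2) (front_cell i) F" "holds (vmem st2) (front_cell i + 2 * bt) ys"
    using extended_front(2) unfolding split[symmetric] holds_append len(1) by auto
  have "sorted_wrt (<) ys" using extended_front(5) unfolding split[symmetric] sorted_wrt_append by simp
  then have "runs (push (root_of t1) (front_cell i + 2 * bt) (length xs - 2 * bt) (root_of t2) a
      (\<lambda>g a. finish i g (2 * bt) (length T2) a)) st2 (96 + 204) (catenation_finished (\<phi> - 300 * int bt))"
  proof (intro runs_push_between)
    fix st' t a'
    assume pushed: "forest st' ((trees q)(i := t))"
      "survivors (elems_of t) = survivors (elems_of t1 @ ys @ elems_of t2)"
      "grown st2 st' (length xs - 2 * bt) a a'"
    then show "runs (finish i (root_of t) (2 * bt) (length T2) a') st' 96 (catenation_finished (\<phi> - 300 * int bt))"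
      unfolding len(1)[symmetric]
      using split len ys overflow held extended_front(3,4) extended_front_view t1
      by (intro runs_finish_overflow[of F ys st2]) (simp_all add: xs_eq)
  qed (use forest bounded held(2) len overflow catenation_lengths zone_i bt extended_front_view
    in \<open>auto simp: xs_eq\<close>)
  then show ?thesis using t1 by simp
qed

lemma paid_extend_front_prog:
  "paid (extend_front_prog i j (length H1') (root_of t2) (length H2) (length T2) a) st \<phi> catenation_finished"
proof -
  let ?p = "if length H1' + length H2 \<le> 3 * bt then finish i (root_of t2) (length H1' + length H2) (length T2) a
       else push 0 (front_cell i + 2 * bt) (length H1' + length H2 - 2 * bt) (root_of t2) a
         (\<lambda>g a. finish i g (2 * bt) (length T2) a)"
  have len: "length xs = length H1' + length H2" by (simp add: xs_eq)
  have "paid ?p st2 \<phi> catenation_finished"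
  proof (cases "length xs \<le> 3 * bt")
    case True
    have "paid (finish i (root_of t2) (length xs) (length T2) a) st2 \<phi> catenation_finished"
      by (rule paid_free) (rule runs_finish_extended_front[OF True])
    then show ?thesis using True unfolding len by simp
  next
    case False
    have "paid (push 0 (front_cell i + 2 * bt) (length xs - 2 * bt) (root_of t2) a
        (\<lambda>g a. finish i g (2 * bt) (length T2) a)) st2 \<phi> catenation_finished"
      by (rule paid_full, rule runs_push_overflow) (use False in simp_all)
    then show ?thesis using False unfolding len by simp
  qed
  then have "paid (copy_cells (rear_cell j) (rear_cell i) (length T2) ?p) (st\<lparr>vmem := m1\<rparr>) \<phi> catenation_finished"
    by (rule paid_step) (rule runs_copy_cells[where xs = T2],
      use extended_front(1) zones_ij zone_i catenation_lengths in \<open>auto simp: cell_eqs st2_eq\<close>)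
  then show ?thesis unfolding extend_front_prog_def
    by (rule paid_step) (rule runs_copy_cells[OF mem_j(1)],
      use zones_ij zone_i catenation_lengths in \<open>auto simp: m1_eq\<close>)
qed

end

lemma runs_finish_on_disk:
  assumes H1': "H1' \<noteq> []" and t1: "t1 \<noteq> None"
    and forest': "forest st' ((trees q)(i := t))"
    and t: "survivors (elems_of t) = survivors (elems_of t1 @ T1' @ H2 @ elems_of t2)"
    and same: "same_outside i (vmem st) (vmem st')" and result: "vresult st' = vresult st"
    and mem: "holds (vmem st') (front_cell i) H1'"
    and bounded': "records_bounded st' a'" "a' \<le> a + 2"
    and size: "disk_size st' \<le> disk_size st + length T1' + length H2"
    and card: "card (vaddrs st') \<le> card (vaddrs st) + 2" and full: "bt \<le> length T1' + length H2 \<or> t2 \<noteq> None"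
  shows "runs (copy_cells (rear_cell j) (rear_cell i) (length T2) (finish i (root_of t) (length H1') (length T2) a'))
    st' n (catenation_finished (\<phi> - 300 * int bt))"
proof -
  let ?st = "st'\<lparr>vmem := put (vmem st') (rear_cell i) T2\<rparr>"
  have "runs (finish i (root_of t) (length H1') (length T2) a') ?st n (catenation_finished (\<phi> - 300 * int bt))"
  proof (rule runs_finish_pushed[OF _ t])
    show "same_outside i (vmem st) (vmem ?st)"
      using same catenation_lengths by (simp, intro same_outside_put) (simp_all add: cell_eqs)
    show "holds (vmem ?st) (front_cell i) H1'"
      using mem catenation_lengths by (simp, subst holds_put_other) (auto simp: cell_eqs)
    show "2 * bt + length T2 + (length H1' - 2 * bt) + bt \<le>
        queue_potential (Queue H1 t1 T1) + queue_potential (Queue H2 t2 T2)"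
      using t1 full catenation_lengths no_tree(2) by (cases t2) (auto simp: queue_potential_def)
    show "\<forall>x\<in>set H1'. \<forall>y\<in>set (elems_of t1 @ T1' @ H2 @ elems_of t2) \<union> set T2. x < y" using front_less by blast
    show "S = survivors (H1' @ (elems_of t1 @ T1' @ H2 @ elems_of t2) @ T2)" using catenation_survivors_trimmed
      by simp
  qed (use forest' result H1' H2 catenation_sorted bounded' card size catenation_lengths in \<open>auto simp: E_eq\<close>)
  moreover have "holds (vmem st') (rear_cell j) T2 = holds (vmem st) (rear_cell j) T2"
  proof (rule holds_cong)
    fix x assume "rear_cell j \<le> x" "x < rear_cell j + length T2"
    then have "in_zone j x" using catenation_lengths by (simp add: in_zone_def cell_eqs)
    then show "vmem st' x = vmem st x" using same zones_disjoint[of j i x] j(2) by (auto simp: same_outside_def)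
  qed
  ultimately show ?thesis using mem_j(2)
    by (intro runs_copy_cells) (use zones_ij zone_i catenation_lengths in \<open>auto simp: cell_eqs\<close>)
qed

context
  fixes xs and st1 :: "'a view"
  assumes H1': "H1' \<noteq> []" and t1: "t1 \<noteq> None"
    and xs_eq: "xs = T1' @ H2" and st1_eq: "st1 = st\<lparr>vmem := put (vmem st) (rear_cell i + length T1') H2\<rparr>"
begin

lemma on_disk_buffers:
  "holds (vmem st1) (rear_cell i) xs" "holds (vmem st1) (front_cell i) H1'"
  "same_outside i (vmem st) (vmem st1)" "sorted_wrt (<) xs"
proof -
  have "holds (vmem st) (rear_cell i) T1'" unfolding trimmed_eq by (rule holds_takeWhile[OF mem_i(2)])
  then show "holds (vmem st1) (rear_cell i) xs"
    unfolding st1_eq xs_eq holds_append by (simp, subst holds_put_other) auto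
  have "holds (vmem st) (front_cell i) H1'" unfolding trimmed_eq by (rule holds_takeWhile[OF mem_i(1)])
  then show "holds (vmem st1) (front_cell i) H1'"
    using catenation_lengths unfolding st1_eq by (simp, subst holds_put_other) (auto simp: cell_eqs)
  show "same_outside i (vmem st) (vmem st1)"
    using catenation_lengths unfolding st1_eq by (simp, intro same_outside_put) (simp_all add: cell_eqs)
  show "sorted_wrt (<) xs" unfolding xs_eq sorted_wrt_append using catenation_sorted catenation_trimmed_less
    by auto
qed

lemma on_disk_view: "vresult st1 = vresult st" "vaddrs st1 = vaddrs st" "velems st1 = velems st"
  "forest st1 tr = forest st tr" "disk_size st1 = disk_size st" "records_bounded st1 c = records_bounded st c"
  by (simp_all add: st1_eq)

lemma runs_extend_rear_short:
  assumes short: "length xs < bt" and t2: "t2 = None"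
  shows "runs (finish i (root_of t1) (length H1') (length xs) a) st1 0 (catenation_finished \<phi>)"
proof (rule runs_finish)
  have "(trees q)(l + 1 := None, i := t1) = trees q" using queue_i unused i by (auto simp: fun_eq_iff)
  then show "forest st1 ((trees q)(i := t1))"
    using forest_remove[OF forest, of "l + 1"] queue_i unused i t2 on_disk_view(4) by (simp add: fun_upd_idem)
  show "queue_ok (Queue H1' t1 xs)"
    using catenation_sorted(5) on_disk_buffers(4) front_less catenation_lengths short t1 H1'
    by (auto simp: queue_ok_def xs_eq)
  show "survivors (H1' @ elems_of t1 @ xs) = S" using catenation_survivors_trimmed t2 no_tree(2)
    by (simp add: xs_eq)
  show "int (300 * bt * card (vaddrs st1) + 900 * queue_potential (Queue H1' t1 xs)) \<le> \<phi>"
    using t1 t2 catenation_lengths on_disk_view(2) by (auto simp: \<phi>_eq queue_potential_def xs_eq)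
qed (use on_disk_buffers on_disk_view bounded word catenation_lengths t2 in \<open>auto simp: E_eq xs_eq\<close>)

lemma runs_extend_rear_long:
  assumes long: "bt \<le> length xs"
  shows "runs (push (root_of t1) (rear_cell i) (length xs) (root_of t2) a (\<lambda>g a.
    copy_cells (rear_cell j) (rear_cell i) (length T2) (finish i g (length H1') (length T2) a))) st1 (96 + 204)
    (catenation_finished (\<phi> - 300 * int bt))"
proof (rule runs_push_between[OF _ on_disk_buffers(1,4) refl long])
  fix st' t a'
  assume "forest st' ((trees q)(i := t))" "survivors (elems_of t) = survivors (elems_of t1 @ xs @ elems_of t2)"
    "grown st1 st' (length xs) a a'"
  then show "runs (copy_cells (rear_cell j) (rear_cell i) (length T2)
      (finish i (root_of t) (length H1') (length T2) a')) st' 96 (catenation_finished (\<phi> - 300 * int bt))"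
    using on_disk_buffers on_disk_view long
    by (intro runs_finish_on_disk[OF H1' t1]) (auto simp: grown_def xs_eq)
qed (use forest on_disk_view bounded catenation_lengths zone_i in \<open>auto simp: xs_eq cell_eqs\<close>)

lemma next_record_of_second:
  assumes short: "length xs < bt" and t2: "t2 = Some r"
  defines "st2 \<equiv> st1\<lparr>vmem := put (vmem st1) (rear_cell i + length xs) (elts r)\<rparr>"
  shows "addr r \<in> vaddrs st1" "velems st1 (addr r) = elts r" "bt \<le> length (elts r)" "length (elts r) \<le> 2 * bt"
    "sorted_wrt (<) (xs @ elts r)" "holds (vmem st2) (rear_cell i) (xs @ elts r)"
    "holds (vmem st2) (front_cell i) H1'" "same_outside i (vmem st) (vmem st2)"
proof -
  have "tree_valid st r" using forest_tree_valid[OF forest, of "l + 1"] t2 by simp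
  note root = tree_valid_root[OF this]
  then show elts: "addr r \<in> vaddrs st1" "velems st1 (addr r) = elts r" "bt \<le> length (elts r)"
      "length (elts r) \<le> 2 * bt"
    using bounded on_disk_view by (auto simp: records_bounded_def)
  have "sorted_wrt (<) (elts r)" using bounded root by (auto simp: records_bounded_def)
  then show "sorted_wrt (<) (xs @ elts r)"
    using on_disk_buffers(4) catenation_trimmed_less ok(2) t2 contents_records[of r]
    by (auto simp: sorted_wrt_append xs_eq queue_ok_def)
  show "holds (vmem st2) (rear_cell i) (xs @ elts r)"
    unfolding st2_def holds_append using on_disk_buffers(1) by (simp, subst holds_put_other) auto
  show "holds (vmem st2) (front_cell i) H1'"
    using on_disk_buffers(2) catenation_lengths unfolding st2_def
    by (simp, subst holds_put_other) (auto simp: cell_eqs)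
  show "same_outside i (vmem st) (vmem st2)"
    using on_disk_buffers(3) short elts unfolding st2_def
    by (simp, intro same_outside_put) (simp_all add: cell_eqs)
qed

lemma runs_extend_rear_from_tree:
  assumes short: "length xs < bt" and t2: "t2 = Some r"
  shows "runs (load_record (addr r) (rear_cell i + length xs) (length (elts r)) (pop_prog (addr r) (\<lambda>g.
    push (root_of t1) (rear_cell i) (length xs + length (elts r)) g a (\<lambda>g a.
      copy_cells (rear_cell j) (rear_cell i) (length T2) (finish i g (length H1') (length T2) a))))) st1 299
    (catenation_finished (\<phi> - 300 * int bt))"
proof -
  let ?ys = "elts r" and ?zs = "contents (tl (records r))"
  let ?st = "st1\<lparr>vmem := put (vmem st1) (rear_cell i + length xs) ?ys\<rparr>"
  let ?k = "\<lambda>g a. copy_cells (rear_cell j) (rear_cell i) (length T2) (finish i g (length H1') (length T2) a)"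
  note loaded = next_record_of_second[OF short t2]
  have "runs (pop_prog (addr r) (\<lambda>g. push (root_of t1) (rear_cell i) (length xs + length ?ys) g a ?k)) ?st
      (54 + 204 + 40) (catenation_finished (\<phi> - 300 * int bt))"
  proof (rule runs_pop_prog[where tr = "(trees q)(l + 1 := t2)" and i = "l + 1"])
    show "forest ?st ((trees q)(l + 1 := t2))" using forest on_disk_view by simp
    fix fd' t
    let ?st' = "?st\<lparr>vaddrs := vaddrs ?st - {addr r}, vfields := fd'\<rparr>"
    assume popped: "forest ?st' ((trees q)(l + 1 := t2, l + 1 := t))" "survivors (elems_of t) = survivors ?zs"
    note freed = records_bounded_free(1,2)[where st = ?st and a = a and x = "addr r" and fd = fd']
      records_bounded_free(3)[where st = ?st and a = a and x = "addr r"]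
    show "runs (push (root_of t1) (rear_cell i) (length xs + length ?ys) (root_of t) a ?k) ?st' (54 + 204)
        (catenation_finished (\<phi> - 300 * int bt))"
    proof (rule runs_push_between[OF _ _ loaded(5)])
      fix st' t' a'
      assume pushed: "forest st' ((trees q)(i := t'))"
        "survivors (elems_of t') = survivors (elems_of t1 @ (xs @ ?ys) @ elems_of t)"
        "grown ?st' st' (length xs + length ?ys) a a'"
      have "survivors (elems_of t') = survivors (elems_of t1 @ T1' @ H2 @ elems_of t2)"
        using pushed(2) popped(2) t2 contents_records[of r] by (simp add: survivors_append xs_eq)
      then show "runs (?k (root_of t') a') st' 54 (catenation_finished (\<phi> - 300 * int bt))"
        using pushed loaded freed on_disk_view bounded t2
        by (intro runs_finish_on_disk[OF H1' t1]) (auto simp: grown_def xs_eq)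
    qed (use popped(1) loaded short zone_i freed(1) bounded on_disk_view in \<open>auto simp: cell_eqs\<close>)
  qed (use t2 in simp)
  then show ?thesis
    using loaded short zone_i on_disk_view by (intro runs_load_record) (auto simp: cell_eqs)
qed

lemma paid_extend_rear_prog:
  "paid (extend_rear_prog i j (root_of t1) (length H1') (length xs) (root_of t2) (length T2) a) st1 \<phi>
    catenation_finished"
proof (cases "bt \<le> length xs")
  let ?k = "\<lambda>g a. copy_cells (rear_cell j) (rear_cell i) (length T2) (finish i g (length H1') (length T2) a)"
  case True
  have "paid (push (root_of t1) (rear_cell i) (length xs) (root_of t2) a ?k) st1 \<phi> catenation_finished"
    by (rule paid_full, rule runs_extend_rear_long[OF True]) simp
  then show ?thesis using True by (simp add: extend_rear_prog_def)
next
  case False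
  show ?thesis
  proof (cases t2)
    case None
    then have "paid (finish i (root_of t1) (length H1') (length xs) a) st1 \<phi> catenation_finished"
      using False by (intro paid_free runs_extend_rear_short) simp_all
    then show ?thesis using None False by (simp add: extend_rear_prog_def)
  next
    case (Some r)
    then have "tree_valid st r" using forest_tree_valid[OF forest, of "l + 1"] by simp
    note root = tree_valid_root[OF this]
    let ?k = "\<lambda>g a. copy_cells (rear_cell j) (rear_cell i) (length T2) (finish i g (length H1') (length T2) a)"
    have "runs (get_field (addr r) size_field (\<lambda>s. load_record (addr r) (rear_cell i + length xs) s
        (pop_prog (addr r) (\<lambda>g. push (root_of t1) (rear_cell i) (length xs + s) g a ?k)))) st1 300
        (catenation_finished (\<phi> - 300 * int bt))"
      using runs_extend_rear_from_tree[OF _ Some] False root on_disk_view by (intro runs_get_size) simp_all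
    then have "paid (get_field (addr r) size_field (\<lambda>s. load_record (addr r) (rear_cell i + length xs) s
        (pop_prog (addr r) (\<lambda>g. push (root_of t1) (rear_cell i) (length xs + s) g a ?k)))) st1 \<phi> catenation_finished"
      by (rule paid_full) simp
    then show ?thesis using False Some root by (simp add: extend_rear_prog_def)
  qed
qed

end

lemma paid_catenate_queues:
  "paid (catenate_queues i j (root_of t1) (length H1) (length T1) (root_of t2) (length H2) (length T2) a) st \<phi>
    catenation_finished"
proof -
  have e_mem: "vmem st (front_cell j) = Elem e" using mem_j(1) H2 by (cases H2) (auto simp: holds_Cons e_eq)
  let ?disk = "\<lambda>h t. copy_cells (front_cell j) (rear_cell i + t) (length H2)
      (extend_rear_prog i j (root_of t1) h (t + length H2) (root_of t2) (length T2) a)"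
  let ?p = "if length H1' = 0 then replace_prog i j (root_of t2) (length H2) (length T2) a
      else if root_of t1 = 0 then extend_front_prog i j (length H1') (root_of t2) (length H2) (length T2) a
      else count_less (rear_cell i) (front_cell j) (length T1) 0 (?disk (length H1'))"
  have "paid ?p st \<phi> catenation_finished"
  proof (cases "H1' = []")
    case True
    then show ?thesis using paid_free[where G = catenation_finished] runs_replace_prog by simp
  next
    case H1': False
    show ?thesis
    proof (cases t1)
      case None
      then show ?thesis using paid_extend_front_prog[OF H1' None refl refl refl] H1' by simp
    next
      case (Some r)
      have "tree_valid st r" using forest_tree_valid[OF forest, of i] queue_i i Some by simp
      then have "root_of t1 \<noteq> 0" using tree_valid_root(2) Some by fastforce
      have "paid (extend_rear_prog i j (root_of t1) (length H1') (length (T1' @ H2)) (root_of t2) (length T2) a)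
          (st\<lparr>vmem := put (vmem st) (rear_cell i + length T1') H2\<rparr>) \<phi> catenation_finished"
        by (rule paid_extend_rear_prog[OF H1' _ refl refl]) (use Some in simp)
      then have "paid (?disk (length H1') (length T1')) st \<phi> catenation_finished"
        by (rule paid_step)
          (rule runs_copy_cells[OF mem_j(1)], use zones_ij zone_i catenation_lengths in \<open>auto simp: cell_eqs\<close>)
      then have "paid (count_less (rear_cell i) (front_cell j) (length T1) 0 (?disk (length H1'))) st \<phi>
          catenation_finished"
        by (rule paid_step) (rule runs_count_less[OF mem_i(2) refl e_mem],
          use zones_ij zone_i catenation_lengths in \<open>auto simp: cell_eqs trimmed_eq\<close>)
      then show ?thesis using H1' \<open>root_of t1 \<noteq> 0\<close> by simp
    qed
  qed
  then show ?thesis unfolding catenate_queues_def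
    by (rule paid_step) (rule runs_count_less[OF mem_i(1) refl e_mem],
      use zones_ij zone_i catenation_lengths bt in \<open>auto simp: trimmed_eq\<close>)
qed

end

end

subsection \<open>Removal of the minimum\<close>

context queue_update
begin

context
  fixes a :: nat and x :: 'a and H T :: "'a list" and t :: "'a rtree option" and S :: "'a set" and E \<phi> :: int
  assumes queue_i: "q i = Queue (x # H) t T" and forest: "forest st (trees q)"
    and mem: "holds (vmem st) (front_cell i) (x # H)" "holds (vmem st) (rear_cell i) T"
    and ok: "queue_ok (Queue (x # H) t T)" and bounded: "records_bounded st a" and word: "a \<le> W"
    and S_eq: "S = survivors (H @ elems_of t @ T)"
    and E_eq: "E = int (disk_size st + length H + length T)"
    and \<phi>_eq: "\<phi> = int (300 * bt * card (vaddrs st) + 900 * queue_potential (Queue (x # H) t T))"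
begin

abbreviation (input) "removal_finished \<equiv> finished i q S E a (vresult st)"

lemma removal_lengths: "length H < 3 * bt" "length T < bt"
  using ok by (auto simp: queue_ok_def)

lemma runs_shift_front:
  assumes "H \<noteq> []"
  shows "runs (copy_cells (front_cell i + 1) (front_cell i) (length H) (finish i (root_of t) (length H) (length T) a))
    st 0 (removal_finished \<phi>)"
proof -
  let ?st = "st\<lparr>vmem := put (vmem st) (front_cell i) H\<rparr>"
  have "runs (finish i (root_of t) (length H) (length T) a) ?st 0 (removal_finished \<phi>)"
  proof (rule runs_finish)
    have "trees q = (trees q)(i := t)" using queue_i by (auto simp: fun_eq_iff)
    then show "forest ?st ((trees q)(i := t))" using forest by simp
    show "same_outside i (vmem st) (vmem ?st)" using removal_lengths by (simp add: same_outside_put)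
    show "holds (vmem ?st) (rear_cell i) T"
      using mem(2) removal_lengths by (simp, subst holds_put_other) (auto simp: cell_eqs)
    show "queue_ok (Queue H t T)" using ok assms by (auto simp: queue_ok_def)
    show "int (300 * bt * card (vaddrs ?st) + 900 * queue_potential (Queue H t T)) \<le> \<phi>"
      by (auto simp: \<phi>_eq queue_potential_def)
  qed (use bounded word S_eq E_eq in auto)
  then show ?thesis
    by (intro runs_copy_cells[where xs = H]) (use mem zone_i removal_lengths in \<open>auto simp: holds_Cons\<close>)
qed

lemma runs_remove_last:
  assumes "H = []" "t = None"
  shows "runs (finish i 0 0 0 a) st 0 (removal_finished \<phi>)"
proof -
  have T: "T = []" using ok assms(2) by (simp add: queue_ok_def)
  have "runs (finish i (root_of (None :: 'a rtree option)) (length ([] :: 'a list)) (length ([] :: 'a list)) a) st 0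
      (removal_finished \<phi>)"
    by (rule runs_finish)
      (use forest_remove[OF forest] assms T bounded word S_eq E_eq bt
        in \<open>auto simp: queue_ok_def queue_potential_def \<phi>_eq\<close>)
  then show ?thesis by simp
qed

context
  fixes r :: "'a rtree" and ys zs ys' :: "'a list" and st1 :: "'a view"
  assumes H: "H = []" and t: "t = Some r"
    and ys_eq: "ys = elts r" and zs_eq: "zs = contents (tl (records r))"
    and trimmed_eq: "ys' = (if T = [] then ys else takeWhile (\<lambda>y. y < hd T) ys)"
    and st1_eq: "st1 = st\<lparr>vmem := put (vmem st) (front_cell i) ys\<rparr>"
begin

lemma first_record: "addr r \<in> vaddrs st" "addr r \<noteq> 0" "velems st (addr r) = ys" "ys \<noteq> []"
    "bt \<le> length ys" "length ys \<le> 2 * bt" "sorted_wrt (<) ys"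
  and first_record_less: "y \<in> set zs \<Longrightarrow> hd ys < y"
proof -
  have r: "trees q i = Some r" using queue_i t by simp
  note root = tree_valid_root[OF forest_tree_valid[OF forest r]]
  show "addr r \<in> vaddrs st" "addr r \<noteq> 0" "velems st (addr r) = ys" "ys \<noteq> []" using root by (simp_all add: ys_eq)
  then show "bt \<le> length ys" "length ys \<le> 2 * bt" "sorted_wrt (<) ys"
    using bounded by (auto simp: records_bounded_def)
  show "y \<in> set zs \<Longrightarrow> hd ys < y" using forest_root_less[OF forest r] by (simp add: zs_eq ys_eq)
qed

lemma refill_survivors: "S = survivors (ys @ zs @ T)"
  using H t contents_records[of r] by (simp add: S_eq ys_eq zs_eq)

lemma refill_potential: "\<phi> = int (300 * bt * card (vaddrs st) + 900 * (2 * bt + length T))"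
  using t H bt by (simp add: \<phi>_eq queue_potential_def)

lemma refill_view: "vresult st1 = vresult st" "vaddrs st1 = vaddrs st" "velems st1 = velems st"
  "forest st1 tr = forest st tr" "disk_size st1 = disk_size st" "records_bounded st1 c = records_bounded st c"
  by (simp_all add: st1_eq)

lemma refill_trimmed: "length ys' \<le> length ys" "sorted_wrt (<) ys'" "set ys' \<subseteq> set ys"
  using first_record(7) by (auto simp: trimmed_eq length_takeWhile_le sorted_wrt_takeWhile dest: set_takeWhileD)

lemma refill_trimmed_less: "y \<in> set ys' \<Longrightarrow> z \<in> set T \<Longrightarrow> y < z"
  using sorted_wrt_hd_le[of T z] ok
  by (auto simp: trimmed_eq queue_ok_def dest!: set_takeWhileD split: if_splits)

lemma refill_survivors_trimmed: "survivors (ys' @ zs' @ T) = survivors (ys @ zs' @ T)"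
  using survivors_takeWhile_append[OF first_record(7), of "hd T" "zs' @ T"]
  by (cases "T = []") (simp_all add: trimmed_eq)

lemma refill_mem: "holds (vmem st1) (front_cell i) ys'" "holds (vmem st1) (rear_cell i) T"
  "same_outside i (vmem st) (vmem st1)"
proof -
  have "holds (vmem st1) (front_cell i) ys" by (simp add: st1_eq)
  then show "holds (vmem st1) (front_cell i) ys'" by (simp add: trimmed_eq holds_takeWhile)
  show "holds (vmem st1) (rear_cell i) T"
    using mem(2) first_record(6) unfolding st1_eq by (simp, subst holds_put_other) (auto simp: cell_eqs)
  show "same_outside i (vmem st) (vmem st1)" using first_record(6) by (simp add: st1_eq same_outside_put)
qed

lemma runs_refill_attrited:
  assumes "ys' = []"
  shows "runs (copy_cells (rear_cell i) (front_cell i) (length T) (finish i 0 (length T) 0 a)) st1 n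
    (removal_finished (\<phi> - 300 * int bt))"
proof -
  let ?st = "st1\<lparr>vmem := put (vmem st1) (front_cell i) T\<rparr>"
  have T: "T \<noteq> []" using assms first_record(4) by (auto simp: trimmed_eq)
  have "hd T \<le> hd ys" using assms first_record(4) T by (cases ys) (auto simp: trimmed_eq split: if_splits)
  then have "hd T \<le> y" if "y \<in> set (ys @ zs)" for y
    using that first_record_less[of y] sorted_wrt_hd_le[OF first_record(7), of y]
    by (auto intro: order_trans less_imp_le)
  then have "survivors ((ys @ zs) @ T) = survivors T"
    by (intro survivors_append_attrited[of "hd T"]) (use T in auto)
  then have S: "S = survivors T" by (simp add: refill_survivors)
  have "runs (finish i (root_of (None :: 'a rtree option)) (length T) (length ([] :: 'a list)) a) ?st n
      (removal_finished (\<phi> - 300 * int bt))"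
  proof (rule runs_finish)
    show "forest ?st ((trees q)(i := None))" using forest_remove[OF forest] by (simp add: refill_view)
    show "same_outside i (vmem st) (vmem ?st)"
      using refill_mem(3) removal_lengths(2) by (simp add: same_outside_put)
    show "queue_ok (Queue T None [])" using ok bt removal_lengths by (simp add: queue_ok_def)
    show "int (300 * bt * card (vaddrs ?st) + 900 * queue_potential (Queue T None [])) \<le> \<phi> - 300 * int bt"
      by (simp add: refill_potential refill_view queue_potential_def)
  qed (use S bounded word refill_view in \<open>auto simp: E_eq\<close>)
  then show ?thesis
    by (intro runs_copy_cells[OF refill_mem(2)]) (use zone_i removal_lengths in \<open>auto simp: cell_eqs\<close>)
qed

context
  fixes st2 :: "'a view" and t' :: "'a rtree option" and fd' :: "nat \<Rightarrow> nat \<Rightarrow> nat"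
  assumes st2_eq: "st2 = st1\<lparr>vaddrs := vaddrs st1 - {addr r}, vfields := fd'\<rparr>"
    and forest': "forest st2 ((trees q)(i := t'))" and t': "survivors (elems_of t') = survivors zs"
begin

lemma popped_bounds: "records_bounded st2 a" "disk_size st2 + length ys = disk_size st"
  "300 * bt * card (vaddrs st2) + 300 * bt = 300 * bt * card (vaddrs st)"
proof -
  note bounded' = bounded[folded refill_view(6)] first_record(1)[folded refill_view(2)]
  show "records_bounded st2 a" unfolding st2_eq by (rule records_bounded_free(1)[OF bounded'])
  show "disk_size st2 + length ys = disk_size st"
    using records_bounded_free(2)[OF bounded', of fd'] first_record(3) unfolding st2_eq
    by (simp add: refill_view)
  have "card (vaddrs st) = Suc (card (vaddrs st2))"
    using records_bounded_free(3)[OF bounded'] unfolding st2_eq by (simp add: refill_view)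
  then show "300 * bt * card (vaddrs st2) + 300 * bt = 300 * bt * card (vaddrs st)" by simp
qed

lemma popped_potential:
  assumes "k \<le> 2 * bt + length T"
  shows "int (300 * bt * card (vaddrs st2) + 900 * k) \<le> \<phi> - 300 * int bt"
proof -
  have "900 * k \<le> 900 * (2 * bt + length T)" using assms by (rule mult_le_mono2)
  then have "300 * bt * card (vaddrs st2) + 900 * k + 300 * bt
      \<le> 300 * bt * card (vaddrs st) + 900 * (2 * bt + length T)"
    using popped_bounds(3) by linarith
  then have "int (300 * bt * card (vaddrs st2) + 900 * k + 300 * bt) \<le> \<phi>"
    unfolding refill_potential by (simp only: of_nat_le_iff)
  then show ?thesis by simp
qed

lemma popped_mem: "vmem st2 = vmem st1" "vresult st2 = vresult st"
  by (simp_all add: st2_eq refill_view)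

lemma runs_refill_exhausted:
  assumes "t' = None"
  shows "runs (copy_cells (rear_cell i) (front_cell i + length ys') (length T) (finish i 0 (length ys' + length T) 0 a))
    st2 n (removal_finished (\<phi> - 300 * int bt))"
proof -
  let ?st = "st2\<lparr>vmem := put (vmem st2) (front_cell i + length ys') T\<rparr>"
  have zs: "zs = []" using assms t' survivors_eq_empty_iff[of zs] by simp
  have "runs (finish i (root_of t') (length (ys' @ T)) (length ([] :: 'a list)) a) ?st n
      (removal_finished (\<phi> - 300 * int bt))"
  proof (rule runs_finish)
    show "forest ?st ((trees q)(i := t'))" using forest' by simp
    show "same_outside i (vmem st) (vmem ?st)"
      using refill_mem(3) removal_lengths(2) refill_trimmed(1) first_record(6)
      by (simp add: popped_mem same_outside_put)
    show "holds (vmem ?st) (front_cell i) (ys' @ T)"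
      unfolding holds_append using refill_mem(1) by (simp add: popped_mem, subst holds_put_other) auto
    have "sorted_wrt (<) (ys' @ T)"
      using refill_trimmed(2) refill_trimmed_less ok by (auto simp: sorted_wrt_append queue_ok_def)
    then show "queue_ok (Queue (ys' @ T) t' [])"
      using assms removal_lengths bt refill_trimmed(1) first_record(6) by (simp add: queue_ok_def)
    show "survivors ((ys' @ T) @ elems_of t' @ []) = S"
      using assms zs refill_survivors refill_survivors_trimmed[of "[]"] by simp
    show "int (300 * bt * card (vaddrs ?st) + 900 * queue_potential (Queue (ys' @ T) t' [])) \<le> \<phi> - 300 * int bt"
      using popped_potential[of "length (ys' @ T)"] refill_trimmed(1) first_record(6) assms
      by (simp add: queue_potential_def)
  qed (use popped_bounds(1,2) popped_mem word refill_trimmed(1) in \<open>auto simp: E_eq\<close>)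
  then have "runs (finish i 0 (length ys' + length T) 0 a) ?st n (removal_finished (\<phi> - 300 * int bt))"
    using assms by simp
  then show ?thesis
    by (intro runs_copy_cells[where xs = T])
      (use refill_mem(2) popped_mem zone_i removal_lengths refill_trimmed(1) first_record(6)
        in \<open>auto simp: cell_eqs\<close>)
qed

lemma second_record:
  assumes r': "t' = Some r'"
  shows "addr r' \<in> vaddrs st2" "velems st2 (addr r') = elts r'" "elts r' \<noteq> []" "key r' \<in> set (elems_of t')"
    "y \<in> set (elems_of t') \<Longrightarrow> key r' \<le> y" "hd ys < key r'"
proof -
  have "tree_valid st2 r'" by (rule forest_tree_valid[OF forest', of i]) (simp add: r')
  note root = tree_valid_root[OF this]
  show "addr r' \<in> vaddrs st2" "velems st2 (addr r') = elts r'" "elts r' \<noteq> []" using root by simp_all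
  show key: "key r' \<in> set (elems_of t')" using root(5) r' contents_records[of r'] by simp
  show "y \<in> set (elems_of t') \<Longrightarrow> key r' \<le> y"
    using \<open>tree_valid st2 r'\<close> r' rtree_ok_key_le[of r'] by (simp add: tree_valid_def)
  show "hd ys < key r'" using key survivors_eq_less_iff[OF t', of "hd ys"] first_record_less by blast
qed

lemma refilled_front:
  assumes ys': "ys' \<noteq> []" and r': "t' = Some r'"
  shows "queue_ok (Queue (takeWhile (\<lambda>y. y < key r') ys') t' T)"
    and "survivors (takeWhile (\<lambda>y. y < key r') ys' @ elems_of t' @ T) = S"
proof -
  let ?ys = "takeWhile (\<lambda>y. y < key r') ys'"
  note second = second_record[OF r']
  have "hd ys' = hd ys" using ys' by (cases ys) (auto simp: trimmed_eq split: if_splits)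
  then have nonempty: "?ys \<noteq> []" using ys' second(6) by (cases ys') auto
  have "y < z" if "y \<in> set ?ys" "z \<in> set (elems_of t') \<union> set T" for y z
    using that second(5)[of z] refill_trimmed_less[of y z] by (auto dest!: set_takeWhileD)
  moreover have "length ?ys \<le> length ys'" by (rule length_takeWhile_le)
  ultimately show "queue_ok (Queue ?ys t' T)"
    using r' nonempty removal_lengths refill_trimmed ok first_record(6)
    by (auto simp: queue_ok_def sorted_wrt_takeWhile)
  have "survivors (?ys @ elems_of t' @ T) = survivors (ys' @ elems_of t' @ T)"
    by (rule survivors_takeWhile_append[OF refill_trimmed(2)]) (use second(4) in simp)
  also have "\<dots> = survivors (ys' @ zs @ T)" using t' by (simp add: survivors_append)
  finally show "survivors (?ys @ elems_of t' @ T) = S"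
    using refill_survivors refill_survivors_trimmed by simp
qed

lemma runs_refill_front:
  assumes ys': "ys' \<noteq> []" and r': "t' = Some r'"
  shows "runs (load_record (addr r') (rear_cell i + 2 * bt) 1 (count_less (front_cell i) (rear_cell i + 2 * bt)
    (length ys') 0 (\<lambda>m. finish i (addr r') m (length T) a))) st2 (Suc n) (removal_finished (\<phi> - 300 * int bt))"
proof -
  let ?ys = "takeWhile (\<lambda>y. y < key r') ys'"
  let ?m = "put (vmem st2) (rear_cell i + 2 * bt) [key r']"
  note second = second_record[OF r']
  have held: "holds ?m (front_cell i) ys'"
    using refill_mem(1) refill_trimmed(1) first_record(6)
    by (subst holds_put_other) (auto simp: popped_mem cell_eqs)
  have "runs (finish i (root_of t') (length ?ys) (length T) a) (st2\<lparr>vmem := ?m\<rparr>) n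
      (removal_finished (\<phi> - 300 * int bt))"
  proof (rule runs_finish)
    show "forest (st2\<lparr>vmem := ?m\<rparr>) ((trees q)(i := t'))" using forest' by simp
    show "same_outside i (vmem st) (vmem (st2\<lparr>vmem := ?m\<rparr>))"
      using refill_mem(3) bt(1) by (simp add: popped_mem same_outside_put cell_eqs)
    show "holds (vmem (st2\<lparr>vmem := ?m\<rparr>)) (front_cell i) ?ys" using holds_takeWhile[OF held] by simp
    show "holds (vmem (st2\<lparr>vmem := ?m\<rparr>)) (rear_cell i) T"
      using refill_mem(2) removal_lengths(2) by (simp add: popped_mem, subst holds_put_other) auto
    show "queue_ok (Queue ?ys t' T)" "survivors (?ys @ elems_of t' @ T) = S"
      by (rule refilled_front[OF ys' r'])+
    have "queue_potential (Queue ?ys t' T) = 2 * bt + length T"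
      using r' length_takeWhile_le[of "\<lambda>y. y < key r'" ys'] refill_trimmed(1) first_record(6)
      by (simp add: queue_potential_def)
    then show "int (300 * bt * card (vaddrs (st2\<lparr>vmem := ?m\<rparr>)) + 900 * queue_potential (Queue ?ys t' T))
      \<le> \<phi> - 300 * int bt"
      using popped_potential[of "2 * bt + length T"] by simp
  qed (use popped_bounds(1,2) popped_mem word refill_trimmed(1) length_takeWhile_le[of "\<lambda>y. y < key r'" ys']
    in \<open>auto simp: E_eq\<close>)
  moreover have "length (take 1 (velems st2 (addr r'))) = 1" "take 1 (velems st2 (addr r')) = [key r']"
    using second(2,3) by (cases "elts r'"; simp)+
  ultimately show ?thesis
    by (intro runs_load_record runs_count_less[where xs = ys' and y = "key r'"])
      (use second(1-3) held r' zone_i refill_trimmed(1) first_record(4,6) bt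
        in \<open>auto simp: cell_eqs put_def Suc_le_eq\<close>)
qed

end

lemma runs_next_record_prog:
  assumes "ys' \<noteq> []"
  shows "runs (next_record_prog i (addr r) (length ys') (length T) a) st1 100 (removal_finished (\<phi> - 300 * int bt))"
  unfolding next_record_prog_def
proof (rule runs_mono[OF runs_pop_prog[where tr = "trees q" and i = i and n = 1]])
  show "forest st1 (trees q)" using forest by (simp add: refill_view)
  show "trees q i = Some r" using queue_i t by simp
  fix fd' t'
  assume popped: "forest (st1\<lparr>vaddrs := vaddrs st1 - {addr r}, vfields := fd'\<rparr>) ((trees q)(i := t'))"
    "survivors (elems_of t') = survivors (contents (tl (records r)))"
  note popped' = refl popped[folded zs_eq]
  show "runs (if root_of t' = 0
       then copy_cells (rear_cell i) (front_cell i + length ys') (length T) (finish i 0 (length ys' + length T) 0 a)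
       else load_record (root_of t') (rear_cell i + 2 * bt) 1 (count_less (front_cell i) (rear_cell i + 2 * bt)
         (length ys') 0 (\<lambda>m. finish i (root_of t') m (length T) a)))
      (st1\<lparr>vaddrs := vaddrs st1 - {addr r}, vfields := fd'\<rparr>) 1 (removal_finished (\<phi> - 300 * int bt))"
  proof (cases t')
    case None
    then show ?thesis using runs_refill_exhausted[OF popped'] by simp
  next
    case (Some r')
    moreover have "addr r' \<noteq> 0" using tree_valid_root(2)[OF forest_tree_valid[OF popped(1), of i]] Some by simp
    ultimately show ?thesis using runs_refill_front[OF popped' assms Some, of 0] by simp
  qed
qed simp

lemma runs_refill_prog:
  "runs (refill_prog i (addr r) (length T) a) st 300 (removal_finished (\<phi> - 300 * int bt))"
proof -
  let ?k = "\<lambda>m. if m = 0 then copy_cells (rear_cell i) (front_cell i) (length T) (finish i 0 (length T) 0 a)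
      else next_record_prog i (addr r) m (length T) a"
  have "runs (?k (length ys')) st1 100 (removal_finished (\<phi> - 300 * int bt))"
    using runs_refill_attrited runs_next_record_prog by (cases "ys' = []") simp_all
  then have "runs (trim_prog (length T) (front_cell i) (rear_cell i) (length ys) ?k) st1 100
      (removal_finished (\<phi> - 300 * int bt))"
  proof (cases T)
    case Nil
    then show ?thesis using \<open>runs (?k (length ys')) st1 100 _\<close> first_record(4)
      by (simp add: trim_prog_def trimmed_eq)
  next
    case (Cons y T')
    then have "vmem st1 (rear_cell i) = Elem (hd T)" using refill_mem(2) by (simp add: holds_Cons)
    moreover have "holds (vmem st1) (front_cell i) ys" by (simp add: st1_eq)
    ultimately have "runs (count_less (front_cell i) (rear_cell i) (length ys) 0 ?k) st1 100
        (removal_finished (\<phi> - 300 * int bt))"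
      using \<open>runs (?k (length ys')) st1 100 _\<close> Cons zone_i first_record(6) bt
      by (intro runs_count_less[where xs = ys and y = "hd T"]) (auto simp: trimmed_eq cell_eqs)
    then show ?thesis using Cons by (simp add: trim_prog_def)
  qed
  then have "runs (load_record (addr r) (front_cell i) (length ys)
      (trim_prog (length T) (front_cell i) (rear_cell i) (length ys) ?k)) st 101 (removal_finished (\<phi> - 300 * int bt))"
    using first_record zone_i by (intro runs_load_record) (auto simp: st1_eq)
  then have "runs (refill_prog i (addr r) (length T) a) st 102 (removal_finished (\<phi> - 300 * int bt))"
    unfolding refill_prog_def using first_record by (intro runs_get_size) auto
  then show ?thesis by (rule runs_mono) simp
qed

end

lemma paid_drop_first:
  "paid (drop_first i (root_of t) (Suc (length H)) (length T) a) st \<phi> removal_finished"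
proof (cases "H = []")
  case False
  have "paid (copy_cells (front_cell i + 1) (front_cell i) (length H) (finish i (root_of t) (length H) (length T) a))
      st \<phi> removal_finished"
    by (rule paid_free) (rule runs_shift_front[OF False])
  moreover have "2 \<le> Suc (length H)" using False by (cases H) auto
  ultimately show ?thesis by (simp add: drop_first_def)
next
  case True
  show ?thesis
  proof (cases t)
    case None
    have "paid (finish i 0 0 0 a) st \<phi> removal_finished"
      by (rule paid_free) (rule runs_remove_last[OF True None])
    then show ?thesis using True None by (simp add: drop_first_def)
  next
    case (Some r)
    have "paid (refill_prog i (addr r) (length T) a) st \<phi> removal_finished"
      by (rule paid_full, rule runs_refill_prog[OF True Some refl refl refl refl]) simp
    then show ?thesis using True Some first_record(2)[OF True Some refl refl refl refl]
      by (simp add: drop_first_def)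
  qed
qed

end

end

subsection \<open>The operations\<close>

context large_blocks
begin

definition large_inv :: "'a config \<Rightarrow> (nat \<Rightarrow> 'a set) \<Rightarrow> nat \<Rightarrow> int \<Rightarrow> int \<Rightarrow> bool" where
  "large_inv s Q t e \<phi> \<longleftrightarrow> (\<exists>st q a. implements s st \<and> large_state st q a \<and> a \<le> 2 * t \<and>
     (\<forall>k<l. Q k = survivors (queue_elems (q k))) \<and> int (disk_size st + (\<Sum>k\<le>l. buffered (q k))) \<le> e \<and>
     int (300 * bt * card (vaddrs st) + 900 * (\<Sum>k\<le>l. queue_potential (q k))) \<le> \<phi>)"

definition performs :: "prog \<Rightarrow> 'a config \<Rightarrow> 'a option \<Rightarrow> (nat \<Rightarrow> 'a set) \<Rightarrow> nat \<Rightarrow> int \<Rightarrow> int \<Rightarrow> bool" where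
  "performs p s r Q t e \<phi> \<longleftrightarrow> (\<exists>s'. exec mc arg p (s\<lparr>result := None, ios := 0\<rparr>) = Some s' \<and> ios s' \<le> 300 \<and>
     result s' = r \<and> large_inv s' Q t e (\<phi> - int bt * int (ios s')))"

lemma finished_large_inv:
  assumes finished: "finished i q (Q i) E A r \<psi> s" and i: "i < l" and A: "A \<le> 2 * t"
    and Q: "\<And>k. k < l \<Longrightarrow> k \<noteq> i \<Longrightarrow> Q k = survivors (queue_elems (q k))"
    and e: "E + int (\<Sum>k\<in>{..l} - {i}. buffered (q k)) \<le> e"
    and \<phi>: "\<psi> + 900 * int (\<Sum>k\<in>{..l} - {i}. queue_potential (q k)) \<le> \<phi>"
  shows "large_inv s Q t e \<phi>" "result s = r"
proof -
  obtain st x a where final: "implements s st" "large_state st (q(i := x)) a" "a \<le> A"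
      "survivors (queue_elems x) = Q i" "int (disk_size st + buffered x) \<le> E"
      "int (300 * bt * card (vaddrs st) + 900 * queue_potential x) \<le> \<psi>" "result s = r"
    using finished by (auto simp: finished_def)
  show "result s = r" by fact
  have sum: "(\<Sum>k\<le>l. f ((q(i := x)) k)) = f x + (\<Sum>k\<in>{..l} - {i}. f (q k))" for f :: "'a queue \<Rightarrow> nat"
    using sum.remove[of "{..l}" i "\<lambda>k. f ((q(i := x)) k)"] i by (simp cong: sum.cong_simp)
  show "large_inv s Q t e \<phi>" unfolding large_inv_def
  proof (intro exI[of _ st] exI[of _ "q(i := x)"] exI[of _ a] conjI)
    show "\<forall>k<l. Q k = survivors (queue_elems ((q(i := x)) k))" using final(4) Q by simp
    show "int (disk_size st + (\<Sum>k\<le>l. buffered ((q(i := x)) k))) \<le> e" unfolding sum using final(5) e by simp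
    show "int (300 * bt * card (vaddrs st) + 900 * (\<Sum>k\<le>l. queue_potential ((q(i := x)) k))) \<le> \<phi>"
      unfolding sum using final(6) \<phi> by simp
  qed (use final A in auto)
qed

lemma performs_paid:
  assumes s: "implements s st" and paid: "paid p (st\<lparr>vresult := None\<rparr>) \<psi> (finished i q (Q i) E A r)"
    and i: "i < l" and A: "A \<le> 2 * t"
    and Q: "\<And>k. k < l \<Longrightarrow> k \<noteq> i \<Longrightarrow> Q k = survivors (queue_elems (q k))"
    and e: "E + int (\<Sum>k\<in>{..l} - {i}. buffered (q k)) \<le> e"
    and \<phi>: "\<psi> + 900 * int (\<Sum>k\<in>{..l} - {i}. queue_potential (q k)) \<le> \<phi>"
  shows "performs p s r Q t e \<phi>"
proof -
  obtain n where n: "n \<le> 300" "runs p (st\<lparr>vresult := None\<rparr>) n (finished i q (Q i) E A r (\<psi> - int (n * bt)))"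
    using paid by (auto simp: paid_def)
  then obtain s' where s': "exec mc arg p (s\<lparr>result := None, ios := 0\<rparr>) = Some s'" "ios s' \<le> n"
      "finished i q (Q i) E A r (\<psi> - int (n * bt)) s'"
    using implements_start[OF s] by (fastforce simp: runs_def)
  have "int (bt * ios s') \<le> int (n * bt)" using s'(2) by (simp add: mult.commute del: of_nat_mult)
  then have "\<psi> - int (n * bt) + 900 * int (\<Sum>k\<in>{..l} - {i}. queue_potential (q k)) \<le> \<phi> - int bt * int (ios s')"
    using \<phi> by simp
  from finished_large_inv[where Q = Q, OF s'(3) i A Q e this] show ?thesis
    unfolding performs_def using s' n by auto
qed

lemma performs_runs:
  assumes s: "implements s st" and state: "large_state st q a" "a \<le> 2 * t"
    and runs: "runs p (st\<lparr>vresult := None\<rparr>) 0 (\<lambda>s'. implements s' (st\<lparr>vresult := r\<rparr>))"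
    and Q: "\<forall>k<l. Q k = survivors (queue_elems (q k))" and e: "int (disk_size st + (\<Sum>k\<le>l. buffered (q k))) \<le> e"
    and \<phi>: "int (300 * bt * card (vaddrs st) + 900 * (\<Sum>k\<le>l. queue_potential (q k))) \<le> \<phi>"
  shows "performs p s r Q t e \<phi>"
proof -
  obtain s' where s': "exec mc arg p (s\<lparr>result := None, ios := 0\<rparr>) = Some s'" "ios s' = 0"
      "implements s' (st\<lparr>vresult := r\<rparr>)"
    using runs implements_start[OF s] by (fastforce simp: runs_def)
  have "result s' = r" using s'(3) by (simp add: implements_def)
  moreover have "large_inv s' Q t e \<phi>" unfolding large_inv_def
    by (intro exI[of _ "st\<lparr>vresult := r\<rparr>"] exI[of _ q] exI[of _ a]) (use s'(3) state Q e \<phi> in simp)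
  ultimately show ?thesis unfolding performs_def using s' by simp
qed

lemma queue_minimum:
  assumes ok: "queue_ok x" and nonempty: "survivors (queue_elems x) \<noteq> {}"
  obtains y H t T where "x = Queue (y # H) t T" "Min (survivors (queue_elems x)) = y"
    "survivors (queue_elems x) - {y} = survivors (H @ elems_of t @ T)"
proof -
  have "front x \<noteq> []" using ok nonempty by (auto simp: queue_ok_def queue_elems_def)
  then obtain y H t T where x: "x = Queue (y # H) t T" by (cases x) (auto simp: neq_Nil_conv)
  have less: "\<forall>z\<in>set (H @ elems_of t @ T). y < z" using ok by (auto simp: x queue_ok_def)
  have elems: "queue_elems x = y # (H @ elems_of t @ T)" by (simp add: x queue_elems_def)
  show thesis
    by (rule that[OF x])
      (use Min_survivors_Cons[OF less] survivors_Cons_minus_Min[OF less] in \<open>simp_all only: elems\<close>)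
qed

lemma find_min_performs:
  assumes inv: "large_inv s Q t e \<phi>" and legal: "cpqa_legal l (FindMin i) Q"
  shows "performs (find_min_prog (large_impl l) i) s (Some (Min (Q i))) Q (Suc t) e (\<phi> + 900)"
proof -
  obtain st q a where state: "implements s st" "large_state st q a" "a \<le> 2 * t"
      "\<forall>k<l. Q k = survivors (queue_elems (q k))" "int (disk_size st + (\<Sum>k\<le>l. buffered (q k))) \<le> e"
      "int (300 * bt * card (vaddrs st) + 900 * (\<Sum>k\<le>l. queue_potential (q k))) \<le> \<phi>"
    using inv by (auto simp: large_inv_def)
  have i: "i < l" "Q i \<noteq> {}" using legal by auto
  then have queue: "queue_mem (vmem st) i (q i)" "queue_ok (q i)" using state(2) by (auto simp: large_state_def)
  obtain x H T u where "q i = Queue (x # H) u T" "Min (Q i) = x"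
    using queue_minimum[OF queue(2)] state(4) i by metis
  then have "vmem st (front_cell i) = Elem (Min (Q i))" using queue(1) by (simp add: queue_mem_def holds_Cons)
  moreover have "B < front_cell i" "front_cell i < M" using front_cell_gt[of i] front_cell_le[of i] i bt by auto
  ultimately have "runs (Output (front_cell i) Halt) (st\<lparr>vresult := None\<rparr>) 0
      (\<lambda>s'. implements s' (st\<lparr>vresult := Some (Min (Q i))\<rparr>))"
    by (intro runs_Output runs_Halt) simp_all
  then show ?thesis unfolding large_impl_def cpqa_impl.simps
    by (intro performs_runs[OF state(1,2)]) (use state in auto)
qed

lemma delete_min_performs:
  assumes inv: "large_inv s Q t e \<phi>" and legal: "cpqa_legal l (DeleteMin i) Q" and t: "t < N"
  shows "performs (delete_min_prog (large_impl l) i) s (Some (Min (Q i))) (cpqa_step (DeleteMin i) Q) (Suc t)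
    (e - 1) (\<phi> + 900)"
proof -
  obtain st q a where state: "implements s st" "large_state st q a" "a \<le> 2 * t"
      "\<forall>k<l. Q k = survivors (queue_elems (q k))" "int (disk_size st + (\<Sum>k\<le>l. buffered (q k))) \<le> e"
      "int (300 * bt * card (vaddrs st) + 900 * (\<Sum>k\<le>l. queue_potential (q k))) \<le> \<phi>"
    using inv by (auto simp: large_inv_def)
  have i: "i < l" "Q i \<noteq> {}" using legal by auto
  then have queue: "queue_mem (vmem st) i (q i)" "queue_ok (q i)" "vmem st (B + 1) = Num a"
    using state(2) by (auto simp: large_state_def)
  obtain x H u T where queue_i: "q i = Queue (x # H) u T" and x: "Min (Q i) = x"
      "Q i - {x} = survivors (H @ elems_of u @ T)"
    using queue_minimum[OF queue(2)] state(4) i by metis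
  let ?st = "st\<lparr>vresult := Some x\<rparr>"
  interpret queue_update B M W bt arg l N i q ?st
    by unfold_locales (use i state(2) in \<open>auto simp: large_state_def\<close>)
  let ?\<psi> = "int (300 * bt * card (vaddrs st) + 900 * queue_potential (q i))"
  let ?finished = "finished i q (cpqa_step (DeleteMin i) Q i) (int (disk_size st + length H + length T)) a (Some x)"
  have "paid (drop_first i (root_of u) (Suc (length H)) (length T) a) ?st ?\<psi>
      (finished i q (Q i - {x}) (int (disk_size st + length H + length T)) a (vresult ?st))"
    by (rule paid_drop_first[OF queue_i])
      (use state(2,3) queue queue_i x t word_ge in \<open>auto simp: large_state_def queue_mem_def\<close>)
  then have "paid (drop_first i (root_of u) (Suc (length H)) (length T) a) ?st ?\<psi> ?finished" using x by simp
  then have "paid (delete_min_prog (large_impl l) i) (st\<lparr>vresult := None\<rparr>) ?\<psi> ?finished"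
    unfolding large_impl_def cpqa_impl.simps
  proof (rule paid_step)
    fix n assume "runs (drop_first i (root_of u) (Suc (length H)) (length T) a) ?st n (?finished (?\<psi> - int (n * bt)))"
    then show "runs (Output (front_cell i) (get_queue i (\<lambda>g h t. CaseNum (B + 1) (drop_first i g h t))))
        (st\<lparr>vresult := None\<rparr>) n (?finished (?\<psi> - int (n * bt)))"
      using queue queue_i zone_i i two_blocks bt memory
      by (intro runs_Output[where x = x] runs_get_queue[where x = "q i"] runs_CaseNum[where v = a])
        (auto simp: queue_mem_def holds_Cons)
  qed
  then show ?thesis unfolding x(1)
  proof (rule performs_paid[OF state(1)])
    show "int (disk_size st + length H + length T) + int (\<Sum>k\<in>{..l} - {i}. buffered (q k)) \<le> e - 1"
      using state(5) sum.remove[of "{..l}" i "\<lambda>k. buffered (q k)"] i queue_i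
      by (simp add: buffered_def[of "Queue _ _ _"] del: of_nat_sum)
    show "?\<psi> + 900 * int (\<Sum>k\<in>{..l} - {i}. queue_potential (q k)) \<le> \<phi> + 900"
      using state(6) sum.remove[of "{..l}" i "\<lambda>k. queue_potential (q k)"] i by (simp del: of_nat_sum)
  qed (use i state in auto)
qed

lemma paid_catenate:
  assumes ij: "i < l" "j \<le> l" "i \<noteq> j" and unused: "\<forall>k\<ge>l. q k = empty_queue"
    and forest: "forest st ((trees q)(l + 1 := middle x))"
    and mem: "\<And>k. k \<le> l \<Longrightarrow> queue_mem (vmem st) k (q k) \<and> queue_ok (q k)"
    and mem_j: "holds (vmem st) (front_cell j) (front x)" "holds (vmem st) (rear_cell j) (rear x)"
    and x: "queue_ok x" "front x \<noteq> []" and bounded: "records_bounded st a" and word: "a \<le> 2 * t" "t < N"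
  shows "paid (catenate_queues i j (root_of (middle (q i))) (length (front (q i))) (length (rear (q i)))
      (root_of (middle x)) (length (front x)) (length (rear x)) a) st
    (int (300 * bt * card (vaddrs st) + 900 * (queue_potential (q i) + queue_potential x)))
    (finished i q (survivors (queue_elems (q i) @ queue_elems x)) (int (disk_size st + buffered (q i) + buffered x))
      (a + 2) (vresult st))"
proof -
  interpret queue_update B M W bt arg l N i q st
    by unfold_locales (use ij unused mem in auto)
  obtain H1 t1 T1 where q_i: "q i = Queue H1 t1 T1" by (cases "q i") auto
  obtain H2 t2 T2 where x_eq: "x = Queue H2 t2 T2" by (cases x) auto
  show ?thesis unfolding q_i x_eq queue.sel
    by (rule paid_catenate_queues[OF ij(2,3) q_i _ _ _ _ _ _ _ _ _ _ refl refl refl])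
      (use forest mem[of i] mem_j x bounded word word_ge ij(1) q_i x_eq in
        \<open>auto simp: queue_mem_def queue_elems_def buffered_def\<close>)
qed

lemma sum_queues:
  fixes f :: "'a queue \<Rightarrow> nat"
  assumes "i \<le> l" "j \<le> l" "i \<noteq> j" "f empty_queue = 0"
  shows "(\<Sum>k\<le>l. f (q k)) = f (q i) + f (q j) + (\<Sum>k\<in>{..l} - {i}. f ((q(j := empty_queue)) k))"
proof -
  have "(\<Sum>k\<in>{..l} - {i}. f (q k)) = f (q j) + (\<Sum>k\<in>{..l} - {i} - {j}. f (q k))"
    using assms by (intro sum.remove) auto
  moreover have "(\<Sum>k\<in>{..l} - {i}. f ((q(j := empty_queue)) k)) = (\<Sum>k\<in>{..l} - {i} - {j}. f (q k))"
    using assms sum.remove[of "{..l} - {i}" j "\<lambda>k. f ((q(j := empty_queue)) k)"] by (simp cong: sum.cong_simp)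
  ultimately show ?thesis using assms(1) sum.remove[of "{..l}" i "\<lambda>k. f (q k)"] by simp
qed

lemma empty_queue_ok: "queue_ok empty_queue"
  using bt by (simp add: queue_ok_def)

lemma empty_queue_eqs: "buffered empty_queue = 0" "queue_potential empty_queue = 0"
    "queue_elems empty_queue = []"
  by (simp_all add: buffered_def queue_potential_def queue_elems_def)

lemma queue_mem_cleared:
  fixes j :: nat
  assumes queues: "queue_mem (vmem st) k (q k)" "queue_ok (q k)"
  defines "m \<equiv> (vmem st)(info_cell j := Num 0, info_cell j + 1 := Num 0, info_cell j + 2 := Num 0)"
  shows "queue_mem m k ((q(j := empty_queue)) k)" "queue_ok ((q(j := empty_queue)) k)"
    "holds m (front_cell k) (front (q k)) \<and> holds m (rear_cell k) (rear (q k))"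
proof -
  have len: "length (front (q k)) \<le> 3 * bt" "length (rear (q k)) < bt" using queues(2)
    by (auto simp: queue_ok_def)
  have "in_zone j (info_cell j)" "in_zone j (info_cell j + 1)" "in_zone j (info_cell j + 2)"
    using bt by (simp_all add: in_zone_def cell_eqs)
  then have same: "m c = vmem st c" if "k \<noteq> j" "in_zone k c" for c
    unfolding m_def using zones_disjoint[OF that] by auto
  show "queue_ok ((q(j := empty_queue)) k)" using queues(2) empty_queue_ok by simp
  show "queue_mem m k ((q(j := empty_queue)) k)"
  proof (cases "k = j")
    case False
    have "queue_mem m k (q k)" by (rule queue_mem_frame[OF queues same[OF False]])
    then show ?thesis using False by simp
  qed (simp add: queue_mem_def m_def)
  show "holds m (front_cell k) (front (q k)) \<and> holds m (rear_cell k) (rear (q k))"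
  proof (cases "k = j")
    case True
    then show ?thesis unfolding m_def using queues(1) len
        holds_cong[of "front_cell k" "front (q k)" m "vmem st"]
        holds_cong[of "rear_cell k" "rear (q k)" m "vmem st"]
      by (auto simp: queue_mem_def cell_eqs m_def)
  next
    case False
    then show ?thesis using queue_mem_frame[OF queues same[OF False]] by (simp add: queue_mem_def)
  qed
qed

lemma paid_catenate_after_clearing:
  assumes state: "large_state st q a" and ij: "i < l" "j < l" "i \<noteq> j" and front: "front (q j) \<noteq> []"
    and word: "a \<le> 2 * t" "t < N"
  shows "paid (set_queue j 0 0 0 (catenate_queues i j (root_of (middle (q i))) (length (front (q i)))
      (length (rear (q i))) (root_of (middle (q j))) (length (front (q j))) (length (rear (q j))) a)) st
    (int (300 * bt * card (vaddrs st) + 900 * (queue_potential (q i) + queue_potential (q j))))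
    (finished i (q(j := empty_queue)) (survivors (queue_elems (q i) @ queue_elems (q j)))
      (int (disk_size st + buffered (q i) + buffered (q j))) (a + 2) (vresult st))"
proof -
  let ?q = "q(j := empty_queue)"
  let ?m = "(vmem st)(info_cell j := Num 0, info_cell j + 1 := Num 0, info_cell j + 2 := Num 0)"
  let ?st = "st\<lparr>vmem := ?m\<rparr>"
  have queues: "queue_mem (vmem st) k (q k)" "queue_ok (q k)" if "k \<le> l" for k
    using state that by (auto simp: large_state_def)
  have cleared: "queue_mem ?m k (?q k)" "queue_ok (?q k)"
      "holds ?m (front_cell k) (front (q k)) \<and> holds ?m (rear_cell k) (rear (q k))" if "k \<le> l" for k
    using queue_mem_cleared[where q = q and j = j, OF queues[OF that]] by blast+
  have "(trees q)(l + 1 := (trees q) j, j := None) = (trees ?q)(l + 1 := middle (q j))"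
    using ij by (simp add: fun_upd_twist)
  then have "forest ?st ((trees ?q)(l + 1 := middle (q j)))"
    using forest_move[of st "trees q" "l + 1" j] state ij by (simp add: large_state_def)
  then have "paid (catenate_queues i j (root_of (middle (?q i))) (length (front (?q i))) (length (rear (?q i)))
      (root_of (middle (q j))) (length (front (q j))) (length (rear (q j))) a) ?st
    (int (300 * bt * card (vaddrs ?st) + 900 * (queue_potential (?q i) + queue_potential (q j))))
    (finished i ?q (survivors (queue_elems (?q i) @ queue_elems (q j)))
      (int (disk_size ?st + buffered (?q i) + buffered (q j))) (a + 2) (vresult ?st))"
    by (intro paid_catenate) (use cleared cleared(3)[of j] state queues(2)[of j] ij front word in
      \<open>simp_all add: large_state_def del: fun_upd_apply, auto\<close>)
  then have "paid (catenate_queues i j (root_of (middle (q i))) (length (front (q i))) (length (rear (q i)))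
      (root_of (middle (q j))) (length (front (q j))) (length (rear (q j))) a) ?st
    (int (300 * bt * card (vaddrs st) + 900 * (queue_potential (q i) + queue_potential (q j))))
    (finished i ?q (survivors (queue_elems (q i) @ queue_elems (q j)))
      (int (disk_size st + buffered (q i) + buffered (q j))) (a + 2) (vresult st))"
    using ij(3) by simp
  then show ?thesis by (rule paid_step) (rule runs_set_queue, use ij in simp_all)
qed

lemma runs_catenate_prog:
  assumes state: "large_state st q a" and ij: "i < l" "j < l"
    and "runs (if length (front (q j)) = 0 then Halt
      else set_queue j 0 0 0 (catenate_queues i j (root_of (middle (q i))) (length (front (q i)))
        (length (rear (q i))) (root_of (middle (q j))) (length (front (q j))) (length (rear (q j))) a)) st n P"
  shows "runs (catenate_prog (large_impl l) i j) st n P"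
proof -
  have "queue_mem (vmem st) i (q i)" "queue_mem (vmem st) j (q j)" "vmem st (B + 1) = Num a"
    using state ij by (auto simp: large_state_def)
  then show ?thesis unfolding large_impl_def cpqa_impl.simps using assms two_blocks bt memory
    by (intro runs_get_queue[where x = "q i"] runs_get_queue[where x = "q j"] runs_CaseNum[where v = a]) auto
qed

lemma catenate_performs:
  assumes inv: "large_inv s Q t e \<phi>" and legal: "cpqa_legal l (CatenateAndAttrite i j) Q" and t: "t < N"
  shows "performs (catenate_prog (large_impl l) i j) s None (cpqa_step (CatenateAndAttrite i j) Q) (Suc t)
    (e + 1) (\<phi> + 900)"
proof -
  obtain st q a where state: "implements s st" "large_state st q a" "a \<le> 2 * t"
      "\<forall>k<l. Q k = survivors (queue_elems (q k))" "int (disk_size st + (\<Sum>k\<le>l. buffered (q k))) \<le> e"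
      "int (300 * bt * card (vaddrs st) + 900 * (\<Sum>k\<le>l. queue_potential (q k))) \<le> \<phi>"
    using inv by (auto simp: large_inv_def)
  have ij: "i < l" "j < l" "i \<noteq> j" using legal by auto
  let ?st = "st\<lparr>vresult := None\<rparr>" and ?Q = "cpqa_step (CatenateAndAttrite i j) Q"
  have state': "large_state ?st q a" using state(2) by simp
  show ?thesis
  proof (cases "front (q j) = []")
    case True
    then have "queue_elems (q j) = []" using state(2) ij
      by (auto simp: large_state_def queue_ok_def queue_elems_def)
    then have "\<forall>k<l. ?Q k = survivors (queue_elems (q k))" using state(4) ij by (simp add: catenate_attrite_def)
    moreover have "runs (catenate_prog (large_impl l) i j) ?st 0 (\<lambda>s'. implements s' ?st)"
      by (rule runs_catenate_prog[OF state' ij(1,2)]) (simp add: True runs_Halt)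
    ultimately show ?thesis by (intro performs_runs[OF state(1,2)]) (use state in auto)
  next
    case False
    let ?q = "q(j := empty_queue)"
    let ?\<psi> = "int (300 * bt * card (vaddrs st) + 900 * (queue_potential (q i) + queue_potential (q j)))"
    let ?finished = "finished i ?q (?Q i) (int (disk_size st + buffered (q i) + buffered (q j))) (a + 2) None"
    have "paid (catenate_prog (large_impl l) i j) ?st ?\<psi> ?finished"
    proof (rule paid_step)
      show "paid (set_queue j 0 0 0 (catenate_queues i j (root_of (middle (q i))) (length (front (q i)))
          (length (rear (q i))) (root_of (middle (q j))) (length (front (q j))) (length (rear (q j))) a))
          ?st ?\<psi> ?finished"
        using paid_catenate_after_clearing[OF state' ij False state(3) t] state(4) ij
        by (simp add: survivors_append)
    qed (rule runs_catenate_prog[OF state' ij(1,2)], use False in simp)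
    then show ?thesis
    proof (rule performs_paid[OF state(1)])
      show "int (disk_size st + buffered (q i) + buffered (q j)) + int (\<Sum>k\<in>{..l} - {i}. buffered (?q k)) \<le> e + 1"
        using state(5) sum_queues[where f = buffered and q = q, OF _ _ ij(3) empty_queue_eqs(1)] ij
        by (simp del: of_nat_sum fun_upd_apply)
      show "?\<psi> + 900 * int (\<Sum>k\<in>{..l} - {i}. queue_potential (?q k)) \<le> \<phi> + 900"
        using state(6) sum_queues[where f = queue_potential and q = q, OF _ _ ij(3) empty_queue_eqs(2)] ij
        by (simp del: of_nat_sum fun_upd_apply)
    qed (use ij state(3,4) in \<open>auto simp: empty_queue_eqs(3)\<close>)
  qed
qed

lemma paid_insert:
  assumes state: "large_state st q a" and i: "i < l" and word: "a \<le> 2 * t" "t < N" and arg: "arg = Some x"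
  shows "paid (insert_prog (large_impl l) i) st
    (int (300 * bt * card (vaddrs st) + 900 * (queue_potential (q i) + 1)))
    (finished i q (survivors (queue_elems (q i) @ [x])) (int (disk_size st + buffered (q i) + 1)) (a + 2) (vresult st))"
proof -
  let ?m = "put (vmem st) (front_cell l) [x]"
  let ?st = "st\<lparr>vmem := ?m\<rparr>" and ?x = "Queue [x] None []"
  have queues: "queue_mem (vmem st) k (q k)" "queue_ok (q k)" if "k \<le> l" for k
    using state that by (auto simp: large_state_def)
  have unused: "\<forall>k\<ge>l. q k = empty_queue" and counter: "vmem st (B + 1) = Num a"
    and bounded: "records_bounded st a"
    using state by (auto simp: large_state_def)
  have mem: "queue_mem ?m k (q k) \<and> queue_ok (q k)" if "k \<le> l" for k
  proof (cases "k = l")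
    case True
    then show ?thesis using queues[OF that] unused bt by (auto simp: queue_mem_def put_def cell_eqs)
  next
    case False
    have "queue_mem ?m k (q k)"
    proof (rule queue_mem_frame[OF queues[OF that]])
      fix c assume "in_zone k c"
      then have "\<not> in_zone l c" using zones_disjoint False by blast
      then show "?m c = vmem st c" using bt by (auto simp: put_def in_zone_def)
    qed
    then show ?thesis using queues(2)[OF that] by simp
  qed
  have "forest ?st ((trees q)(l + 1 := middle ?x))"
    using state forest_remove[of st "trees q" "l + 1"] by (simp add: large_state_def)
  from paid_catenate[OF i order_refl _ unused this _ _ _ _ _ _ word]
  have "paid (catenate_queues i l (root_of (middle (q i))) (length (front (q i))) (length (rear (q i)))
      (root_of (middle ?x)) (length (front ?x)) (length (rear ?x)) a) ?st
    (int (300 * bt * card (vaddrs ?st) + 900 * (queue_potential (q i) + queue_potential ?x)))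
    (finished i q (survivors (queue_elems (q i) @ queue_elems ?x)) (int (disk_size ?st + buffered (q i) + buffered ?x))
      (a + 2) (vresult ?st))"
    using mem i bounded bt by (simp add: queue_ok_def)
  then have "paid (catenate_queues i l (root_of (middle (q i))) (length (front (q i))) (length (rear (q i))) 0 1 0 a)
      ?st (int (300 * bt * card (vaddrs st) + 900 * (queue_potential (q i) + 1)))
      (finished i q (survivors (queue_elems (q i) @ [x])) (int (disk_size st + buffered (q i) + 1))
        (a + 2) (vresult st))"
    by (simp add: queue_potential_def queue_elems_def buffered_def)
  then show ?thesis unfolding large_impl_def cpqa_impl.simps
  proof (rule paid_step, intro runs_GetArg[OF _ _ arg] runs_get_queue[where x = "q i"] runs_CaseNum[where v = a])
  qed (use mem i counter front_cell_gt[of l] front_cell_le[of l] two_blocks bt memory in \<open>auto simp: put_def\<close>)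
qed

lemma insert_performs:
  assumes inv: "large_inv s Q t e \<phi>" and legal: "cpqa_legal l (InsertAndAttrite i x) Q" and t: "t < N"
    and arg: "arg = Some x"
  shows "performs (insert_prog (large_impl l) i) s None (cpqa_step (InsertAndAttrite i x) Q) (Suc t) (e + 1) (\<phi> + 900)"
proof -
  obtain st q a where state: "implements s st" "large_state st q a" "a \<le> 2 * t"
      "\<forall>k<l. Q k = survivors (queue_elems (q k))" "int (disk_size st + (\<Sum>k\<le>l. buffered (q k))) \<le> e"
      "int (300 * bt * card (vaddrs st) + 900 * (\<Sum>k\<le>l. queue_potential (q k))) \<le> \<phi>"
    using inv by (auto simp: large_inv_def)
  have i: "i < l" using legal by simp
  have "large_state (st\<lparr>vresult := None\<rparr>) q a" using state(2) by simp
  from paid_insert[OF this i state(3) t arg]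
  have "paid (insert_prog (large_impl l) i) (st\<lparr>vresult := None\<rparr>)
    (int (300 * bt * card (vaddrs st) + 900 * (queue_potential (q i) + 1)))
    (finished i q (cpqa_step (InsertAndAttrite i x) Q i) (int (disk_size st + buffered (q i) + 1)) (a + 2) None)"
    using state(4) i by (simp add: survivors_append insert_attrite_eq_catenate)
  then show ?thesis
  proof (rule performs_paid[OF state(1)])
    show "int (disk_size st + buffered (q i) + 1) + int (\<Sum>k\<in>{..l} - {i}. buffered (q k)) \<le> e + 1"
      using state(5) sum.remove[of "{..l}" i "\<lambda>k. buffered (q k)"] i by (simp del: of_nat_sum)
    show "int (300 * bt * card (vaddrs st) + 900 * (queue_potential (q i) + 1)) +
        900 * int (\<Sum>k\<in>{..l} - {i}. queue_potential (q k)) \<le> \<phi> + 900"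
      using state(6) sum.remove[of "{..l}" i "\<lambda>k. queue_potential (q k)"] i by (simp del: of_nat_sum)
  qed (use i state in auto)
qed

lemma large_step:
  assumes "large_inv s Q t e \<phi>" "cpqa_legal l x Q" "t < N" "op_arg x = arg"
  shows "performs (op_prog (large_impl l) x) s (cpqa_answer x Q) (cpqa_step x Q) (Suc t) (e + size_change x) (\<phi> + 900)"
  using assms find_min_performs delete_min_performs catenate_performs insert_performs
  by (cases x) (auto simp: size_change_def simp del: cpqa_legal.simps)

lemma large_inv_blank: "large_inv blank_config (\<lambda>_. {}) 0 0 0"
  unfolding large_inv_def
proof (intro exI conjI)
  show "large_state blank_view (\<lambda>_. empty_queue) 0"
    using empty_queue_ok
    by (simp add: large_state_def forest_def blank_view_def records_bounded_def queue_mem_def)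
  show "implements blank_config blank_view" by (rule implements_blank)
qed (simp_all add: empty_queue_eqs disk_size_def blank_view_def)

lemma large_inv_nonneg: "large_inv s Q t e \<phi> \<Longrightarrow> 0 \<le> \<phi>"
  unfolding large_inv_def by (elim exE conjE) (erule order_trans[OF of_nat_0_le_iff])

lemma large_inv_blocks_used:
  assumes "large_inv s Q t e \<phi>"
  shows "int (bt * blocks_used s) \<le> 12 * e"
proof -
  obtain st q a where state: "implements s st" "large_state st q a"
      "int (disk_size st + (\<Sum>k\<le>l. buffered (q k))) \<le> e"
    using assms by (auto simp: large_inv_def)
  have "(\<Sum>x\<in>vaddrs st. bt) \<le> disk_size st" unfolding disk_size_def
    by (rule sum_mono) (use state(2) in \<open>auto simp: large_state_def records_bounded_def\<close>)
  then have "bt * card (vaddrs st) \<le> disk_size st" by (simp add: mult.commute)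
  moreover have "bt * blocks_used s \<le> bt * (12 * card (vaddrs st))"
    using implements_blocks_used[OF state(1)] by (rule mult_le_mono2)
  ultimately have "bt * blocks_used s \<le> 12 * disk_size st" by linarith
  then show ?thesis using state(3) by linarith
qed

end

section \<open>The bounds for all block sizes\<close>

lemma word_bounds:
  fixes n M C :: nat
  assumes "2 \<le> M" "8 \<le> C"
  shows "32 * n + 47 \<le> (n + M) ^ C" "M \<le> (n + M) ^ C" "2 * n * n + 2 * n \<le> (n + M) ^ C"
proof -
  define x where "x = n + M"
  have x: "2 \<le> x" "n \<le> x" "M \<le> x" using assms by (auto simp: x_def)
  have power: "x ^ k \<le> x ^ C" if "k \<le> 8" for k using x that assms by (intro power_increasing) auto
  have two_power: "2 ^ k * x \<le> x ^ (k + 1)" for k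
    using power_mono[OF x(1), of k] x by (simp add: mult.commute)
  have "32 * n + 47 \<le> 2 ^ 6 * x" using x by simp
  also have "\<dots> \<le> x ^ 7" using two_power[of 6] by simp
  also have "\<dots> \<le> x ^ C" by (rule power) simp
  finally show "32 * n + 47 \<le> (n + M) ^ C" unfolding x_def .
  show "M \<le> (n + M) ^ C" using power[of 1] x by (simp add: x_def)
  have "2 * n * n + 2 * n \<le> 2 * (x * x) + 2 * (x * x)"
    using x mult_le_mono[OF x(2) x(2)] mult_le_mono[of n x 1 x] by simp
  also have "\<dots> = 2 ^ 2 * (x * x)" by simp
  also have "\<dots> \<le> x ^ 2 * (x * x)" using power_mono[OF x(1), of 2] by (intro mult_le_mono1) simp
  also have "\<dots> = x ^ 4" by (simp add: eval_nat_numeral)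
  also have "\<dots> \<le> x ^ C" by (rule power) simp
  finally show "2 * n * n + 2 * n \<le> (n + M) ^ C" unfolding x_def .
qed

lemma prod_encode_le:
  assumes "a \<le> n" "c \<le> n"
  shows "prod_encode (a, c) \<le> 2 * n * n + 2 * n"
proof -
  have "(a + c) * Suc (a + c) \<le> (2 * n) * Suc (2 * n)" using assms by (intro mult_le_mono) auto
  then have "(a + c) * Suc (a + c) div 2 \<le> (2 * n) * Suc (2 * n) div 2" by (rule div_le_mono)
  then show ?thesis using assms by (simp add: prod_encode_def triangle_def)
qed

lemma small_impl_meets_bounds:
  fixes ops :: "'a::linorder cpqa_op list"
  assumes b: "1 \<le> b" "b < 128" "b \<le> B" and l: "1 \<le> l" "l * b \<le> M" "2 * B \<le> M" and C: "256 * 900 \<le> C"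
    and legal: "all_legal l ops (\<lambda>_. {})"
  shows "meets_bounds C b \<lparr>mem_size = M, block_size = B, word_max = (length ops + M) ^ C\<rparr>
    (io_programs.small_impl B l) ops"
proof -
  let ?W = "(length ops + M) ^ C"
  have M: "2 \<le> M" "8 \<le> C" using assms by auto
  note word = word_bounds[OF M, of "length ops"]
  have "l * 1 \<le> l * b" using b(1) by (intro mult_le_mono2)
  then have "l \<le> M" using l(2) by linarith
  then interpret small_blocks B M ?W arg l "length ops" for arg :: "'a option"
  proof unfold_locales
    show "1 \<le> ?W" "16 * length ops + 31 \<le> ?W" using word(1) by linarith+
    show "prod_encode (a, c) \<le> ?W" if "a \<le> length ops" "c \<le> length ops" for a c
      using prod_encode_le[OF that] word(3) by (rule order_trans)
  qed (use b l in linarith)+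
  interpret amortized_impl mc "small_impl l" l "length ops" 80 1 80 "\<lambda>s Q t e \<phi>. small_inv s Q t e \<and> 0 \<le> \<phi>"
    by unfold_locales (use small_step small_inv_blank small_inv_blocks_used in fastforce)+
  show ?thesis by (rule meets_bounds[where \<gamma> = 128, OF legal]) (use b C in auto)
qed

lemma large_impl_meets_bounds:
  fixes ops :: "'a::linorder cpqa_op list"
  assumes b: "128 \<le> b" "b \<le> B" and l: "1 \<le> l" "l * b \<le> M" "2 * B \<le> M" and C: "256 * 900 \<le> C"
    and legal: "all_legal l ops (\<lambda>_. {})"
  shows "meets_bounds C b \<lparr>mem_size = M, block_size = B, word_max = (length ops + M) ^ C\<rparr>
    (large_programs.large_impl B (b div 128) l) ops"
proof -
  let ?W = "(length ops + M) ^ C"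
  obtain bt where bt_eq: "b div 128 = bt" by blast
  have "128 * bt + b mod 128 = b" "b mod 128 < 128" "1 \<le> bt" using b(1) by (auto simp flip: bt_eq)
  then have b_bounds: "1 \<le> bt" "128 * bt \<le> b" "b \<le> 256 * bt" by linarith+
  note word = word_bounds[of M C "length ops"]
  have "128 * (bt * l) = l * (128 * bt)" by simp
  also have "\<dots> \<le> l * b" using b_bounds(2) by (rule mult_le_mono2)
  finally have "B + 2 + 16 * (bt * l) + 16 * bt \<le> M" using b_bounds b l by linarith
  then interpret large_blocks B M ?W bt arg l "length ops" for arg :: "'a option"
    by unfold_locales (use b l b_bounds C word in simp_all)
  interpret amortized_impl mc "large_impl l" l "length ops" 300 bt 900 large_inv
    by unfold_locales
      (use large_step[unfolded performs_def] large_inv_blank large_inv_blocks_used large_inv_nonneg in fastforce)+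
  show ?thesis unfolding bt_eq by (rule meets_bounds[where \<gamma> = 256, OF legal]) (use b b_bounds C in auto)
qed

theorem theorem1:
  "\<exists>C::nat. \<forall>B b l M :: nat.
     1 \<le> b \<and> b \<le> B \<and> 1 \<le> l \<and> l * b \<le> M \<and> 2 * B \<le> M \<longrightarrow>
     (\<exists>D :: cpqa_impl. \<forall>ops :: 'a::linorder cpqa_op list.
        all_legal l ops (\<lambda>_. {}) \<longrightarrow>
        (\<exists>s tr.
           run_ops \<lparr>mem_size = M, block_size = B, word_max = (length ops + M) ^ C\<rparr>
             D ops blank_config = Some (s, tr) \<and>
           map fst tr = all_answers ops (\<lambda>_. {}) \<and>
           (\<forall>t \<in> set (map snd tr). t \<le> C) \<and>
           real (sum_list (map snd tr)) \<le> real C * (real (length ops) / real b) \<and>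
           real (blocks_used s) \<le>
             real C * ((real (length (filter is_catenate_or_insert ops))
                        - real (length (filter is_delete ops))) / real b)))"
  unfolding meets_bounds_def[symmetric]
proof -
  obtain C :: nat where C: "256 * 900 \<le> C" by blast
  have "\<exists>D. \<forall>ops :: 'a cpqa_op list. all_legal l ops (\<lambda>_. {}) \<longrightarrow>
      meets_bounds C b \<lparr>mem_size = M, block_size = B, word_max = (length ops + M) ^ C\<rparr> D ops"
    if "1 \<le> b \<and> b \<le> B \<and> 1 \<le> l \<and> l * b \<le> M \<and> 2 * B \<le> M" for B b l M
  proof (cases "b < 128")
    case True
    with that C show ?thesis
      by (intro exI[of _ "io_programs.small_impl B l"]) (auto intro: small_impl_meets_bounds)
  next
    case False
    with that C show ?thesis
      by (intro exI[of _ "large_programs.large_impl B (b div 128) l"]) (auto intro: large_impl_meets_bounds)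
  qed
  then show "\<exists>C. \<forall>B b l M. 1 \<le> b \<and> b \<le> B \<and> 1 \<le> l \<and> l * b \<le> M \<and> 2 * B \<le> M \<longrightarrow>
      (\<exists>D. \<forall>ops :: 'a cpqa_op list. all_legal l ops (\<lambda>_. {}) \<longrightarrow>
        meets_bounds C b \<lparr>mem_size = M, block_size = B, word_max = (length ops + M) ^ C\<rparr> D ops)"
    by blast
qed

end
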